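(* Let $k,r\geq 2$ be integers and let $a\in\{1,\ldots,k-1\}$ be coprime with $k$. Let $d$ be a positive integer. The $\mathbb{C}^*$-pseudo-plane $S(k,r,a)$ admits a $\mathbb{C}^*$-equivariant étale endomorphism of degree $d$ (hence non-proper for $d>1$) if and only if $$d\equiv 1 \mod k(r-1)\qquad\text{or}\qquad \bigl(k\mid r,\ a=1\ \text{ and }\ d\equiv r \mod k(r-1)\bigr).$$ In particular, the $\mathbb{C}^*$-equivariant Generalized Jacobian Conjecture fails for every $S(k,r,a)$ with $k,r\geq 2$, and hence for every finite cover of it.
   Context: All varieties are complex algebraic varieties. For positive integers $k,r$ let $\tilde S(k,r)=\{x^ry=z^k-1\}\subseteq \operatorname{Spec}(\mathbb{C}[x,y,z])$, with the $\mathbb{C}^*$-action $\lambda\cdot(x,y,z)=(\lambda x,\lambda^{-r}y,z)$; this surface is simply connected. Identify $\mathbb{Z}_k$ with the group of complex $k$-th roots of unity. For $a\in\{1,\ldots,k\}$ coprime with $k$ let $\mathbb{Z}_k$ act freely on $\tilde S(k,r)$ by $\varepsilon *_a(x,y,z)=(\varepsilon x,\varepsilon^{-r}y,\varepsilon^{-a}z)$. Then $S(k,r,a)=\tilde S(k,r)/\mathbb{Z}_k$ is the quotient surface, equipped with the $\mathbb{C}^*$-action induced from the $\mathbb{C}^*$-action $\lambda\cdot(x,y,z)=(\lambda x,\lambda^{-r}y,z)$ on $\tilde S(k,r)$ (which commutes with the $\mathbb{Z}_k$-action). A smooth complex variety with an effective algebraic action of a group $G$ satisfies the $G$-equivariant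 Generalized Jacobian Conjecture if all its $G$-equivariant étale endomorphisms are proper. A finite cover of $S(k,r,a)$ means a finite étale cover by a (connected) variety, i.e. up to isomorphism a quotient $\tilde S(k,r)/H$ by a subgroup $H\subseteq\mathbb{Z}_k$ (including the universal cover $\tilde S(k,r)$), with the $\mathbb{C}^*$-action induced from $\tilde S(k,r)$. *)

theory Defs
  imports Complex_Main "HOL-Algebra.Embedded_Algebras" "HOL-Number_Theory.Cong"
begin

section \<open>Affine varieties over the complex numbers\<close>

text \<open>
  A (reduced) complex affine variety is given by its set of closed points together with its algebra
  of regular functions. Only the values of a regular function on the points matter: \<open>regular X\<close> is
  meant to be closed under changing a function outside \<open>points X\<close>, and functions that agree on
  \<open>points X\<close> represent the same element of the coordinate ring.
\<close>

record 'a variety =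
  points :: "'a set"
  regular :: "('a \<Rightarrow> complex) set"

inductive_set generated_algebra :: "('a \<Rightarrow> complex) set \<Rightarrow> ('a \<Rightarrow> complex) set"
  for G :: "('a \<Rightarrow> complex) set" where
  gen: "g \<in> G \<Longrightarrow> g \<in> generated_algebra G"
| const: "(\<lambda>_. c) \<in> generated_algebra G"
| add: "f \<in> generated_algebra G \<Longrightarrow> g \<in> generated_algebra G \<Longrightarrow> (\<lambda>p. f p + g p) \<in> generated_algebra G"
| mult: "f \<in> generated_algebra G \<Longrightarrow> g \<in> generated_algebra G \<Longrightarrow> (\<lambda>p. f p * g p) \<in> generated_algebra G"

definition generated_variety :: "'a set \<Rightarrow> ('a \<Rightarrow> complex) set \<Rightarrow> 'a variety" where
  "generated_variety V G =
     \<lparr>points = V, regular = {f. \<exists>g\<in>generated_algebra G. \<forall>p\<in>V. f p = g p}\<rparr>"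

definition affine_space :: "nat \<Rightarrow> (nat \<Rightarrow> complex) variety" where
  "affine_space n = generated_variety {v. \<forall>i\<ge>n. v i = 0} ((\<lambda>i v. v i) ` {..<n})"

definition zariski_closed :: "'a variety \<Rightarrow> 'a set \<Rightarrow> bool" where
  "zariski_closed X C \<longleftrightarrow> (\<exists>F\<subseteq>regular X. C = {p \<in> points X. \<forall>f\<in>F. f p = 0})"

text \<open>
  Being an affine variety: for some finite tuple of functions generating the regular functions, the
  map to affine space given by the tuple is injective on points, with Zariski closed image.
\<close>

definition affine_variety :: "'a variety \<Rightarrow> bool" where
  "affine_variety X \<longleftrightarrow>
     (\<exists>n (x :: nat \<Rightarrow> 'a \<Rightarrow> complex).
        X = generated_variety (points X) (x ` {..<n}) \<and>
        inj_on (\<lambda>p i. if i < n then x i p else 0) (points X) \<and>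
        zariski_closed (affine_space n) ((\<lambda>p i. if i < n then x i p else 0) ` points X))"

definition morphism :: "'a variety \<Rightarrow> 'b variety \<Rightarrow> ('a \<Rightarrow> 'b) \<Rightarrow> bool" where
  "morphism X Y f \<longleftrightarrow> f ` points X \<subseteq> points Y \<and> (\<forall>g\<in>regular Y. g \<circ> f \<in> regular X)"

definition product_variety :: "'a variety \<Rightarrow> 'b variety \<Rightarrow> ('a \<times> 'b) variety" where
  "product_variety X Y =
     generated_variety (points X \<times> points Y)
       ((\<lambda>f. f \<circ> fst) ` regular X \<union> (\<lambda>g. g \<circ> snd) ` regular Y)"

text \<open>
  Proper means separated, of finite type and universally closed; the first two are automatic for
  morphisms of affine varieties. For universal closedness it suffices to consider the products with
  affine spaces: every base change along an affine variety over the target is the restriction of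
  such a product to a closed subset, and closedness is local on the target.
\<close>

definition closed_map :: "'a variety \<Rightarrow> 'b variety \<Rightarrow> ('a \<Rightarrow> 'b) \<Rightarrow> bool" where
  "closed_map X Y f \<longleftrightarrow> (\<forall>C. zariski_closed X C \<longrightarrow> zariski_closed Y (f ` C))"

definition proper :: "'a variety \<Rightarrow> 'b variety \<Rightarrow> ('a \<Rightarrow> 'b) \<Rightarrow> bool" where
  "proper X Y f \<longleftrightarrow> morphism X Y f \<and>
     (\<forall>n. closed_map (product_variety X (affine_space n)) (product_variety Y (affine_space n))
            (map_prod f id))"

text \<open>
  The Zariski tangent space at \<open>p\<close> consists of the point derivations of the coordinate ring at \<open>p\<close>.
  A derivation is a function on the whole function type; it is set to zero outside \<open>regular X\<close> so
  that equality of tangent vectors is equality of functions.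
\<close>

definition tangent_space :: "'a variety \<Rightarrow> 'a \<Rightarrow> (('a \<Rightarrow> complex) \<Rightarrow> complex) set" where
  "tangent_space X p = {D.
     (\<forall>f. f \<notin> regular X \<longrightarrow> D f = 0) \<and>
     (\<forall>f\<in>regular X. \<forall>g\<in>regular X. (\<forall>q\<in>points X. f q = g q) \<longrightarrow> D f = D g) \<and>
     (\<forall>f\<in>regular X. \<forall>g\<in>regular X. D (\<lambda>q. f q + g q) = D f + D g) \<and>
     (\<forall>c. \<forall>f\<in>regular X. D (\<lambda>q. c * f q) = c * D f) \<and>
     (\<forall>f\<in>regular X. \<forall>g\<in>regular X. D (\<lambda>q. f q * g q) = f p * D g + g p * D f)}"

definition tangent_map ::
  "'b variety \<Rightarrow> ('a \<Rightarrow> 'b) \<Rightarrow> (('a \<Rightarrow> complex) \<Rightarrow> complex) \<Rightarrow> (('b \<Rightarrow> complex) \<Rightarrow> complex)" where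
  "tangent_map Y f D = (\<lambda>g. if g \<in> regular Y then D (g \<circ> f) else 0)"

text \<open>
  Etale morphisms of smooth complex varieties: the (linear) tangent map is an isomorphism at every
  closed point. The definition is to be used for smooth \<open>X\<close> and \<open>Y\<close> only.
\<close>

definition etale :: "'a variety \<Rightarrow> 'b variety \<Rightarrow> ('a \<Rightarrow> 'b) \<Rightarrow> bool" where
  "etale X Y f \<longleftrightarrow> morphism X Y f \<and>
     (\<forall>p\<in>points X. bij_betw (tangent_map Y f) (tangent_space X p) (tangent_space Y (f p)))"

subsection \<open>Function fields and degree\<close>

definition nonzero_regular :: "'a variety \<Rightarrow> ('a \<Rightarrow> complex) set" where
  "nonzero_regular X = {b \<in> regular X. \<exists>p\<in>points X. b p \<noteq> 0}"

text \<open>The fraction \<open>a / b\<close>, as an equivalence class of pairs of numerators and denominators.\<close>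

definition fraction ::
  "'a variety \<Rightarrow> ('a \<Rightarrow> complex) \<Rightarrow> ('a \<Rightarrow> complex) \<Rightarrow> (('a \<Rightarrow> complex) \<times> ('a \<Rightarrow> complex)) set" where
  "fraction X a b = {(a', b'). a' \<in> regular X \<and> b' \<in> nonzero_regular X \<and>
                               (\<forall>p\<in>points X. a p * b' p = a' p * b p)}"

text \<open>For irreducible \<open>X\<close> the operations do not depend on representatives, so each of the unions
  below is a union of equal sets.\<close>

definition function_field :: "'a variety \<Rightarrow> (('a \<Rightarrow> complex) \<times> ('a \<Rightarrow> complex)) set ring" where
  "function_field X =
     \<lparr>carrier = {fraction X a b | a b. a \<in> regular X \<and> b \<in> nonzero_regular X},
      monoid.mult = (\<lambda>u v. \<Union>(a, b)\<in>u. \<Union>(a', b')\<in>v.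
                fraction X (\<lambda>p. a p * a' p) (\<lambda>p. b p * b' p)),
      one = fraction X (\<lambda>_. 1) (\<lambda>_. 1),
      zero = fraction X (\<lambda>_. 0) (\<lambda>_. 1),
      add = (\<lambda>u v. \<Union>(a, b)\<in>u. \<Union>(a', b')\<in>v.
                fraction X (\<lambda>p. a p * b' p + a' p * b p) (\<lambda>p. b p * b' p))\<rparr>"

definition dominant :: "'a variety \<Rightarrow> 'b variety \<Rightarrow> ('a \<Rightarrow> 'b) \<Rightarrow> bool" where
  "dominant X Y f \<longleftrightarrow> morphism X Y f \<and>
     (\<forall>C. zariski_closed Y C \<and> f ` points X \<subseteq> C \<longrightarrow> C = points Y)"

definition pullback ::
  "'a variety \<Rightarrow> ('a \<Rightarrow> 'b) \<Rightarrow> (('b \<Rightarrow> complex) \<times> ('b \<Rightarrow> complex)) set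
     \<Rightarrow> (('a \<Rightarrow> complex) \<times> ('a \<Rightarrow> complex)) set" where
  "pullback X f u = (\<Union>(a, b)\<in>u. fraction X (a \<circ> f) (b \<circ> f))"

definition has_degree :: "'a variety \<Rightarrow> 'b variety \<Rightarrow> ('a \<Rightarrow> 'b) \<Rightarrow> nat \<Rightarrow> bool" where
  "has_degree X Y f d \<longleftrightarrow> dominant X Y f \<and>
     ring.dimension (function_field X) d
       (pullback X f ` carrier (function_field Y)) (carrier (function_field X))"

section \<open>Torus actions and the equivariant Generalized Jacobian Conjecture\<close>

text \<open>An action of the multiplicative group is a function \<open>act\<close>, used only at nonzero scalars.\<close>

definition multiplicative_group :: "complex variety" where
  "multiplicative_group = generated_variety (- {0}) {\<lambda>l. l, \<lambda>l. inverse l}"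

definition algebraic_torus_action :: "'a variety \<Rightarrow> (complex \<Rightarrow> 'a \<Rightarrow> 'a) \<Rightarrow> bool" where
  "algebraic_torus_action X act \<longleftrightarrow>
     morphism (product_variety multiplicative_group X) X (\<lambda>(l, p). act l p) \<and>
     (\<forall>p\<in>points X. act 1 p = p) \<and>
     (\<forall>l m. l \<noteq> 0 \<and> m \<noteq> 0 \<longrightarrow> (\<forall>p\<in>points X. act (l * m) p = act l (act m p)))"

definition equivariant ::
  "'a variety \<Rightarrow> (complex \<Rightarrow> 'a \<Rightarrow> 'a) \<Rightarrow> (complex \<Rightarrow> 'b \<Rightarrow> 'b) \<Rightarrow> ('a \<Rightarrow> 'b) \<Rightarrow> bool" where
  "equivariant X actX actY f \<longleftrightarrow> (\<forall>l. l \<noteq> 0 \<longrightarrow> (\<forall>p\<in>points X. f (actX l p) = actY l (f p)))"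

definition equivariant_etale_endo ::
  "'a variety \<Rightarrow> (complex \<Rightarrow> 'a \<Rightarrow> 'a) \<Rightarrow> ('a \<Rightarrow> 'a) \<Rightarrow> bool" where
  "equivariant_etale_endo X act f \<longleftrightarrow> etale X X f \<and> equivariant X act act f"

text \<open>For a smooth variety with an effective algebraic torus action:\<close>

definition equivariant_GJC :: "'a variety \<Rightarrow> (complex \<Rightarrow> 'a \<Rightarrow> 'a) \<Rightarrow> bool" where
  "equivariant_GJC X act \<longleftrightarrow> (\<forall>f. equivariant_etale_endo X act f \<longrightarrow> proper X X f)"

definition equivariant_iso ::
  "'a variety \<Rightarrow> (complex \<Rightarrow> 'a \<Rightarrow> 'a) \<Rightarrow> 'b variety \<Rightarrow> (complex \<Rightarrow> 'b \<Rightarrow> 'b) \<Rightarrow> ('a \<Rightarrow> 'b) \<Rightarrow> bool" where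
  "equivariant_iso X actX Y actY f \<longleftrightarrow>
     morphism X Y f \<and> equivariant X actX actY f \<and>
     (\<exists>g. morphism Y X g \<and> (\<forall>p\<in>points X. g (f p) = p) \<and> (\<forall>q\<in>points Y. f (g q) = q))"

section \<open>Quotients by finite groups\<close>

definition orbit :: "'g set \<Rightarrow> ('g \<Rightarrow> 'a \<Rightarrow> 'a) \<Rightarrow> 'a \<Rightarrow> 'a set" where
  "orbit H act p = (\<lambda>h. act h p) ` H"

text \<open>The points of the quotient are the orbits, its regular functions are the invariant regular
  functions (viewed as functions of the orbit).\<close>

definition quotient_variety :: "'a variety \<Rightarrow> 'g set \<Rightarrow> ('g \<Rightarrow> 'a \<Rightarrow> 'a) \<Rightarrow> 'a set variety" where
  "quotient_variety X H act =
     \<lparr>points = orbit H act ` points X,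
      regular = {f. (\<lambda>p. f (orbit H act p)) \<in> regular X}\<rparr>"

definition induced_action :: "('g \<Rightarrow> 'a \<Rightarrow> 'a) \<Rightarrow> 'g \<Rightarrow> 'a set \<Rightarrow> 'a set" where
  "induced_action act l O' = act l ` O'"

section \<open>The pseudo-planes\<close>

type_synonym point3 = "complex \<times> complex \<times> complex"

definition S_tilde :: "nat \<Rightarrow> nat \<Rightarrow> point3 variety" where
  "S_tilde k r = generated_variety {(x, y, z). x ^ r * y = z ^ k - 1}
     {\<lambda>(x, y, z). x, \<lambda>(x, y, z). y, \<lambda>(x, y, z). z}"

definition torus_action :: "nat \<Rightarrow> complex \<Rightarrow> point3 \<Rightarrow> point3" where
  "torus_action r l = (\<lambda>(x, y, z). (l * x, l powi (- int r) * y, z))"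

definition roots_of_unity_group :: "nat \<Rightarrow> complex monoid" where
  "roots_of_unity_group k = \<lparr>carrier = {e. e ^ k = 1}, monoid.mult = (*), one = 1\<rparr>"

definition root_action :: "nat \<Rightarrow> nat \<Rightarrow> complex \<Rightarrow> point3 \<Rightarrow> point3" where
  "root_action r a e = (\<lambda>(x, y, z). (e * x, e powi (- int r) * y, e powi (- int a) * z))"

definition S_tilde_quotient :: "nat \<Rightarrow> nat \<Rightarrow> nat \<Rightarrow> complex set \<Rightarrow> point3 set variety" where
  "S_tilde_quotient k r a H = quotient_variety (S_tilde k r) H (root_action r a)"

definition pseudo_plane :: "nat \<Rightarrow> nat \<Rightarrow> nat \<Rightarrow> point3 set variety" where
  "pseudo_plane k r a = S_tilde_quotient k r a (carrier (roots_of_unity_group k))"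

definition induced_torus_action :: "nat \<Rightarrow> complex \<Rightarrow> point3 set \<Rightarrow> point3 set" where
  "induced_torus_action r = induced_action (torus_action r)"

text \<open>Since \<open>S_tilde k r\<close> is simply connected, the finite covers of \<open>pseudo_plane k r a\<close> are, up to isomorphism,
  the quotients of \<open>S_tilde k r\<close> by subgroups of the group of roots of unity.\<close>

definition finite_cover_of_pseudo_plane ::
  "nat \<Rightarrow> nat \<Rightarrow> nat \<Rightarrow> 'a variety \<Rightarrow> (complex \<Rightarrow> 'a \<Rightarrow> 'a) \<Rightarrow> bool" where
  "finite_cover_of_pseudo_plane k r a X act \<longleftrightarrow>
     affine_variety X \<and> algebraic_torus_action X act \<and>
     (\<exists>H f. subgroup H (roots_of_unity_group k) \<and>
            equivariant_iso X act (S_tilde_quotient k r a H) (induced_torus_action r) f)"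

end

theory Submission
  imports
    "HOL-Computational_Algebra.Fundamental_Theorem_Algebra"
    "HOL-Analysis.Continuum_Not_Denumerable"
    "HOL-Analysis.Derivative"
    "HOL-Library.Function_Algebras"
    "HOL-Library.FuncSet"
    "HOL-Algebra.Finite_Extensions"
    Defs
begin

text \<open>
  The torus quotient of the surface \<open>S = {x\<^sup>r y = z\<^sup>k - 1}\<close> is the \<open>z\<close>-line: on the slice \<open>x = 1\<close> a
  function of weight \<open>n\<close> becomes \<open>x\<^sup>n q(z)\<close> with a polynomial \<open>q\<close> (\<open>weight_function\<close>). The theorem is
  therefore a statement about polynomials in one variable.

  Degrees that can occur. Let \<open>f\<close> be an equivariant etale endomorphism of the quotient \<open>S / \<mu>\<^sub>k\<close>. Let \<open>t(z)\<close>
  represent the pullback of the invariant function \<open>z\<^sup>k\<close>, and \<open>x\<^sup>k u(z)\<close> that of \<open>x\<^sup>k\<close>. Comparing tangent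
  vectors through invariant monomials that are local coordinates of the quotient shows that every zero of
  \<open>t\<close> has order \<open>k\<close> (\<open>zero_order\<close>), that \<open>t - 1\<close> has order \<open>r\<close> at every zero of \<open>u\<close> (\<open>hub_order\<close>), and that
  \<open>t\<close> is unramified elsewhere (\<open>generic_unramified\<close>). Counting critical points gives
  \<open>deg t = k (1 + (r - 1) N)\<close>, where \<open>N\<close> is the number of zeros of \<open>u\<close> (\<open>degree_from_ramification\<close>). Their
  set is stable under \<open>k\<close>-th roots of unity, so \<open>N\<close> is divisible by \<open>k\<close> unless the origin is a zero, in
  which case \<open>N\<close> is \<open>1\<close> modulo \<open>k\<close>, and the behaviour at the origin forces \<open>a = 1\<close> and \<open>k dvd r\<close>. The function
  field of the quotient is generated over its pullback by \<open>z\<^sup>k\<close> (\<open>function_field_generated\<close>), so the degree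
  of \<open>f\<close> is \<open>deg t / k = 1 + (r - 1) N\<close> (\<open>degree_theorem\<close>). These are the two congruences.

  Existence. If \<open>A\<^sup>r B (z\<^sup>k - 1) = Q\<^sup>k - 1\<close> and \<open>Q'\<close> is a nonzero constant multiple of \<open>A\<^bsup>r-1\<^esup>\<close>, then
  \<open>(x, y, z) \<mapsto> (x A(z), y B(z), Q(z))\<close> is an equivariant etale endomorphism of \<open>S\<close> (\<open>lift_map_etale\<close>); with
  the right symmetry under roots of unity it descends to the quotients, along which \<open>S\<close> is etale
  (\<open>cover_etale\<close>). With \<open>Q\<close> an antiderivative of \<open>A\<^bsup>r-1\<^esup>\<close>, the divisibility of \<open>Q\<^sup>k - const\<close> by \<open>A\<^sup>r\<close> is a
  system of homogeneous equations in the roots of \<open>A\<close>. By symmetry there are fewer equations than unknowns,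
  so the projective dimension theorem (\<open>homogeneous_common_zero\<close>) provides a nontrivial solution for every
  admissible \<open>N = deg A\<close> (\<open>exists_lift_data\<close>).

  Properness. If the degree exceeds one, there is some \<open>z\<close> with \<open>t(z) = 1\<close> that is not a \<open>k\<close>-th root of unity
  (\<open>collapsed_orbit\<close>). The torus orbit over \<open>z\<close> is closed, but its image is an orbit over a root of unity,
  which has a fixed point in its closure. So the map is not closed (\<open>collapse_not_closed\<close>). The maps with
  \<open>N = k\<close> descend to the quotient by every group of roots of unity and collapse an orbit in the same way,
  which settles all finite covers.
\<close>

hide_const (open) Polynomials.degree Polynomials.lead_coeff up_ring.coeff up_ring.monom module.smult
no_notation var (\<open>X\<index>\<close>)

section \<open>Homogeneous systems with more unknowns than equations\<close>

definition scale_fun :: "complex \<Rightarrow> ('a \<Rightarrow> complex) \<Rightarrow> 'a \<Rightarrow> complex" where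
  "scale_fun c f = (\<lambda>x. c * f x)"

lemma scale_fun_apply [simp]: "scale_fun c f x = c * f x"
  by (simp add: scale_fun_def)

interpretation fun_vs: vector_space scale_fun
  by unfold_locales (auto simp: fun_eq_iff algebra_simps)

lemma sum_fun_eval: "(\<Sum>i\<in>I. f i) x = (\<Sum>i\<in>I. f i x)" for f :: "'i \<Rightarrow> 'a \<Rightarrow> 'b::comm_monoid_add"
  by (induction I rule: infinite_finite_induct) auto

lemma prod_fun_eval: "(\<Prod>i\<in>I. f i) x = (\<Prod>i\<in>I. f i x)" for f :: "'i \<Rightarrow> 'a \<Rightarrow> 'b::comm_monoid_mult"
  by (induction I rule: infinite_finite_induct) auto

lemma power_fun_eval: "(f ^ n) x = f x ^ n" for f :: "'a \<Rightarrow> 'b::comm_semiring_1"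
  by (induction n) auto

text \<open>
  Polynomial functions in \<open>M\<close> variables are functions on all sequences that only
  use the entries below \<open>M\<close>; this gives polynomials in a number of variables that
  may vary inside a statement.
\<close>

definition monomial :: "nat \<Rightarrow> (nat \<Rightarrow> nat) \<Rightarrow> (nat \<Rightarrow> complex) \<Rightarrow> complex" where
  "monomial M e = (\<lambda>x. \<Prod>i<M. x i ^ e i)"

definition forms :: "nat \<Rightarrow> nat \<Rightarrow> ((nat \<Rightarrow> complex) \<Rightarrow> complex) set" where
  "forms M d = fun_vs.span {monomial M e | e. sum e {..<M} = d}"

definition poly_functions :: "nat \<Rightarrow> nat \<Rightarrow> ((nat \<Rightarrow> complex) \<Rightarrow> complex) set" where
  "poly_functions M d = fun_vs.span {monomial M e | e. sum e {..<M} \<le> d}"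

definition all_poly_functions :: "nat \<Rightarrow> ((nat \<Rightarrow> complex) \<Rightarrow> complex) set" where
  "all_poly_functions M = fun_vs.span (range (monomial M))"

lemma span_mult:
  fixes f g :: "'a \<Rightarrow> complex"
  assumes f: "f \<in> fun_vs.span S" and g: "g \<in> fun_vs.span T"
    and st: "\<And>s t. s \<in> S \<Longrightarrow> t \<in> T \<Longrightarrow> s * t \<in> fun_vs.span U"
  shows "f * g \<in> fun_vs.span U"
proof -
  have 1: "s * g \<in> fun_vs.span U" if "s \<in> S" for s
    using g
  proof (induction rule: fun_vs.span_induct_alt)
    case base
    show ?case using fun_vs.span_zero[of U] by (metis mult_zero_right)
  next
    case (step c x y)
    have "s * (scale_fun c x + y) = scale_fun c (s * x) + s * y"
      by (auto simp: fun_eq_iff algebra_simps)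
    then show ?case using step st[OF that step(1)]
      by (metis fun_vs.span_add fun_vs.span_scale)
  qed
  show ?thesis using f
  proof (induction rule: fun_vs.span_induct_alt)
    case base
    show ?case using fun_vs.span_zero[of U] by (metis mult_zero_left)
  next
    case (step c x y)
    have "(scale_fun c x + y) * g = scale_fun c (x * g) + y * g"
      by (auto simp: fun_eq_iff algebra_simps)
    then show ?case using step 1[OF step(1)]
      by (metis fun_vs.span_add fun_vs.span_scale)
  qed
qed

lemma monomial_mult: "monomial M e * monomial M e' = monomial M (\<lambda>i. e i + e' i)"
  by (auto simp: monomial_def fun_eq_iff prod.distrib power_add)

lemma forms_mult: "f \<in> forms M d \<Longrightarrow> g \<in> forms M e \<Longrightarrow> f * g \<in> forms M (d + e)"
  unfolding forms_def
  by (erule (1) span_mult) (force simp: monomial_mult sum.distrib intro: fun_vs.span_base)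

lemma poly_functions_mult:
  "f \<in> poly_functions M d \<Longrightarrow> g \<in> poly_functions M e \<Longrightarrow> f * g \<in> poly_functions M (d + e)"
  unfolding poly_functions_def
  by (erule (1) span_mult) (force simp: monomial_mult sum.distrib intro: fun_vs.span_base)

lemma all_poly_functions_mult:
  "f \<in> all_poly_functions M \<Longrightarrow> g \<in> all_poly_functions M \<Longrightarrow> f * g \<in> all_poly_functions M"
  unfolding all_poly_functions_def
  by (erule (1) span_mult) (auto simp: monomial_mult intro: fun_vs.span_base)

lemma const_eq_scale: "(\<lambda>_. c) = scale_fun c (monomial M (\<lambda>_. 0))"
  by (auto simp: monomial_def fun_eq_iff)

lemma forms_const: "(\<lambda>_. c) \<in> forms M 0"
  unfolding forms_def const_eq_scale[of _ M]
  by (intro fun_vs.span_scale fun_vs.span_base CollectI exI[of _ "\<lambda>_. 0"]) auto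

lemma coordinate_eq_monomial: "i < M \<Longrightarrow> (\<lambda>x. x i) = monomial M (\<lambda>j. if j = i then 1 else 0)"
  by (auto simp: monomial_def fun_eq_iff if_distrib if_distribR cong: if_cong)

lemma forms_coordinate: "i < M \<Longrightarrow> (\<lambda>x. x i) \<in> forms M 1"
  unfolding forms_def
  by (subst coordinate_eq_monomial, assumption) (auto intro!: fun_vs.span_base exI)

lemma forms_zero: "0 \<in> forms M d"
  and forms_add: "f \<in> forms M d \<Longrightarrow> g \<in> forms M d \<Longrightarrow> f + g \<in> forms M d"
  and forms_diff: "f \<in> forms M d \<Longrightarrow> g \<in> forms M d \<Longrightarrow> f - g \<in> forms M d"
  and forms_scale: "f \<in> forms M d \<Longrightarrow> scale_fun c f \<in> forms M d"
  and forms_sum: "(\<And>i. i \<in> I \<Longrightarrow> F i \<in> forms M d) \<Longrightarrow> (\<Sum>i\<in>I. F i) \<in> forms M d"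
  unfolding forms_def
  by (auto intro: fun_vs.span_zero fun_vs.span_add fun_vs.span_diff fun_vs.span_scale fun_vs.span_sum)

lemma forms_power: "f \<in> forms M d \<Longrightarrow> f ^ n \<in> forms M (n * d)"
proof (induction n)
  case 0
  then show ?case using forms_const[of 1 M] by (simp add: one_fun_def)
next
  case (Suc n)
  then have "f * f ^ n \<in> forms M (d + n * d)" by (intro forms_mult)
  then show ?case by (simp only: power_Suc mult_Suc)
qed

lemma all_poly_functions_add:
    "f \<in> all_poly_functions M \<Longrightarrow> g \<in> all_poly_functions M \<Longrightarrow> f + g \<in> all_poly_functions M"
  and all_poly_functions_diff:
    "f \<in> all_poly_functions M \<Longrightarrow> g \<in> all_poly_functions M \<Longrightarrow> f - g \<in> all_poly_functions M"
  and all_poly_functions_zero: "0 \<in> all_poly_functions M"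
  and all_poly_functions_sum:
    "(\<And>i. i \<in> I \<Longrightarrow> F i \<in> all_poly_functions M) \<Longrightarrow> (\<Sum>i\<in>I. F i) \<in> all_poly_functions M"
  unfolding all_poly_functions_def
  by (auto intro: fun_vs.span_zero fun_vs.span_add fun_vs.span_diff fun_vs.span_scale fun_vs.span_sum)

lemma forms_subset: "forms M d \<subseteq> all_poly_functions M"
  unfolding forms_def all_poly_functions_def by (rule fun_vs.span_mono) auto

lemma forms_subset_poly_functions: "forms M d \<subseteq> poly_functions M d"
  unfolding forms_def poly_functions_def by (rule fun_vs.span_mono) auto

lemma poly_functions_mono: "d \<le> e \<Longrightarrow> poly_functions M d \<subseteq> poly_functions M e"
  unfolding poly_functions_def by (rule fun_vs.span_mono) auto

lemma all_poly_functions_const: "(\<lambda>_. c) \<in> all_poly_functions M"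
  using forms_const forms_subset by blast

lemma all_poly_functions_coordinate: "i < M \<Longrightarrow> (\<lambda>x. x i) \<in> all_poly_functions M"
  using forms_coordinate forms_subset by blast

lemma forms_homogeneous:
  assumes "f \<in> forms M d"
  shows "f (\<lambda>i. l * x i) = l ^ d * f x"
  using assms unfolding forms_def
proof (induction rule: fun_vs.span_induct_alt)
  case base
  show ?case by simp
next
  case (step c m y)
  then obtain e where e: "m = monomial M e" "sum e {..<M} = d" by auto
  have "m (\<lambda>i. l * x i) = l ^ d * m x"
    by (simp add: e(1) monomial_def power_mult_distrib prod.distrib power_sum flip: e(2))
  then show ?case using step by (simp add: algebra_simps)
qed

text \<open>
  Padding each monomial with powers of \<open>x i\<close> does not change it on the hyperplane
  \<open>x i = 1\<close>.
\<close>

lemma homogenize: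
  assumes "g \<in> all_poly_functions M" "i < M"
  shows "\<exists>N0. \<forall>N\<ge>N0. \<exists>g'\<in>forms M N. \<forall>x. x i = 1 \<longrightarrow> g' x = g x"
  using assms(1) unfolding all_poly_functions_def
proof (induction rule: fun_vs.span_induct_alt)
  case base
  show ?case using forms_zero by (intro exI[of _ 0] allI impI bexI[of _ 0]) auto
next
  case (step c m y)
  then obtain e where e: "m = monomial M e" by auto
  from step obtain N0 where N0: "\<And>N. N \<ge> N0 \<Longrightarrow> \<exists>g'\<in>forms M N. \<forall>x. x i = 1 \<longrightarrow> g' x = y x" by blast
  show ?case
  proof (intro exI[of _ "max N0 (sum e {..<M})"] allI impI)
    fix N assume N: "N \<ge> max N0 (sum e {..<M})"
    then obtain g' where g': "g' \<in> forms M N" "\<And>x. x i = 1 \<Longrightarrow> g' x = y x" using N0[of N] by auto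
    define h where "h = (\<lambda>x::nat \<Rightarrow> complex. x i) ^ (N - sum e {..<M}) * monomial M e"
    have "monomial M e \<in> forms M (sum e {..<M})"
      unfolding forms_def by (rule fun_vs.span_base) auto
    then have "h \<in> forms M ((N - sum e {..<M}) * 1 + sum e {..<M})"
      unfolding h_def by (intro forms_mult forms_power forms_coordinate assms)
    then have "h \<in> forms M N" using N by simp
    then have "scale_fun c h + g' \<in> forms M N" by (intro forms_add forms_scale g')
    moreover have "(scale_fun c h + g') x = (scale_fun c m + y) x" if "x i = 1" for x
      using g'(2) that by (simp add: h_def e power_fun_eval)
    ultimately show "\<exists>g'\<in>forms M N. \<forall>x. x i = 1 \<longrightarrow> g' x = (scale_fun c m + y) x" by blast
  qed
qed

definition poly_ideal :: "nat \<Rightarrow> ((nat \<Rightarrow> complex) \<Rightarrow> complex) set \<Rightarrow> bool" where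
  "poly_ideal M I \<longleftrightarrow> I \<subseteq> all_poly_functions M \<and> 0 \<in> I \<and> (\<forall>f\<in>I. \<forall>g\<in>I. f + g \<in> I) \<and>
     (\<forall>f\<in>I. \<forall>g\<in>all_poly_functions M. g * f \<in> I)"

lemma poly_ideal_sum:
  "poly_ideal M I \<Longrightarrow> (\<And>j. j \<in> J \<Longrightarrow> F j \<in> I) \<Longrightarrow> (\<Sum>j\<in>J. F j) \<in> I"
  by (induction J rule: infinite_finite_induct) (auto simp: poly_ideal_def)

lemma poly_ideal_uminus: "poly_ideal M I \<Longrightarrow> f \<in> I \<Longrightarrow> - f \<in> I"
proof -
  assume I: "poly_ideal M I" "f \<in> I"
  then have "(\<lambda>_. -1) * f \<in> I" using all_poly_functions_const by (auto simp: poly_ideal_def)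
  moreover have "(\<lambda>_. -1) * f = - f" by (auto simp: fun_eq_iff)
  ultimately show ?thesis by simp
qed

lemma poly_ideal_diff: "poly_ideal M I \<Longrightarrow> f \<in> I \<Longrightarrow> g \<in> I \<Longrightarrow> f - g \<in> I"
  using poly_ideal_uminus[of M I g] unfolding poly_ideal_def by (metis add_uminus_conv_diff)

lemma finite_span_levels:
  assumes "f \<in> all_poly_functions M"
  shows "\<exists>n. f \<in> fun_vs.span (monomial M ` ({..<M} \<rightarrow>\<^sub>E {..n}))"
  using assms unfolding all_poly_functions_def
proof (induction rule: fun_vs.span_induct_alt)
  case base
  show ?case by (intro exI fun_vs.span_zero)
next
  case (step c m y)
  then obtain e n where e: "m = monomial M e"
    and n: "y \<in> fun_vs.span (monomial M ` ({..<M} \<rightarrow>\<^sub>E {..n}))" by blast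
  define n' where "n' = n + sum e {..<M}"
  have le: "e i \<le> n'" if "i < M" for i
    using member_le_sum[of i "{..<M}" e] that by (auto simp: n'_def)
  have "monomial M e = monomial M (restrict e {..<M})" by (auto simp: monomial_def)
  moreover have "restrict e {..<M} \<in> {..<M} \<rightarrow>\<^sub>E {..n'}" using le by auto
  ultimately have "m \<in> monomial M ` ({..<M} \<rightarrow>\<^sub>E {..n'})" using e by blast
  moreover have "y \<in> fun_vs.span (monomial M ` ({..<M} \<rightarrow>\<^sub>E {..n'}))"
    by (rule subsetD[OF fun_vs.span_mono n], rule image_mono, rule PiE_mono) (auto simp: n'_def)
  ultimately show ?case
    by (meson fun_vs.span_add fun_vs.span_scale fun_vs.span_base)
qed

text \<open>
  Maximality is stated as the existence of inverses modulo the ideal, the form in which the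
  Nullstellensatz uses it.
\<close>

locale maximal_poly_ideal =
  fixes M :: nat and J :: "((nat \<Rightarrow> complex) \<Rightarrow> complex) set"
  assumes ideal: "poly_ideal M J" and proper_ideal: "1 \<notin> J"
    and inverse_mod: "\<And>f. f \<in> all_poly_functions M \<Longrightarrow> f \<notin> J \<Longrightarrow> \<exists>g\<in>all_poly_functions M. 1 - g * f \<in> J"
begin

lemma ideal_mult: "f \<in> J \<Longrightarrow> g \<in> all_poly_functions M \<Longrightarrow> g * f \<in> J"
  using ideal by (auto simp: poly_ideal_def)

lemma ideal_add: "f \<in> J \<Longrightarrow> g \<in> J \<Longrightarrow> g + f \<in> J"
  using ideal by (auto simp: poly_ideal_def)

lemma ideal_const: "(\<lambda>_. c) \<in> J \<Longrightarrow> c = 0"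
proof (rule ccontr)
  assume "(\<lambda>_. c) \<in> J" "c \<noteq> 0"
  then have "(\<lambda>_. inverse c) * (\<lambda>_. c) \<in> J" using ideal_mult all_poly_functions_const by blast
  moreover have "(\<lambda>_. inverse c) * (\<lambda>_::nat \<Rightarrow> complex. c) = 1" using \<open>c \<noteq> 0\<close> by (auto simp: fun_eq_iff)
  ultimately show False using proper_ideal by simp
qed

lemma ideal_prime:
  assumes "f \<in> all_poly_functions M" "g \<in> all_poly_functions M" "f * g \<in> J" "f \<notin> J"
  shows "g \<in> J"
proof -
  obtain h where h: "h \<in> all_poly_functions M" "1 - h * f \<in> J" using inverse_mod assms by blast
  have "g * (1 - h * f) + h * (f * g) \<in> J" using assms h by (intro ideal_add ideal_mult[OF assms(3)] ideal_mult[OF h(2)])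
  moreover have "g * (1 - h * f) + h * (f * g) = g" by (simp only: algebra_simps) simp
  ultimately show ?thesis by metis
qed

text \<open>
  A maximal ideal is prime, and a polynomial in one coordinate splits into linear factors over
  the complex numbers.
\<close>

lemma linear_in_ideal_of_poly:
  assumes "i < M" "q \<noteq> 0" "(\<lambda>x. poly q (x i)) \<in> J"
  shows "\<exists>c. (\<lambda>x. x i - c) \<in> J"
  using assms(2,3)
proof (induction "degree q" arbitrary: q)
  case 0
  then obtain c where "q = [:c:]" by (metis degree_eq_zeroE)
  then show ?case using 0 ideal_const by auto
next
  case (Suc n)
  then obtain c where "poly q c = 0"
    using fundamental_theorem_of_algebra[of q] by (auto simp: constant_degree)
  then obtain q' where q': "q = [:-c, 1:] * q'" by (metis dvdE poly_eq_0_iff_dvd)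
  then have "q' \<noteq> 0" using Suc by auto
  then have "n = degree q'" using Suc(2) unfolding q' by (subst (asm) degree_mult_eq) auto
  have poly_fun: "(\<lambda>x. poly p (x i)) \<in> all_poly_functions M" for p
  proof (induction p)
    case 0
    show ?case using all_poly_functions_const[of 0] by simp
  next
    case (pCons a p)
    have "(\<lambda>x. poly (pCons a p) (x i)) = (\<lambda>_. a) + (\<lambda>x. x i) * (\<lambda>x. poly p (x i))" by auto
    then show ?case using pCons assms(1)
      by (metis all_poly_functions_add all_poly_functions_const all_poly_functions_coordinate all_poly_functions_mult)
  qed
  have "(\<lambda>x. poly q (x i)) = (\<lambda>x. poly [:-c, 1:] (x i)) * (\<lambda>x. poly q' (x i))"
    unfolding q' by (rule ext) (simp only: poly_mult times_fun_apply)
  then have "(\<lambda>x. poly [:-c, 1:] (x i)) \<in> J \<or> (\<lambda>x. poly q' (x i)) \<in> J"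
    using Suc.prems ideal_prime poly_fun by metis
  then show ?case using Suc(1)[OF \<open>n = degree q'\<close> \<open>q' \<noteq> 0\<close>] by (auto simp: diff_conv_add_uminus add.commute simp del: add_uminus_conv_diff)
qed

text \<open>
  Were no \<open>x i - c\<close> in the ideal, all of them would have inverses in the residue
  field. These inverses are uncountably many, while the residue field is a countable union of
  finite-dimensional spaces, so some of them are linearly dependent. Clearing denominators in
  the dependence gives a nonzero polynomial in \<open>x i\<close> that lies in the ideal.
\<close>

lemma coordinate_mod:
  assumes i: "i < M"
  shows "\<exists>c. (\<lambda>x. x i - c) \<in> J"
proof (rule ccontr)
  assume *: "\<nexists>c. (\<lambda>x. x i - c) \<in> J"
  define X where "X = (\<lambda>c x. x i - c :: complex)"
  have X: "X c \<in> all_poly_functions M" for c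
    using all_poly_functions_diff[OF all_poly_functions_coordinate[OF i] all_poly_functions_const[of c M]]
    by (simp add: X_def fun_diff_def)
  have "\<forall>c. \<exists>g\<in>all_poly_functions M. 1 - g * X c \<in> J"
    using inverse_mod X * by (auto simp: X_def)
  then obtain g where g: "\<And>c. g c \<in> all_poly_functions M" "\<And>c. 1 - g c * X c \<in> J" by metis
  (* countably many finite sets of monomials, so one of their spans contains infinitely many
     inverses *)
  define B where "B n = monomial M ` ({..<M} \<rightarrow>\<^sub>E {..n::nat})" for n
  have fin_B: "finite (B n)" for n unfolding B_def by (intro finite_imageI finite_PiE) auto
  have "\<exists>n. g c \<in> fun_vs.span (B n)" for c
    using finite_span_levels[OF g(1)] by (simp add: B_def)
  then have "(UNIV :: complex set) = (\<Union>n. {c. g c \<in> fun_vs.span (B n)})" by blast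
  then obtain n where inf: "infinite {c. g c \<in> fun_vs.span (B n)}"
    using uncountable_UNIV_complex countable_finite by (metis (mono_tags, lifting) countable_UN countableI_type)
  obtain F where F: "finite F" "card F = Suc (card (B n))" "F \<subseteq> {c. g c \<in> fun_vs.span (B n)}"
    using infinite_arbitrarily_large[OF inf] by blast
  have inj: "inj_on g F"
  proof (rule inj_onI, rule ccontr)
    fix c d assume cd: "g c = g d" "c \<noteq> d"
    have "(1 - g c * X c) - (1 - g d * X d) \<in> J" by (rule poly_ideal_diff[OF ideal g(2) g(2)])
    moreover have "(1 - g c * X c) - (1 - g d * X d) = (\<lambda>_. c - d) * g c"
      by (auto simp: fun_eq_iff X_def cd(1) algebra_simps)
    ultimately have "(\<lambda>_. c - d) * g c \<in> J" by metis
    then have "(\<lambda>_. inverse (c - d)) * ((\<lambda>_. c - d) * g c) \<in> J"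
      by (rule ideal_mult[OF _ all_poly_functions_const])
    moreover have "(\<lambda>_. inverse (c - d)) * ((\<lambda>_. c - d) * g c) = g c" using cd(2) by (auto simp: fun_eq_iff)
    ultimately have "g c \<in> J" by metis
    then have "X c * g c \<in> J" by (rule ideal_mult[OF _ X])
    then have "(1 - g c * X c) + X c * g c \<in> J" by (rule ideal_add[OF _ g(2)])
    then show False using proper_ideal by simp
  qed
  have "fun_vs.dependent (g ` F)"
  proof (rule ccontr)
    assume "\<not> fun_vs.dependent (g ` F)"
    moreover have "g ` F \<subseteq> fun_vs.span (B n)" using F(3) by blast
    ultimately have "card (g ` F) \<le> card (B n)" using fun_vs.independent_span_bound[OF fin_B] by blast
    then show False using F(2) card_image[OF inj] by linarith
  qed
  then have "\<exists>u. (\<exists>v\<in>g ` F. u v \<noteq> 0) \<and> (\<Sum>v\<in>g ` F. scale_fun (u v) v) = 0"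
    by (simp only: fun_vs.dependent_finite[OF finite_imageI[OF F(1)]])
  then obtain u where u: "\<exists>v\<in>g ` F. u v \<noteq> 0" "(\<Sum>v\<in>g ` F. scale_fun (u v) v) = 0"
    by (elim exE conjE)
  define l where "l c = u (g c)" for c
  obtain c0 where c0: "c0 \<in> F" "l c0 \<noteq> 0" using u by (auto simp: l_def)
  have sum0: "(\<Sum>c\<in>F. scale_fun (l c) (g c)) = 0"
    using u(2) by (simp add: sum.reindex[OF inj] l_def)
  (* the numerator of the sum of l c / (x i - c) *)
  define p where "p = (\<Sum>c\<in>F. smult (l c) (\<Prod>d\<in>F - {c}. [:-d, 1:]))"
  have "poly p c0 = (\<Sum>c\<in>F. if c = c0 then l c0 * (\<Prod>d\<in>F - {c0}. c0 - d) else 0)"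
    unfolding p_def poly_sum
    by (rule sum.cong) (use c0 F in \<open>auto simp: poly_prod intro!: prod_zero\<close>)
  also have "\<dots> = l c0 * (\<Prod>d\<in>F - {c0}. c0 - d)" using c0 F by simp
  finally have "poly p c0 \<noteq> 0" using c0 F by auto
  then have "p \<noteq> 0" by auto
  have one: "1 \<in> all_poly_functions M" unfolding one_fun_def by (rule all_poly_functions_const)
  have Xprod: "(\<Prod>d\<in>A. X d) \<in> all_poly_functions M" for A
  proof (induction A rule: infinite_finite_induct)
    case (insert d A)
    then show ?case using all_poly_functions_mult[OF X] by (metis prod.insert)
  qed (simp_all only: prod.infinite prod.empty one not_False_eq_True)
  have "(\<Sum>c\<in>F. (\<lambda>x. l c) * (\<Prod>d\<in>F - {c}. X d) * (1 - g c * X c)) \<in> J"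
    by (intro poly_ideal_sum[OF ideal] ideal_mult g all_poly_functions_mult all_poly_functions_const Xprod)
  also have "(\<Sum>c\<in>F. (\<lambda>x. l c) * (\<Prod>d\<in>F - {c}. X d) * (1 - g c * X c))
      = (\<Sum>c\<in>F. (\<lambda>x. l c) * (\<Prod>d\<in>F - {c}. X d)) - (\<Prod>d\<in>F. X d) * (\<Sum>c\<in>F. scale_fun (l c) (g c))"
    unfolding sum_distrib_left sum_subtractf[symmetric]
  proof (rule sum.cong)
    fix c assume c: "c \<in> F"
    have "(\<Prod>d\<in>F. X d) = X c * (\<Prod>d\<in>F - {c}. X d)" using c F(1) by (simp add: prod.remove)
    moreover have "scale_fun (l c) (g c) = (\<lambda>x. l c) * g c" by (auto simp: fun_eq_iff)
    ultimately show "(\<lambda>x. l c) * (\<Prod>d\<in>F - {c}. X d) * (1 - g c * X c) =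
       (\<lambda>x. l c) * (\<Prod>d\<in>F - {c}. X d) - (\<Prod>d\<in>F. X d) * scale_fun (l c) (g c)"
      by (simp only: algebra_simps mult_1_left)
  qed simp
  also have "\<dots> = (\<lambda>x. poly p (x i))"
    by (auto simp: sum0 fun_eq_iff p_def poly_sum poly_prod sum_fun_eval prod_fun_eval X_def)
  finally show False using linear_in_ideal_of_poly[OF i \<open>p \<noteq> 0\<close>] * by blast
qed

text \<open>
  Modulo the ideal each coordinate is a constant, so every polynomial is congruent to its value
  at the point with these coordinates.
\<close>

lemma zero_of_maximal_ideal: "\<exists>x. \<forall>f\<in>J. f x = 0"
proof -
  obtain c where c: "\<And>i. i < M \<Longrightarrow> (\<lambda>x. x i - c i) \<in> J" using coordinate_mod by metis
  define S where "S = {f \<in> all_poly_functions M. f - (\<lambda>_. f c) \<in> J}"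
  have S_mult: "f * g \<in> S" if "f \<in> S" "g \<in> S" for f g
  proof -
    have "g * (f - (\<lambda>_. f c)) + (\<lambda>_. f c) * (g - (\<lambda>_. g c)) \<in> J"
      using that by (intro ideal_add ideal_mult all_poly_functions_const) (auto simp: S_def)
    also have "g * (f - (\<lambda>_. f c)) + (\<lambda>_. f c) * (g - (\<lambda>_. g c)) = f * g - (\<lambda>_. (f * g) c)"
      by (auto simp: fun_eq_iff algebra_simps)
    finally show ?thesis using that all_poly_functions_mult unfolding S_def by blast
  qed
  have S_one: "1 \<in> S"
    using all_poly_functions_const[of 1] ideal by (auto simp: S_def poly_ideal_def one_fun_def zero_fun_def fun_diff_def)
  have S_coord: "(\<lambda>x. x i) \<in> S" if "i < M" for i
    using c[OF that] all_poly_functions_coordinate[OF that] by (simp add: S_def fun_diff_def)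
  have S_power: "f ^ n \<in> S" if "f \<in> S" for f n
  proof (induction n)
    case 0
    show ?case using S_one by (metis power_0)
  next
    case (Suc n)
    show ?case using S_mult[OF that Suc] by (metis power_Suc)
  qed
  have "(\<Prod>i\<in>A. (\<lambda>x. x i) ^ e i) \<in> S" if "A \<subseteq> {..<M}" for A and e :: "nat \<Rightarrow> nat"
    using that
  proof (induction A rule: infinite_finite_induct)
    case (insert j A)
    then have "(\<lambda>x. x j) ^ e j * (\<Prod>i\<in>A. (\<lambda>x. x i) ^ e i) \<in> S"
      by (intro S_mult S_power S_coord) auto
    then show ?case using insert by (metis (no_types, lifting) prod.insert)
  qed (simp_all only: prod.infinite prod.empty S_one not_False_eq_True)
  moreover have "monomial M e = (\<Prod>i<M. (\<lambda>x. x i) ^ e i)" for e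
    by (auto simp: fun_eq_iff monomial_def prod_fun_eval power_fun_eval)
  ultimately have S_mon: "monomial M e \<in> S" for e by simp
  have all: "f - (\<lambda>_. f c) \<in> J" if "f \<in> all_poly_functions M" for f
    using that unfolding all_poly_functions_def
  proof (induction rule: fun_vs.span_induct_alt)
    case base
    show ?case using ideal by (simp add: poly_ideal_def zero_fun_def fun_diff_def)
  next
    case (step a m y)
    then have "m - (\<lambda>_. m c) \<in> J" using S_mon by (auto simp: S_def)
    then have "(\<lambda>_. a) * (m - (\<lambda>_. m c)) + (y - (\<lambda>_. y c)) \<in> J"
      using step by (intro ideal_add ideal_mult all_poly_functions_const)
    moreover have "(\<lambda>_. a) * (m - (\<lambda>_. m c)) + (y - (\<lambda>_. y c)) = (scale_fun a m + y) - (\<lambda>_. (scale_fun a m + y) c)"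
      by (rule ext) (simp add: algebra_simps)
    ultimately show ?case by (simp only:)
  qed
  have "f c = 0" if "f \<in> J" for f
  proof -
    have "f - (\<lambda>_. f c) \<in> J" using all that ideal by (auto simp: poly_ideal_def)
    then have "f - (f - (\<lambda>_. f c)) \<in> J" using that poly_ideal_diff[OF ideal] by blast
    then show ?thesis using ideal_const by (simp add: fun_diff_def)
  qed
  then show ?thesis by blast
qed

end

lemma exists_maximal_ideal:
  assumes I: "poly_ideal M I" "1 \<notin> I"
  shows "\<exists>J. I \<subseteq> J \<and> maximal_poly_ideal M J"
proof -
  define A where "A = {J. poly_ideal M J \<and> I \<subseteq> J \<and> 1 \<notin> J}"
  have "\<exists>J\<in>A. \<forall>K\<in>A. J \<subseteq> K \<longrightarrow> K = J"
  proof (rule subset_Zorn_nonempty)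
    show "A \<noteq> {}" using I by (auto simp: A_def)
  next
    fix C assume C: "C \<noteq> {}" "subset.chain A C"
    have ideals: "poly_ideal M K" "I \<subseteq> K" "1 \<notin> K" if "K \<in> C" for K
      using C(2) that by (auto simp: subset.chain_def A_def)
    have "poly_ideal M (\<Union>C)"
      unfolding poly_ideal_def
    proof (intro conjI ballI)
      show "\<Union>C \<subseteq> all_poly_functions M" using ideals(1) unfolding poly_ideal_def by blast
      show "0 \<in> \<Union>C" using C(1) ideals(1) unfolding poly_ideal_def by blast
      fix f g assume fg: "f \<in> \<Union>C" "g \<in> \<Union>C"
      then obtain J K where JK: "J \<in> C" "K \<in> C" "f \<in> J" "g \<in> K" by blast
      then have "J \<subseteq> K \<or> K \<subseteq> J" using C(2) by (auto simp: subset.chain_def)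
      then obtain L where "L \<in> C" "f \<in> L" "g \<in> L" using JK by blast
      then have "f + g \<in> L" using ideals(1) unfolding poly_ideal_def by blast
      then show "f + g \<in> \<Union>C" using \<open>L \<in> C\<close> by blast
    next
      fix f g assume "f \<in> \<Union>C" and g: "g \<in> all_poly_functions M"
      then obtain L where "L \<in> C" "f \<in> L" by blast
      then have "g * f \<in> L" using ideals(1) g unfolding poly_ideal_def by blast
      then show "g * f \<in> \<Union>C" using \<open>L \<in> C\<close> by blast
    qed
    then show "\<Union>C \<in> A" using C(1) ideals(2,3) unfolding A_def by blast
  qed
  then obtain J where J: "J \<in> A" "\<And>K. K \<in> A \<Longrightarrow> J \<subseteq> K \<Longrightarrow> K = J" by blast
  have ideal: "poly_ideal M J" using J by (auto simp: A_def)
  have "maximal_poly_ideal M J"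
  proof
    show "poly_ideal M J" "1 \<notin> J" using J by (auto simp: A_def)
    fix f assume f: "f \<in> all_poly_functions M" "f \<notin> J"
    define K where "K = {m + g * f | m g. m \<in> J \<and> g \<in> all_poly_functions M}"
    have JK: "J \<subseteq> K"
    proof
      fix m assume "m \<in> J"
      then show "m \<in> K" unfolding K_def using all_poly_functions_zero
        by (intro CollectI exI[of _ m] exI[of _ 0]) auto
    qed
    have "f \<in> K" unfolding K_def using all_poly_functions_const[of 1] ideal
      by (intro CollectI exI[of _ 0] exI[of _ 1]) (auto simp: poly_ideal_def one_fun_def)
    have "poly_ideal M K"
      unfolding poly_ideal_def
    proof (intro conjI ballI)
      show "K \<subseteq> all_poly_functions M" using ideal f
        by (auto simp: K_def poly_ideal_def intro!: all_poly_functions_add all_poly_functions_mult)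
      show "0 \<in> K" using JK ideal by (auto simp: poly_ideal_def)
      fix a b assume "a \<in> K" "b \<in> K"
      then obtain m g m' g' where e: "a = m + g * f" "m \<in> J" "g \<in> all_poly_functions M"
        "b = m' + g' * f" "m' \<in> J" "g' \<in> all_poly_functions M" by (auto simp: K_def)
      then have "a + b = (m + m') + (g + g') * f" by (simp add: algebra_simps)
      then show "a + b \<in> K" using e ideal unfolding K_def
        by (intro CollectI exI[of _ "m + m'"] exI[of _ "g + g'"]) (auto simp: poly_ideal_def intro: all_poly_functions_add)
    next
      fix a b assume "a \<in> K" and b: "b \<in> all_poly_functions M"
      then obtain m g where e: "a = m + g * f" "m \<in> J" "g \<in> all_poly_functions M" by (auto simp: K_def)
      then have "b * a = b * m + (b * g) * f" by (simp add: algebra_simps)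
      then show "b * a \<in> K" using e b ideal unfolding K_def
        by (intro CollectI exI[of _ "b * m"] exI[of _ "b * g"]) (auto simp: poly_ideal_def intro: all_poly_functions_mult)
    qed
    then have "1 \<in> K" using J JK \<open>f \<in> K\<close> f unfolding A_def by blast
    then obtain m g where m: "1 = m + g * f" "m \<in> J" "g \<in> all_poly_functions M" by (auto simp: K_def)
    then have "1 - g * f \<in> J" by (metis add_diff_cancel_right')
    then show "\<exists>g\<in>all_poly_functions M. 1 - g * f \<in> J" using m(3) by blast
  qed
  then show ?thesis using J by (auto simp: A_def)
qed

lemma weak_nullstellensatz:
  assumes "poly_ideal M I" "\<And>x. \<exists>f\<in>I. f x \<noteq> 0"
  shows "1 \<in> I"
proof (rule ccontr)
  assume "1 \<notin> I"
  then obtain J where "I \<subseteq> J" "maximal_poly_ideal M J" using exists_maximal_ideal assms by blast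
  then obtain x where "\<forall>f\<in>J. f x = 0" using maximal_poly_ideal.zero_of_maximal_ideal by blast
  then show False using assms(2)[of x] \<open>I \<subseteq> J\<close> by blast
qed

text \<open>
  The Nullstellensatz for homogeneous systems: the equations together with \<open>x i =
  1\<close> have no solution, so they generate the unit ideal. Homogenizing the resulting
  identity with respect to \<open>x i\<close> turns it into one for \<open>x i ^ N\<close>.
\<close>

lemma coordinate_power_in_ideal:
  fixes q M :: nat
  assumes f: "\<And>j. j < q \<Longrightarrow> f j \<in> forms M (d j)"
    and no_zero: "\<And>x. (\<And>j. j < q \<Longrightarrow> f j x = 0) \<Longrightarrow> (\<And>i. i < M \<Longrightarrow> x i = 0)"
    and i: "i < M"
  shows "\<exists>N0. \<forall>N\<ge>N0. \<exists>g. (\<forall>j<q. d j \<le> N \<and> g j \<in> forms M (N - d j)) \<and>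
           (\<forall>x. x i ^ N = (\<Sum>j<q. g j x * f j x))"
proof -
  (* adding the equation x i = 1 excludes the origin, the only common zero *)
  define X where "X = (\<lambda>x. x i - 1 :: complex)"
  have X: "X \<in> all_poly_functions M"
    using all_poly_functions_diff[OF all_poly_functions_coordinate[OF i] all_poly_functions_const[of 1 M]]
    by (simp add: X_def fun_diff_def)
  have F: "f j \<in> all_poly_functions M" if "j < q" for j using f[OF that] forms_subset by blast
  define I where "I = {(\<Sum>j<q. g j * f j) + h * X | g h.
    (\<forall>j<q. g j \<in> all_poly_functions M) \<and> h \<in> all_poly_functions M}"
  have "poly_ideal M I"
    unfolding poly_ideal_def
  proof (intro conjI ballI)
    show "I \<subseteq> all_poly_functions M"
      unfolding I_def using F X
      by (auto intro!: all_poly_functions_add all_poly_functions_sum all_poly_functions_mult)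
    have "(\<Sum>j<q. 0 * f j) + 0 * X = 0" by simp
    then show "0 \<in> I" unfolding I_def using all_poly_functions_zero[of M]
      by (intro CollectI exI[of _ "\<lambda>_. 0"] exI[of _ 0]) simp
  next
    fix a b assume "a \<in> I" "b \<in> I"
    then obtain g h g' h' where e: "a = (\<Sum>j<q. g j * f j) + h * X" "b = (\<Sum>j<q. g' j * f j) + h' * X"
      "\<forall>j<q. g j \<in> all_poly_functions M" "h \<in> all_poly_functions M"
      "\<forall>j<q. g' j \<in> all_poly_functions M" "h' \<in> all_poly_functions M" unfolding I_def by blast
    have "a + b = (\<Sum>j<q. (g j + g' j) * f j) + (h + h') * X"
      by (simp only: e(1,2) ring_distribs sum.distrib ac_simps)
    then show "a + b \<in> I" unfolding I_def using e
      by (intro CollectI exI[of _ "\<lambda>j. g j + g' j"] exI[of _ "h + h'"]) (blast intro: all_poly_functions_add)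
  next
    fix a b assume "a \<in> I" and b: "b \<in> all_poly_functions M"
    then obtain g h where e: "a = (\<Sum>j<q. g j * f j) + h * X"
      "\<forall>j<q. g j \<in> all_poly_functions M" "h \<in> all_poly_functions M" unfolding I_def by blast
    have "b * a = (\<Sum>j<q. (b * g j) * f j) + (b * h) * X"
      by (simp only: e(1) ring_distribs sum_distrib_left ac_simps)
    then show "b * a \<in> I" unfolding I_def using e b
      by (intro CollectI exI[of _ "\<lambda>j. b * g j"] exI[of _ "b * h"]) (blast intro: all_poly_functions_mult)
  qed
  moreover have "\<exists>a\<in>I. a x \<noteq> 0" for x
  proof (rule ccontr)
    assume "\<not> (\<exists>a\<in>I. a x \<noteq> 0)"
    then have z: "a x = 0" if "a \<in> I" for a using that by blast
    have one: "1 \<in> all_poly_functions M" unfolding one_fun_def by (rule all_poly_functions_const)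
    have "X = (\<Sum>j<q. 0 * f j) + 1 * X" by simp
    then have "X \<in> I" unfolding I_def using one all_poly_functions_zero[of M]
      by (intro CollectI exI[of _ "\<lambda>_. 0"] exI[of _ 1]) simp
    then have "x i = 1" using z[of X] by (simp add: X_def)
    moreover have "f j x = 0" if j: "j < q" for j
    proof -
      have "(\<Sum>j'<q. (if j' = j then 1 else 0) * f j') = (\<Sum>j'<q. if j' = j then f j' else 0)"
        by (intro sum.cong) auto
      also have "\<dots> = f j" using j by (subst sum.delta) auto
      finally have "f j = (\<Sum>j'<q. (if j' = j then 1 else 0) * f j') + 0 * X"
        by (simp only: mult_zero_left add_0_right)
      then have "f j \<in> I" unfolding I_def using one all_poly_functions_zero[of M]
        by (intro CollectI exI[of _ "\<lambda>j'. if j' = j then 1 else 0"] exI[of _ 0]) simp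
      then show ?thesis using z by blast
    qed
    ultimately show False using no_zero[of x i] i by simp
  qed
  ultimately have "1 \<in> I" by (rule weak_nullstellensatz)
  then obtain g h where g: "\<And>j. j < q \<Longrightarrow> g j \<in> all_poly_functions M"
    and one: "1 = (\<Sum>j<q. g j * f j) + h * X" unfolding I_def by blast
  have one': "(\<Sum>j<q. g j x * f j x) = 1" if "x i = 1" for x
    using arg_cong[OF one, of "\<lambda>F. F x"] that by (simp add: X_def sum_fun_eval)
  have "\<forall>j. \<exists>n. j < q \<longrightarrow> (\<forall>N\<ge>n. \<exists>g'\<in>forms M N. \<forall>x. x i = 1 \<longrightarrow> g' x = g j x)"
    using homogenize[OF g i] by blast
  then obtain n where n: "\<And>j N. j < q \<Longrightarrow> n j \<le> N \<Longrightarrow> \<exists>g'\<in>forms M N. \<forall>x. x i = 1 \<longrightarrow> g' x = g j x"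
    by metis
  define N0 where "N0 = Suc (\<Sum>j<q. n j + d j)"
  show ?thesis
  proof (intro exI[of _ N0] allI impI)
    fix N assume N: "N0 \<le> N"
    have le: "Suc (n j + d j) \<le> N" if "j < q" for j
      using N member_le_sum[of j "{..<q}" "\<lambda>j. n j + d j"] that unfolding N0_def by force
    have "\<forall>j. \<exists>g'. j < q \<longrightarrow> g' \<in> forms M (N - 1 - d j) \<and> (\<forall>x. x i = 1 \<longrightarrow> g' x = g j x)"
    proof
      fix j show "\<exists>g'. j < q \<longrightarrow> g' \<in> forms M (N - 1 - d j) \<and> (\<forall>x. x i = 1 \<longrightarrow> g' x = g j x)"
      proof (cases "j < q")
        case True
        then have "n j \<le> N - 1 - d j" using le[of j] by simp
        then show ?thesis using n[OF True] by blast
      qed simp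
    qed
    then obtain g' where g': "\<And>j. j < q \<Longrightarrow> g' j \<in> forms M (N - 1 - d j)"
      "\<And>j x. j < q \<Longrightarrow> x i = 1 \<Longrightarrow> g' j x = g j x" by metis
    define G where "G j = (\<lambda>x. x i) * g' j" for j
    have "G j \<in> forms M (N - d j)" if "j < q" for j
    proof -
      have "G j \<in> forms M (1 + (N - 1 - d j))"
        unfolding G_def using that by (intro forms_mult forms_coordinate i g')
      moreover have "1 + (N - 1 - d j) = N - d j" using le[OF that] by simp
      ultimately show ?thesis by simp
    qed
    moreover have "x i ^ N = (\<Sum>j<q. G j x * f j x)" for x
    proof (cases "x i = 0")
      case True
      then show ?thesis using N by (simp add: G_def N0_def)
    next
      case False
      define y where "y = (\<lambda>m. x m / x i)"
      have x: "x = (\<lambda>m. x i * y m)" using False by (auto simp: y_def)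
      have y: "y i = 1" using False by (simp add: y_def)
      have "G j x * f j x = x i ^ N * (g j y * f j y)" if "j < q" for j
      proof -
        have "g' j x = x i ^ (N - 1 - d j) * g' j y"
          by (subst x) (rule forms_homogeneous[OF g'(1)[OF that]])
        moreover have "f j x = x i ^ d j * f j y"
          by (subst x) (rule forms_homogeneous[OF f[OF that]])
        moreover have "x i * x i ^ (N - 1 - d j) * x i ^ d j = x i ^ N"
          using le[OF that] by (simp flip: power_Suc power_add)
        ultimately show ?thesis using g'(2)[OF that, of y] y by (simp add: G_def mult.assoc)
      qed
      then have "(\<Sum>j<q. G j x * f j x) = x i ^ N * (\<Sum>j<q. g j y * f j y)"
        by (simp add: sum_distrib_left)
      then show ?thesis using one'[of y] y by simp
    qed
    moreover have "d j \<le> N" if "j < q" for j using le[OF that] by simp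
    ultimately show "\<exists>g. (\<forall>j<q. d j \<le> N \<and> g j \<in> forms M (N - d j)) \<and> (\<forall>x. x i ^ N = (\<Sum>j<q. g j x * f j x))"
      by blast
  qed
qed

definition power_products :: "nat \<Rightarrow> (nat \<Rightarrow> (nat \<Rightarrow> complex) \<Rightarrow> complex) \<Rightarrow> nat \<Rightarrow> nat \<Rightarrow> nat \<Rightarrow> ((nat \<Rightarrow> complex) \<Rightarrow> complex) set"
  where "power_products M f q N T =
    (\<lambda>(e, s). monomial M e * (\<Prod>j<q. f j ^ s j)) ` (({..<M} \<rightarrow>\<^sub>E {..<N}) \<times> ({..<q} \<rightarrow>\<^sub>E {..T}))"

lemma finite_power_products: "finite (power_products M f q N T)"
  unfolding power_products_def by (intro finite_imageI finite_cartesian_product finite_PiE) auto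

lemma card_power_products: "card (power_products M f q N T) \<le> N ^ M * (T + 1) ^ q"
proof -
  have "card (power_products M f q N T) \<le> card (({..<M} \<rightarrow>\<^sub>E {..<N}) \<times> ({..<q} \<rightarrow>\<^sub>E {..T}))"
    unfolding power_products_def by (intro card_image_le finite_cartesian_product finite_PiE) auto
  then show ?thesis by (simp add: card_cartesian_product card_PiE)
qed

lemma power_products_mono: "T \<le> T' \<Longrightarrow> power_products M f q N T \<subseteq> power_products M f q N T'"
  unfolding power_products_def by (intro image_mono Sigma_mono PiE_mono subset_refl) auto

text \<open>
  By the identities for \<open>x i ^ N\<close>, a monomial with a large exponent can be traded
  for multiples of the \<open>f j\<close> by forms of smaller degree. So the polynomial ring is
  generated, over the subring of polynomials in the \<open>f j\<close>, by the finitely many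
  monomials with small exponents.
\<close>

lemma forms_subset_span_power_products:
  assumes dpos: "\<And>j. j < q \<Longrightarrow> 0 < d j"
    and G: "\<And>i j. i < M \<Longrightarrow> j < q \<Longrightarrow> d j \<le> N \<and> G i j \<in> forms M (N - d j)"
    and xN: "\<And>i x. i < M \<Longrightarrow> x i ^ N = (\<Sum>j<q. G i j x * f j x)"
  shows "forms M n \<subseteq> fun_vs.span (power_products M f q N n)"
proof (induction n rule: less_induct)
  case (less n)
  have "monomial M e \<in> fun_vs.span (power_products M f q N n)" if e: "sum e {..<M} = n" for e
  proof (cases "\<forall>i<M. e i < N")
    case True
    have "monomial M e = monomial M (restrict e {..<M}) * (\<Prod>j<q. f j ^ restrict (\<lambda>_. 0) {..<q} j)"
      by (auto simp: monomial_def fun_eq_iff prod_fun_eval power_fun_eval)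
    then have "monomial M e \<in> power_products M f q N n"
      unfolding power_products_def using True
      by (intro image_eqI[of _ _ "(restrict e {..<M}, restrict (\<lambda>_. 0) {..<q})"]) auto
    then show ?thesis by (rule fun_vs.span_base)
  next
    case False
    then obtain i where i: "i < M" "N \<le> e i" by (auto simp: not_less)
    define e' where "e' = e(i := e i - N)"
    have split: "monomial M e x = x i ^ N * monomial M e' x" for x
    proof -
      have "monomial M e x = x i ^ e i * (\<Prod>m\<in>{..<M} - {i}. x m ^ e m)"
        unfolding monomial_def using i by (simp add: prod.remove)
      moreover have "monomial M e' x = x i ^ (e i - N) * (\<Prod>m\<in>{..<M} - {i}. x m ^ e m)"
        unfolding monomial_def using i by (simp add: prod.remove e'_def)
      moreover have "x i ^ e i = x i ^ N * x i ^ (e i - N)" using i by (simp flip: power_add)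
      ultimately show ?thesis by simp
    qed
    have deg_e': "sum e' {..<M} + N = n"
    proof -
      have "sum e {..<M} = e i + sum e ({..<M} - {i})" using i by (simp add: sum.remove)
      moreover have "sum e' {..<M} = e i - N + sum e ({..<M} - {i})" using i by (simp add: sum.remove e'_def)
      ultimately show ?thesis using i e by simp
    qed
    have eq: "monomial M e = (\<Sum>j<q. (G i j * monomial M e') * f j)"
      by (rule ext) (simp add: split xN[OF i(1)] sum_fun_eval sum_distrib_left sum_distrib_right mult_ac)
    have "(G i j * monomial M e') * f j \<in> fun_vs.span (power_products M f q N n)" if j: "j < q" for j
    proof -
      have "monomial M e' \<in> forms M (sum e' {..<M})"
        unfolding forms_def by (rule fun_vs.span_base) auto
      then have "G i j * monomial M e' \<in> forms M (N - d j + sum e' {..<M})"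
        using G[OF i(1) j] by (intro forms_mult) auto
      moreover have lt: "N - d j + sum e' {..<M} < n" and le: "N - d j + sum e' {..<M} \<le> n - 1"
        using deg_e' dpos[OF j] G[OF i(1) j] by auto
      ultimately have "G i j * monomial M e' \<in> fun_vs.span (power_products M f q N (N - d j + sum e' {..<M}))"
        using less by blast
      then have "G i j * monomial M e' \<in> fun_vs.span (power_products M f q N (n - 1))"
        using fun_vs.span_mono[OF power_products_mono[OF le]] by blast
      then show ?thesis
      proof (rule span_mult[OF _ fun_vs.span_base[of "f j" "{f j}"]])
        fix s t assume "s \<in> power_products M f q N (n - 1)" "t \<in> {f j}"
        then obtain a b where s: "s = monomial M a * (\<Prod>j<q. f j ^ b j)" "t = f j"
          and ab: "a \<in> {..<M} \<rightarrow>\<^sub>E {..<N}" "b \<in> {..<q} \<rightarrow>\<^sub>E {..n - 1}" unfolding power_products_def by auto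
        define b' where "b' = b(j := Suc (b j))"
        have "(\<Prod>j<q. f j ^ b' j) = f j ^ Suc (b j) * (\<Prod>m\<in>{..<q} - {j}. f m ^ b m)"
          using j by (simp add: prod.remove[of _ j] b'_def)
        also have "\<dots> = (\<Prod>j<q. f j ^ b j) * f j"
          using j by (subst prod.remove[of "{..<q}" j]) (simp_all only: power_Suc ac_simps finite_lessThan lessThan_iff)
        finally have "s * t = monomial M a * (\<Prod>j<q. f j ^ b' j)" using s by (simp only: ac_simps)
        moreover have "n > 0" using lt by simp
        then have "b' m \<in> {..n}" if "m < q" for m
          using PiE_mem[OF ab(2), of m] that by (auto simp: b'_def)
        then have "b' \<in> {..<q} \<rightarrow>\<^sub>E {..n}" using ab(2) j
          by (auto simp: b'_def PiE_iff extensional_def)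
        ultimately have "s * t \<in> power_products M f q N n"
          unfolding power_products_def using ab by (intro image_eqI[of _ _ "(a, b')"]) auto
        then show "s * t \<in> fun_vs.span (power_products M f q N n)" by (rule fun_vs.span_base)
      qed simp
    qed
    then show ?thesis unfolding eq by (intro fun_vs.span_sum) auto
  qed
  then show ?case unfolding forms_def
    by (intro fun_vs.span_minimal fun_vs.subspace_span) blast
qed

text \<open>
  Polynomials of degree at most \<open>T * M\<close> separate the points of a grid with \<open>T
  + 1\<close> values per coordinate, so the space has at least as many dimensions as the grid
  has points. This crude bound replaces the exact dimension.
\<close>

lemma grid_size_le_card_spanning:
  assumes fin: "finite Z" and span: "poly_functions M (T * M) \<subseteq> fun_vs.span Z"
  shows "(T + 1) ^ M \<le> card Z"
proof -
  define A where "A = (of_nat ` {..T} :: complex set)"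
  have A: "finite A" "card A = T + 1" by (auto simp: A_def card_image inj_on_def)
  define D where "D = ({..<M} \<rightarrow>\<^sub>E A)"
  have D: "finite D" "card D = (T + 1) ^ M" using A by (auto simp: D_def card_PiE intro!: finite_PiE)
  (* the Lagrange interpolation functions of the grid *)
  define L where "L g = (\<Prod>i<M. \<Prod>c\<in>A - {g i}. (\<lambda>x. x i - c))" for g :: "nat \<Rightarrow> complex"
  have L_eval: "L g x = (\<Prod>i<M. \<Prod>c\<in>A - {g i}. x i - c)" for g x
    by (simp add: L_def prod_fun_eval)
  have L_off: "L g h = 0" if "g \<in> D" "h \<in> D" "g \<noteq> h" for g h
  proof -
    have "\<not> (\<forall>i\<in>{..<M}. g i = h i)"
      using PiE_ext[of g "{..<M}" "\<lambda>_. A" h] that unfolding D_def by blast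
    then obtain i where i: "i < M" "g i \<noteq> h i" by auto
    then have "h i \<in> A - {g i}" using that by (auto simp: D_def PiE_iff)
    then have "(\<Prod>c\<in>A - {g i}. h i - c) = 0" using A by (intro prod_zero) auto
    then show ?thesis unfolding L_eval using i by (intro prod_zero) auto
  qed
  have L_diag: "L g g \<noteq> 0" for g unfolding L_eval using A by auto
  have inj: "inj_on L D" using L_off L_diag by (metis inj_onI)
  have lin: "(\<lambda>x. x i - c) \<in> poly_functions M 1" if "i < M" for i c
  proof -
    have "(\<lambda>x. x i) - (\<lambda>_. c) \<in> poly_functions M 1"
      using forms_coordinate[OF that] forms_const[of c M] forms_subset_poly_functions[of M]
        poly_functions_mono[of 0 1 M] unfolding poly_functions_def
      by (intro fun_vs.span_diff) (blast+)
    then show ?thesis by (simp add: fun_diff_def)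
  qed
  have one: "1 \<in> poly_functions M 0"
    using forms_const[of 1 M] forms_subset_poly_functions[of M 0] by (auto simp: one_fun_def)
  have inner: "(\<Prod>c\<in>B. (\<lambda>x. x i - c)) \<in> poly_functions M (card B)" if "finite B" "i < M" for i B
    using that(1)
  proof (induction B rule: finite_induct)
    case (insert c B)
    have "(\<lambda>x. x i - c) * (\<Prod>c\<in>B. (\<lambda>x. x i - c)) \<in> poly_functions M (1 + card B)"
      by (intro poly_functions_mult lin that insert.IH)
    then show ?case using insert.hyps by (simp only: prod.insert card_insert_disjoint plus_1_eq_Suc not_False_eq_True)
  qed (simp only: prod.empty card.empty one)
  have outer: "(\<Prod>i<m. \<Prod>c\<in>A - {g i}. (\<lambda>x. x i - c)) \<in> poly_functions M (T * m)"
    if g: "g \<in> D" and m: "m \<le> M" for g m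
    using m
  proof (induction m)
    case (Suc m)
    have "g m \<in> A" using Suc.prems g by (auto simp: D_def PiE_iff)
    then have "card (A - {g m}) = T" using A by simp
    then have "(\<Prod>i<m. \<Prod>c\<in>A - {g i}. (\<lambda>x. x i - c)) * (\<Prod>c\<in>A - {g m}. (\<lambda>x. x m - c)) \<in> poly_functions M (T * m + T)"
      using Suc inner[of "A - {g m}" m] A by (intro poly_functions_mult) auto
    then show ?case by (simp only: prod.lessThan_Suc mult_Suc_right add.commute)
  qed (simp only: lessThan_0 prod.empty mult_0_right one)
  have sub: "L ` D \<subseteq> fun_vs.span Z" using outer[of _ M] span by (auto simp: L_def)
  have scalars: "u l = 0" if u: "(\<Sum>l\<in>L ` D. scale_fun (u l) l) = 0" and l: "l \<in> L ` D"
    for u :: "((nat \<Rightarrow> complex) \<Rightarrow> complex) \<Rightarrow> complex" and l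
  proof -
    from l obtain g where g: "g \<in> D" "l = L g" by blast
    have "(\<Sum>h\<in>D. u (L h) * L h g) = 0"
      using arg_cong[OF u, of "\<lambda>F. F g"] by (simp add: sum.reindex[OF inj] sum_fun_eval)
    moreover have "(\<Sum>h\<in>D. u (L h) * L h g) = (\<Sum>h\<in>D. if h = g then u (L g) * L g g else 0)"
      using L_off g by (intro sum.cong) auto
    moreover have "\<dots> = u (L g) * L g g" using g(1) D(1) by (subst sum.delta) auto
    ultimately have "u (L g) * L g g = 0" by metis
    then show "u l = 0" using L_diag[of g] g(2) by (simp only: mult_eq_0_iff simp_thms)
  qed
  have indep: "\<not> fun_vs.dependent (L ` D)"
    apply (rule fun_vs.independent_if_scalars_zero[OF finite_imageI[OF D(1)]])
    subgoal for u l by (rule scalars[of u l])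
    done
  have "finite (L ` D) \<and> card (L ` D) \<le> card Z"
    by (rule fun_vs.independent_span_bound[OF fin indep sub])
  then have "card (L ` D) \<le> card Z" by (rule conjunct2)
  then show ?thesis unfolding card_image[OF inj] D(2) .
qed

text \<open>
  The projective dimension theorem. If the origin were the only zero, the polynomial ring would
  be finite over the subring generated by the \<open>q\<close> equations, and the dimension of
  the space of polynomials of degree at most \<open>m\<close> would grow at most like the
  \<open>q\<close>-th power of \<open>m\<close> instead of the \<open>M\<close>-th.
\<close>

theorem homogeneous_common_zero:
  assumes f: "\<And>j. j < q \<Longrightarrow> f j \<in> forms M (d j)" and dpos: "\<And>j. j < q \<Longrightarrow> 0 < d j"
    and q: "q < M"
  shows "\<exists>x. (\<exists>i<M. x i \<noteq> 0) \<and> (\<forall>j<q. f j x = 0)"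
proof (rule ccontr)
  assume "\<not> ?thesis"
  then have no_zero: "\<And>x. (\<And>j. j < q \<Longrightarrow> f j x = 0) \<Longrightarrow> (\<And>i. i < M \<Longrightarrow> x i = 0)" by blast
  define P where "P i N g \<longleftrightarrow> (\<forall>j<q. d j \<le> N \<and> g j \<in> forms M (N - d j)) \<and>
           (\<forall>x. x i ^ N = (\<Sum>j<q. g j x * f j x))" for i N g
  have "\<exists>N0. \<forall>N\<ge>N0. \<exists>g. P i N g" if "i < M" for i
    unfolding P_def using coordinate_power_in_ideal[of q f M d i, OF f] no_zero that by blast
  then obtain n where n: "\<And>i N. i < M \<Longrightarrow> n i \<le> N \<Longrightarrow> \<exists>g. P i N g" by metis
  define N where "N = (\<Sum>i<M. n i)"
  have "n i \<le> N" if "i < M" for i using that unfolding N_def by (intro member_le_sum) auto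
  then have "\<exists>g. P i N g" if "i < M" for i using n that by blast
  then obtain G where G: "\<And>i. i < M \<Longrightarrow> P i N (G i)" by metis
  have span: "forms M m \<subseteq> fun_vs.span (power_products M f q N m)" for m
    by (rule forms_subset_span_power_products[of q d M N G f]) (use dpos G in \<open>auto simp: P_def\<close>)
  have span': "poly_functions M m \<subseteq> fun_vs.span (power_products M f q N m)" for m
    unfolding poly_functions_def
  proof (intro fun_vs.span_minimal fun_vs.subspace_span subsetI)
    fix h assume "h \<in> {monomial M e |e. sum e {..<M} \<le> m}"
    then obtain e where e: "h = monomial M e" "sum e {..<M} \<le> m" by blast
    then have "h \<in> forms M (sum e {..<M})" unfolding forms_def by (auto intro: fun_vs.span_base)
    then show "h \<in> fun_vs.span (power_products M f q N m)"
      using span fun_vs.span_mono[OF power_products_mono[OF e(2)]] by blast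
  qed
  (* large enough for (T + 1)^M to exceed the growth N^M (T M + 1)^q *)
  define T where "T = N ^ M * M ^ q"
  have "(T + 1) ^ M \<le> N ^ M * (T * M + 1) ^ q"
    using grid_size_le_card_spanning[OF finite_power_products span'] card_power_products order_trans by blast
  also have "\<dots> \<le> N ^ M * (M * (T + 1)) ^ q" using q by (intro mult_left_mono power_mono) auto
  also have "\<dots> = T * (T + 1) ^ q"
    by (simp only: power_mult_distrib mult.assoc[symmetric] T_def[symmetric])
  also have "\<dots> < (T + 1) * (T + 1) ^ q" by simp
  also have "\<dots> = (T + 1) ^ Suc q" by simp
  also have "\<dots> \<le> (T + 1) ^ M" using q by (intro power_increasing) auto
  finally show False by simp
qed

section \<open>Polynomials with homogeneous coefficients\<close>

text \<open>
  A polynomial in \<open>z\<close> whose coefficients are forms in parameters \<open>b\<close>,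
  homogeneous of total degree \<open>d\<close> when \<open>z\<close> has degree one, and whose
  exponents are all congruent to \<open>d\<close> modulo \<open>k\<close>. The congruence is the
  symmetry under \<open>k\<close>-th roots of unity; the homogeneity makes the coefficients
  usable in the projective dimension theorem.
\<close>

definition graded :: "nat \<Rightarrow> nat \<Rightarrow> nat \<Rightarrow> ((nat \<Rightarrow> complex) \<Rightarrow> complex poly) \<Rightarrow> bool" where
  "graded k M d H \<longleftrightarrow> (\<forall>i. (\<lambda>b. coeff (H b) i) \<in> forms M (d - i) \<and>
     (\<not> (i \<le> d \<and> k dvd d - i) \<longrightarrow> (\<forall>b. coeff (H b) i = 0)))"

lemma graded_coeff: "graded k M d H \<Longrightarrow> (\<lambda>b. coeff (H b) i) \<in> forms M (d - i)"
  and graded_coeff_zero: "graded k M d H \<Longrightarrow> \<not> (i \<le> d \<and> k dvd d - i) \<Longrightarrow> coeff (H b) i = 0"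
  by (auto simp: graded_def)

lemma graded_mult:
  assumes H: "graded k M d H" and K: "graded k M e K"
  shows "graded k M (d + e) (\<lambda>b. H b * K b)"
  unfolding graded_def
proof (intro allI conjI impI)
  fix i
  have "(\<lambda>b. coeff (H b) j) * (\<lambda>b. coeff (K b) (i - j)) \<in> forms M (d + e - i)" if "j \<le> i" for j
  proof (cases "j \<le> d \<and> i - j \<le> e")
    case True
    then have "d - j + (e - (i - j)) = d + e - i" using that by arith
    then show ?thesis using forms_mult[OF graded_coeff[OF H] graded_coeff[OF K]] by metis
  next
    case False
    then have "(\<lambda>b. coeff (H b) j) * (\<lambda>b. coeff (K b) (i - j)) = 0"
      using graded_coeff_zero[OF H, of j] graded_coeff_zero[OF K, of "i - j"] by (auto simp: fun_eq_iff)
    then show ?thesis using forms_zero by simp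
  qed
  then have "(\<Sum>j\<le>i. (\<lambda>b. coeff (H b) j) * (\<lambda>b. coeff (K b) (i - j))) \<in> forms M (d + e - i)"
    by (intro forms_sum) auto
  moreover have "(\<Sum>j\<le>i. (\<lambda>b. coeff (H b) j) * (\<lambda>b. coeff (K b) (i - j))) = (\<lambda>b. coeff (H b * K b) i)"
    by (rule ext) (simp add: coeff_mult sum_fun_eval)
  ultimately show "(\<lambda>b. coeff (H b * K b) i) \<in> forms M (d + e - i)" by simp
next
  fix i b assume i: "\<not> (i \<le> d + e \<and> k dvd d + e - i)"
  have "coeff (H b) j * coeff (K b) (i - j) = 0" if "j \<le> i" for j
  proof (rule ccontr)
    assume "coeff (H b) j * coeff (K b) (i - j) \<noteq> 0"
    then have nz: "coeff (H b) j \<noteq> 0" "coeff (K b) (i - j) \<noteq> 0" by simp_all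
    have 1: "j \<le> d \<and> k dvd d - j" using graded_coeff_zero[OF H] nz(1) by blast
    have 2: "i - j \<le> e \<and> k dvd e - (i - j)" using graded_coeff_zero[OF K] nz(2) by blast
    have "d + e - i = (d - j) + (e - (i - j))" using that 1 2 by arith
    then have "k dvd d + e - i" using 1 2 dvd_add by metis
    moreover have "i \<le> d + e" using that 1 2 by arith
    ultimately show False using i by blast
  qed
  then show "coeff (H b * K b) i = 0" unfolding coeff_mult by (intro sum.neutral) simp
qed

lemma graded_add:
  assumes "graded k M d H" "graded k M d K" shows "graded k M d (\<lambda>b. H b + K b)"
proof -
  have "(\<lambda>b. coeff (H b) i + coeff (K b) i) \<in> forms M (d - i)" for i
    using forms_add[OF graded_coeff[OF assms(1)] graded_coeff[OF assms(2)], of i]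
    by (simp add: plus_fun_def)
  then show ?thesis using assms by (auto simp: graded_def)
qed

lemma graded_diff:
  assumes "graded k M d H" "graded k M d K" shows "graded k M d (\<lambda>b. H b - K b)"
proof -
  have "(\<lambda>b. coeff (H b) i - coeff (K b) i) \<in> forms M (d - i)" for i
    using forms_diff[OF graded_coeff[OF assms(1)] graded_coeff[OF assms(2)], of i]
    by (simp add: fun_diff_def)
  then show ?thesis using assms by (auto simp: graded_def)
qed

lemma graded_monom: "graded k M d (\<lambda>b. monom 1 d)"
  using forms_const[of 1 M] forms_zero[of M] by (auto simp: graded_def zero_fun_def)

lemma graded_const: "graded k M 0 (\<lambda>b. [:c:])"
proof -
  have "(\<lambda>b. coeff [:c:] i) \<in> forms M (0 - i)" for i
    using forms_const[of "coeff [:c:] i" M] by simp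
  then show ?thesis by (auto simp: graded_def coeff_pCons split: nat.split)
qed

lemma graded_scalar:
  assumes c: "c \<in> forms M e" and k: "k dvd e"
  shows "graded k M e (\<lambda>b. [:c b:])"
proof -
  have "(\<lambda>b. coeff [:c b:] i) \<in> forms M (e - i)" for i
    using c forms_zero[of M] by (cases i) (auto simp: zero_fun_def)
  then show ?thesis using k by (auto simp: graded_def coeff_pCons split: nat.split)
qed

lemma graded_smult:
  assumes "c \<in> forms M e" "k dvd e" "graded k M d H"
  shows "graded k M (e + d) (\<lambda>b. smult (c b) (H b))"
  using graded_mult[OF graded_scalar[OF assms(1,2)] assms(3)] by simp

lemma graded_smult_const: "graded k M d H \<Longrightarrow> graded k M d (\<lambda>b. smult c (H b))"
  using graded_smult[OF forms_const[of c] dvd_0_right] by simp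

lemma graded_zero: "graded k M d (\<lambda>b. 0)"
  using forms_zero[of M] by (auto simp: graded_def zero_fun_def)

lemma graded_power: "graded k M d H \<Longrightarrow> graded k M (n * d) (\<lambda>b. H b ^ n)"
proof (induction n)
  case 0
  show ?case using graded_const[where c = 1] by (simp add: one_pCons)
next
  case (Suc n)
  then have "graded k M (d + n * d) (\<lambda>b. H b * H b ^ n)" by (intro graded_mult)
  then show ?case by simp
qed

lemma graded_prod: "(\<And>j. j < n \<Longrightarrow> graded k M d (H j)) \<Longrightarrow> graded k M (n * d) (\<lambda>b. \<Prod>j<n. H j b)"
proof (induction n)
  case 0
  show ?case using graded_const[where c = 1] by (simp add: one_pCons)
next
  case (Suc n)
  then have "graded k M (n * d + d) (\<lambda>b. (\<Prod>j<n. H j b) * H n b)" by (intro graded_mult) auto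
  then show ?case by (simp add: add.commute mult.commute)
qed

lemma graded_pderiv:
  assumes "graded k M (Suc d) H" shows "graded k M d (\<lambda>b. pderiv (H b))"
proof -
  have "(\<lambda>b. coeff (pderiv (H b)) i) \<in> forms M (d - i)" for i
    using forms_scale[OF graded_coeff[OF assms, of "Suc i"], of "of_nat (Suc i)"]
    by (simp add: coeff_pderiv scale_fun_def)
  then show ?thesis using assms by (auto simp: graded_def coeff_pderiv)
qed

lemma graded_rotate:
  assumes "graded k M d H" "w ^ k = 1"
  shows "poly (H b) (w * z) = w ^ d * poly (H b) z"
proof -
  have "coeff (H b) i * (w * z) ^ i = w ^ d * (coeff (H b) i * z ^ i)" for i
  proof (cases "i \<le> d \<and> k dvd d - i")
    case True
    then obtain m where "d = i + k * m" by (metis dvd_def le_add_diff_inverse)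
    then have "w ^ d = w ^ i" using assms(2) by (simp add: power_add power_mult)
    then show ?thesis by (simp add: power_mult_distrib)
  next
    case False
    then show ?thesis using graded_coeff_zero[OF assms(1)] by simp
  qed
  then show ?thesis unfolding poly_altdef sum_distrib_left by (intro sum.cong) auto
qed

definition antiderivative :: "complex poly \<Rightarrow> complex poly" where
  "antiderivative p = (\<Sum>i\<le>degree p. monom (coeff p i / of_nat (Suc i)) (Suc i))"

lemma coeff_antiderivative:
  "coeff (antiderivative p) i = (case i of 0 \<Rightarrow> 0 | Suc m \<Rightarrow> coeff p m / of_nat (Suc m))"
proof (cases i)
  case 0
  then show ?thesis by (simp add: antiderivative_def coeff_sum)
next
  case (Suc m)
  have "coeff (antiderivative p) i = (\<Sum>j\<le>degree p. if j = m then coeff p m / of_nat (Suc m) else 0)"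
    unfolding antiderivative_def coeff_sum by (intro sum.cong) (auto simp: Suc)
  then show ?thesis using Suc by (auto simp: coeff_eq_0)
qed

lemma pderiv_antiderivative: "pderiv (antiderivative p) = p"
  by (rule poly_eqI) (simp add: coeff_pderiv coeff_antiderivative del: of_nat_Suc)

lemma graded_antiderivative:
  assumes "graded k M d H" shows "graded k M (Suc d) (\<lambda>b. antiderivative (H b))"
proof -
  have "(\<lambda>b. coeff (antiderivative (H b)) i) \<in> forms M (Suc d - i)" for i
  proof (cases i)
    case 0
    then show ?thesis using forms_zero[of M] by (simp add: coeff_antiderivative zero_fun_def)
  next
    case (Suc m)
    then show ?thesis using forms_scale[OF graded_coeff[OF assms, of m], of "1 / of_nat (Suc m)"]
      by (simp add: coeff_antiderivative scale_fun_def)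
  qed
  then show ?thesis using assms by (auto simp: graded_def coeff_antiderivative split: nat.split)
qed

text \<open>
  This is \<open>A\<^bsup>1-r\<^esup> (A\<^bsup>r\<^esup> F)'\<close>, see
  \<open>pderiv_power_mult\<close>.
\<close>

definition twisted_derivative :: "nat \<Rightarrow> complex poly \<Rightarrow> complex poly \<Rightarrow> complex poly" where
  "twisted_derivative r A F = smult (of_nat r) (pderiv A) * F + A * pderiv F"

lemma twisted_derivative_add:
  "twisted_derivative r A (F + G) = twisted_derivative r A F + twisted_derivative r A G"
  by (simp add: twisted_derivative_def pderiv_add smult_add_right algebra_simps)

lemma twisted_derivative_smult:
  "twisted_derivative r A (smult c F) = smult c (twisted_derivative r A F)"
  by (simp add: twisted_derivative_def pderiv_smult smult_add_right mult.commute)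

lemma pderiv_power_mult:
  assumes "r > 0"
  shows "pderiv (A ^ r * F) = A ^ (r - 1) * twisted_derivative r A F"
proof -
  obtain m where m: "r = Suc m" using assms by (cases r) auto
  show ?thesis
    unfolding twisted_derivative_def pderiv_mult m pderiv_power_Suc
    by (simp only: diff_Suc_1 power_Suc distrib_left mult_smult_left mult_smult_right ac_simps)
qed

lemma coeff_twisted_monom:
  assumes "coeff A N = 1" "degree A = N" "0 < N"
  shows "coeff (twisted_derivative r A (monom 1 j)) (N - 1 + j) = of_nat (r * N + j)"
    and "i > N - 1 + j \<Longrightarrow> coeff (twisted_derivative r A (monom 1 j)) i = 0"
proof -
  have c: "coeff (twisted_derivative r A (monom 1 j)) i =
    (if j \<le> i then of_nat r * of_nat (Suc (i - j)) * coeff A (Suc (i - j)) else 0) +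
    (if j \<le> Suc i \<and> j > 0 then of_nat j * coeff A (Suc i - j) else 0)" for i
  proof -
    have "coeff (smult (of_nat r) (pderiv A) * monom 1 j) i =
      (if j \<le> i then of_nat r * of_nat (Suc (i - j)) * coeff A (Suc (i - j)) else 0)"
      by (subst mult.commute) (simp add: coeff_monom_mult coeff_pderiv)
    moreover have "coeff (A * pderiv (monom 1 j)) i = (if j \<le> Suc i \<and> j > 0 then of_nat j * coeff A (Suc i - j) else 0)"
    proof (cases j)
      case (Suc m)
      then show ?thesis by (subst mult.commute) (simp add: pderiv_monom coeff_monom_mult del: of_nat_Suc)
    qed (simp add: pderiv_monom)
    ultimately show ?thesis by (simp add: twisted_derivative_def)
  qed
  have N: "Suc (N - 1) = N" using assms by simp
  show "coeff (twisted_derivative r A (monom 1 j)) (N - 1 + j) = of_nat (r * N + j)"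
    unfolding c using assms N by auto
  assume i: "i > N - 1 + j"
  then have "coeff A (Suc (i - j)) = 0" "coeff A (Suc i - j) = 0" using assms by (auto intro!: coeff_eq_0)
  then show "coeff (twisted_derivative r A (monom 1 j)) i = 0" unfolding c by (cases j) auto
qed

text \<open>
  Division with remainder by the operator \<open>twisted_derivative r A\<close>: the leading
  term of its value at \<open>z\<^sup>j\<close> is a nonzero multiple of
  \<open>z\<^bsup>N-1+j\<^esup>\<close>, so these degrees can be cleared from the top down to
  leave a remainder of degree at most \<open>N - 2\<close>. All divisions are by integers, so
  homogeneity in the parameters is kept.
\<close>

fun reduce :: "nat \<Rightarrow> nat \<Rightarrow> complex poly \<Rightarrow> nat \<Rightarrow> complex poly \<Rightarrow> complex poly" where
  "reduce r N A 0 H = H"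
| "reduce r N A (Suc j) H = reduce r N A j
     (H - smult (coeff H (N - 1 + j) / of_nat (r * N + j)) (twisted_derivative r A (monom 1 j)))"

lemma reduce_congruent: "\<exists>F. H = twisted_derivative r A F + reduce r N A j H"
proof (induction j arbitrary: H)
  case 0
  show ?case by (intro exI[of _ 0]) (simp add: twisted_derivative_def)
next
  case (Suc j)
  define c where "c = coeff H (N - 1 + j) / of_nat (r * N + j)"
  obtain F where "H - smult c (twisted_derivative r A (monom 1 j)) = twisted_derivative r A F + reduce r N A (Suc j) H"
    using Suc[of "H - smult c (twisted_derivative r A (monom 1 j))"] by (auto simp: c_def)
  then have "H = twisted_derivative r A (F + smult c (monom 1 j)) + reduce r N A (Suc j) H"
    by (simp only: twisted_derivative_add twisted_derivative_smult algebra_simps)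
  then show ?case by blast
qed

lemma coeff_reduce:
  assumes "coeff A N = 1" "degree A = N" "0 < N" "0 < r"
    and "\<And>i. i \<ge> N - 1 + j \<Longrightarrow> coeff H i = 0" "i \<ge> N - 1"
  shows "coeff (reduce r N A j H) i = 0"
  using assms(5)
proof (induction j arbitrary: H)
  case 0
  then show ?case using assms(6) by simp
next
  case (Suc j)
  have "coeff (H - smult (coeff H (N - 1 + j) / of_nat (r * N + j)) (twisted_derivative r A (monom 1 j))) i = 0"
    if "i \<ge> N - 1 + j" for i
  proof (cases "i = N - 1 + j")
    case True
    have "(of_nat (r * N + j) :: complex) \<noteq> 0" using assms(3,4) by (simp only: of_nat_eq_0_iff) simp
    then show ?thesis
      unfolding True coeff_diff coeff_smult coeff_twisted_monom(1)[OF assms(1-3)]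
      by (simp del: of_nat_add of_nat_mult)
  next
    case False
    then show ?thesis using that Suc.prems[of i] by (simp add: coeff_twisted_monom(2)[OF assms(1-3)])
  qed
  then show ?case unfolding reduce.simps(2) by (rule Suc.IH)
qed

lemma graded_reduce:
  assumes A: "graded k M N A" and N: "0 < N" and H: "graded k M e H"
  shows "graded k M e (\<lambda>b. reduce r N (A b) j (H b))"
  using H
proof (induction j arbitrary: H)
  case (Suc j)
  have "graded k M (N - 1) (\<lambda>b. pderiv (A b))" using A N by (intro graded_pderiv) simp
  then have "graded k M (N - 1 + j) (\<lambda>b. smult (of_nat r) (pderiv (A b)) * monom 1 j)"
    by (intro graded_mult graded_smult_const graded_monom)
  moreover have "graded k M (N - 1 + j) (\<lambda>b. A b * pderiv (monom 1 j))"
  proof (cases j)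
    case 0
    then show ?thesis by (simp add: pderiv_monom graded_zero)
  next
    case (Suc m)
    have "graded k M (N + m) (\<lambda>b. A b * pderiv (monom 1 j))"
      using A Suc by (intro graded_mult graded_pderiv) (simp_all add: graded_monom)
    then show ?thesis using Suc N by simp
  qed
  ultimately have V: "graded k M (N - 1 + j) (\<lambda>b. twisted_derivative r (A b) (monom 1 j))"
    unfolding twisted_derivative_def by (rule graded_add)
  define c where "c b = coeff (H b) (N - 1 + j) / of_nat (r * N + j)" for b
  have "graded k M e (\<lambda>b. smult (c b) (twisted_derivative r (A b) (monom 1 j)))"
  proof (cases "N - 1 + j \<le> e \<and> k dvd e - (N - 1 + j)")
    case True
    have "c \<in> forms M (e - (N - 1 + j))"
      using forms_scale[OF graded_coeff[OF Suc.prems, of "N - 1 + j"], of "1 / of_nat (r * N + j)"]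
      by (simp add: scale_fun_def c_def[abs_def])
    then have "graded k M (e - (N - 1 + j) + (N - 1 + j)) (\<lambda>b. smult (c b) (twisted_derivative r (A b) (monom 1 j)))"
      using True V by (intro graded_smult) auto
    then show ?thesis using True by simp
  next
    case False
    then have "c b = 0" for b using graded_coeff_zero[OF Suc.prems] by (simp add: c_def)
    then show ?thesis by (simp add: graded_zero)
  qed
  then have "graded k M e (\<lambda>b. H b - smult (c b) (twisted_derivative r (A b) (monom 1 j)))"
    by (rule graded_diff[OF Suc.prems])
  from Suc.IH[OF this] show ?case unfolding reduce.simps(2) c_def .
qed simp

section \<open>The polynomials behind the endomorphisms\<close>

lemma card_unity_roots: "0 < k \<Longrightarrow> card {w::complex. w ^ k = 1} = k"
  using card_nth_roots[of 1 k] by simp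

lemma exists_nontrivial_unity_root:
  assumes "2 \<le> k" shows "\<exists>w::complex. w ^ k = 1 \<and> w \<noteq> 1"
proof (rule ccontr)
  assume "\<not> ?thesis"
  then have "{w::complex. w ^ k = 1} \<subseteq> {1}" by auto
  from card_mono[OF _ this] show False using card_unity_roots[of k] assms by simp
qed

text \<open>
  If \<open>Q\<close> vanishes at all zeros of \<open>Q'\<close>, then each zero of
  \<open>Q'\<close> has one higher multiplicity in \<open>Q\<close>; since the degrees differ by
  one, there is only one zero.
\<close>

lemma proots_extra_root:
  fixes Q :: "complex poly"
  assumes "pderiv Q \<noteq> 0" and dvd: "\<And>x. poly (pderiv Q) x = 0 \<Longrightarrow> poly Q x = 0"
  shows "\<exists>e. (\<forall>x. poly (pderiv Q) x = 0 \<longrightarrow> x = e) \<and> (\<forall>x. poly Q x = 0 \<longrightarrow> x = e)"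
proof -
  have Q: "Q \<noteq> 0" using assms(1) by auto
  have order: "Polynomial.order x Q = Suc (Polynomial.order x (pderiv Q))" if "poly Q x = 0" for x
    using order_pderiv[of Q x] that Q by (simp add: order_root)
  have sub: "proots (pderiv Q) \<subseteq># proots Q"
  proof (rule mset_subset_eqI)
    fix x
    show "count (proots (pderiv Q)) x \<le> count (proots Q) x"
    proof (cases "poly (pderiv Q) x = 0")
      case True
      then show ?thesis using order[OF dvd[OF True]] assms(1) Q by simp
    next
      case False
      then show ?thesis using assms(1) by (simp add: order_root)
    qed
  qed
  have "degree Q \<noteq> 0" using assms(1) by (auto simp: pderiv_eq_0_iff)
  then have "size (proots Q - proots (pderiv Q)) = 1"
    using sub by (simp add: size_Diff_submset size_proots_complex degree_pderiv)
  then obtain e where e: "proots Q - proots (pderiv Q) = {#e#}" using size_1_singleton_mset by blast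
  have Qe: "x = e" if "poly Q x = 0" for x
  proof (rule ccontr)
    assume "x \<noteq> e"
    then have "count (proots Q - proots (pderiv Q)) x = 0" by (simp add: e)
    then show False using order[OF that] assms(1) Q by simp
  qed
  then show ?thesis using dvd by blast
qed

lemma poly_eqI_eval: "(\<And>x. poly p x = poly q x) \<Longrightarrow> p = q" for p q :: "complex poly"
  by (simp add: poly_eq_poly_eq_iff[symmetric] fun_eq_iff)

lemma unity_poly_dvd:
  fixes q :: "complex poly"
  assumes k: "0 < k" and c: "c \<noteq> 0" and z: "\<And>w. w ^ k = c \<Longrightarrow> poly q w = 0"
  shows "monom 1 k - [:c:] dvd q"
proof -
  define m where "m = monom 1 k - [:c:]"
  have m_eq: "m = monom 1 k + [:-c:]" by (simp add: m_def)
  have dm: "degree m = k" unfolding m_eq using k by (subst degree_add_eq_left) (auto simp: degree_monom_eq)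
  then have m0: "m \<noteq> 0" using k by auto
  have "q mod m = 0"
  proof (rule ccontr)
    assume nz: "q mod m \<noteq> 0"
    have root: "poly (q mod m) w = 0" if "w ^ k = c" for w
    proof -
      have "poly q w = poly (q div m) w * poly m w + poly (q mod m) w"
        by (metis div_mult_mod_eq poly_add poly_mult)
      moreover have "poly m w = 0" using that by (simp add: m_def poly_monom)
      ultimately show ?thesis using z[OF that] by simp
    qed
    have "k = card {w. w ^ k = c}" using card_nth_roots[OF c, of k] k by simp
    also have "\<dots> \<le> card {w. poly (q mod m) w = 0}"
      using root poly_roots_finite[OF nz] by (intro card_mono) auto
    also have "\<dots> \<le> degree (q mod m)" by (rule card_poly_roots_bound[OF nz])
    also have "\<dots> < k" using degree_mod_less'[OF m0 nz] dm by simp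
    finally show False by simp
  qed
  then show ?thesis by (simp add: m_def mod_eq_0_iff_dvd)
qed

text \<open>
  The symmetry under roots of unity leaves so few possible exponents in the remainder that it
  has fewer coefficients than there are parameters.
\<close>

lemma card_reduced_indices:
  assumes k: "2 \<le> k" and nz: "\<delta> = 0 \<Longrightarrow> 0 < n" and \<delta>: "\<delta> \<le> 1"
    and dvd: "\<delta> = 1 \<Longrightarrow> k dvd r" and r: "2 \<le> r"
    and N: "N = k * n + \<delta>" and D: "D = 1 + (r - 1) * N"
  shows "card {i. i < N - 1 \<and> i \<le> (k - 1) * D \<and> k dvd (k - 1) * D - i} < n + \<delta>" (is "card ?I < _")
proof (cases "\<delta> = 0")
  case True
  have "?I \<subseteq> (\<lambda>m. k * m + (k - 1)) ` {..<n - 1}"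
  proof
    fix i assume i: "i \<in> ?I"
    have "(k - 1) * D = (k - 1) + k * ((k - 1) * (r - 1) * n)"
      using True by (simp add: D N algebra_simps)
    then have "[(k - 1) * D = k - 1] (mod k)" by (simp add: cong_def)
    moreover have "[(k - 1) * D = i] (mod k)" using i by (auto simp: cong_altdef_nat)
    ultimately have "[i = k - 1] (mod k)" using cong_sym cong_trans by blast
    then have im: "i mod k = k - 1" using k by (simp add: cong_def)
    define m where "m = i div k"
    have im': "i = k * m + (k - 1)" using im mult_div_mod_eq[of k i] by (simp add: m_def)
    have "Suc i = k * Suc m" using im' k by simp
    moreover have "Suc i < k * n" using i True by (auto simp: N)
    ultimately have "Suc m < n" using k by (metis mult_less_cancel1)
    then show "i \<in> (\<lambda>m. k * m + (k - 1)) ` {..<n - 1}" using im' by auto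
  qed
  then have "card ?I \<le> card ((\<lambda>m. k * m + (k - 1)) ` {..<n - 1})" by (intro card_mono) auto
  also have "\<dots> \<le> n - 1" using card_image_le[of "{..<n - 1}"] by simp
  finally show ?thesis using nz[OF True] by simp
next
  case False
  then have \<delta>1: "\<delta> = 1" using \<delta> by simp
  obtain s where s: "r = k * s" using dvd[OF \<delta>1] by (elim dvdE)
  have "D = r + k * ((r - 1) * n)" using r \<delta>1 by (cases r) (simp_all add: D N algebra_simps)
  then have kD: "k dvd D" using s by simp
  have "?I \<subseteq> (\<lambda>m. k * m) ` {..<n}"
  proof
    fix i assume i: "i \<in> ?I"
    then have "k dvd i" using kD dvd_diffD1[of k "(k - 1) * D" i] by simp
    then obtain m where "i = k * m" by blast
    then show "i \<in> (\<lambda>m. k * m) ` {..<n}" using i \<delta>1 k by (auto simp: N)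
  qed
  then have "card ?I \<le> card ((\<lambda>m. k * m) ` {..<n})" by (intro card_mono) auto
  also have "\<dots> \<le> n" using card_image_le[of "{..<n}"] by simp
  finally show ?thesis using \<delta>1 by simp
qed

text \<open>
  With \<open>Q' = A\<^bsup>r-1\<^esup>\<close>, the power \<open>Q\<^sup>k\<close> is congruent
  to a constant modulo \<open>A\<^sup>r\<close> as soon as \<open>Q\<^bsup>k-1\<^esup>\<close>
  is a value of the twisted derivative, that is, as soon as the remainder of
  \<open>Q\<^bsup>k-1\<^esup>\<close> vanishes. The coefficients of the remainder are forms in
  the roots of \<open>A\<close> (and one more parameter, the constant term of \<open>Q\<close>,
  if \<open>A\<close> vanishes at the origin), fewer than there are parameters, so they have a
  common zero other than the origin. At such a zero the constant is not zero: otherwise all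
  roots of \<open>Q\<close> and \<open>A\<close> would coincide, and then all parameters would
  vanish.
\<close>

lemma exists_power_relation:
  assumes k: "2 \<le> k" and r: "2 \<le> r" and \<delta>: "\<delta> \<le> 1"
    and nz: "\<delta> = 0 \<Longrightarrow> 0 < n" and kr: "\<delta> = 1 \<Longrightarrow> k dvd r"
    and N: "N = k * n + \<delta>" and D: "D = 1 + (r - 1) * N"
  shows "\<exists>A Q F c0. c0 \<noteq> 0 \<and> degree A = N \<and> A \<noteq> 0 \<and> degree Q = D \<and> pderiv Q = A ^ (r - 1) \<and>
     Q ^ k = [:c0:] + smult (of_nat k) (A ^ r * F) \<and> Q ^ (k - 1) = twisted_derivative r A F \<and>
     (\<forall>w z. w ^ k = 1 \<longrightarrow> poly A (w * z) = w ^ \<delta> * poly A z) \<and>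
     (\<forall>w z. w ^ k = 1 \<longrightarrow> poly Q (w * z) = w ^ (1 - \<delta>) * poly Q z)"
proof -
  define M where "M = n + \<delta>"
  have N0: "0 < N" using nz k \<delta> by (cases "\<delta> = 0") (auto simp: N)
  (* the parameters b j and their rotations are the roots; the coefficients are homogeneous in
     b *)
  define A where "A b = monom 1 \<delta> * (\<Prod>j<n. monom 1 k - [:b j ^ k:])" for b :: "nat \<Rightarrow> complex"
  define Q where "Q b = (if \<delta> = 0 then 0 else [:b n ^ D:]) + antiderivative (A b ^ (r - 1))" for b :: "nat \<Rightarrow> complex"
  have lin_deg: "degree (monom 1 k - [:c:]) = k" "coeff (monom 1 k - [:c:]) k = 1" for c :: complex
  proof -
    have e: "monom 1 k - [:c:] = monom 1 k + [:-c:]" by simp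
    show "degree (monom 1 k - [:c:]) = k"
      unfolding e using k by (subst degree_add_eq_left) (auto simp: degree_monom_eq)
    show "coeff (monom 1 k - [:c:]) k = 1" using k by (cases k) auto
  qed
  have lin_nz: "monom 1 k - [:c:] \<noteq> 0" for c :: complex using lin_deg[of c] by force
  have prod_deg: "degree (\<Prod>j<m. monom 1 k - [:b j ^ k:]) = k * m \<and> lead_coeff (\<Prod>j<m. monom 1 k - [:b j ^ k:]) = 1"
    for b :: "nat \<Rightarrow> complex" and m
  proof (induction m)
    case (Suc m)
    have "(\<Prod>j<m. monom 1 k - [:b j ^ k:]) \<noteq> 0" using lin_nz by simp
    then have "degree (\<Prod>j<Suc m. monom 1 k - [:b j ^ k:]) = k * Suc m"
      using Suc lin_nz[of "b m ^ k"] lin_deg(1)[of "b m ^ k"]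
      by (simp add: degree_mult_eq del: prod_zero_iff)
    moreover have "lead_coeff (\<Prod>j<Suc m. monom 1 k - [:b j ^ k:]) = 1"
    proof -
      have "lead_coeff (monom 1 k - [:b m ^ k:]) = 1" unfolding lin_deg(1) by (rule lin_deg(2))
      then show ?thesis
        using conjunct2[OF Suc] by (metis prod.lessThan_Suc lead_coeff_mult mult_1_left)
    qed
    ultimately show ?case by blast
  qed simp
  have A_nz: "A b \<noteq> 0" for b using lin_nz by (simp add: A_def)
  have A_deg: "degree (A b) = N" for b
    using A_nz[of b] prod_deg[where b = b and m = n] by (simp add: A_def degree_mult_eq degree_monom_eq N)
  have A_lead: "coeff (A b) N = 1" for b
  proof -
    have "lead_coeff (A b) = 1"
      unfolding A_def lead_coeff_mult lead_coeff_monom using conjunct2[OF prod_deg] by (metis mult_1_left)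
    then show ?thesis unfolding A_deg .
  qed
  have A_graded: "graded k M N A"
  proof -
    have "graded k M (n * k) (\<lambda>b. \<Prod>j<n. monom 1 k - [:b j ^ k:])"
    proof (rule graded_prod)
      fix j assume "j < n"
      then have "(\<lambda>b. b j) ^ k \<in> forms M (k * 1)"
        by (intro forms_power forms_coordinate) (simp add: M_def)
      moreover have "(\<lambda>b. b j) ^ k = (\<lambda>b::nat \<Rightarrow> complex. b j ^ k)" by (rule ext) (simp add: power_fun_eval)
      ultimately have "(\<lambda>b. b j ^ k) \<in> forms M k" by simp
      then show "graded k M k (\<lambda>b. monom 1 k - [:b j ^ k:])"
        by (intro graded_diff graded_monom graded_scalar) auto
    qed
    then have "graded k M (\<delta> + n * k) (\<lambda>b. monom 1 \<delta> * (\<Prod>j<n. monom 1 k - [:b j ^ k:]))"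
      by (intro graded_mult graded_monom)
    then show ?thesis by (simp add: A_def[abs_def] N mult.commute add.commute)
  qed
  have Q_graded: "graded k M D Q"
  proof -
    have 1: "graded k M D (\<lambda>b. antiderivative (A b ^ (r - 1)))"
      using graded_antiderivative[OF graded_power[OF A_graded, of "r - 1"]] by (simp add: D)
    have 2: "graded k M D (\<lambda>b. if \<delta> = 0 then 0 else [:b n ^ D:])"
    proof (cases "\<delta> = 0")
      case True
      then show ?thesis by (simp add: graded_zero)
    next
      case False
      then have \<delta>1: "\<delta> = 1" using \<delta> by simp
      have "D = r + k * ((r - 1) * n)" using r \<delta>1 by (cases r) (simp_all add: D N algebra_simps)
      then have kD: "k dvd D" using kr \<delta>1 by simp
      have "(\<lambda>b. b n) ^ D \<in> forms M (D * 1)"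
        using \<delta>1 by (intro forms_power forms_coordinate) (simp add: M_def)
      moreover have "(\<lambda>b. b n) ^ D = (\<lambda>b::nat \<Rightarrow> complex. b n ^ D)" by (rule ext) (simp add: power_fun_eval)
      ultimately have "(\<lambda>b. b n ^ D) \<in> forms M D" by simp
      then show ?thesis using False graded_scalar[OF _ kD] by simp
    qed
    show ?thesis using graded_add[OF 2 1] by (simp add: Q_def[abs_def])
  qed
  define e where "e = (k - 1) * D"
  (* the remainder whose coefficients are to vanish *)
  define \<rho> where "\<rho> b = reduce r N (A b) (Suc e) (Q b ^ (k - 1))" for b
  have rho_graded: "graded k M e \<rho>"
    unfolding \<rho>_def[abs_def] e_def by (intro graded_reduce A_graded N0 graded_power Q_graded)
  have rho_high: "coeff (\<rho> b) i = 0" if "i \<ge> N - 1" for b i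
    unfolding \<rho>_def
  proof (rule coeff_reduce[OF A_lead A_deg N0 _ _ that])
    show "0 < r" using r by simp
    fix i assume "i \<ge> N - 1 + Suc e"
    then show "coeff (Q b ^ (k - 1)) i = 0"
      using graded_coeff_zero[OF graded_power[OF Q_graded, of "k - 1"], of i b] by (simp add: e_def)
  qed
  define I where "I = {i. i < N - 1 \<and> i \<le> e \<and> k dvd e - i}"
  have finI: "finite I" by (simp add: I_def)
  have cardI: "card I < M"
    using card_reduced_indices[OF k nz \<delta> kr r N D] by (simp add: I_def e_def M_def)
  obtain h where h: "bij_betw h {0..<card I} I" using ex_bij_betw_nat_finite[OF finI] by blast
  have e_big: "N \<le> e"
  proof -
    have "1 * N \<le> (r - 1) * N" using r by (intro mult_le_mono1) simp
    then have "N \<le> D" unfolding D mult_1 by (rule trans_le_add2)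
    have "1 * D \<le> (k - 1) * D" using k by (intro mult_le_mono1) simp
    then have "D \<le> e" unfolding e_def mult_1 .
    then show ?thesis using \<open>N \<le> D\<close> by (rule order_trans[rotated])
  qed
  have "\<exists>b. (\<exists>i<M. b i \<noteq> 0) \<and> (\<forall>j<card I. (\<lambda>b. coeff (\<rho> b) (h j)) b = 0)"
  proof (rule homogeneous_common_zero[where d = "\<lambda>j. e - h j"])
    fix j assume "j < card I"
    then have "h j \<in> I" using h by (auto simp: bij_betw_def)
    then show "0 < e - h j" using e_big by (auto simp: I_def)
    show "(\<lambda>b. coeff (\<rho> b) (h j)) \<in> forms M (e - h j)" by (rule graded_coeff[OF rho_graded])
  qed (rule cardI)
  then obtain b where b: "\<exists>i<M. b i \<noteq> 0" and hz: "\<And>j. j < card I \<Longrightarrow> coeff (\<rho> b) (h j) = 0" by blast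
  have "\<rho> b = 0"
  proof (rule poly_eqI)
    fix i
    show "coeff (\<rho> b) i = coeff 0 i"
    proof (cases "i \<in> I")
      case True
      then have "i \<in> h ` {0..<card I}" using h by (simp add: bij_betw_def)
      then obtain j where "j < card I" "h j = i" by auto
      then show ?thesis using hz by auto
    next
      case False
      then show ?thesis using rho_high[of i b] graded_coeff_zero[OF rho_graded, of i b]
        by (auto simp: I_def not_less)
    qed
  qed
  then obtain F where F: "Q b ^ (k - 1) = twisted_derivative r (A b) F"
    using reduce_congruent[of "Q b ^ (k - 1)" r "A b" N "Suc e"] by (auto simp: \<rho>_def)
  have Q': "pderiv (Q b) = A b ^ (r - 1)" by (simp add: Q_def pderiv_add pderiv_antiderivative)
  have Q_deg: "degree (Q b) = D"
  proof -
    have "degree (pderiv (Q b)) = (r - 1) * N" using A_nz[of b] by (simp add: Q' degree_power_eq A_deg)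
    moreover have "degree (Q b) \<noteq> 0"
    proof
      assume "degree (Q b) = 0"
      then have "pderiv (Q b) = 0" by (simp add: pderiv_eq_0_iff)
      then show False using A_nz[of b] by (simp add: Q')
    qed
    ultimately show ?thesis by (simp add: degree_pderiv D)
  qed
  have "pderiv (Q b ^ k - smult (of_nat k) (A b ^ r * F)) = 0"
  proof -
    obtain k' where k': "k = Suc k'" using k by (cases k) auto
    have "pderiv (Q b ^ k) = smult (of_nat k) (Q b ^ (k - 1) * A b ^ (r - 1))"
      unfolding k' pderiv_power_Suc Q' by simp
    moreover have "pderiv (A b ^ r * F) = A b ^ (r - 1) * Q b ^ (k - 1)"
      using pderiv_power_mult[of r "A b" F] F r by simp
    ultimately show ?thesis by (simp add: pderiv_diff pderiv_smult mult.commute)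
  qed
  then obtain c0 where "Q b ^ k - smult (of_nat k) (A b ^ r * F) = [:c0:]"
    by (metis degree_eq_zeroE pderiv_eq_0_iff)
  then have rel: "Q b ^ k = [:c0:] + smult (of_nat k) (A b ^ r * F)" by (simp add: diff_eq_eq)
  have symA: "poly (A b) (w * z) = w ^ \<delta> * poly (A b) z" if "w ^ k = 1" for w z
    using graded_rotate[OF A_graded that, of b z] that by (simp add: N power_add power_mult)
  have symQ: "poly (Q b) (w * z) = w ^ (1 - \<delta>) * poly (Q b) z" if "w ^ k = 1" for w z
  proof -
    have "w ^ D = w ^ (1 - \<delta>)"
    proof (cases "\<delta> = 0")
      case True
      have "w ^ D = w * (w ^ k) ^ (n * (r - 1))"
        by (simp add: D N True power_add flip: power_mult) (simp add: mult_ac)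
      then show ?thesis using True that by simp
    next
      case False
      then have \<delta>1: "\<delta> = 1" using \<delta> by simp
      obtain s where s: "r = k * s" using kr[OF \<delta>1] by (elim dvdE)
      have "D = r + k * ((r - 1) * n)" using r \<delta>1 by (cases r) (simp_all add: D N algebra_simps)
      then have "w ^ D = (w ^ k) ^ s * (w ^ k) ^ ((r - 1) * n)" by (simp add: power_add power_mult s)
      then show ?thesis using that \<delta>1 by simp
    qed
    then show ?thesis using graded_rotate[OF Q_graded that] by simp
  qed
  have "c0 \<noteq> 0"
  proof
    assume "c0 = 0"
    then have rel0: "Q b ^ k = smult (of_nat k) (A b ^ r * F)" using rel by simp
    have AQ: "poly (Q b) x = 0" if "poly (A b) x = 0" for x
      using arg_cong[OF rel0, of "\<lambda>p. poly p x"] that r k by (simp add: power_0_left)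
    obtain \<epsilon> where \<epsilon>: "\<And>x. poly (pderiv (Q b)) x = 0 \<Longrightarrow> x = \<epsilon>" "\<And>x. poly (Q b) x = 0 \<Longrightarrow> x = \<epsilon>"
      using proots_extra_root[of "Q b"] AQ A_nz[of b] by (auto simp: Q')
    have "\<epsilon> = 0"
    proof (cases "\<delta> = 0")
      case True
      have "poly (Q b) 0 = 0" by (simp add: Q_def True poly_0_coeff_0 coeff_antiderivative)
      then show ?thesis using \<epsilon>(2) by simp
    next
      case False
      then have "poly (A b) 0 = 0" by (simp add: A_def poly_monom)
      then show ?thesis using \<epsilon>(2)[OF AQ, of 0] by simp
    qed
    have "b j = 0" if "j < n" for j
    proof -
      have "poly (A b) (b j) = 0" using that by (auto simp: A_def poly_prod poly_monom intro!: prod_zero)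
      then show ?thesis using \<epsilon>(2)[OF AQ] \<open>\<epsilon> = 0\<close> by simp
    qed
    moreover have "b n = 0" if "\<delta> \<noteq> 0"
    proof -
      have "poly (A b) 0 = 0" using that by (simp add: A_def poly_monom)
      then have "poly (Q b) 0 = 0" by (rule AQ)
      then have "b n ^ D = 0" using that by (simp add: Q_def poly_0_coeff_0 coeff_antiderivative)
      then show ?thesis by simp
    qed
    ultimately show False using b \<delta> unfolding M_def
      by (metis add.right_neutral le_eq_less_or_eq less_one less_Suc_eq Suc_eq_plus1)
  qed
  then show ?thesis using A_nz A_deg Q_deg Q' rel F symA symQ by blast
qed

text \<open>
  The identities that make \<open>(x, y, z) \<mapsto> (x A(z), y B(z), Q(z))\<close> an etale
  endomorphism of the surface.
\<close>

definition lift_data :: "nat \<Rightarrow> nat \<Rightarrow> complex poly \<Rightarrow> complex poly \<Rightarrow> complex poly \<Rightarrow> bool" where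
  "lift_data k r A B Q \<longleftrightarrow> A ^ r * B * (monom 1 k - 1) = Q ^ k - 1 \<and>
     (\<exists>c. c \<noteq> 0 \<and> pderiv Q = smult c (A ^ (r - 1)))"

lemma pcompose_power: "pcompose (p ^ n) q = pcompose p q ^ n" for p q :: "complex poly"
  by (induction n) (simp_all add: pcompose_mult pcompose_1)

text \<open>
  The cofactor of \<open>A\<^sup>r\<close> in \<open>Q\<^sup>k - c0\<close> has a zero and, by
  symmetry, vanishes at all its rotations. Rescaling the variable moves this zero to one, so
  that \<open>z\<^sup>k - 1\<close> divides the cofactor; rescaling \<open>Q\<close> turns
  \<open>c0\<close> into one. The case \<open>\<delta> = 1\<close> is the one where
  \<open>A\<close> vanishes at the origin.
\<close>

lemma exists_lift_data:
  assumes k: "2 \<le> k" and r: "2 \<le> r" and \<delta>: "N mod k = \<delta>" "\<delta> \<le> 1" and kr: "\<delta> = 1 \<Longrightarrow> k dvd r"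
  shows "\<exists>A B Q. lift_data k r A B Q \<and> degree A = N \<and> degree Q = 1 + (r - 1) * N \<and>
     (\<forall>w z. w ^ k = 1 \<longrightarrow> poly A (w * z) = w ^ \<delta> * poly A z \<and> poly B (w * z) = poly B z \<and>
        poly Q (w * z) = w ^ (1 - \<delta>) * poly Q z)"
proof (cases "N = 0")
  case True
  then have "\<delta> = 0" using \<delta> by simp
  moreover have "lift_data k r 1 1 [:0, 1:]"
    unfolding lift_data_def by (intro conjI exI[of _ 1]) (simp_all add: monom_altdef pderiv_pCons)
  ultimately show ?thesis using True by (intro exI[of _ 1] exI[of _ "[:0, 1:]"]) simp
next
  case False
  define n where "n = N div k"
  have N: "N = k * n + \<delta>" using \<delta>(1) by (simp add: n_def flip: \<delta>(1))
  have n: "0 < n" if "\<delta> = 0" using False N that by (cases n) auto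
  define D where "D = 1 + (r - 1) * N"
  obtain A Q F c0 where c0: "c0 \<noteq> 0" and A: "degree A = N" "A \<noteq> 0" and Q: "degree Q = D" "pderiv Q = A ^ (r - 1)"
    and rel: "Q ^ k = [:c0:] + smult (of_nat k) (A ^ r * F)" and tw: "Q ^ (k - 1) = twisted_derivative r A F"
    and symA: "\<And>w z. w ^ k = 1 \<Longrightarrow> poly A (w * z) = w ^ \<delta> * poly A z"
    and symQ: "\<And>w z. w ^ k = 1 \<Longrightarrow> poly Q (w * z) = w ^ (1 - \<delta>) * poly Q z"
    using exists_power_relation[OF k r \<delta>(2) n kr N D_def] by blast
  have rel': "poly Q z ^ k = c0 + of_nat k * (poly A z ^ r * poly F z)" for z
    using arg_cong[OF rel, of "\<lambda>p. poly p z"] by simp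
  have FA: "poly F z \<noteq> 0" if "poly A z = 0" for z
  proof
    assume F: "poly F z = 0"
    have "poly Q z ^ (k - 1) = 0"
      using arg_cong[OF tw, of "\<lambda>p. poly p z"] that F by (simp add: twisted_derivative_def)
    then have "poly Q z = 0" by simp
    then show False using rel'[of z] c0 that r k by (simp add: power_0_left)
  qed
  have "degree F \<noteq> 0"
  proof
    assume F: "degree F = 0"
    have "degree (Q ^ k) = k * D" using Q by (cases "Q = 0") (auto simp: degree_power_eq D_def)
    moreover have "degree (Q ^ k) \<le> r * N"
      unfolding rel using A F degree_mult_le[of "A ^ r" F] degree_power_le[of A r]
      by (intro degree_add_le order_trans[OF degree_smult_le]) (auto simp: mult.commute)
    moreover have "r * N < k * D"
    proof -
      have "r * N \<le> 2 * ((r - 1) * N)" using r by (cases r) auto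
      also have "\<dots> < 2 * D" by (simp add: D_def)
      also have "\<dots> \<le> k * D" using k by simp
      finally show ?thesis .
    qed
    ultimately show False by simp
  qed
  then obtain z1 where z1: "poly F z1 = 0"
    using fundamental_theorem_of_algebra[of F] by (auto simp: constant_degree)
  have Az1: "poly A z1 \<noteq> 0" using FA z1 by blast
  have "z1 \<noteq> 0"
  proof
    assume "z1 = 0"
    obtain w :: complex where w: "w ^ k = 1" "w \<noteq> 1" using exists_nontrivial_unity_root[OF k] by blast
    show False
    proof (cases "\<delta> = 0")
      case True
      then have "poly Q 0 = 0" using symQ[OF w(1), of 0] w(2) by simp
      then show False using rel'[of 0] z1 \<open>z1 = 0\<close> c0 k by (simp add: power_0_left)
    next
      case False
      then have "\<delta> = 1" using \<delta>(2) by simp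
      then have "poly A 0 = 0" using symA[OF w(1), of 0] w(2) by simp
      then show False using Az1 \<open>z1 = 0\<close> by simp
    qed
  qed
  obtain g where g: "g ^ k = c0" "g \<noteq> 0"
  proof -
    have "card {z. z ^ k = c0} > 0" using card_nth_roots[OF c0, of k] k by simp
    then obtain g where "g ^ k = c0" by (auto simp: card_gt_0_iff)
    then show ?thesis using that c0 k by (metis power_0_left zero_neq_numeral le_zero_eq)
  qed
  define A1 where "A1 = pcompose A [:0, z1:]"
  define Q1 where "Q1 = smult (inverse g) (pcompose Q [:0, z1:])"
  define F1 where "F1 = smult (of_nat k / c0) (pcompose F [:0, z1:])"
  have A1: "poly A1 z = poly A (z1 * z)" and Q1: "poly Q1 z = inverse g * poly Q (z1 * z)"
    and F1: "poly F1 z = of_nat k / c0 * poly F (z1 * z)" for z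
    by (simp_all add: A1_def Q1_def F1_def poly_pcompose mult.commute)
  have AF1: "A1 ^ r * F1 = Q1 ^ k - 1"
  proof (rule poly_eqI_eval)
    fix z
    have "poly (Q1 ^ k - 1) z = poly Q (z1 * z) ^ k / c0 - 1"
      using g by (simp add: Q1 power_mult_distrib field_simps flip: g(1))
    also have "\<dots> = poly (A1 ^ r * F1) z" using c0 by (simp add: rel' A1 F1 field_simps)
    finally show "poly (A1 ^ r * F1) z = poly (Q1 ^ k - 1) z" by simp
  qed
  have "poly F1 w = 0" if "w ^ k = 1" for w
  proof -
    have "poly Q (w * z1) ^ k = poly Q z1 ^ k"
      using that by (simp add: symQ power_mult_distrib flip: power_mult) (simp add: mult.commute[of _ k] power_mult)
    then have "poly A (w * z1) ^ r * poly F (w * z1) = 0" using rel'[of z1] rel'[of "w * z1"] z1 k by simp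
    moreover have "w \<noteq> 0" using that k by (auto simp: power_0_left)
    then have "poly A (w * z1) \<noteq> 0" using symA[OF that] Az1 by simp
    ultimately show ?thesis by (simp add: F1 mult.commute)
  qed
  then have "monom 1 k - [:1:] dvd F1" using k by (intro unity_poly_dvd) auto
  then obtain B where B: "F1 = (monom 1 k - 1) * B" by (auto simp: one_pCons)
  have data: "A1 ^ r * B * (monom 1 k - 1) = Q1 ^ k - 1" using AF1 B by (simp add: mult_ac)
  have "pderiv Q1 = smult (inverse g * z1) (A1 ^ (r - 1))"
    by (simp add: Q1_def A1_def pderiv_smult pderiv_pcompose Q(2) pcompose_power pderiv_pCons)
  then have lift: "lift_data k r A1 B Q1" unfolding lift_data_def using data g \<open>z1 \<noteq> 0\<close>
    by (intro conjI exI[of _ "inverse g * z1"]) simp_all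
  have symA1: "poly A1 (w * z) = w ^ \<delta> * poly A1 z" if "w ^ k = 1" for w z
    using symA[OF that, of "z1 * z"] by (simp add: A1 mult.left_commute)
  have symQ1: "poly Q1 (w * z) = w ^ (1 - \<delta>) * poly Q1 z" if "w ^ k = 1" for w z
    using symQ[OF that, of "z1 * z"] by (simp add: Q1 mult.left_commute)
  have symB: "poly B (w * z) = poly B z" if w: "w ^ k = 1" for w z
  proof -
    have wr: "(w ^ \<delta>) ^ r = 1"
    proof (cases "\<delta> = 0")
      case False
      then have "\<delta> = 1" using \<delta>(2) by simp
      moreover from kr[OF this] obtain s where "r = k * s" by blast
      ultimately show ?thesis using w by (simp add: power_mult)
    qed simp
    have "A1 ^ r * (monom 1 k - 1) * (pcompose B [:0, w:] - B) = 0"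
    proof (rule poly_eqI_eval)
      fix x
      have d: "poly A1 x ^ r * poly B x * (x ^ k - 1) = poly Q1 x ^ k - 1" for x
        using arg_cong[OF data, of "\<lambda>p. poly p x"] by (simp add: poly_monom)
      have "poly Q1 (w * x) ^ k = poly Q1 x ^ k"
        using w by (simp add: symQ1 power_mult_distrib flip: power_mult) (simp add: mult.commute[of _ k] power_mult)
      then have "poly A1 x ^ r * poly B (w * x) * (x ^ k - 1) = poly A1 x ^ r * poly B x * (x ^ k - 1)"
        using d[of x] d[of "w * x"] w wr by (simp add: symA1[OF w] power_mult_distrib)
      then show "poly (A1 ^ r * (monom 1 k - 1) * (pcompose B [:0, w:] - B)) x = poly 0 x"
        by (simp add: poly_pcompose poly_monom algebra_simps)
    qed
    moreover have "A1 ^ r \<noteq> 0" using A \<open>z1 \<noteq> 0\<close> by (simp add: A1_def pcompose_eq_0_iff)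
    moreover have "monom 1 k - 1 \<noteq> (0 :: complex poly)"
    proof
      assume "monom 1 k - 1 = (0 :: complex poly)"
      then have "coeff (monom 1 k - 1 :: complex poly) k = 0" by simp
      then show False using k by simp
    qed
    ultimately have "pcompose B [:0, w:] = B" by auto
    then have "poly (pcompose B [:0, w:]) z = poly B z" by simp
    then show ?thesis by (simp add: poly_pcompose mult.commute)
  qed
  have "degree A1 = N" "degree Q1 = D" using A Q \<open>z1 \<noteq> 0\<close> g by (auto simp: A1_def Q1_def degree_pcompose)
  then show ?thesis using lift symA1 symQ1 symB unfolding D_def by blast
qed

section \<open>Varieties, tangent maps and quotients\<close>

text \<open>
  The closure properties of the regular functions that the arguments below use; they hold for
  affine varieties and pass to quotients.
\<close>

definition function_variety :: "'a variety \<Rightarrow> bool" where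
  "function_variety X \<longleftrightarrow> (\<forall>c. (\<lambda>_. c) \<in> regular X) \<and>
     (\<forall>f\<in>regular X. \<forall>g\<in>regular X. (\<lambda>p. f p + g p) \<in> regular X) \<and>
     (\<forall>f\<in>regular X. \<forall>g\<in>regular X. (\<lambda>p. f p * g p) \<in> regular X) \<and>
     (\<forall>f\<in>regular X. \<forall>g. (\<forall>p\<in>points X. f p = g p) \<longrightarrow> g \<in> regular X)"

lemma regular_const: "function_variety X \<Longrightarrow> (\<lambda>_. c) \<in> regular X"
  and regular_add: "function_variety X \<Longrightarrow> f \<in> regular X \<Longrightarrow> g \<in> regular X \<Longrightarrow> (\<lambda>p. f p + g p) \<in> regular X"
  and regular_mult: "function_variety X \<Longrightarrow> f \<in> regular X \<Longrightarrow> g \<in> regular X \<Longrightarrow> (\<lambda>p. f p * g p) \<in> regular X"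
  and regular_cong: "function_variety X \<Longrightarrow> f \<in> regular X \<Longrightarrow> (\<And>p. p \<in> points X \<Longrightarrow> f p = g p) \<Longrightarrow> g \<in> regular X"
  by (auto simp: function_variety_def)

lemma regular_scale: "function_variety X \<Longrightarrow> f \<in> regular X \<Longrightarrow> (\<lambda>p. c * f p) \<in> regular X"
  using regular_mult[OF _ regular_const] by blast

lemma regular_uminus: "function_variety X \<Longrightarrow> f \<in> regular X \<Longrightarrow> (\<lambda>p. - f p) \<in> regular X"
  using regular_scale[of X f "-1"] by simp

lemma regular_diff: "function_variety X \<Longrightarrow> f \<in> regular X \<Longrightarrow> g \<in> regular X \<Longrightarrow> (\<lambda>p. f p - g p) \<in> regular X"
  using regular_add[OF _ _ regular_uminus, of X f g] by simp

lemma regular_power: "function_variety X \<Longrightarrow> f \<in> regular X \<Longrightarrow> (\<lambda>p. f p ^ n) \<in> regular X"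
  by (induction n) (auto intro: regular_const regular_mult)

lemma regular_sum:
  "function_variety X \<Longrightarrow> (\<And>i. i \<in> I \<Longrightarrow> F i \<in> regular X) \<Longrightarrow> (\<lambda>p. \<Sum>i\<in>I. F i p) \<in> regular X"
  by (induction I rule: infinite_finite_induct) (auto intro: regular_const regular_add)

lemma regular_poly: "function_variety X \<Longrightarrow> f \<in> regular X \<Longrightarrow> (\<lambda>p. poly P (f p)) \<in> regular X"
  by (induction P) (auto intro: regular_const regular_add regular_mult)

lemmas regular_intros = regular_const regular_add regular_mult regular_scale regular_uminus
  regular_diff regular_power regular_sum regular_poly

lemma points_generated [simp]: "points (generated_variety V G) = V"
  by (simp add: generated_variety_def)

lemma function_variety_generated: "function_variety (generated_variety V G)"
  unfolding function_variety_def generated_variety_def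
  by (auto intro: generated_algebra.intros)

lemma generator_regular: "g \<in> G \<Longrightarrow> g \<in> regular (generated_variety V G)"
  by (auto simp: generated_variety_def intro: generated_algebra.gen)

lemma regular_generated_cases:
  assumes "f \<in> regular (generated_variety V G)"
  obtains g where "g \<in> generated_algebra G" "\<And>p. p \<in> V \<Longrightarrow> f p = g p"
  using assms by (auto simp: generated_variety_def)

lemma points_quotient [simp]: "points (quotient_variety X H act) = orbit H act ` points X"
  by (simp add: quotient_variety_def)

lemma regular_quotient_iff: "f \<in> regular (quotient_variety X H act) \<longleftrightarrow> (\<lambda>p. f (orbit H act p)) \<in> regular X"
  by (simp add: quotient_variety_def)

lemma function_variety_quotient:
  "function_variety X \<Longrightarrow> function_variety (quotient_variety X H act)"
  unfolding function_variety_def[of "quotient_variety X H act"]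
  by (auto simp: regular_quotient_iff intro: regular_intros)
    (rule regular_cong, assumption+, simp)

lemma morphism_quotient: "morphism X (quotient_variety X H act) (orbit H act)"
  by (auto simp: morphism_def regular_quotient_iff comp_def)

lemma morphismI:
  "(\<And>p. p \<in> points X \<Longrightarrow> f p \<in> points Y) \<Longrightarrow> (\<And>g. g \<in> regular Y \<Longrightarrow> (\<lambda>p. g (f p)) \<in> regular X) \<Longrightarrow> morphism X Y f"
  by (auto simp: morphism_def comp_def)

lemma morphism_regular: "morphism X Y f \<Longrightarrow> g \<in> regular Y \<Longrightarrow> (\<lambda>p. g (f p)) \<in> regular X"
  by (auto simp: morphism_def comp_def)

lemma morphism_point: "morphism X Y f \<Longrightarrow> p \<in> points X \<Longrightarrow> f p \<in> points Y"
  by (auto simp: morphism_def)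

lemma morphism_compose: "morphism X Y f \<Longrightarrow> morphism Y Z g \<Longrightarrow> morphism X Z (g \<circ> f)"
proof (rule morphismI)
  assume f: "morphism X Y f" and g: "morphism Y Z g"
  show "(g \<circ> f) p \<in> points Z" if "p \<in> points X" for p
    using morphism_point[OF g morphism_point[OF f that]] by simp
  show "(\<lambda>p. h ((g \<circ> f) p)) \<in> regular X" if "h \<in> regular Z" for h
    using morphism_regular[OF f morphism_regular[OF g that]] by simp
qed

lemma tangent_outside: "D \<in> tangent_space X p \<Longrightarrow> f \<notin> regular X \<Longrightarrow> D f = 0"
  unfolding tangent_space_def by blast

lemma tangent_cong:
  "D \<in> tangent_space X p \<Longrightarrow> f \<in> regular X \<Longrightarrow> g \<in> regular X \<Longrightarrow>
    (\<And>q. q \<in> points X \<Longrightarrow> f q = g q) \<Longrightarrow> D f = D g"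
  unfolding tangent_space_def by blast

lemma tangent_add:
  "D \<in> tangent_space X p \<Longrightarrow> f \<in> regular X \<Longrightarrow> g \<in> regular X \<Longrightarrow> D (\<lambda>q. f q + g q) = D f + D g"
  unfolding tangent_space_def by blast

lemma tangent_scale: "D \<in> tangent_space X p \<Longrightarrow> f \<in> regular X \<Longrightarrow> D (\<lambda>q. c * f q) = c * D f"
  unfolding tangent_space_def by blast

lemma tangent_mult:
  "D \<in> tangent_space X p \<Longrightarrow> f \<in> regular X \<Longrightarrow> g \<in> regular X \<Longrightarrow>
    D (\<lambda>q. f q * g q) = f p * D g + g p * D f"
  unfolding tangent_space_def by blast

lemma tangent_const:
  assumes "function_variety X" "D \<in> tangent_space X p" shows "D (\<lambda>_. c) = 0"
proof -
  have "D (\<lambda>_. 1) = 0"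
    using tangent_mult[OF assms(2) regular_const[OF assms(1), of 1] regular_const[OF assms(1), of 1]] by simp
  then show ?thesis using tangent_scale[OF assms(2) regular_const[OF assms(1), of 1], of c] by simp
qed

lemma tangent_diff:
  assumes "function_variety X" "D \<in> tangent_space X p" "f \<in> regular X" "g \<in> regular X"
  shows "D (\<lambda>q. f q - g q) = D f - D g"
  using tangent_add[OF assms(2,3) regular_scale[OF assms(1,4), of "-1"]] tangent_scale[OF assms(2,4), of "-1"] by simp

lemma tangent_sum:
  assumes "function_variety X" "D \<in> tangent_space X p" "\<And>i. i \<in> I \<Longrightarrow> F i \<in> regular X"
  shows "D (\<lambda>q. \<Sum>i\<in>I. F i q) = (\<Sum>i\<in>I. D (F i))"
  using assms(3)
proof (induction I rule: infinite_finite_induct)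
  case (insert i I)
  then show ?case using tangent_add[OF assms(2), of "F i" "\<lambda>q. \<Sum>i\<in>I. F i q"] regular_sum[OF assms(1), of I F] by simp
qed (use tangent_const[OF assms(1,2), of 0] in auto)

lemma tangent_poly:
  assumes "function_variety X" "D \<in> tangent_space X p" "f \<in> regular X"
  shows "D (\<lambda>q. poly P (f q)) = poly (pderiv P) (f p) * D f"
proof (induction P)
  case 0
  then show ?case using tangent_const[OF assms(1,2), of 0] by simp
next
  case (pCons a P)
  have P: "(\<lambda>q. poly P (f q)) \<in> regular X" by (rule regular_poly[OF assms(1,3)])
  have "D (\<lambda>q. poly (pCons a P) (f q)) = D (\<lambda>_. a) + D (\<lambda>q. f q * poly P (f q))"
    using tangent_add[OF assms(2) regular_const[OF assms(1), of a] regular_mult[OF assms(1,3) P]] by simp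
  also have "\<dots> = f p * D (\<lambda>q. poly P (f q)) + poly P (f p) * D f"
    using tangent_const[OF assms(1,2), of a] tangent_mult[OF assms(2,3) P] by simp
  finally show ?case using pCons by (simp add: pderiv_pCons algebra_simps)
qed

lemma tangent_power:
  assumes "function_variety X" "D \<in> tangent_space X p" "f \<in> regular X"
  shows "D (\<lambda>q. f q ^ n) = of_nat n * f p ^ (n - 1) * D f"
  using tangent_poly[OF assms, of "monom 1 n"] by (simp add: poly_monom pderiv_monom)

lemma tangent_ext:
  assumes "D \<in> tangent_space X p" "D' \<in> tangent_space X p" "\<And>f. f \<in> regular X \<Longrightarrow> D f = D' f"
  shows "D = D'"
  using assms tangent_outside by (metis ext)

lemma tangent_map_eq: "g \<in> regular Y \<Longrightarrow> tangent_map Y f D g = D (\<lambda>p. g (f p))"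
  by (simp add: tangent_map_def comp_def)

lemma tangent_map_in:
  assumes Y: "function_variety Y" and f: "morphism X Y f" and p: "p \<in> points X" and D: "D \<in> tangent_space X p"
  shows "tangent_map Y f D \<in> tangent_space Y (f p)"
  unfolding tangent_space_def
proof (intro CollectI conjI allI ballI impI)
  fix g assume "g \<notin> regular Y" then show "tangent_map Y f D g = 0" by (simp add: tangent_map_def)
next
  fix g h assume gh: "g \<in> regular Y" "h \<in> regular Y"
  note r = morphism_regular[OF f gh(1)] morphism_regular[OF f gh(2)]
  show "tangent_map Y f D (\<lambda>q. g q + h q) = tangent_map Y f D g + tangent_map Y f D h"
    using tangent_add[OF D r] gh regular_add[OF Y gh] by (simp add: tangent_map_eq)
  show "tangent_map Y f D (\<lambda>q. g q * h q) = g (f p) * tangent_map Y f D h + h (f p) * tangent_map Y f D g"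
    using tangent_mult[OF D r] gh regular_mult[OF Y gh] by (simp add: tangent_map_eq)
  assume "\<forall>q\<in>points Y. g q = h q"
  then show "tangent_map Y f D g = tangent_map Y f D h"
    using gh morphism_point[OF f] by (simp add: tangent_map_eq) (rule tangent_cong[OF D r], simp)
next
  fix c g assume g: "g \<in> regular Y"
  show "tangent_map Y f D (\<lambda>q. c * g q) = c * tangent_map Y f D g"
    using tangent_scale[OF D morphism_regular[OF f g]] g regular_scale[OF Y g] by (simp add: tangent_map_eq)
qed

lemma tangent_map_compose:
  assumes "morphism Y Z g"
  shows "tangent_map Z (g \<circ> f) D = tangent_map Z g (tangent_map Y f D)"
  using assms by (auto simp: tangent_map_def morphism_def fun_eq_iff comp_assoc)

lemma tangent_map_cong:
  assumes X: "function_variety X" and D: "D \<in> tangent_space X p" and f: "morphism X Y f"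
    and eq: "\<And>q. q \<in> points X \<Longrightarrow> f q = f' q"
  shows "tangent_map Y f D = tangent_map Y f' D"
proof
  fix g
  show "tangent_map Y f D g = tangent_map Y f' D g"
  proof (cases "g \<in> regular Y")
    case True
    have r: "(\<lambda>p. g (f p)) \<in> regular X" by (rule morphism_regular[OF f True])
    then have "(\<lambda>p. g (f' p)) \<in> regular X" using eq by (auto intro: regular_cong[OF X])
    then show ?thesis using tangent_cong[OF D r] eq True by (simp add: tangent_map_eq)
  qed (simp add: tangent_map_def)
qed

lemma morphism_cong:
  assumes X: "function_variety X" and f: "morphism X Y f" and eq: "\<And>q. q \<in> points X \<Longrightarrow> f q = f' q"
  shows "morphism X Y f'"
proof (rule morphismI)
  show "f' p \<in> points Y" if "p \<in> points X" for p using morphism_point[OF f that] eq[OF that] by simp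
  show "(\<lambda>p. g (f' p)) \<in> regular X" if "g \<in> regular Y" for g
    by (rule regular_cong[OF X morphism_regular[OF f that]]) (simp add: eq)
qed

lemma etale_compose:
  assumes "etale X Y f" "etale Y Z g"
  shows "etale X Z (g \<circ> f)"
  unfolding etale_def
proof (intro conjI ballI)
  show "morphism X Z (g \<circ> f)" using assms by (auto simp: etale_def intro: morphism_compose)
  fix p assume p: "p \<in> points X"
  then have "f p \<in> points Y" using assms by (auto simp: etale_def morphism_def)
  then have "bij_betw (tangent_map Z g \<circ> tangent_map Y f) (tangent_space X p) (tangent_space Z (g (f p)))"
    using assms p by (intro bij_betw_trans) (auto simp: etale_def)
  moreover have "morphism Y Z g" using assms by (simp add: etale_def)
  then have "tangent_map Z g \<circ> tangent_map Y f = tangent_map Z (g \<circ> f)"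
    by (intro ext) (simp only: comp_apply tangent_map_compose)
  ultimately show "bij_betw (tangent_map Z (g \<circ> f)) (tangent_space X p) (tangent_space Z ((g \<circ> f) p))" by simp
qed

lemma etale_isomorphism:
  assumes X: "function_variety X" and Y: "function_variety Y"
    and f: "morphism X Y f" and g: "morphism Y X g"
    and gf: "\<And>p. p \<in> points X \<Longrightarrow> g (f p) = p" and fg: "\<And>q. q \<in> points Y \<Longrightarrow> f (g q) = q"
  shows "etale X Y f"
  unfolding etale_def
proof (intro conjI ballI f)
  fix p assume p: "p \<in> points X"
  have q: "f p \<in> points Y" by (rule morphism_point[OF f p])
  have inv1: "tangent_map X g (tangent_map Y f D) = D" if "D \<in> tangent_space X p" for D
  proof -
    have "tangent_map X g (tangent_map Y f D) = tangent_map X (g \<circ> f) D" by (rule tangent_map_compose[OF g, symmetric])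
    also have "\<dots> = tangent_map X (\<lambda>q. q) D"
      by (rule tangent_map_cong[OF X that morphism_compose[OF f g]]) (simp add: gf)
    also have "\<dots> = D" using tangent_outside[OF that] by (auto simp: tangent_map_def fun_eq_iff comp_def)
    finally show ?thesis .
  qed
  have inv2: "tangent_map Y f (tangent_map X g D) = D" if "D \<in> tangent_space Y (f p)" for D
  proof -
    have "tangent_map Y f (tangent_map X g D) = tangent_map Y (f \<circ> g) D" by (rule tangent_map_compose[OF f, symmetric])
    also have "\<dots> = tangent_map Y (\<lambda>q. q) D"
      by (rule tangent_map_cong[OF Y that morphism_compose[OF g f]]) (simp add: fg)
    also have "\<dots> = D" using tangent_outside[OF that] by (auto simp: tangent_map_def fun_eq_iff comp_def)
    finally show ?thesis .
  qed
  show "bij_betw (tangent_map Y f) (tangent_space X p) (tangent_space Y (f p))"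
  proof (rule bij_betw_byWitness[where f' = "tangent_map X g"])
    show "tangent_map Y f ` tangent_space X p \<subseteq> tangent_space Y (f p)"
      using tangent_map_in[OF Y f p] by blast
    show "tangent_map X g ` tangent_space Y (f p) \<subseteq> tangent_space X p"
      using tangent_map_in[OF X g q] gf[OF p] by auto
  qed (use inv1 inv2 in auto)
qed

text \<open>
  On tangent spaces the square formed by \<open>f\<close>, \<open>f'\<close> and the two etale
  maps commutes, and three of its sides are bijective.
\<close>

lemma etale_descends:
  assumes X: "function_variety X" and \<pi>X: "etale X X' \<pi>" and \<pi>Y: "etale Y Y' \<pi>'" and f: "etale X Y f"
    and surj: "points X' = \<pi> ` points X" and reg: "\<And>h. (\<lambda>p. h (\<pi> p)) \<in> regular X \<Longrightarrow> h \<in> regular X'"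
    and eq: "\<And>p. p \<in> points X \<Longrightarrow> f' (\<pi> p) = \<pi>' (f p)"
  shows "etale X' Y' f'"
proof -
  have m: "morphism X Y' (\<pi>' \<circ> f)" "morphism X X' \<pi>"
    using f \<pi>X \<pi>Y by (auto simp: etale_def intro: morphism_compose)
  have m': "morphism X Y' (f' \<circ> \<pi>)" by (rule morphism_cong[OF X m(1)]) (simp add: eq)
  have mf: "morphism X' Y' f'"
  proof (rule morphismI)
    show "f' q \<in> points Y'" if "q \<in> points X'" for q
      using that surj morphism_point[OF m'] by auto
    show "(\<lambda>p. g (f' p)) \<in> regular X'" if "g \<in> regular Y'" for g
      using morphism_regular[OF m' that] by (intro reg) simp
  qed
  have "bij_betw (tangent_map Y' f') (tangent_space X' (\<pi> p)) (tangent_space Y' (f' (\<pi> p)))" if p: "p \<in> points X" for p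
  proof -
    have fp: "f p \<in> points Y" using f p by (auto simp: etale_def morphism_def)
    have "bij_betw (tangent_map Y' \<pi>' \<circ> tangent_map Y f) (tangent_space X p) (tangent_space Y' (\<pi>' (f p)))"
      using f \<pi>Y p fp by (intro bij_betw_trans) (auto simp: etale_def)
    moreover have "(tangent_map Y' \<pi>' \<circ> tangent_map Y f) D = (tangent_map Y' f' \<circ> tangent_map X' \<pi>) D"
      if D: "D \<in> tangent_space X p" for D
    proof -
      have "(tangent_map Y' \<pi>' \<circ> tangent_map Y f) D = tangent_map Y' (\<pi>' \<circ> f) D"
        using \<pi>Y tangent_map_compose[of Y Y' \<pi>' f D] by (simp add: etale_def)
      also have "\<dots> = tangent_map Y' (f' \<circ> \<pi>) D"
        by (rule tangent_map_cong[OF X D m(1)]) (simp add: eq)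
      also have "\<dots> = (tangent_map Y' f' \<circ> tangent_map X' \<pi>) D"
        by (simp add: tangent_map_compose[OF mf])
      finally show ?thesis .
    qed
    ultimately have "bij_betw (tangent_map Y' f' \<circ> tangent_map X' \<pi>) (tangent_space X p) (tangent_space Y' (\<pi>' (f p)))"
      by (metis (no_types, lifting) bij_betw_cong)
    moreover have "bij_betw (tangent_map X' \<pi>) (tangent_space X p) (tangent_space X' (\<pi> p))"
      using \<pi>X p by (auto simp: etale_def)
    ultimately show ?thesis using bij_betw_comp_iff eq[OF p] by metis
  qed
  then show ?thesis using mf surj by (auto simp: etale_def)
qed

text \<open>
  Universal closedness over the zero-dimensional affine space is closedness.
\<close>

lemma closed_map_of_proper:
  assumes X: "function_variety X" and Y: "function_variety Y" and f: "proper X Y f"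
  shows "closed_map X Y f"
proof -
  have pt: "points (affine_space 0) = {\<lambda>_. 0}" by (auto simp: affine_space_def)
  have mf: "morphism X Y f" using f by (simp add: proper_def)
  have cm: "closed_map (product_variety X (affine_space 0)) (product_variety Y (affine_space 0)) (map_prod f id)"
    using f by (simp add: proper_def)
  show ?thesis
    unfolding closed_map_def
  proof (intro allI impI)
    fix C assume "zariski_closed X C"
    then obtain F where F: "F \<subseteq> regular X" "C = {p \<in> points X. \<forall>f\<in>F. f p = 0}"
      by (auto simp: zariski_closed_def)
    have "zariski_closed (product_variety X (affine_space 0)) (C \<times> {\<lambda>_. 0})"
      unfolding zariski_closed_def
    proof (intro exI conjI)
      show "(\<lambda>f. f \<circ> fst) ` F \<subseteq> regular (product_variety X (affine_space 0))"
        using F(1) by (auto simp: product_variety_def intro!: generator_regular)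
      show "C \<times> {\<lambda>_. 0} = {p \<in> points (product_variety X (affine_space 0)). \<forall>f\<in>(\<lambda>f. f \<circ> fst) ` F. f p = 0}"
        using F(2) by (auto simp: product_variety_def pt)
    qed
    then have "zariski_closed (product_variety Y (affine_space 0)) (map_prod f id ` (C \<times> {\<lambda>_. 0}))"
      using cm by (simp add: closed_map_def)
    then obtain E where E: "E \<subseteq> regular (product_variety Y (affine_space 0))"
      "map_prod f id ` (C \<times> {\<lambda>_. 0}) = {p \<in> points (product_variety Y (affine_space 0)). \<forall>f\<in>E. f p = 0}"
      by (auto simp: zariski_closed_def)
    have slice: "(\<lambda>q. h (q, \<lambda>_. 0)) \<in> regular Y" if h: "h \<in> regular (product_variety Y (affine_space 0))" for h
    proof -
      obtain g where g: "g \<in> generated_algebra ((\<lambda>f. f \<circ> fst) ` regular Y \<union> (\<lambda>g. g \<circ> snd) ` regular (affine_space 0))"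
        "\<And>p. p \<in> points Y \<times> {\<lambda>_. 0} \<Longrightarrow> h p = g p"
        using h unfolding product_variety_def pt by (elim regular_generated_cases) blast
      have "(\<lambda>q. g (q, \<lambda>_. 0)) \<in> regular Y"
        using g(1) by induction (auto simp: comp_def intro: regular_intros[OF Y])
      then show ?thesis by (rule regular_cong[OF Y]) (simp add: g(2))
    qed
    show "zariski_closed Y (f ` C)"
      unfolding zariski_closed_def
    proof (intro exI conjI)
      show "(\<lambda>h q. h (q, \<lambda>_. 0)) ` E \<subseteq> regular Y" using E(1) slice by auto
      have "f ` C = {q. (q, \<lambda>_. 0) \<in> map_prod f id ` (C \<times> {\<lambda>_::nat. 0::complex})}" by force
      also have "\<dots> = {p \<in> points Y. \<forall>f\<in>(\<lambda>h q. h (q, \<lambda>_. 0)) ` E. f p = 0}"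
        unfolding E(2) by (auto simp: product_variety_def pt)
      finally show "f ` C = {p \<in> points Y. \<forall>f\<in>(\<lambda>h q. h (q, \<lambda>_. 0)) ` E. f p = 0}" .
    qed
  qed
qed

text \<open>
  A finite group acts, and \<open>l\<close> separates \<open>p\<close> from the rest of its
  orbit in a strong sense: the functions \<open>l\<close> and its translates behave like
  orthogonal idempotents modulo an invariant function \<open>j\<close> that vanishes on the
  orbit. This is what freeness of the action at \<open>p\<close> gives, in a form that avoids
  completions.
\<close>

locale free_action_at =
  fixes X :: "'a variety" and H :: "complex set" and act :: "complex \<Rightarrow> 'a \<Rightarrow> 'a"
    and p :: 'a and l j :: "'a \<Rightarrow> complex"
  assumes X: "function_variety X" and finite_H: "finite H" and one_H: "1 \<in> H"
    and translate: "\<And>e. e \<in> H \<Longrightarrow> bij_betw (\<lambda>e'. e' * e) H H"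
    and act_one: "\<And>q. q \<in> points X \<Longrightarrow> act 1 q = q"
    and act_mult: "\<And>e e' q. e \<in> H \<Longrightarrow> e' \<in> H \<Longrightarrow> q \<in> points X \<Longrightarrow> act (e * e') q = act e (act e' q)"
    and act_morphism: "\<And>e. e \<in> H \<Longrightarrow> morphism X X (act e)"
    and p: "p \<in> points X" and l: "l \<in> regular X" and j: "j \<in> regular X"
    and j_invariant: "\<And>e q. e \<in> H \<Longrightarrow> q \<in> points X \<Longrightarrow> j (act e q) = j q"
    and j_p: "j p = 0" and l_p: "l p = 1" and l_orbit: "\<And>e. e \<in> H \<Longrightarrow> e \<noteq> 1 \<Longrightarrow> l (act e p) = 0"
    and idem: "\<exists>m\<in>regular X. \<forall>q\<in>points X. l q * (l q - 1) = j q * m q"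
    and orth: "\<And>e. e \<in> H \<Longrightarrow> e \<noteq> 1 \<Longrightarrow> \<exists>m\<in>regular X. \<forall>q\<in>points X. l q * l (act e q) = j q * m q"
begin

abbreviation "Y \<equiv> quotient_variety X H act"

definition invariant :: "('a \<Rightarrow> complex) \<Rightarrow> bool" where
  "invariant b \<longleftrightarrow> b \<in> regular X \<and> (\<forall>e\<in>H. \<forall>q\<in>points X. b (act e q) = b q)"

definition descend :: "('a \<Rightarrow> complex) \<Rightarrow> 'a set \<Rightarrow> complex" where
  "descend b = (\<lambda>P. b (SOME q. q \<in> P))"

definition trace :: "('a \<Rightarrow> complex) \<Rightarrow> 'a \<Rightarrow> complex" where
  "trace f = (\<lambda>q. \<Sum>e\<in>H. f (act e q))"

text \<open>
  With \<open>l\<close> idempotent modulo \<open>j\<close>, the polynomial \<open>3 l\<^sup>2 -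
  2 l\<^sup>3\<close> is idempotent modulo \<open>j\<^sup>2\<close>. The next order is needed
  because derivations see functions modulo squares only.
\<close>

definition bump :: "'a \<Rightarrow> complex" where
  "bump = (\<lambda>q. l q * (l q * (3 - 2 * l q)))"

lemma Y: "function_variety Y" by (rule function_variety_quotient[OF X])

lemma act_point: "e \<in> H \<Longrightarrow> q \<in> points X \<Longrightarrow> act e q \<in> points X"
  using morphism_point[OF act_morphism] .

lemma act_regular: "e \<in> H \<Longrightarrow> f \<in> regular X \<Longrightarrow> (\<lambda>q. f (act e q)) \<in> regular X"
  using morphism_regular[OF act_morphism] .

lemma descend_orbit:
  assumes "invariant b" "q \<in> points X" shows "descend b (orbit H act q) = b q"
proof -
  have "act 1 q \<in> orbit H act q" using one_H by (auto simp: orbit_def)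
  then have "(SOME q'. q' \<in> orbit H act q) \<in> orbit H act q" by (rule someI)
  then show ?thesis using assms by (auto simp: descend_def orbit_def invariant_def)
qed

lemma descend_regular: "invariant b \<Longrightarrow> descend b \<in> regular Y"
  unfolding regular_quotient_iff
  by (rule regular_cong[OF X, of b]) (auto simp: invariant_def descend_orbit)

lemma invariant_orbit: 
  assumes "g \<in> regular Y" shows "invariant (\<lambda>q. g (orbit H act q))"
proof -
  have "orbit H act (act e q) = orbit H act q" if "e \<in> H" "q \<in> points X" for e q
  proof -
    have "orbit H act (act e q) = (\<lambda>e'. act (e' * e) q) ` H"
      using that act_mult by (auto simp: orbit_def)
    also have "\<dots> = (\<lambda>e'. act e' q) ` ((\<lambda>e'. e' * e) ` H)" by (simp add: image_image)
    finally show ?thesis using translate[OF that(1)] by (simp add: bij_betw_def orbit_def)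
  qed
  then show ?thesis using assms by (auto simp: invariant_def regular_quotient_iff)
qed

lemma trace_invariant:
  assumes "f \<in> regular X" shows "invariant (trace f)"
  unfolding invariant_def
proof (intro conjI ballI)
  show "trace f \<in> regular X" unfolding trace_def by (intro regular_sum[OF X] act_regular assms)
  fix e q assume e: "e \<in> H" and q: "q \<in> points X"
  have "trace f (act e q) = (\<Sum>e'\<in>H. f (act (e' * e) q))"
    unfolding trace_def using act_mult e q by (intro sum.cong) auto
  also have "\<dots> = trace f q" unfolding trace_def by (rule sum.reindex_bij_betw[OF translate[OF e]])
  finally show "trace f (act e q) = trace f q" .
qed

lemma invariant_mult: "invariant b \<Longrightarrow> invariant b' \<Longrightarrow> invariant (\<lambda>q. b q * b' q)"
  and invariant_add: "invariant b \<Longrightarrow> invariant b' \<Longrightarrow> invariant (\<lambda>q. b q + b' q)"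
  by (auto simp: invariant_def intro: regular_intros[OF X])

lemma bump: "bump \<in> regular X" unfolding bump_def by (intro regular_intros[OF X] l)

lemma bump_p: "bump p = 1" by (simp add: bump_def l_p)

lemma bump_orbit: "e \<in> H \<Longrightarrow> e \<noteq> 1 \<Longrightarrow> bump (act e p) = 0" by (simp add: bump_def l_orbit)

lemma trace_bump_p:
  "trace (\<lambda>q. bump q * f q) p = f p"
proof -
  have "trace (\<lambda>q. bump q * f q) p = (\<Sum>e\<in>H. if e = 1 then f p else 0)"
    unfolding trace_def by (intro sum.cong) (auto simp: bump_orbit bump_p act_one[OF p])
  then show ?thesis using finite_H one_H by simp
qed

context
  fixes D' assumes D': "D' \<in> tangent_space Y (orbit H act p)"
begin

definition "E b = D' (descend b)"

lemma E_cong: "invariant b \<Longrightarrow> invariant b' \<Longrightarrow> (\<And>q. q \<in> points X \<Longrightarrow> b q = b' q) \<Longrightarrow> E b = E b'"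
  unfolding E_def by (rule tangent_cong[OF D']) (auto simp: descend_regular descend_orbit)

lemma E_add: "invariant b \<Longrightarrow> invariant b' \<Longrightarrow> E (\<lambda>q. b q + b' q) = E b + E b'"
proof -
  assume b: "invariant b" "invariant b'"
  have "E (\<lambda>q. b q + b' q) = D' (\<lambda>P. descend b P + descend b' P)"
    unfolding E_def
    by (rule tangent_cong[OF D']) (auto simp: b descend_regular descend_orbit invariant_add intro!: regular_add[OF Y])
  then show ?thesis using tangent_add[OF D'] b descend_regular by (simp add: E_def)
qed

lemma E_mult: "invariant b \<Longrightarrow> invariant b' \<Longrightarrow> E (\<lambda>q. b q * b' q) = b p * E b' + b' p * E b"
proof -
  assume b: "invariant b" "invariant b'"
  have "E (\<lambda>q. b q * b' q) = D' (\<lambda>P. descend b P * descend b' P)"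
    unfolding E_def
    by (rule tangent_cong[OF D']) (auto simp: b descend_regular descend_orbit invariant_mult intro!: regular_mult[OF Y])
  then show ?thesis using tangent_mult[OF D'] b descend_regular descend_orbit[OF _ p] by (simp add: E_def)
qed

lemma E_scale: "invariant b \<Longrightarrow> E (\<lambda>q. c * b q) = c * E b"
proof -
  assume b: "invariant b"
  then have cb: "invariant (\<lambda>q. c * b q)" by (auto simp: invariant_def intro: regular_intros[OF X])
  have "E (\<lambda>q. c * b q) = D' (\<lambda>P. c * descend b P)"
    unfolding E_def
    by (rule tangent_cong[OF D']) (auto simp: b cb descend_regular descend_orbit intro!: regular_scale[OF Y])
  then show ?thesis using tangent_scale[OF D'] b descend_regular by (simp add: E_def)
qed

lemma E_zero: "E (\<lambda>q. 0) = 0"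
proof -
  have "invariant (\<lambda>q. 0)" by (auto simp: invariant_def intro: regular_intros[OF X])
  from E_add[OF this this] show ?thesis by simp
qed

lemma E_sum: "(\<And>i. i \<in> I \<Longrightarrow> invariant (b i)) \<Longrightarrow> E (\<lambda>q. \<Sum>i\<in>I. b i q) = (\<Sum>i\<in>I. E (b i))"
proof (induction I rule: infinite_finite_induct)
  case (insert i I)
  have "invariant (\<lambda>q. \<Sum>i\<in>I. b i q)"
    using insert by (auto simp: invariant_def intro: regular_sum[OF X])
  then show ?case using insert E_add[of "b i"] by simp
qed (simp_all add: E_zero)

text \<open>
  A multiple of \<open>j\<^sup>2\<close> is killed by a derivation at a zero of
  \<open>j\<close>.
\<close>

lemma E_trace_square:
  assumes m: "m \<in> regular X" and c: "c \<in> regular X" and eq: "\<And>q. q \<in> points X \<Longrightarrow> c q = j q * j q * m q"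
  shows "E (trace c) = 0"
proof -
  have ij: "invariant j" using j j_invariant by (auto simp: invariant_def)
  note im = trace_invariant[OF m]
  have "E (trace c) = E (\<lambda>q. j q * (j q * trace m q))"
  proof (rule E_cong)
    fix q assume q: "q \<in> points X"
    show "trace c q = j q * (j q * trace m q)"
      unfolding trace_def sum_distrib_left
      by (rule sum.cong) (auto simp: eq act_point q j_invariant)
  qed (intro trace_invariant[OF c] invariant_mult[OF ij invariant_mult[OF ij im]])+
  also have "\<dots> = 0" using E_mult[OF ij invariant_mult[OF ij im]] j_p by simp
  finally show ?thesis .
qed

definition "lift f = (if f \<in> regular X then E (trace (\<lambda>q. bump q * f q)) else 0)"

text \<open>
  Expanding the product of two traces as a sum over the group, only the diagonal term survives,
  since the translates of the bump are orthogonal modulo \<open>j\<^sup>2\<close>.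
\<close>

lemma lift_mult:
  assumes f: "f \<in> regular X" and g: "g \<in> regular X"
  shows "lift (\<lambda>q. f q * g q) = f p * lift g + g p * lift f"
proof -
  have bf: "(\<lambda>q. bump q * f q) \<in> regular X" and bg: "(\<lambda>q. bump q * g q) \<in> regular X"
    and fg: "(\<lambda>q. f q * g q) \<in> regular X"
    by (intro regular_intros[OF X] bump f g)+
  define c where "c d = (\<lambda>q. (bump q * f q) * (bump (act d q) * g (act d q)))" for d
  have c: "c d \<in> regular X" if "d \<in> H" for d
    unfolding c_def using act_regular[OF that bg] by (intro regular_mult[OF X bf]) simp
  have prod: "trace (\<lambda>q. bump q * f q) q * trace (\<lambda>q. bump q * g q) q = (\<Sum>d\<in>H. trace (c d) q)"
    if q: "q \<in> points X" for q
  proof -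
    have "(\<Sum>d\<in>H. trace (c d) q) = (\<Sum>e\<in>H. \<Sum>d\<in>H. c d (act e q))"
      unfolding trace_def by (rule sum.swap)
    also have "\<dots> = (\<Sum>e\<in>H. (bump (act e q) * f (act e q)) * trace (\<lambda>q. bump q * g q) q)"
    proof (rule sum.cong)
      fix e assume e: "e \<in> H"
      have "(\<Sum>d\<in>H. c d (act e q)) = (bump (act e q) * f (act e q)) * (\<Sum>d\<in>H. bump (act (d * e) q) * g (act (d * e) q))"
        unfolding c_def sum_distrib_left by (rule sum.cong) (auto simp: act_mult e q)
      also have "(\<Sum>d\<in>H. bump (act (d * e) q) * g (act (d * e) q)) = trace (\<lambda>q. bump q * g q) q"
        unfolding trace_def by (rule sum.reindex_bij_betw[OF translate[OF e]])
      finally show "(\<Sum>d\<in>H. c d (act e q)) = (bump (act e q) * f (act e q)) * trace (\<lambda>q. bump q * g q) q" .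
    qed simp
    finally show ?thesis by (simp add: trace_def sum_distrib_right)
  qed
  have off: "E (trace (c d)) = 0" if d: "d \<in> H" "d \<noteq> 1" for d
  proof -
    obtain m where m: "m \<in> regular X" "\<And>q. q \<in> points X \<Longrightarrow> l q * l (act d q) = j q * m q"
      using orth[OF d] by blast
    show ?thesis
    proof (rule E_trace_square[OF _ c[OF d(1)]])
      show "(\<lambda>q. m q * m q * ((3 - 2 * l q) * (3 - 2 * l (act d q)) * f q * g (act d q))) \<in> regular X"
        by (intro regular_intros[OF X] m l f act_regular[OF d(1)] g)
      fix q assume q: "q \<in> points X"
      have "c d q = (l q * l (act d q)) * (l q * l (act d q)) * ((3 - 2 * l q) * (3 - 2 * l (act d q)) * f q * g (act d q))"
        by (simp add: c_def bump_def algebra_simps)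
      then show "c d q = j q * j q * (m q * m q * ((3 - 2 * l q) * (3 - 2 * l (act d q)) * f q * g (act d q)))"
        by (simp add: m(2)[OF q] mult_ac)
    qed
  qed
  have on: "E (trace (c 1)) = lift (\<lambda>q. f q * g q)"
  proof -
    obtain m where m: "m \<in> regular X" "\<And>q. q \<in> points X \<Longrightarrow> l q * (l q - 1) = j q * m q"
      using idem by blast
    define c' where "c' = (\<lambda>q. (bump q * bump q - bump q) * (f q * g q))"
    have c': "c' \<in> regular X" unfolding c'_def by (intro regular_intros[OF X] bump f g)
    have bfg: "(\<lambda>q. bump q * (f q * g q)) \<in> regular X" by (intro regular_intros[OF X] bump f g)
    have "E (trace (c 1)) = E (\<lambda>q. trace c' q + trace (\<lambda>q. bump q * (f q * g q)) q)"
    proof (rule E_cong[OF trace_invariant[OF c[OF one_H]] invariant_add[OF trace_invariant[OF c'] trace_invariant[OF bfg]]])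
      fix q assume q: "q \<in> points X"
      show "trace (c 1) q = trace c' q + trace (\<lambda>q. bump q * (f q * g q)) q"
        unfolding trace_def sum.distrib[symmetric]
        by (rule sum.cong) (simp_all add: c_def c'_def act_one[OF act_point[OF _ q]] algebra_simps)
    qed
    also have "\<dots> = E (trace c') + E (trace (\<lambda>q. bump q * (f q * g q)))"
      by (rule E_add[OF trace_invariant[OF c'] trace_invariant[OF bfg]])
    also have "E (trace c') = 0"
    proof (rule E_trace_square[OF _ c'])
      show "(\<lambda>q. m q * m q * (- ((3 - 2 * l q) * (2 * l q + 1) * f q * g q))) \<in> regular X"
        by (intro regular_intros[OF X] m l f g)
      fix q assume q: "q \<in> points X"
      have "c' q = (l q * (l q - 1)) * (l q * (l q - 1)) * (- ((3 - 2 * l q) * (2 * l q + 1) * f q * g q))"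
        unfolding c'_def bump_def by (simp add: algebra_simps)
      then show "c' q = j q * j q * (m q * m q * (- ((3 - 2 * l q) * (2 * l q + 1) * f q * g q)))"
        by (simp add: m(2)[OF q] mult_ac)
    qed
    finally show ?thesis using fg by (simp add: lift_def)
  qed
  have "E (\<lambda>q. trace (\<lambda>q. bump q * f q) q * trace (\<lambda>q. bump q * g q) q) = E (\<lambda>q. \<Sum>d\<in>H. trace (c d) q)"
  proof (rule E_cong)
    show "invariant (\<lambda>q. \<Sum>d\<in>H. trace (c d) q)"
      using trace_invariant[OF c] by (auto simp: invariant_def intro!: regular_sum[OF X])
  qed (auto intro: invariant_mult trace_invariant bf bg prod)
  also have "\<dots> = (\<Sum>d\<in>H. E (trace (c d)))" by (rule E_sum[OF trace_invariant[OF c]])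
  also have "\<dots> = (\<Sum>d\<in>H. if d = 1 then lift (\<lambda>q. f q * g q) else 0)"
    using off on by (intro sum.cong) auto
  also have "\<dots> = lift (\<lambda>q. f q * g q)" using finite_H one_H by simp
  finally show ?thesis
    using E_mult[OF trace_invariant[OF bf] trace_invariant[OF bg]] f g by (simp add: trace_bump_p lift_def)
qed

lemma lift_add:
  assumes f: "f \<in> regular X" and g: "g \<in> regular X"
  shows "lift (\<lambda>q. f q + g q) = lift f + lift g"
proof -
  have bf: "(\<lambda>q. bump q * f q) \<in> regular X" and bg: "(\<lambda>q. bump q * g q) \<in> regular X"
    by (intro regular_intros[OF X] bump f g)+
  have "trace (\<lambda>q. bump q * (f q + g q)) = (\<lambda>q. trace (\<lambda>q. bump q * f q) q + trace (\<lambda>q. bump q * g q) q)"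
    by (simp add: trace_def fun_eq_iff distrib_left sum.distrib)
  then show ?thesis using E_add[OF trace_invariant[OF bf] trace_invariant[OF bg]] f g regular_add[OF X f g]
    by (simp add: lift_def)
qed

lemma lift_scale:
  assumes f: "f \<in> regular X" shows "lift (\<lambda>q. c * f q) = c * lift f"
proof -
  have bf: "(\<lambda>q. bump q * f q) \<in> regular X" by (intro regular_intros[OF X] bump f)
  have "trace (\<lambda>q. bump q * (c * f q)) = (\<lambda>q. c * trace (\<lambda>q. bump q * f q) q)"
    by (simp add: trace_def fun_eq_iff sum_distrib_left mult.left_commute)
  then show ?thesis using E_scale[OF trace_invariant[OF bf]] f regular_scale[OF X f] by (simp add: lift_def)
qed

lemma lift_tangent: "lift \<in> tangent_space X p"
  unfolding tangent_space_def
proof (intro CollectI conjI allI ballI impI)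
  fix f assume "f \<notin> regular X" then show "lift f = 0" by (simp add: lift_def)
next
  fix f g assume fg: "f \<in> regular X" "g \<in> regular X" "\<forall>q\<in>points X. f q = g q"
  have "E (trace (\<lambda>q. bump q * f q)) = E (trace (\<lambda>q. bump q * g q))"
  proof (rule E_cong)
    show "trace (\<lambda>q. bump q * f q) q = trace (\<lambda>q. bump q * g q) q" if "q \<in> points X" for q
      unfolding trace_def using fg(3) act_point[OF _ that] by (intro sum.cong) auto
  qed (intro trace_invariant regular_mult[OF X] bump fg(1,2))+
  then show "lift f = lift g" using fg by (simp add: lift_def)
qed (simp_all add: lift_mult lift_add lift_scale)

lemma lift_invariant:
  assumes b: "invariant b" shows "lift b = E b"
proof -
  have b': "b \<in> regular X" using b by (simp add: invariant_def)
  have one: "lift (\<lambda>_. 1) = 0"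
    using lift_mult[OF regular_const[OF X, of 1] regular_const[OF X, of 1]] by simp
  have "E (trace (\<lambda>q. bump q * b q)) = E (\<lambda>q. b q * trace bump q)"
  proof (rule E_cong)
    show "trace (\<lambda>q. bump q * b q) q = b q * trace bump q" if "q \<in> points X" for q
      unfolding trace_def sum_distrib_left using b that by (intro sum.cong) (auto simp: invariant_def)
  qed (auto intro!: trace_invariant regular_mult[OF X] bump b' invariant_mult b)
  also have "\<dots> = b p * E (trace bump) + trace bump p * E b"
    by (rule E_mult[OF b trace_invariant[OF bump]])
  also have "E (trace bump) = 0" using one regular_const[OF X, of 1] by (simp add: lift_def)
  also have "trace bump p = 1" using trace_bump_p[of "\<lambda>_. 1"] by simp
  finally show ?thesis using b' by (simp add: lift_def)
qed

lemma tangent_map_lift: "tangent_map Y (orbit H act) lift = D'"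
proof
  fix g
  show "tangent_map Y (orbit H act) lift g = D' g"
  proof (cases "g \<in> regular Y")
    case True
    then have "tangent_map Y (orbit H act) lift g = E (\<lambda>q. g (orbit H act q))"
      using lift_invariant[OF invariant_orbit] by (simp add: tangent_map_eq)
    also have "\<dots> = D' g"
      unfolding E_def
      by (rule tangent_cong[OF D' _ True]) (auto simp: descend_orbit invariant_orbit True descend_regular)
    finally show ?thesis .
  next
    case False
    then show ?thesis using tangent_outside[OF D'] by (simp add: tangent_map_def)
  qed
qed

end

lemma tangent_trace:
  assumes D: "D \<in> tangent_space X p" and f: "f \<in> regular X"
  shows "D (trace (\<lambda>q. bump q * f q)) = D f"
proof -
  have bf: "(\<lambda>q. bump q * f q) \<in> regular X" by (intro regular_intros[OF X] bump f)
  have "D bump = 0"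
    unfolding bump_def using l_p
    by (simp add: tangent_mult[OF D] tangent_diff[OF X D] tangent_scale[OF D] tangent_const[OF X D]
        regular_intros[OF X] l)
  then have on: "D (\<lambda>q. bump q * f q) = D f" using tangent_mult[OF D bump f] by (simp add: bump_p)
  have off: "D (\<lambda>q. bump (act e q) * f (act e q)) = 0" if e: "e \<in> H" "e \<noteq> 1" for e
  proof -
    define L where "L = (\<lambda>q. l (act e q))"
    define G where "G = (\<lambda>q. (3 - 2 * l (act e q)) * f (act e q))"
    have L: "L \<in> regular X" unfolding L_def by (rule act_regular[OF e(1) l])
    have G: "G \<in> regular X" unfolding G_def by (intro regular_intros[OF X] act_regular[OF e(1)] l f)
    have "(\<lambda>q. bump (act e q) * f (act e q)) = (\<lambda>q. L q * (L q * G q))"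
      by (simp add: bump_def L_def G_def fun_eq_iff mult_ac)
    moreover have "L p = 0" using l_orbit[OF e] by (simp add: L_def)
    ultimately show ?thesis using tangent_mult[OF D L regular_mult[OF X L G]] by simp
  qed
  have "D (trace (\<lambda>q. bump q * f q)) = (\<Sum>e\<in>H. D (\<lambda>q. bump (act e q) * f (act e q)))"
    unfolding trace_def using act_regular[OF _ bf] by (intro tangent_sum[OF X D]) simp
  also have "\<dots> = (\<Sum>e\<in>H. if e = 1 then D f else 0)"
  proof (rule sum.cong)
    fix e assume e: "e \<in> H"
    show "D (\<lambda>q. bump (act e q) * f (act e q)) = (if e = 1 then D f else 0)"
    proof (cases "e = 1")
      case True
      have "D (\<lambda>q. bump (act e q) * f (act e q)) = D (\<lambda>q. bump q * f q)"
        by (rule tangent_cong[OF D _ bf]) (use act_regular[OF e bf] True act_one in auto)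
      then show ?thesis using on True by simp
    qed (use off e in auto)
  qed simp
  also have "\<dots> = D f" using finite_H one_H by simp
  finally show ?thesis .
qed

text \<open>
  Tangent vectors of the quotient lift: evaluate them at the trace of \<open>bump * f\<close>,
  an invariant function that agrees with \<open>f\<close> near \<open>p\<close>. The same trace
  shows that a tangent vector is determined by its values on invariant functions.
\<close>

theorem quotient_tangent_bij:
  "bij_betw (tangent_map Y (orbit H act)) (tangent_space X p) (tangent_space Y (orbit H act p))"
  unfolding bij_betw_def
proof
  show "inj_on (tangent_map Y (orbit H act)) (tangent_space X p)"
  proof (rule inj_onI)
    fix D D' assume D: "D \<in> tangent_space X p" "D' \<in> tangent_space X p"
      and eq: "tangent_map Y (orbit H act) D = tangent_map Y (orbit H act) D'"
    have inv: "D b = tangent_map Y (orbit H act) D (descend b)" if b: "invariant b" and D: "D \<in> tangent_space X p" for b D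
    proof -
      have "(\<lambda>q. descend b (orbit H act q)) \<in> regular X"
        using descend_regular[OF b] by (simp add: regular_quotient_iff)
      then have "D b = D (\<lambda>q. descend b (orbit H act q))"
        using b by (intro tangent_cong[OF D]) (auto simp: invariant_def descend_orbit)
      then show ?thesis by (simp add: tangent_map_eq descend_regular[OF b])
    qed
    show "D = D'"
    proof (rule tangent_ext[OF D])
      fix f assume f: "f \<in> regular X"
      then have i: "invariant (trace (\<lambda>q. bump q * f q))"
        by (intro trace_invariant regular_mult[OF X] bump)
      show "D f = D' f" using inv[OF i D(1)] inv[OF i D(2)] eq tangent_trace[OF D(1) f] tangent_trace[OF D(2) f] by simp
    qed
  qed
  show "tangent_map Y (orbit H act) ` tangent_space X p = tangent_space Y (orbit H act p)"
  proof (rule subset_antisym)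
    show "tangent_map Y (orbit H act) ` tangent_space X p \<subseteq> tangent_space Y (orbit H act p)"
      using tangent_map_in[OF Y morphism_quotient p] by blast
    show "tangent_space Y (orbit H act p) \<subseteq> tangent_map Y (orbit H act) ` tangent_space X p"
    proof
      fix D' assume D': "D' \<in> tangent_space Y (orbit H act p)"
      show "D' \<in> tangent_map Y (orbit H act) ` tangent_space X p"
        using tangent_map_lift[OF D', symmetric] lift_tangent[OF D'] by (rule image_eqI[where x = "lift D'"])
    qed
  qed
qed

end

section \<open>The surface \<open>x\<^sup>r y = z\<^sup>k - 1\<close>\<close>

definition coord_x :: "point3 \<Rightarrow> complex" where "coord_x p = fst p"
definition coord_y :: "point3 \<Rightarrow> complex" where "coord_y p = fst (snd p)"
definition coord_z :: "point3 \<Rightarrow> complex" where "coord_z p = snd (snd p)"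

lemma coord_simps [simp]: "coord_x (x, y, z) = x" "coord_y (x, y, z) = y" "coord_z (x, y, z) = z"
  by (simp_all add: coord_x_def coord_y_def coord_z_def)

lemma S_tilde_eq: "S_tilde k r = generated_variety {(x, y, z). x ^ r * y = z ^ k - 1} {coord_x, coord_y, coord_z}"
proof -
  have "(\<lambda>(x, y, z). x) = coord_x" "(\<lambda>(x, y, z). y) = coord_y" "(\<lambda>(x, y, z). z) = coord_z" by auto
  then show ?thesis by (simp add: S_tilde_def)
qed

lemma points_S_tilde: "points (S_tilde k r) = {(x, y, z). x ^ r * y = z ^ k - 1}"
  by (simp add: S_tilde_eq)

lemma in_S_tilde [simp]: "(x, y, z) \<in> points (S_tilde k r) \<longleftrightarrow> x ^ r * y = z ^ k - 1"
  by (simp add: points_S_tilde)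

lemma in_S_tilde_coord: "p \<in> points (S_tilde k r) \<longleftrightarrow> coord_x p ^ r * coord_y p = coord_z p ^ k - 1"
  by (cases p) simp

lemma S_tilde: "function_variety (S_tilde k r)"
  by (simp add: S_tilde_eq function_variety_generated)

lemma coord_regular: "coord_x \<in> regular (S_tilde k r)" "coord_y \<in> regular (S_tilde k r)" "coord_z \<in> regular (S_tilde k r)"
  by (simp_all add: S_tilde_eq generator_regular)

lemma regular_S_tilde_induct [consumes 1, case_names cong x y z const add mult]:
  assumes f: "f \<in> regular (S_tilde k r)"
    and cong: "\<And>f g. (\<And>p. p \<in> points (S_tilde k r) \<Longrightarrow> f p = g p) \<Longrightarrow> g \<in> regular (S_tilde k r) \<Longrightarrow> P g \<Longrightarrow> P f"
    and "P coord_x" "P coord_y" "P coord_z" "\<And>c. P (\<lambda>_. c)"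
    and "\<And>f g. f \<in> regular (S_tilde k r) \<Longrightarrow> g \<in> regular (S_tilde k r) \<Longrightarrow> P f \<Longrightarrow> P g \<Longrightarrow> P (\<lambda>p. f p + g p)"
    and "\<And>f g. f \<in> regular (S_tilde k r) \<Longrightarrow> g \<in> regular (S_tilde k r) \<Longrightarrow> P f \<Longrightarrow> P g \<Longrightarrow> P (\<lambda>p. f p * g p)"
  shows "P f"
proof -
  obtain g where g: "g \<in> generated_algebra {coord_x, coord_y, coord_z}"
    and eq: "\<And>p. p \<in> points (S_tilde k r) \<Longrightarrow> f p = g p"
    using f by (auto simp: S_tilde_eq generated_variety_def)
  have "g \<in> regular (S_tilde k r) \<and> P g"
    using g by induction (use assms(3-) coord_regular regular_intros[OF S_tilde] in auto)
  then show ?thesis using cong eq by blast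
qed

lemma morphism_to_S_tilde:
  assumes X: "function_variety X" and pt: "\<And>p. p \<in> points X \<Longrightarrow> \<phi> p \<in> points (S_tilde k r)"
    and c: "(\<lambda>p. coord_x (\<phi> p)) \<in> regular X" "(\<lambda>p. coord_y (\<phi> p)) \<in> regular X" "(\<lambda>p. coord_z (\<phi> p)) \<in> regular X"
  shows "morphism X (S_tilde k r) \<phi>"
proof (rule morphismI[OF pt])
  fix g assume "g \<in> regular (S_tilde k r)"
  then show "(\<lambda>p. g (\<phi> p)) \<in> regular X"
  proof (induction rule: regular_S_tilde_induct)
    case (cong f g)
    show ?case by (rule regular_cong[OF X cong(3)]) (simp add: cong(1) pt)
  qed (intro c regular_intros[OF X]; assumption)+
qed

lemma tangent_S_tilde_unique:
  assumes D: "D \<in> tangent_space (S_tilde k r) p" and D': "D' \<in> tangent_space (S_tilde k r) p"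
    and eq: "D coord_x = D' coord_x" "D coord_y = D' coord_y" "D coord_z = D' coord_z"
  shows "D = D'"
proof (rule tangent_ext[OF D D'])
  fix f assume "f \<in> regular (S_tilde k r)"
  then have "f \<in> regular (S_tilde k r) \<and> D f = D' f"
  proof (induction rule: regular_S_tilde_induct)
    case (cong f g)
    then have "f \<in> regular (S_tilde k r)" by (metis regular_cong[OF S_tilde])
    then show ?case using cong tangent_cong[OF D, of f g] tangent_cong[OF D', of f g] by simp
  qed (auto simp: eq coord_regular tangent_const[OF S_tilde D] tangent_const[OF S_tilde D']
      tangent_add[OF D] tangent_add[OF D'] tangent_mult[OF D] tangent_mult[OF D'] intro: regular_intros[OF S_tilde])
  then show "D f = D' f" by simp
qed

lemma tangent_S_tilde_relation:
  assumes D: "D \<in> tangent_space (S_tilde k r) (x, y, z)"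
  shows "of_nat r * x ^ (r - 1) * y * D coord_x + x ^ r * D coord_y = of_nat k * z ^ (k - 1) * D coord_z"
proof -
  let ?S = "S_tilde k r"
  note ri = regular_intros[OF S_tilde] coord_regular
  have "D (\<lambda>p. coord_x p ^ r * coord_y p) = D (\<lambda>p. coord_z p ^ k - 1)"
    by (rule tangent_cong[OF D]) (auto intro!: ri simp: in_S_tilde_coord)
  moreover have "D (\<lambda>p. coord_x p ^ r * coord_y p) = of_nat r * x ^ (r - 1) * y * D coord_x + x ^ r * D coord_y"
    using tangent_mult[OF D regular_power[OF S_tilde coord_regular(1), of r] coord_regular(2)]
      tangent_power[OF S_tilde D coord_regular(1), of r] by (simp add: algebra_simps)
  moreover have "D (\<lambda>p. coord_z p ^ k - 1) = of_nat k * z ^ (k - 1) * D coord_z"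
    using tangent_diff[OF S_tilde D regular_power[OF S_tilde coord_regular(3), of k] regular_const[OF S_tilde, of 1]]
      tangent_power[OF S_tilde D coord_regular(3), of k] tangent_const[OF S_tilde D] by simp
  ultimately show ?thesis by simp
qed

text \<open>
  A curve with prescribed derivative. Where \<open>x\<close> does not vanish one solves for
  \<open>y\<close>. Where it does, a perturbation of \<open>z\<close> of order \<open>r\<close>
  makes \<open>z\<^sup>k - 1\<close> divisible by the power of \<open>x\<close>, and its leading
  coefficient controls \<open>y\<close>.
\<close>

lemma S_tilde_curve:
  assumes k: "0 < k" and r: "2 \<le> r" and p: "x ^ r * y = z ^ k - 1"
    and rel: "of_nat r * x ^ (r - 1) * y * \<alpha> + x ^ r * \<beta> = of_nat k * z ^ (k - 1) * \<gamma>"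
  shows "\<exists>Y Z. Y 0 = y \<and> Z 0 = z \<and> (\<forall>\<^sub>F s in nhds 0. (x + \<alpha> * s) ^ r * Y s = Z s ^ k - 1) \<and>
    (Y has_field_derivative \<beta>) (at 0) \<and> (Z has_field_derivative \<gamma>) (at (0::complex))"
proof (cases "x = 0")
  case False
  define Z where "Z s = z + \<gamma> * s" for s
  define Y where "Y s = (Z s ^ k - 1) / (x + \<alpha> * s) ^ r" for s
  have xr: "x ^ r = x ^ (r - 1) * x" using r by (cases r) auto
  have zk: "z ^ k - 1 = x ^ r * y" using p by simp
  have "((\<lambda>s. x + \<alpha> * s) \<longlongrightarrow> x + \<alpha> * 0) (nhds 0)" by (intro tendsto_intros filterlim_ident)
  then have ev: "\<forall>\<^sub>F s in nhds 0. x + \<alpha> * s \<noteq> 0" using False by (intro tendsto_imp_eventually_ne) auto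
  have "(Z has_field_derivative \<gamma>) (at 0)" unfolding Z_def by (auto intro!: derivative_eq_intros)
  moreover have "(Y has_field_derivative \<beta>) (at 0)"
  proof -
    have "(Y has_field_derivative ((of_nat k * z ^ (k - 1) * \<gamma>) * x ^ r - (z ^ k - 1) * (of_nat r * x ^ (r - 1) * \<alpha>)) / (x ^ r * x ^ r)) (at 0)"
      unfolding Y_def Z_def using False by (auto intro!: derivative_eq_intros)
    moreover have "((of_nat k * z ^ (k - 1) * \<gamma>) * x ^ r - (z ^ k - 1) * (of_nat r * x ^ (r - 1) * \<alpha>)) / (x ^ r * x ^ r) = \<beta>"
      unfolding rel[symmetric] zk using False by (simp add: field_simps)
    ultimately show ?thesis by simp
  qed
  moreover have "\<forall>\<^sub>F s in nhds 0. (x + \<alpha> * s) ^ r * Y s = Z s ^ k - 1"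
    using ev by eventually_elim (simp add: Y_def)
  moreover have "Y 0 = y" "Z 0 = z" using False p by (simp_all add: Y_def Z_def field_simps)
  ultimately show ?thesis by blast
next
  case True
  have zk: "z ^ k = 1" using p r True by (simp add: power_0_left)
  then have z: "z \<noteq> 0" using k by (auto simp: power_0_left)
  have \<gamma>: "\<gamma> = 0" using rel True r k z by (simp add: power_0_left)
  show ?thesis
  proof (cases "\<alpha> = 0")
    case a: True
    have "((\<lambda>s. y + \<beta> * s) has_field_derivative \<beta>) (at 0)" by (auto intro!: derivative_eq_intros)
    then show ?thesis using True a zk r \<gamma>
      by (intro exI[of _ "\<lambda>s. y + \<beta> * s"] exI[of _ "\<lambda>_. z"]) (auto simp: power_0_left)
  next
    case a: False
    define m where "m = of_nat k * z ^ (k - 1)"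
    have m: "m \<noteq> 0" using k z by (simp add: m_def)
    define w where "w s = \<alpha> ^ r * (y + \<beta> * s) / m" for s
    define Z where "Z s = z + s ^ r * w s" for s
    define S where "S s = (\<Sum>i<k. z ^ (k - Suc i) * Z s ^ i)" for s
    define Y where "Y s = w s * S s / \<alpha> ^ r" for s
    have dw: "(w has_field_derivative \<alpha> ^ r * \<beta> / m) (at 0)"
      unfolding w_def using m by (auto intro!: derivative_eq_intros)
    have dZ: "(Z has_field_derivative 0) (at 0)"
      unfolding Z_def using r by (auto intro!: derivative_eq_intros dw simp: power_0_left)
    have Z0: "Z 0 = z" using r by (simp add: Z_def power_0_left)
    have "(S has_field_derivative (\<Sum>i<k. 0)) (at 0)"
      unfolding S_def by (auto intro!: derivative_eq_intros dZ)
    then have dS: "(S has_field_derivative 0) (at 0)" by simp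
    have S0: "S 0 = m"
    proof -
      have "S 0 = (\<Sum>i<k. z ^ (k - 1))"
        unfolding S_def Z0 by (intro sum.cong) (auto simp flip: power_add)
      then show ?thesis by (simp add: m_def)
    qed
    have "(Y has_field_derivative \<beta>) (at 0)"
      unfolding Y_def using a m by (auto intro!: derivative_eq_intros dw dS simp: S0)
    moreover have "Y 0 = y" using a m by (simp add: Y_def S0 w_def)
    moreover have "(x + \<alpha> * s) ^ r * Y s = Z s ^ k - 1" for s
    proof -
      have "Z s ^ k - 1 = (Z s - z) * S s"
        unfolding S_def zk[symmetric] by (rule power_diff_sumr2)
      then show ?thesis using a True by (simp add: Y_def Z_def power_mult_distrib)
    qed
    ultimately show ?thesis using Z0 dZ \<gamma> by (intro exI[of _ Y] exI[of _ Z]) simp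
  qed
qed

lemma regular_along_curve:
  assumes f: "f \<in> regular (S_tilde k r)"
    and c: "\<forall>\<^sub>F s in nhds (0::complex). (X s, Y s, Z s) \<in> points (S_tilde k r)"
    and d: "(X has_field_derivative \<alpha>) (at 0)" "(Y has_field_derivative \<beta>) (at 0)" "(Z has_field_derivative \<gamma>) (at 0)"
  shows "\<exists>d. ((\<lambda>s. f (X s, Y s, Z s)) has_field_derivative d) (at 0)"
  using f
proof (induction rule: regular_S_tilde_induct)
  case (cong f g)
  have "\<forall>\<^sub>F s in nhds 0. f (X s, Y s, Z s) = g (X s, Y s, Z s)"
    using c by eventually_elim (simp add: cong(1))
  then have "((\<lambda>s. f (X s, Y s, Z s)) has_field_derivative d) (at 0) =
    ((\<lambda>s. g (X s, Y s, Z s)) has_field_derivative d) (at 0)" for d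
    by (intro DERIV_cong_ev refl)
  then show ?case using cong(3) by simp
next
  case (mult f g)
  then obtain a b where "((\<lambda>s. f (X s, Y s, Z s)) has_field_derivative a) (at 0)"
    "((\<lambda>s. g (X s, Y s, Z s)) has_field_derivative b) (at 0)" by blast
  from DERIV_mult[OF this] show ?case by (rule exI)
next
  case (add f g)
  then obtain a b where "((\<lambda>s. f (X s, Y s, Z s)) has_field_derivative a) (at 0)"
    "((\<lambda>s. g (X s, Y s, Z s)) has_field_derivative b) (at 0)" by blast
  from DERIV_add[OF this] show ?case by (rule exI)
qed (use d in \<open>auto intro: DERIV_const\<close>)

text \<open>
  Differentiation along a differentiable curve through the point is a point derivation.
\<close>

lemma tangent_S_tilde_exists:
  assumes k: "0 < k" and r: "2 \<le> r" and p: "x ^ r * y = z ^ k - 1"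
    and rel: "of_nat r * x ^ (r - 1) * y * \<alpha> + x ^ r * \<beta> = of_nat k * z ^ (k - 1) * \<gamma>"
  shows "\<exists>D\<in>tangent_space (S_tilde k r) (x, y, z). D coord_x = \<alpha> \<and> D coord_y = \<beta> \<and> D coord_z = \<gamma>"
proof -
  obtain Y Z where Y: "Y 0 = y" "(Y has_field_derivative \<beta>) (at 0)" and Z: "Z 0 = z" "(Z has_field_derivative \<gamma>) (at 0)"
    and ev: "\<forall>\<^sub>F s in nhds 0. (x + \<alpha> * s) ^ r * Y s = Z s ^ k - 1"
    using S_tilde_curve[OF k r p rel] by blast
  have X: "((\<lambda>s. x + \<alpha> * s) has_field_derivative \<alpha>) (at 0)" by (auto intro!: derivative_eq_intros)
  define c where "c s = (x + \<alpha> * s, Y s, Z s)" for s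
  have ev': "\<forall>\<^sub>F s in nhds 0. (x + \<alpha> * s, Y s, Z s) \<in> points (S_tilde k r)" using ev by simp
  have c0: "c 0 = (x, y, z)" by (simp add: c_def Y Z)
  define D where "D f = (if f \<in> regular (S_tilde k r) then deriv (\<lambda>s. f (c s)) 0 else 0)" for f
  have D: "((\<lambda>s. f (c s)) has_field_derivative D f) (at 0)" if f: "f \<in> regular (S_tilde k r)" for f
    using regular_along_curve[OF f ev' X Y(2) Z(2)] f DERIV_imp_deriv by (auto simp: D_def c_def)
  have D_eq: "D f = d" if "f \<in> regular (S_tilde k r)" "((\<lambda>s. f (c s)) has_field_derivative d) (at 0)" for f d
    using that D DERIV_unique by blast
  have "D \<in> tangent_space (S_tilde k r) (x, y, z)"
    unfolding tangent_space_def
  proof (intro CollectI conjI allI ballI impI)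
    fix f assume "f \<notin> regular (S_tilde k r)" then show "D f = 0" by (simp add: D_def)
  next
    fix f g assume f: "f \<in> regular (S_tilde k r)" and g: "g \<in> regular (S_tilde k r)"
    show "D (\<lambda>q. f q + g q) = D f + D g"
      by (rule D_eq[OF regular_add[OF S_tilde f g] DERIV_add[OF D[OF f] D[OF g]]])
    show "D (\<lambda>q. f q * g q) = f (x, y, z) * D g + g (x, y, z) * D f"
      using D_eq[OF regular_mult[OF S_tilde f g] DERIV_mult[OF D[OF f] D[OF g]]] by (simp add: c0 algebra_simps)
    assume eq: "\<forall>q\<in>points (S_tilde k r). f q = g q"
    have "\<forall>\<^sub>F s in nhds 0. f (c s) = g (c s)"
      using ev' by eventually_elim (use eq in \<open>simp add: c_def\<close>)
    then have "((\<lambda>s. f (c s)) has_field_derivative D g) (at 0)"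
      using D[OF g] DERIV_cong_ev[of 0 0 "\<lambda>s. f (c s)" "\<lambda>s. g (c s)" "D g" "D g"] by simp
    then show "D f = D g" by (rule D_eq[OF f])
  next
    fix a f assume f: "f \<in> regular (S_tilde k r)"
    show "D (\<lambda>q. a * f q) = a * D f" by (rule D_eq[OF regular_scale[OF S_tilde f] DERIV_cmult[OF D[OF f]]])
  qed
  moreover have "D coord_x = \<alpha>" "D coord_y = \<beta>" "D coord_z = \<gamma>"
    using X Y Z by (auto intro!: D_eq coord_regular simp: c_def)
  ultimately show ?thesis by blast
qed

text \<open>
  The points with \<open>x = 0\<close> are limits of points with \<open>x \<noteq> 0\<close>,
  along curves that move in the direction of \<open>x\<close>.
\<close>

lemma regular_zero_by_density:
  assumes k: "0 < k" and r: "2 \<le> r" and f: "f \<in> regular (S_tilde k r)"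
    and zero: "\<And>x y z. (x, y, z) \<in> points (S_tilde k r) \<Longrightarrow> x \<noteq> 0 \<Longrightarrow> f (x, y, z) = 0"
    and p: "p \<in> points (S_tilde k r)"
  shows "f p = 0"
proof -
  obtain x y z where xyz: "p = (x, y, z)" by (cases p)
  show ?thesis
  proof (cases "x = 0")
    case False
    then show ?thesis using zero p xyz by simp
  next
    case True
    have rel: "of_nat r * x ^ (r - 1) * y * 1 + x ^ r * 0 = of_nat k * z ^ (k - 1) * 0"
      using True r by (simp add: power_0_left)
    have q: "x ^ r * y = z ^ k - 1" using p xyz by simp
    obtain Y Z where Y: "Y 0 = y" "(Y has_field_derivative 0) (at 0)" and Z: "Z 0 = z" "(Z has_field_derivative 0) (at 0)"
      and ev: "\<forall>\<^sub>F s in nhds 0. (x + 1 * s) ^ r * Y s = Z s ^ k - 1"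
      using S_tilde_curve[OF k r q rel] by blast
    have X: "((\<lambda>s. x + 1 * s) has_field_derivative 1) (at 0)" by (auto intro!: derivative_eq_intros)
    have ev': "\<forall>\<^sub>F s in nhds 0. (x + 1 * s, Y s, Z s) \<in> points (S_tilde k r)" using ev by simp
    obtain d where "((\<lambda>s. f (x + 1 * s, Y s, Z s)) has_field_derivative d) (at 0)"
      using regular_along_curve[OF f ev' X Y(2) Z(2)] by blast
    then have "isCont (\<lambda>s. f (x + 1 * s, Y s, Z s)) 0" by (rule DERIV_isCont)
    then have "((\<lambda>s. f (x + 1 * s, Y s, Z s)) \<longlongrightarrow> f p) (at 0)" by (simp add: isCont_def Y Z xyz)
    moreover have "\<forall>\<^sub>F s in at 0. f (x + 1 * s, Y s, Z s) = 0"
    proof -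
      have "\<forall>\<^sub>F s in at 0. (x + 1 * s, Y s, Z s) \<in> points (S_tilde k r) \<and> s \<noteq> 0"
        using ev' by (simp add: eventually_at_filter eventually_mono)
      then show ?thesis by eventually_elim (use zero True in auto)
    qed
    then have "((\<lambda>s. f (x + 1 * s, Y s, Z s)) \<longlongrightarrow> 0) (at 0)" by (rule tendsto_eventually)
    ultimately show ?thesis using tendsto_unique[of "at (0::complex)"] by auto
  qed
qed

text \<open>
  On the chart \<open>x \<noteq> 0\<close> the surface is the graph of \<open>y = (z\<^sup>k -
  1) / x\<^sup>r\<close>, so regular functions are Laurent polynomials in \<open>x\<close> over
  the polynomials in \<open>z\<close>.
\<close>

lemma regular_on_chart:
  assumes "f \<in> regular (S_tilde k r)"
  shows "\<exists>N B. \<forall>x z. x \<noteq> 0 \<longrightarrow> x ^ N * f (x, (z ^ k - 1) / x ^ r, z) = poly (poly B [:x:]) z"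
  using assms
proof (induction rule: regular_S_tilde_induct)
  case (cong f g)
  then obtain N B where "\<And>x z. x \<noteq> 0 \<Longrightarrow> x ^ N * g (x, (z ^ k - 1) / x ^ r, z) = poly (poly B [:x:]) z" by blast
  moreover have "f (x, (z ^ k - 1) / x ^ r, z) = g (x, (z ^ k - 1) / x ^ r, z)" if "x \<noteq> 0" for x z
    using that by (intro cong(1)) simp
  ultimately show ?case by (intro exI[of _ N] exI[of _ B]) simp
next
  case x
  show ?case by (intro exI[of _ 0] exI[of _ "[:0, 1:]"]) simp
next
  case y
  show ?case by (intro exI[of _ r] exI[of _ "[:monom 1 k - 1:]"]) (simp add: poly_monom)
next
  case z
  show ?case by (intro exI[of _ 0] exI[of _ "[:[:0, 1:]:]"]) simp
next
  case (const c)
  show ?case by (intro exI[of _ 0] exI[of _ "[:[:c:]:]"]) simp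
next
  case (add f g)
  then obtain N B M C where
    f: "\<And>x z. x \<noteq> 0 \<Longrightarrow> x ^ N * f (x, (z ^ k - 1) / x ^ r, z) = poly (poly B [:x:]) z"
    and g: "\<And>x z. x \<noteq> 0 \<Longrightarrow> x ^ M * g (x, (z ^ k - 1) / x ^ r, z) = poly (poly C [:x:]) z" by blast
  have "x ^ (N + M) * (f (x, (z ^ k - 1) / x ^ r, z) + g (x, (z ^ k - 1) / x ^ r, z))
    = poly (poly (monom 1 M * B + monom 1 N * C) [:x:]) z" if "x \<noteq> 0" for x z
    using f[OF that, of z, symmetric] g[OF that, of z, symmetric]
    by (simp add: poly_monom power_add algebra_simps)
  then show ?case by blast
next
  case (mult f g)
  then obtain N B M C where
    f: "\<And>x z. x \<noteq> 0 \<Longrightarrow> x ^ N * f (x, (z ^ k - 1) / x ^ r, z) = poly (poly B [:x:]) z"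
    and g: "\<And>x z. x \<noteq> 0 \<Longrightarrow> x ^ M * g (x, (z ^ k - 1) / x ^ r, z) = poly (poly C [:x:]) z" by blast
  have "x ^ (N + M) * (f (x, (z ^ k - 1) / x ^ r, z) * g (x, (z ^ k - 1) / x ^ r, z))
    = poly (poly (B * C) [:x:]) z" if "x \<noteq> 0" for x z
    using f[OF that, of z, symmetric] g[OF that, of z, symmetric]
    by (simp add: power_add algebra_simps)
  then show ?case by blast
qed

lemma bivariate_along_line: "\<exists>P. \<forall>s. poly P s = poly (poly B [:poly u s:]) (poly v s)"
  for B :: "complex poly poly"
proof (induction B)
  case 0
  show ?case by (intro exI[of _ 0]) simp
next
  case (pCons b B)
  then obtain P where P: "\<And>s. poly P s = poly (poly B [:poly u s:]) (poly v s)" by blast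
  show ?case by (intro exI[of _ "pcompose b v + u * P"]) (simp add: poly_pcompose P)
qed

text \<open>
  The surface is irreducible: its dense chart \<open>x \<noteq> 0\<close> is an open subset of
  the plane, where the product of two nonzero polynomials does not vanish identically.
\<close>

theorem S_tilde_domain:
  assumes k: "0 < k" and r: "2 \<le> r" and f: "f \<in> regular (S_tilde k r)" and g: "g \<in> regular (S_tilde k r)"
    and p: "p \<in> points (S_tilde k r)" "f p \<noteq> 0" and q: "q \<in> points (S_tilde k r)" "g q \<noteq> 0"
  shows "\<exists>p\<in>points (S_tilde k r). coord_x p \<noteq> 0 \<and> f p \<noteq> 0 \<and> g p \<noteq> 0"
proof -
  obtain x0 y0 z0 where 0: "x0 ^ r * y0 = z0 ^ k - 1" "x0 \<noteq> 0" "f (x0, y0, z0) \<noteq> 0"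
    using regular_zero_by_density[OF k r f _ p(1)] p(2) by auto
  obtain x1 y1 z1 where 1: "x1 ^ r * y1 = z1 ^ k - 1" "x1 \<noteq> 0" "g (x1, y1, z1) \<noteq> 0"
    using regular_zero_by_density[OF k r g _ q(1)] q(2) by auto
  define u where "u = [:x0, x1 - x0:]"
  define v where "v = [:z0, z1 - z0:]"
  obtain N B where B: "\<And>x z. x \<noteq> 0 \<Longrightarrow> x ^ N * f (x, (z ^ k - 1) / x ^ r, z) = poly (poly B [:x:]) z"
    using regular_on_chart[OF f] by blast
  obtain M C where C: "\<And>x z. x \<noteq> 0 \<Longrightarrow> x ^ M * g (x, (z ^ k - 1) / x ^ r, z) = poly (poly C [:x:]) z"
    using regular_on_chart[OF g] by blast
  obtain P where P: "\<And>s. poly P s = poly (poly B [:poly u s:]) (poly v s)" using bivariate_along_line by blast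
  obtain Q where Q: "\<And>s. poly Q s = poly (poly C [:poly u s:]) (poly v s)" using bivariate_along_line by blast
  have y: "y0 = (z0 ^ k - 1) / x0 ^ r" "y1 = (z1 ^ k - 1) / x1 ^ r" using 0 1 by (simp_all add: field_simps)
  have "poly P 0 = x0 ^ N * f (x0, y0, z0)" using B[OF 0(2), of z0] y by (simp add: P u_def v_def)
  then have "P \<noteq> 0" using 0 by auto
  have "poly Q 1 = x1 ^ M * g (x1, y1, z1)" using C[OF 1(2), of z1] y by (simp add: Q u_def v_def)
  then have "Q \<noteq> 0" using 1 by auto
  have "u \<noteq> 0" using 0 by (simp add: u_def)
  then have "P * Q * u \<noteq> 0" using \<open>P \<noteq> 0\<close> \<open>Q \<noteq> 0\<close> by simp
  then have "finite {s. poly (P * Q * u) s = 0}" by (rule poly_roots_finite)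
  then obtain s where s: "poly (P * Q * u) s \<noteq> 0" using infinite_UNIV_char_0 by (metis (mono_tags, lifting) ex_new_if_finite mem_Collect_eq)
  define x z where "x = poly u s" and "z = poly v s"
  have x: "x \<noteq> 0" using s by (simp add: x_def)
  have "f (x, (z ^ k - 1) / x ^ r, z) \<noteq> 0" using B[OF x, of z] s by (auto simp: P x_def z_def)
  moreover have "g (x, (z ^ k - 1) / x ^ r, z) \<noteq> 0" using C[OF x, of z] s by (auto simp: Q x_def z_def)
  ultimately show ?thesis using x by (intro bexI[of _ "(x, (z ^ k - 1) / x ^ r, z)"]) auto
qed

section \<open>Quotients of the surface and lifted endomorphisms\<close>

lemma root_action_eq: "root_action r a e (x, y, z) = (e * x, inverse (e ^ r) * y, inverse (e ^ a) * z)"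
  by (simp add: root_action_def power_int_minus)

lemma torus_action_eq: "torus_action r l (x, y, z) = (l * x, inverse (l ^ r) * y, z)"
  by (simp add: torus_action_def power_int_minus)

lemma coord_root_action [simp]:
  "coord_x (root_action r a e p) = e * coord_x p" "coord_y (root_action r a e p) = inverse (e ^ r) * coord_y p"
  "coord_z (root_action r a e p) = inverse (e ^ a) * coord_z p"
  by (cases p; simp add: root_action_eq)+

lemma coord_torus_action [simp]:
  "coord_x (torus_action r l p) = l * coord_x p" "coord_y (torus_action r l p) = inverse (l ^ r) * coord_y p"
  "coord_z (torus_action r l p) = coord_z p"
  by (cases p; simp add: torus_action_eq)+

lemma point3_eqI: "coord_x p = coord_x q \<Longrightarrow> coord_y p = coord_y q \<Longrightarrow> coord_z p = coord_z q \<Longrightarrow> p = q"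
  by (cases p; cases q) simp

lemma root_torus_commute: "root_action r a e (torus_action r l p) = torus_action r l (root_action r a e p)"
  by (rule point3_eqI) simp_all

lemma torus_point: "l \<noteq> 0 \<Longrightarrow> p \<in> points (S_tilde k r) \<Longrightarrow> torus_action r l p \<in> points (S_tilde k r)"
  by (simp add: in_S_tilde_coord power_mult_distrib field_simps)

lemma unity_coprime:
  fixes e :: complex
  assumes "e ^ a = 1" "e ^ k = 1" "coprime a k"
  shows "e = 1"
proof (cases "a = 0")
  case True
  then show ?thesis using assms by simp
next
  case False
  then obtain x y where "a * x = k * y + gcd a k" using bezout_nat by blast
  then have "a * x = Suc (k * y)" using assms by simp
  then have "(e ^ a) ^ x = e * (e ^ k) ^ y" by (simp flip: power_mult)
  then show ?thesis using assms by simp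
qed

text \<open>
  Modulo the torus the chart \<open>x \<noteq> 0\<close> is the \<open>z\<close>-line, with the
  slice \<open>x = 1\<close>. A function of weight \<open>n\<close> is therefore
  \<open>x\<^sup>n\<close> times a polynomial in \<open>z\<close>; this reduces all questions on
  equivariant maps to polynomials in one variable.
\<close>

lemma weight_function:
  assumes k: "0 < k" and r: "2 \<le> r" and f: "f \<in> regular (S_tilde k r)"
    and w: "\<And>l p. l \<noteq> 0 \<Longrightarrow> p \<in> points (S_tilde k r) \<Longrightarrow> f (torus_action r l p) = l ^ n * f p"
  shows "\<exists>q. \<forall>p\<in>points (S_tilde k r). f p = coord_x p ^ n * poly q (coord_z p)"
proof -
  have "\<exists>q. \<forall>z. f (1, z ^ k - 1, z) = poly q z"
    using f
  proof (induction rule: regular_S_tilde_induct)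
    case (cong f g)
    then show ?case by (metis in_S_tilde mult_1 power_one)
  next
    case x
    show ?case by (intro exI[of _ 1]) simp
  next
    case y
    show ?case by (intro exI[of _ "monom 1 k - 1"]) (simp add: poly_monom)
  next
    case z
    show ?case by (intro exI[of _ "[:0, 1:]"]) simp
  next
    case (const c)
    show ?case by (intro exI[of _ "[:c:]"]) simp
  next
    case (add f g)
    then show ?case by (metis poly_add)
  next
    case (mult f g)
    then show ?case by (metis poly_mult)
  qed
  then obtain q where q: "\<And>z. f (1, z ^ k - 1, z) = poly q z" by blast
  have h: "(\<lambda>p. f p - coord_x p ^ n * poly q (coord_z p)) \<in> regular (S_tilde k r)"
    by (intro regular_intros[OF S_tilde] f coord_regular)
  have "f p - coord_x p ^ n * poly q (coord_z p) = 0" if "p \<in> points (S_tilde k r)" for p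
  proof (rule regular_zero_by_density[OF k r h _ that])
    fix x y z assume p: "(x, y, z) \<in> points (S_tilde k r)" and x: "x \<noteq> 0"
    have "(x, y, z) = torus_action r x (1, z ^ k - 1, z)" using p x by (simp add: torus_action_eq field_simps)
    then have "f (x, y, z) = x ^ n * poly q z" using w[OF x, of "(1, z ^ k - 1, z)"] by (simp add: q)
    then show "f (x, y, z) - coord_x (x, y, z) ^ n * poly q (coord_z (x, y, z)) = 0" by simp
  qed
  then show ?thesis by auto
qed

text \<open>
  The quotient by the group of \<open>h\<close>-th roots of unity. These are all subgroups of
  the group of \<open>k\<close>-th roots, so the locale covers the pseudo-plane itself (\<open>h
  = k\<close>) and all its finite covers.
\<close>

locale surface_quotient =
  fixes k r a h :: nat
  assumes k2: "2 \<le> k" and r2: "2 \<le> r" and coprime_ak: "coprime a k" and h0: "0 < h"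
    and H_sub: "\<And>e::complex. e ^ h = 1 \<Longrightarrow> e ^ k = 1"
begin

definition H :: "complex set" where "H = {e. e ^ h = 1}"

abbreviation "S \<equiv> S_tilde k r"
abbreviation "act \<equiv> root_action r a"
abbreviation "\<pi> \<equiv> orbit H act"
abbreviation "Sq \<equiv> S_tilde_quotient k r a H"

lemma Sq_eq: "Sq = quotient_variety S H act" by (simp add: S_tilde_quotient_def)

lemma Sq: "function_variety Sq" unfolding Sq_eq by (rule function_variety_quotient[OF S_tilde])

lemma points_Sq: "points Sq = \<pi> ` points S" by (simp add: Sq_eq)

lemma regular_Sq: "f \<in> regular Sq \<longleftrightarrow> (\<lambda>p. f (\<pi> p)) \<in> regular S" by (simp add: Sq_eq regular_quotient_iff)

lemma k0: "0 < k" using k2 by simp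

lemma H_pow_h: "e \<in> H \<Longrightarrow> e ^ h = 1" by (simp add: H_def)
lemma H_pow_k: "e \<in> H \<Longrightarrow> e ^ k = 1" using H_sub by (simp add: H_def)
lemma H_nonzero: "e \<in> H \<Longrightarrow> e \<noteq> 0" using h0 by (auto simp: H_def power_0_left)
lemma H_one: "1 \<in> H" by (simp add: H_def)
lemma H_mult: "e \<in> H \<Longrightarrow> e' \<in> H \<Longrightarrow> e * e' \<in> H" by (simp add: H_def power_mult_distrib)
lemma H_inverse: "e \<in> H \<Longrightarrow> inverse e \<in> H" by (simp add: H_def power_inverse)

lemma finite_H: "finite H"
proof -
  have "card H > 0" using card_unity_roots[OF h0] h0 by (simp add: H_def)
  then show ?thesis by (simp add: card_gt_0_iff)
qed

lemma H_translate: "e \<in> H \<Longrightarrow> bij_betw (\<lambda>e'. e' * e) H H"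
  by (rule bij_betw_byWitness[where f' = "\<lambda>e'. e' * inverse e"])
    (auto simp: H_nonzero H_mult H_inverse)

lemma act_point:
  assumes e: "e \<in> H" and p: "p \<in> points S" shows "act e p \<in> points S"
proof -
  have "(e ^ a) ^ k = (e ^ k) ^ a" by (simp flip: power_mult add: mult.commute)
  then have "(inverse (e ^ a) * coord_z p) ^ k = coord_z p ^ k"
    using H_pow_k[OF e] by (simp add: power_mult_distrib power_inverse)
  moreover have "(e * coord_x p) ^ r * (inverse (e ^ r) * coord_y p) = coord_x p ^ r * coord_y p"
    using H_nonzero[OF e] by (simp add: power_mult_distrib)
  ultimately show ?thesis using p unfolding in_S_tilde_coord coord_root_action by metis
qed

lemma act_mult: "act (e * e') p = act e (act e' p)"
  by (rule point3_eqI) (simp_all add: power_mult_distrib mult_ac)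

lemma act_one: "act 1 p = p"
  by (rule point3_eqI) simp_all

lemma act_morphism: "e \<in> H \<Longrightarrow> morphism S S (act e)"
  by (rule morphism_to_S_tilde[OF S_tilde act_point]) (auto intro!: regular_intros[OF S_tilde] coord_regular)

lemma orbit_act: "e \<in> H \<Longrightarrow> \<pi> (act e p) = \<pi> p"
proof -
  assume e: "e \<in> H"
  have "\<pi> (act e p) = (\<lambda>e'. act e' p) ` ((\<lambda>e'. e' * e) ` H)" by (simp add: orbit_def image_image act_mult)
  then show ?thesis using H_translate[OF e] by (simp add: bij_betw_def orbit_def)
qed

lemma in_orbit: "p \<in> \<pi> p"
  using H_one act_one[of p] by (force simp: orbit_def)

lemma orbit_eq_iff: "\<pi> p = \<pi> q \<longleftrightarrow> (\<exists>e\<in>H. q = act e p)"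
proof
  assume "\<pi> p = \<pi> q"
  then have "q \<in> \<pi> p" using in_orbit[of q] by simp
  then show "\<exists>e\<in>H. q = act e p" by (auto simp: orbit_def)
qed (auto simp: orbit_act)

text \<open>
  If a function that does not vanish at \<open>p\<close> transforms by a faithful character, its
  values separate the orbit of \<open>p\<close>, and the Lagrange polynomial of these values
  gives the function \<open>l\<close> required for free actions.
\<close>

lemma free_action_from_character:
  assumes p: "p \<in> points S" and t: "t \<in> regular S" "t p \<noteq> 0"
    and \<xi>: "\<And>e q. e \<in> H \<Longrightarrow> t (act e q) = \<xi> e * t q" "\<And>e. e \<in> H \<Longrightarrow> \<xi> e ^ h = 1"
      "\<And>e. e \<in> H \<Longrightarrow> e \<noteq> 1 \<Longrightarrow> \<xi> e \<noteq> 1"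
  shows "bij_betw (tangent_map Sq \<pi>) (tangent_space S p) (tangent_space Sq (\<pi> p))"
proof -
  define c where "c = t p"
  define W where "W = {w. w ^ h = c ^ h}"
  have c: "c \<noteq> 0" using t by (simp add: c_def)
  have "card W > 0" using card_nth_roots[of "c ^ h" h] c h0 by (simp add: W_def)
  then have W: "finite W" "c \<in> W" by (simp_all add: card_gt_0_iff W_def)
  (* the values of t on the orbit are among the numbers w with w^h = c^h *)
  define L0 where "L0 = (\<Prod>w\<in>W - {c}. [:- w, 1:])"
  have L0c: "poly L0 c \<noteq> 0" using W by (auto simp: L0_def poly_prod)
  define L where "L = smult (inverse (poly L0 c)) L0"
  have Lc: "poly L c = 1" using L0c by (simp add: L_def)
  have Lw: "poly L w = 0" if "w ^ h = c ^ h" "w \<noteq> c" for w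
    using that W by (auto simp: L_def L0_def poly_prod W_def intro!: prod_zero)
  define l where "l q = poly L (t q)" for q
  define j where "j q = t q ^ h - c ^ h" for q
  have div: "\<exists>m. \<forall>x. poly q x = (x ^ h - c ^ h) * poly m x" if "\<And>w. w ^ h = c ^ h \<Longrightarrow> poly q w = 0" for q
  proof -
    have "monom 1 h - [:c ^ h:] dvd q" using that c h0 by (intro unity_poly_dvd) auto
    then obtain m where "q = (monom 1 h - [:c ^ h:]) * m" by blast
    then show ?thesis by (intro exI[of _ m]) (simp add: poly_monom)
  qed
  have "free_action_at S H act p l j"
  proof
    show "function_variety S" by (rule S_tilde)
    show "l \<in> regular S" "j \<in> regular S" unfolding l_def[abs_def] j_def[abs_def]
      by (intro regular_intros[OF S_tilde] t)+
    fix e q assume e: "e \<in> H"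
    show "j (act e q) = j q" by (simp add: j_def \<xi>(1,2)[OF e] power_mult_distrib)
  next
    fix e assume e: "e \<in> H" "e \<noteq> 1"
    have "(\<xi> e * c) ^ h = c ^ h" "\<xi> e * c \<noteq> c" using \<xi> e c by (auto simp: power_mult_distrib)
    then show "l (act e p) = 0" by (simp add: l_def \<xi>(1)[OF e(1)] Lw flip: c_def)
    have "poly (L * pcompose L [:0, \<xi> e:]) w = 0" if w: "w ^ h = c ^ h" for w
    proof (cases "w = c")
      case True
      then show ?thesis using Lw[of "\<xi> e * c"] \<open>(\<xi> e * c) ^ h = c ^ h\<close> \<open>\<xi> e * c \<noteq> c\<close>
        by (simp add: poly_pcompose mult.commute)
    qed (simp add: Lw[OF w])
    from div[OF this] obtain m where m: "\<And>x. poly L x * poly L (x * \<xi> e) = (x ^ h - c ^ h) * poly m x"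
      by (auto simp: poly_pcompose)
    show "\<exists>m\<in>regular S. \<forall>q\<in>points S. l q * l (act e q) = j q * m q"
    proof (intro bexI ballI)
      show "(\<lambda>q. poly m (t q)) \<in> regular S" by (intro regular_poly[OF S_tilde] t)
      fix q show "l q * l (act e q) = j q * poly m (t q)"
        using m[of "t q"] by (simp add: l_def j_def \<xi>(1)[OF e(1)] mult.commute)
    qed
  next
    have "poly (L * (L - 1)) w = 0" if w: "w ^ h = c ^ h" for w
      using Lw[OF w] Lc by (cases "w = c") simp_all
    from div[OF this] obtain m where m: "\<And>x. poly L x * (poly L x - 1) = (x ^ h - c ^ h) * poly m x" by auto
    show "\<exists>m\<in>regular S. \<forall>q\<in>points S. l q * (l q - 1) = j q * m q"
    proof (intro bexI ballI)
      show "(\<lambda>q. poly m (t q)) \<in> regular S" by (intro regular_poly[OF S_tilde] t)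
      fix q show "l q * (l q - 1) = j q * poly m (t q)" using m[of "t q"] by (simp add: l_def j_def)
    qed
  qed (auto simp: finite_H H_one H_translate act_one act_mult act_morphism p l_def j_def Lc simp flip: c_def)
  from free_action_at.quotient_tangent_bij[OF this] show ?thesis by (simp add: Sq_eq)
qed

text \<open>
  Where \<open>x\<close> does not vanish the group acts faithfully on its values. At the other
  points \<open>z\<close> is a root of unity, and the action on \<open>z\<close> is faithful
  because \<open>a\<close> is coprime to \<open>k\<close>.
\<close>

lemma cover_etale: "etale S Sq \<pi>"
  unfolding etale_def
proof (intro conjI ballI)
  show "morphism S Sq \<pi>" unfolding Sq_eq by (rule morphism_quotient)
  fix p assume p: "p \<in> points S"
  show "bij_betw (tangent_map Sq \<pi>) (tangent_space S p) (tangent_space Sq (\<pi> p))"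
  proof (cases "coord_x p = 0")
    case False
    show ?thesis
      by (rule free_action_from_character[OF p coord_regular(1) False, where \<xi> = "\<lambda>e. e"]) (auto simp: H_def)
  next
    case True
    then have "coord_z p ^ k = 1" using p r2 by (simp add: in_S_tilde_coord power_0_left)
    then have z: "coord_z p \<noteq> 0" using k0 by (auto simp: power_0_left)
    show ?thesis
    proof (rule free_action_from_character[OF p coord_regular(3) z, where \<xi> = "\<lambda>e. inverse (e ^ a)"])
      fix e assume e: "e \<in> H"
      have "(e ^ a) ^ h = (e ^ h) ^ a" by (simp flip: power_mult add: mult.commute)
      then show "inverse (e ^ a) ^ h = 1" using H_pow_h[OF e] by (simp add: power_inverse)
      assume "e \<noteq> 1"
      then show "inverse (e ^ a) \<noteq> 1" using unity_coprime[OF _ H_pow_k[OF e] coprime_ak] by auto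
    qed simp
  qed
qed

lemma induced_torus_orbit: "induced_torus_action r l (\<pi> p) = \<pi> (torus_action r l p)"
  by (auto simp: induced_torus_action_def induced_action_def orbit_def root_torus_commute image_iff)

definition descend_map :: "(point3 \<Rightarrow> point3) \<Rightarrow> point3 set \<Rightarrow> point3 set" where
  "descend_map f P = (\<Union>p\<in>P. \<pi> (f p))"

lemma descend_map_orbit:
  assumes "p \<in> points S" "\<And>e. e \<in> H \<Longrightarrow> \<pi> (f (act e p)) = \<pi> (f p)"
  shows "descend_map f (\<pi> p) = \<pi> (f p)"
  using assms(2) H_one by (auto simp: descend_map_def orbit_def[of H act p])

lemma descend_map_equivariant_etale:
  assumes f: "etale S S f" and inv: "\<And>e p. e \<in> H \<Longrightarrow> p \<in> points S \<Longrightarrow> \<pi> (f (act e p)) = \<pi> (f p)"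
    and eq: "\<And>l p. l \<noteq> 0 \<Longrightarrow> p \<in> points S \<Longrightarrow> f (torus_action r l p) = torus_action r l (f p)"
  shows "equivariant_etale_endo Sq (induced_torus_action r) (descend_map f)"
  unfolding equivariant_etale_endo_def
proof
  have d: "descend_map f (\<pi> p) = \<pi> (f p)" if "p \<in> points S" for p
    by (rule descend_map_orbit[OF that]) (rule inv[OF _ that])
  show "etale Sq Sq (descend_map f)"
    by (rule etale_descends[OF S_tilde cover_etale cover_etale f points_Sq]) (simp_all add: regular_Sq d)
  show "equivariant Sq (induced_torus_action r) (induced_torus_action r) (descend_map f)"
    unfolding equivariant_def points_Sq
    by (auto simp: induced_torus_orbit d eq torus_point)
qed

end

definition lift_map :: "complex poly \<Rightarrow> complex poly \<Rightarrow> complex poly \<Rightarrow> point3 \<Rightarrow> point3" where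
  "lift_map A B Q = (\<lambda>(x, y, z). (x * poly A z, y * poly B z, poly Q z))"

lemma coord_lift_map [simp]:
  "coord_x (lift_map A B Q p) = coord_x p * poly A (coord_z p)"
  "coord_y (lift_map A B Q p) = coord_y p * poly B (coord_z p)"
  "coord_z (lift_map A B Q p) = poly Q (coord_z p)"
  by (cases p; simp add: lift_map_def)+

lemma lift_map_torus: "lift_map A B Q (torus_action r l p) = torus_action r l (lift_map A B Q p)"
  by (rule point3_eqI) simp_all

lemma lift_data_eval:
  assumes "lift_data k r A B Q" shows "poly A z ^ r * poly B z * (z ^ k - 1) = poly Q z ^ k - 1"
proof -
  have "poly (A ^ r * B * (monom 1 k - 1)) z = poly (Q ^ k - 1) z"
    using assms by (simp only: lift_data_def)
  then show ?thesis by (simp add: poly_monom)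
qed

text \<open>
  The last identity is the derivative of \<open>A\<^sup>r B (z\<^sup>k - 1) = Q\<^sup>k -
  1\<close>, divided by \<open>A\<^bsup>r-1\<^esup>\<close>.
\<close>

lemma lift_data_derivative:
  assumes k: "0 < k" and r: "2 \<le> r" and d: "lift_data k r A B Q" and Q: "0 < degree Q"
  obtains c where "c \<noteq> 0" "\<And>z. poly (pderiv Q) z = c * poly A z ^ (r - 1)"
    "\<And>z. of_nat r * poly (pderiv A) z * (poly B z * (z ^ k - 1)) +
       poly A z * (poly (pderiv B) z * (z ^ k - 1) + poly B z * (of_nat k * z ^ (k - 1))) =
       of_nat k * c * poly Q z ^ (k - 1)"
proof -
  obtain c where c: "c \<noteq> 0" "pderiv Q = smult c (A ^ (r - 1))" and rel: "A ^ r * B * (monom 1 k - 1) = Q ^ k - 1"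
    using d by (auto simp: lift_data_def)
  obtain k' where k': "k = Suc k'" using k by (cases k) auto
  have A: "A \<noteq> 0"
  proof
    assume "A = 0"
    then have "pderiv Q = 0" using c r by (simp add: power_0_left)
    then show False using Q by (simp add: pderiv_eq_0_iff)
  qed
  have "pderiv (A ^ r * (B * (monom 1 k - 1))) = pderiv (Q ^ k - 1)" using rel by (simp add: mult.assoc)
  moreover have "pderiv (A ^ r * (B * (monom 1 k - 1))) = A ^ (r - 1) * twisted_derivative r A (B * (monom 1 k - 1))"
    using r by (intro pderiv_power_mult) simp
  moreover have "pderiv (Q ^ k - 1) = A ^ (r - 1) * smult (of_nat k * c) (Q ^ (k - 1))"
    unfolding pderiv_diff k' pderiv_power_Suc c(2) by (simp add: mult.commute)
  ultimately have "A ^ (r - 1) * twisted_derivative r A (B * (monom 1 k - 1)) =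
    A ^ (r - 1) * smult (of_nat k * c) (Q ^ (k - 1))" by metis
  then have "twisted_derivative r A (B * (monom 1 k - 1)) = smult (of_nat k * c) (Q ^ (k - 1))"
    using mult_left_cancel[of "A ^ (r - 1)"] A by (metis power_not_zero)
  then have tw: "poly (twisted_derivative r A (B * (monom 1 k - 1))) z = of_nat k * c * poly Q z ^ (k - 1)" for z
    by simp
  show thesis
  proof (rule that[OF c(1)])
    show "poly (pderiv Q) z = c * poly A z ^ (r - 1)" for z by (simp add: c(2))
    show "of_nat r * poly (pderiv A) z * (poly B z * (z ^ k - 1)) +
       poly A z * (poly (pderiv B) z * (z ^ k - 1) + poly B z * (of_nat k * z ^ (k - 1))) =
       of_nat k * c * poly Q z ^ (k - 1)" for z
      unfolding tw[symmetric]
      by (simp add: twisted_derivative_def pderiv_mult pderiv_diff pderiv_monom poly_monom algebra_simps)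
  qed
qed

text \<open>
  Surjectivity of the tangent map of the lifted endomorphism, as linear algebra: the unknowns
  are the derivatives of the three coordinates. The point is delicate where \<open>A\<close>
  vanishes, since there \<open>z\<close> is not moved to first order; the derivative identity
  then makes \<open>A'\<close>, \<open>B\<close>, \<open>x\<close> and \<open>y\<close> nonzero.
\<close>

lemma lift_tangent_solve:
  fixes x y z A A' B B' q c w :: complex
  assumes k: "0 < k" and r: "2 \<le> r"
    and c: "c \<noteq> 0" and w: "x ^ r * y = w" and R0: "A ^ r * B * w = q ^ k - 1"
    and R3: "of_nat r * A' * (B * w) + A * (B' * w + B * (of_nat k * z ^ (k - 1))) = of_nat k * c * q ^ (k - 1)"
    and T2: "of_nat r * (x * A) ^ (r - 1) * (y * B) * \<alpha>2 + (x * A) ^ r * \<beta>2 = of_nat k * q ^ (k - 1) * \<gamma>2"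
  shows "\<exists>\<alpha> \<beta> \<gamma>. of_nat r * x ^ (r - 1) * y * \<alpha> + x ^ r * \<beta> = of_nat k * z ^ (k - 1) * \<gamma> \<and>
    A * \<alpha> + x * A' * \<gamma> = \<alpha>2 \<and> B * \<beta> + y * B' * \<gamma> = \<beta>2 \<and> c * A ^ (r - 1) * \<gamma> = \<gamma>2"
proof -
  obtain s where s: "r = Suc (Suc s)" using r by (metis add_2_eq_Suc le_Suc_ex)
  have q0: "q ^ k = 1 \<Longrightarrow> q \<noteq> 0" using k by (auto simp: power_0_left)
  show ?thesis
  proof (cases "A = 0")
    case A: True
    then have "q ^ k = 1" using R0 s by simp
    then have qn: "q \<noteq> 0" by (rule q0)
    (* the derivative identity, at a zero of A *)
    have nz: "of_nat r * A' * (B * w) \<noteq> 0" using R3 A c qn k by simp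
    then have nz': "A' \<noteq> 0" "B \<noteq> 0" "w \<noteq> 0" by auto
    then have xy: "x \<noteq> 0" "y \<noteq> 0" using w s by auto
    have g2: "\<gamma>2 = 0" using T2 A qn k s by simp
    define \<gamma> where "\<gamma> = \<alpha>2 / (x * A')"
    define \<beta> where "\<beta> = (\<beta>2 - y * B' * \<gamma>) / B"
    define \<alpha> where "\<alpha> = (of_nat k * z ^ (k - 1) * \<gamma> - x ^ r * \<beta>) / (of_nat r * x ^ (r - 1) * y)"
    have "of_nat r * x ^ (r - 1) * y \<noteq> 0" using xy r by simp
    then have "of_nat r * x ^ (r - 1) * y * \<alpha> = of_nat k * z ^ (k - 1) * \<gamma> - x ^ r * \<beta>"
      unfolding \<alpha>_def by simp
    moreover have "x * A' * \<gamma> = \<alpha>2" using xy nz' by (simp add: \<gamma>_def)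
    moreover have "B * \<beta> + y * B' * \<gamma> = \<beta>2" using nz' by (simp add: \<beta>_def)
    ultimately show ?thesis using A g2 s
      by (intro exI[of _ \<alpha>] exI[of _ \<beta>] exI[of _ \<gamma>]) simp
  next
    case A: False
    define \<gamma> where "\<gamma> = \<gamma>2 / (c * A ^ (r - 1))"
    define \<alpha> where "\<alpha> = (\<alpha>2 - x * A' * \<gamma>) / A"
    have g: "c * A ^ (r - 1) * \<gamma> = \<gamma>2" using A c by (simp add: \<gamma>_def)
    have al: "A * \<alpha> + x * A' * \<gamma> = \<alpha>2" using A by (simp add: \<alpha>_def)
    have R1: "of_nat k * q ^ (k - 1) * \<gamma>2 =
      A ^ (r - 1) * (of_nat r * A' * (B * w) + A * (B' * w + B * (of_nat k * z ^ (k - 1)))) * \<gamma>"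
      unfolding R3 g[symmetric] by simp
    show ?thesis
    proof (cases "B = 0")
      case False
      define \<beta> where "\<beta> = (\<beta>2 - y * B' * \<gamma>) / B"
      have be: "B * \<beta> + y * B' * \<gamma> = \<beta>2" using False by (simp add: \<beta>_def)
      have "A ^ r * B * (of_nat r * x ^ (r - 1) * y * \<alpha> + x ^ r * \<beta> - of_nat k * z ^ (k - 1) * \<gamma>) = 0"
        using T2[unfolded R1] unfolding al[symmetric] be[symmetric] w[symmetric] s
        by (simp add: power_mult_distrib algebra_simps)
      then have "of_nat r * x ^ (r - 1) * y * \<alpha> + x ^ r * \<beta> = of_nat k * z ^ (k - 1) * \<gamma>" using A False by simp
      then show ?thesis using al be g by blast
    next
      case B: True
      then have "q ^ k = 1" using R0 by simp
      then have qn: "q \<noteq> 0" by (rule q0)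
      have "A * (B' * w) \<noteq> 0" using R3 B c qn k by simp
      then have xy: "x \<noteq> 0" "y \<noteq> 0" using w s by auto
      define \<beta> where "\<beta> = (of_nat k * z ^ (k - 1) * \<gamma> - of_nat r * x ^ (r - 1) * y * \<alpha>) / x ^ r"
      have "x ^ r * \<beta> = of_nat k * z ^ (k - 1) * \<gamma> - of_nat r * x ^ (r - 1) * y * \<alpha>"
        using xy by (simp add: \<beta>_def)
      moreover have "y * B' * \<gamma> = \<beta>2"
      proof -
        have "x ^ r * A ^ r * (\<beta>2 - y * B' * \<gamma>) = 0"
          using T2[unfolded R1] B unfolding w[symmetric] s by (simp add: power_mult_distrib algebra_simps)
        then show ?thesis using xy A by simp
      qed
      ultimately show ?thesis using al g B by (intro exI[of _ \<alpha>] exI[of _ \<beta>] exI[of _ \<gamma>]) simp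
    qed
  qed
qed

text \<open>
  The counterpart of \<open>lift_tangent_solve\<close> for injectivity.
\<close>

lemma lift_tangent_injective:
  fixes x y z A A' B B' q c w :: complex
  assumes k: "0 < k" and r: "2 \<le> r"
    and c: "c \<noteq> 0" and w: "x ^ r * y = w" and R0: "A ^ r * B * w = q ^ k - 1"
    and R3: "of_nat r * A' * (B * w) + A * (B' * w + B * (of_nat k * z ^ (k - 1))) = of_nat k * c * q ^ (k - 1)"
    and T: "of_nat r * x ^ (r - 1) * y * \<alpha> + x ^ r * \<beta> = of_nat k * z ^ (k - 1) * \<gamma>"
    and zero: "A * \<alpha> + x * A' * \<gamma> = 0" "B * \<beta> + y * B' * \<gamma> = 0" "c * A ^ (r - 1) * \<gamma> = 0"
  shows "\<alpha> = 0 \<and> \<beta> = 0 \<and> \<gamma> = 0"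
proof -
  obtain s where s: "r = Suc (Suc s)" using r by (metis add_2_eq_Suc le_Suc_ex)
  have q0: "q ^ k = 1 \<Longrightarrow> q \<noteq> 0" using k by (auto simp: power_0_left)
  show ?thesis
  proof (cases "A = 0")
    case A: True
    then have "q ^ k = 1" using R0 s by simp
    then have qn: "q \<noteq> 0" by (rule q0)
    have nz: "of_nat r * A' * (B * w) \<noteq> 0" using R3 A c qn k by simp
    then have nz': "A' \<noteq> 0" "B \<noteq> 0" "w \<noteq> 0" by auto
    then have xy: "x \<noteq> 0" "y \<noteq> 0" using w s by auto
    then have "\<gamma> = 0" "\<beta> = 0" using zero A nz' by simp_all
    moreover have "\<alpha> = 0" using T xy r \<open>\<gamma> = 0\<close> \<open>\<beta> = 0\<close> by simp
    ultimately show ?thesis by simp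
  next
    case A: False
    then have g: "\<gamma> = 0" "\<alpha> = 0" using zero c by simp_all
    show ?thesis
    proof (cases "B = 0")
      case False
      then show ?thesis using zero g by simp
    next
      case B: True
      then have "q ^ k = 1" using R0 by simp
      then have qn: "q \<noteq> 0" by (rule q0)
      have "A * (B' * w) \<noteq> 0" using R3 B c qn k by simp
      then have "x \<noteq> 0" using w s by auto
      then show ?thesis using T g by simp
    qed
  qed
qed

theorem lift_map_etale:
  assumes k: "0 < k" and r: "2 \<le> r" and d: "lift_data k r A B Q" and Q: "0 < degree Q"
  shows "etale (S_tilde k r) (S_tilde k r) (lift_map A B Q)"
proof -
  let ?S = "S_tilde k r" and ?f = "lift_map A B Q"
  obtain c where c: "c \<noteq> 0" and R2: "\<And>z. poly (pderiv Q) z = c * poly A z ^ (r - 1)" and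
    R3: "\<And>z. of_nat r * poly (pderiv A) z * (poly B z * (z ^ k - 1)) +
       poly A z * (poly (pderiv B) z * (z ^ k - 1) + poly B z * (of_nat k * z ^ (k - 1))) =
       of_nat k * c * poly Q z ^ (k - 1)" using lift_data_derivative[OF k r d Q] by blast
  note R0 = lift_data_eval[OF d]
  have pt: "?f p \<in> points ?S" if "p \<in> points ?S" for p
  proof -
    have "(coord_x p * poly A (coord_z p)) ^ r * (coord_y p * poly B (coord_z p)) =
      poly A (coord_z p) ^ r * poly B (coord_z p) * (coord_x p ^ r * coord_y p)"
      by (simp add: power_mult_distrib)
    also have "\<dots> = poly Q (coord_z p) ^ k - 1"
      using that R0[of "coord_z p"] by (simp add: in_S_tilde_coord)
    finally show ?thesis by (simp add: in_S_tilde_coord)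
  qed
  have m: "morphism ?S ?S ?f"
    by (rule morphism_to_S_tilde[OF S_tilde pt]) (auto intro!: regular_intros[OF S_tilde] coord_regular)
  show ?thesis
    unfolding etale_def
  proof (intro conjI ballI m)
    fix p assume p: "p \<in> points ?S"
    obtain x y z where xyz: "p = (x, y, z)" by (cases p)
    have w: "x ^ r * y = z ^ k - 1" using p xyz by simp
    have fp: "?f p = (x * poly A z, y * poly B z, poly Q z)" by (simp add: xyz lift_map_def)
    have fpp: "(x * poly A z) ^ r * (y * poly B z) = poly Q z ^ k - 1" using pt[OF p] by (simp add: fp)
    have TX: "tangent_map ?S ?f D coord_x = poly A z * D coord_x + x * poly (pderiv A) z * D coord_z"
      and TY: "tangent_map ?S ?f D coord_y = poly B z * D coord_y + y * poly (pderiv B) z * D coord_z"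
      and TZ: "tangent_map ?S ?f D coord_z = c * poly A z ^ (r - 1) * D coord_z"
      if D: "D \<in> tangent_space ?S p" for D
    proof -
      note rp = regular_poly[OF S_tilde coord_regular(3)] and tp = tangent_poly[OF S_tilde D coord_regular(3)]
      show "tangent_map ?S ?f D coord_x = poly A z * D coord_x + x * poly (pderiv A) z * D coord_z"
        using tangent_mult[OF D coord_regular(1) rp, of A] tp[of A] by (simp add: tangent_map_eq coord_regular xyz)
      show "tangent_map ?S ?f D coord_y = poly B z * D coord_y + y * poly (pderiv B) z * D coord_z"
        using tangent_mult[OF D coord_regular(2) rp, of B] tp[of B] by (simp add: tangent_map_eq coord_regular xyz)
      show "tangent_map ?S ?f D coord_z = c * poly A z ^ (r - 1) * D coord_z"
        using tp[of Q] by (simp add: tangent_map_eq coord_regular xyz R2)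
    qed
    note T_in = tangent_map_in[OF S_tilde m p]
    show "bij_betw (tangent_map ?S ?f) (tangent_space ?S p) (tangent_space ?S (?f p))"
      unfolding bij_betw_def
    proof
      show "inj_on (tangent_map ?S ?f) (tangent_space ?S p)"
      proof (rule inj_onI)
        fix D E assume D: "D \<in> tangent_space ?S p" and E: "E \<in> tangent_space ?S p"
          and eq: "tangent_map ?S ?f D = tangent_map ?S ?f E"
        have rel: "of_nat r * x ^ (r - 1) * y * (D coord_x - E coord_x) + x ^ r * (D coord_y - E coord_y) =
            of_nat k * z ^ (k - 1) * (D coord_z - E coord_z)"
          using tangent_S_tilde_relation[OF D[unfolded xyz]] tangent_S_tilde_relation[OF E[unfolded xyz]]
          by (simp add: algebra_simps)
        have "D coord_x - E coord_x = 0 \<and> D coord_y - E coord_y = 0 \<and> D coord_z - E coord_z = 0"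
        proof (rule lift_tangent_injective[OF k r c w R0 R3 rel])
          show "poly A z * (D coord_x - E coord_x) + x * poly (pderiv A) z * (D coord_z - E coord_z) = 0"
            using TX[OF D] TX[OF E] eq by (simp add: algebra_simps)
          show "poly B z * (D coord_y - E coord_y) + y * poly (pderiv B) z * (D coord_z - E coord_z) = 0"
            using TY[OF D] TY[OF E] eq by (simp add: algebra_simps)
          show "c * poly A z ^ (r - 1) * (D coord_z - E coord_z) = 0"
            unfolding right_diff_distrib using TZ[OF D] TZ[OF E] eq by auto
        qed
        then show "D = E" by (intro tangent_S_tilde_unique[OF D E]) auto
      qed
      show "tangent_map ?S ?f ` tangent_space ?S p = tangent_space ?S (?f p)"
      proof (rule subset_antisym)
        show "tangent_map ?S ?f ` tangent_space ?S p \<subseteq> tangent_space ?S (?f p)" using T_in by blast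
        show "tangent_space ?S (?f p) \<subseteq> tangent_map ?S ?f ` tangent_space ?S p"
        proof
          fix E assume E: "E \<in> tangent_space ?S (?f p)"
          obtain \<alpha> \<beta> \<gamma> where rel: "of_nat r * x ^ (r - 1) * y * \<alpha> + x ^ r * \<beta> = of_nat k * z ^ (k - 1) * \<gamma>"
            and eqs: "poly A z * \<alpha> + x * poly (pderiv A) z * \<gamma> = E coord_x"
              "poly B z * \<beta> + y * poly (pderiv B) z * \<gamma> = E coord_y" "c * poly A z ^ (r - 1) * \<gamma> = E coord_z"
            using lift_tangent_solve[OF k r c w R0 R3 tangent_S_tilde_relation[OF E[unfolded fp]]] by blast
          obtain D where D: "D \<in> tangent_space ?S p" "D coord_x = \<alpha>" "D coord_y = \<beta>" "D coord_z = \<gamma>"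
            using tangent_S_tilde_exists[OF k r w rel] xyz by blast
          have "tangent_map ?S ?f D = E"
            by (rule tangent_S_tilde_unique[OF T_in[OF D(1)] E]) (use TX[OF D(1)] TY[OF D(1)] TZ[OF D(1)] D eqs in \<open>simp_all only:\<close>)
          then show "E \<in> tangent_map ?S ?f ` tangent_space ?S p" using D(1) by blast
        qed
      qed
    qed
  qed
qed

section \<open>Function fields\<close>

locale integral_variety =
  fixes X :: "'a variety"
  assumes X: "function_variety X"
    and nonempty: "points X \<noteq> {}"
    and integral: "\<And>f g. f \<in> nonzero_regular X \<Longrightarrow> g \<in> nonzero_regular X \<Longrightarrow> \<exists>p\<in>points X. f p \<noteq> 0 \<and> g p \<noteq> 0"
begin

abbreviation "R \<equiv> regular X"
abbreviation "NZ \<equiv> nonzero_regular X"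
abbreviation "L \<equiv> function_field X"
abbreviation "F \<equiv> fraction X"

lemma NZ_R: "b \<in> NZ \<Longrightarrow> b \<in> R" by (simp add: nonzero_regular_def)

lemma NZ_mult: "b \<in> NZ \<Longrightarrow> c \<in> NZ \<Longrightarrow> (\<lambda>p. b p * c p) \<in> NZ"
  using integral[of b c] regular_mult[OF X] by (auto simp: nonzero_regular_def)

lemma NZ_const: "c \<noteq> 0 \<Longrightarrow> (\<lambda>_. c) \<in> NZ"
  using nonempty regular_const[OF X] by (auto simp: nonzero_regular_def)

lemma cancel:
  assumes "b \<in> NZ" "f \<in> R" "g \<in> R" "\<And>p. p \<in> points X \<Longrightarrow> b p * f p = b p * g p" "p \<in> points X"
  shows "f p = g p"
proof (rule ccontr)
  assume "f p \<noteq> g p"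
  then have "(\<lambda>p. f p - g p) \<in> NZ"
    using assms regular_diff[OF X] by (auto simp: nonzero_regular_def)
  then obtain q where "q \<in> points X" "b q \<noteq> 0" "f q - g q \<noteq> 0" using integral[OF assms(1)] by blast
  then show False using assms(4)[of q] by simp
qed

lemma fraction_mem_iff: "(a', b') \<in> F a b \<longleftrightarrow> a' \<in> R \<and> b' \<in> NZ \<and> (\<forall>p\<in>points X. a p * b' p = a' p * b p)"
  by (simp add: fraction_def)

lemma fraction_subset:
  assumes ab: "a \<in> R" "b \<in> NZ" "a' \<in> R" "b' \<in> NZ" and eq: "\<forall>p\<in>points X. a p * b' p = a' p * b p"
  shows "F a b \<subseteq> F a' b'"
proof
  fix u assume "u \<in> F a b"
  then obtain c d where u: "u = (c, d)" "c \<in> R" "d \<in> NZ" "\<forall>p\<in>points X. a p * d p = c p * b p"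
    by (cases u) (auto simp: fraction_mem_iff)
  have "a' p * d p = c p * b' p" if p: "p \<in> points X" for p
  proof (rule cancel[OF ab(2) _ _ _ p])
    show "(\<lambda>p. a' p * d p) \<in> R" "(\<lambda>p. c p * b' p) \<in> R"
      using ab u by (auto intro!: regular_mult[OF X] simp: NZ_R)
    fix q assume q: "q \<in> points X"
    have "b q * (a' q * d q) = (a q * b' q) * d q" using eq q by simp
    also have "\<dots> = b q * (c q * b' q)" using u(4) q by (metis mult.assoc mult.commute)
    finally show "b q * (a' q * d q) = b q * (c q * b' q)" .
  qed
  then show "u \<in> F a' b'" using u by (simp add: fraction_mem_iff)
qed

lemma fraction_eq:
  assumes ab: "a \<in> R" "b \<in> NZ" "a' \<in> R" "b' \<in> NZ" and eq: "\<And>p. p \<in> points X \<Longrightarrow> a p * b' p = a' p * b p"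
  shows "F a b = F a' b'"
  using fraction_subset[OF ab] fraction_subset[OF ab(3,4,1,2)] eq by (metis subset_antisym)

lemma fraction_self: "a \<in> R \<Longrightarrow> b \<in> NZ \<Longrightarrow> (a, b) \<in> F a b"
  by (simp add: fraction_mem_iff)

lemma fraction_eq_iff:
  assumes "a \<in> R" "b \<in> NZ" "a' \<in> R" "b' \<in> NZ"
  shows "F a b = F a' b' \<longleftrightarrow> (\<forall>p\<in>points X. a p * b' p = a' p * b p)"
proof
  assume "F a b = F a' b'"
  then have "(a', b') \<in> F a b" using fraction_self[OF assms(3,4)] by simp
  then show "\<forall>p\<in>points X. a p * b' p = a' p * b p" by (simp add: fraction_mem_iff)
qed (rule fraction_eq[OF assms], simp)

lemma carrier_L: "carrier L = {F a b | a b. a \<in> R \<and> b \<in> NZ}"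
  by (simp add: function_field_def)

lemma fraction_in: "a \<in> R \<Longrightarrow> b \<in> NZ \<Longrightarrow> F a b \<in> carrier L"
  by (auto simp: carrier_L)

lemma L_cases: assumes "u \<in> carrier L" obtains a b where "u = F a b" "a \<in> R" "b \<in> NZ"
  using assms by (auto simp: carrier_L)

lemma mult_fraction:
  assumes "a \<in> R" "b \<in> NZ" "c \<in> R" "d \<in> NZ"
  shows "F a b \<otimes>\<^bsub>L\<^esub> F c d = F (\<lambda>p. a p * c p) (\<lambda>p. b p * d p)"
proof -
  have "F (\<lambda>p. a' p * c' p) (\<lambda>p. b' p * d' p) = F (\<lambda>p. a p * c p) (\<lambda>p. b p * d p)"
    if "(a', b') \<in> F a b" "(c', d') \<in> F c d" for a' b' c' d'
  proof (rule fraction_eq)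
    show "(\<lambda>p. a' p * c' p) \<in> R" "(\<lambda>p. b' p * d' p) \<in> NZ" "(\<lambda>p. a p * c p) \<in> R" "(\<lambda>p. b p * d p) \<in> NZ"
      using that assms by (auto simp: fraction_mem_iff intro: regular_mult[OF X] NZ_mult)
    fix p assume p: "p \<in> points X"
    have "a p * b' p = a' p * b p" "c p * d' p = c' p * d p" using that p by (auto simp: fraction_mem_iff)
    then have "(a p * b' p) * (c p * d' p) = (a' p * b p) * (c' p * d p)" by simp
    then show "a' p * c' p * (b p * d p) = a p * c p * (b' p * d' p)" by (simp only: ac_simps)
  qed
  then have "F a b \<otimes>\<^bsub>L\<^esub> F c d = (\<Union>(a', b')\<in>F a b. \<Union>(c', d')\<in>F c d. F (\<lambda>p. a p * c p) (\<lambda>p. b p * d p))"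
    unfolding function_field_def monoid.simps by (intro SUP_cong) auto
  then show ?thesis using fraction_self[OF assms(1,2)] fraction_self[OF assms(3,4)] by auto
qed

lemma add_fraction:
  assumes "a \<in> R" "b \<in> NZ" "c \<in> R" "d \<in> NZ"
  shows "F a b \<oplus>\<^bsub>L\<^esub> F c d = F (\<lambda>p. a p * d p + c p * b p) (\<lambda>p. b p * d p)"
proof -
  have "F (\<lambda>p. a' p * d' p + c' p * b' p) (\<lambda>p. b' p * d' p) = F (\<lambda>p. a p * d p + c p * b p) (\<lambda>p. b p * d p)"
    if "(a', b') \<in> F a b" "(c', d') \<in> F c d" for a' b' c' d'
  proof (rule fraction_eq)
    show "(\<lambda>p. a' p * d' p + c' p * b' p) \<in> R" "(\<lambda>p. b' p * d' p) \<in> NZ"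
      "(\<lambda>p. a p * d p + c p * b p) \<in> R" "(\<lambda>p. b p * d p) \<in> NZ"
      using that assms by (auto simp: fraction_mem_iff intro!: regular_mult[OF X] regular_add[OF X] NZ_mult simp: NZ_R)
    fix p assume p: "p \<in> points X"
    have 1: "a p * b' p = a' p * b p" and 2: "c p * d' p = c' p * d p" using that p by (auto simp: fraction_mem_iff)
    have "(a p * d p + c p * b p) * (b' p * d' p) = (a p * b' p) * (d p * d' p) + (c p * d' p) * (b p * b' p)"
      by (simp add: algebra_simps)
    also have "\<dots> = (a' p * d' p + c' p * b' p) * (b p * d p)" unfolding 1 2 by (simp add: algebra_simps)
    finally show "(a' p * d' p + c' p * b' p) * (b p * d p) = (a p * d p + c p * b p) * (b' p * d' p)" by simp
  qed
  then have "F a b \<oplus>\<^bsub>L\<^esub> F c d = (\<Union>(a', b')\<in>F a b. \<Union>(c', d')\<in>F c d. F (\<lambda>p. a p * d p + c p * b p) (\<lambda>p. b p * d p))"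
    unfolding function_field_def ring.simps by (intro SUP_cong) auto
  then show ?thesis using fraction_self[OF assms(1,2)] fraction_self[OF assms(3,4)] by auto
qed

lemma one_L: "\<one>\<^bsub>L\<^esub> = F (\<lambda>_. 1) (\<lambda>_. 1)" and zero_L: "\<zero>\<^bsub>L\<^esub> = F (\<lambda>_. 0) (\<lambda>_. 1)"
  by (simp_all add: function_field_def)

lemmas closed = regular_mult[OF X] regular_add[OF X] regular_uminus[OF X] regular_const[OF X] NZ_mult NZ_const

lemma fraction_zero_iff: "a \<in> R \<Longrightarrow> b \<in> NZ \<Longrightarrow> F a b = \<zero>\<^bsub>L\<^esub> \<longleftrightarrow> (\<forall>p\<in>points X. a p = 0)"
  unfolding zero_L by (subst fraction_eq_iff) (auto intro!: closed simp: NZ_R)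

lemma L_cring: "cring L"
proof (rule cringI)
  show "abelian_group L"
  proof (rule abelian_groupI)
    show "\<zero>\<^bsub>L\<^esub> \<in> carrier L" unfolding zero_L by (auto intro!: fraction_in closed)
    fix u v assume "u \<in> carrier L" "v \<in> carrier L"
    then obtain a b c d where u: "u = F a b" "a \<in> R" "b \<in> NZ" and v: "v = F c d" "c \<in> R" "d \<in> NZ"
      by (elim L_cases)
    show "u \<oplus>\<^bsub>L\<^esub> v \<in> carrier L" using u v by (auto simp: add_fraction NZ_R intro!: fraction_in closed)
    show "u \<oplus>\<^bsub>L\<^esub> v = v \<oplus>\<^bsub>L\<^esub> u" using u v by (simp add: add_fraction mult.commute add.commute)
    fix w assume "w \<in> carrier L"
    then obtain e g where w: "w = F e g" "e \<in> R" "g \<in> NZ" by (elim L_cases)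
    show "u \<oplus>\<^bsub>L\<^esub> v \<oplus>\<^bsub>L\<^esub> w = u \<oplus>\<^bsub>L\<^esub> (v \<oplus>\<^bsub>L\<^esub> w)"
      using u v w by (simp add: add_fraction closed NZ_R algebra_simps)
  next
    fix u assume "u \<in> carrier L"
    then obtain a b where u: "u = F a b" "a \<in> R" "b \<in> NZ" by (elim L_cases)
    show "\<zero>\<^bsub>L\<^esub> \<oplus>\<^bsub>L\<^esub> u = u" using u by (simp add: zero_L add_fraction closed NZ_R)
    have "F (\<lambda>p. - a p) b \<oplus>\<^bsub>L\<^esub> u = \<zero>\<^bsub>L\<^esub>"
      using u by (simp add: add_fraction closed NZ_R) (subst fraction_zero_iff, auto intro!: closed simp: NZ_R)
    then show "\<exists>y\<in>carrier L. y \<oplus>\<^bsub>L\<^esub> u = \<zero>\<^bsub>L\<^esub>" using u by (intro bexI[of _ "F (\<lambda>p. - a p) b"]) (auto intro!: fraction_in closed)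
  qed
  show "comm_monoid L"
  proof (rule comm_monoidI)
    show "\<one>\<^bsub>L\<^esub> \<in> carrier L" unfolding one_L by (auto intro!: fraction_in closed)
    fix u v assume "u \<in> carrier L" "v \<in> carrier L"
    then obtain a b c d where u: "u = F a b" "a \<in> R" "b \<in> NZ" and v: "v = F c d" "c \<in> R" "d \<in> NZ"
      by (elim L_cases)
    show "u \<otimes>\<^bsub>L\<^esub> v \<in> carrier L" using u v by (auto simp: mult_fraction NZ_R intro!: fraction_in closed)
    show "u \<otimes>\<^bsub>L\<^esub> v = v \<otimes>\<^bsub>L\<^esub> u" using u v by (simp add: mult_fraction mult.commute)
    fix w assume "w \<in> carrier L"
    then obtain e g where w: "w = F e g" "e \<in> R" "g \<in> NZ" by (elim L_cases)
    show "u \<otimes>\<^bsub>L\<^esub> v \<otimes>\<^bsub>L\<^esub> w = u \<otimes>\<^bsub>L\<^esub> (v \<otimes>\<^bsub>L\<^esub> w)"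
      using u v w by (simp add: mult_fraction closed NZ_R algebra_simps)
  next
    fix u assume "u \<in> carrier L"
    then obtain a b where u: "u = F a b" "a \<in> R" "b \<in> NZ" by (elim L_cases)
    show "\<one>\<^bsub>L\<^esub> \<otimes>\<^bsub>L\<^esub> u = u" using u by (simp add: one_L mult_fraction closed NZ_R)
  qed
  fix u v w assume "u \<in> carrier L" "v \<in> carrier L" "w \<in> carrier L"
  then obtain a b c d e g where u: "u = F a b" "a \<in> R" "b \<in> NZ" and v: "v = F c d" "c \<in> R" "d \<in> NZ"
    and w: "w = F e g" "e \<in> R" "g \<in> NZ" by (elim L_cases)
  show "(u \<oplus>\<^bsub>L\<^esub> v) \<otimes>\<^bsub>L\<^esub> w = u \<otimes>\<^bsub>L\<^esub> w \<oplus>\<^bsub>L\<^esub> v \<otimes>\<^bsub>L\<^esub> w"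
    using u v w by (simp add: mult_fraction add_fraction closed NZ_R) (rule fraction_eq, auto intro!: closed simp: NZ_R algebra_simps)
qed

lemma L_field: "field L"
proof -
  interpret L: cring L by (rule L_cring)
  show ?thesis
  proof (rule L.cring_fieldI2)
    show "\<zero>\<^bsub>L\<^esub> \<noteq> \<one>\<^bsub>L\<^esub>"
      unfolding one_L zero_L using nonempty by (subst fraction_eq_iff) (auto intro!: closed simp: NZ_R)
    fix u assume "u \<in> carrier L" "u \<noteq> \<zero>\<^bsub>L\<^esub>"
    then obtain a b where u: "u = F a b" "a \<in> R" "b \<in> NZ" by (elim L_cases)
    then have a: "a \<in> NZ" using \<open>u \<noteq> \<zero>\<^bsub>L\<^esub>\<close> fraction_zero_iff by (auto simp: nonzero_regular_def)
    have "u \<otimes>\<^bsub>L\<^esub> F b a = \<one>\<^bsub>L\<^esub>"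
      using u a by (simp add: mult_fraction NZ_R one_L) (rule fraction_eq, auto intro!: closed simp: NZ_R)
    then show "\<exists>v\<in>carrier L. u \<otimes>\<^bsub>L\<^esub> v = \<one>\<^bsub>L\<^esub>" using u a by (blast intro: fraction_in NZ_R)
  qed
qed

definition embed :: "('a \<Rightarrow> complex) \<Rightarrow> (('a \<Rightarrow> complex) \<times> ('a \<Rightarrow> complex)) set" where
  "embed a = F a (\<lambda>_. 1)"

lemma embed_in: "a \<in> R \<Longrightarrow> embed a \<in> carrier L"
  unfolding embed_def by (auto intro!: fraction_in closed)

lemma embed_add: "a \<in> R \<Longrightarrow> b \<in> R \<Longrightarrow> embed (\<lambda>p. a p + b p) = embed a \<oplus>\<^bsub>L\<^esub> embed b"
  by (simp add: embed_def add_fraction closed NZ_R)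

lemma embed_mult: "a \<in> R \<Longrightarrow> b \<in> R \<Longrightarrow> embed (\<lambda>p. a p * b p) = embed a \<otimes>\<^bsub>L\<^esub> embed b"
  by (simp add: embed_def mult_fraction closed NZ_R)

lemma embed_cong: "a \<in> R \<Longrightarrow> b \<in> R \<Longrightarrow> (\<And>p. p \<in> points X \<Longrightarrow> a p = b p) \<Longrightarrow> embed a = embed b"
  unfolding embed_def by (rule fraction_eq) (auto intro!: closed simp: NZ_R)

lemma embed_nonzero:
  assumes a: "a \<in> NZ" shows "embed a \<noteq> \<zero>\<^bsub>L\<^esub>"
proof
  assume "embed a = \<zero>\<^bsub>L\<^esub>"
  then have "\<forall>p\<in>points X. a p = 0"
    using fraction_zero_iff[OF NZ_R[OF a] NZ_const[of 1]] by (simp add: embed_def)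
  then show False using a by (simp add: nonzero_regular_def)
qed

lemma fraction_eq_quotient:
  assumes "a \<in> R" "b \<in> NZ" shows "F a b = embed a \<otimes>\<^bsub>L\<^esub> inv\<^bsub>L\<^esub> embed b"
proof -
  interpret L: field L by (rule L_field)
  have b: "embed b \<in> Units L" using embed_nonzero[OF assms(2)] embed_in[OF NZ_R[OF assms(2)]] by (simp add: L.field_Units)
  have "F a b \<otimes>\<^bsub>L\<^esub> embed b = embed a"
    unfolding embed_def using assms by (simp add: mult_fraction closed NZ_R) (rule fraction_eq, auto intro!: closed simp: NZ_R)
  then have "embed a \<otimes>\<^bsub>L\<^esub> inv\<^bsub>L\<^esub> embed b = F a b \<otimes>\<^bsub>L\<^esub> (embed b \<otimes>\<^bsub>L\<^esub> inv\<^bsub>L\<^esub> embed b)"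
    using assms b fraction_in[OF assms] by (metis L.Units_closed L.Units_inv_closed L.m_assoc)
  then show ?thesis using b fraction_in[OF assms] by simp
qed

text \<open>
  The value of a rational function at a point where some representation as a fraction has a
  nonzero denominator.
\<close>

definition has_value :: "(('a \<Rightarrow> complex) \<times> ('a \<Rightarrow> complex)) set \<Rightarrow> 'a \<Rightarrow> complex \<Rightarrow> bool" where
  "has_value u p c \<longleftrightarrow> (\<exists>a b. u = F a b \<and> a \<in> R \<and> b \<in> NZ \<and> b p \<noteq> 0 \<and> c = a p / b p)"

lemma has_valueI:
  "u = F a b \<Longrightarrow> a \<in> R \<Longrightarrow> b \<in> NZ \<Longrightarrow> b p \<noteq> 0 \<Longrightarrow> c = a p / b p \<Longrightarrow> has_value u p c"
  unfolding has_value_def by blast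

lemma has_valueE:
  assumes "has_value u p c" obtains a b where "u = F a b" "a \<in> R" "b \<in> NZ" "b p \<noteq> 0" "c = a p / b p"
  using assms unfolding has_value_def by blast

lemma has_value_unique:
  assumes p: "p \<in> points X" and c: "has_value u p c" and c': "has_value u p c'"
  shows "c = c'"
proof -
  obtain a b where u: "u = F a b" "a \<in> R" "b \<in> NZ" "b p \<noteq> 0" "c = a p / b p" by (rule has_valueE[OF c])
  obtain a' b' where v: "u = F a' b'" "a' \<in> R" "b' \<in> NZ" "b' p \<noteq> 0" "c' = a' p / b' p" by (rule has_valueE[OF c'])
  have "a p * b' p = a' p * b p" using fraction_eq_iff[OF u(2,3) v(2,3)] u(1) v(1) p by simp
  then show ?thesis unfolding u(5) v(5) using u(4) v(4) by (simp add: frac_eq_eq)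
qed

lemma has_value_add:
  assumes c: "has_value u p c" and d: "has_value v p d"
  shows "has_value (u \<oplus>\<^bsub>L\<^esub> v) p (c + d)"
proof -
  obtain a b where u: "u = F a b" "a \<in> R" "b \<in> NZ" "b p \<noteq> 0" "c = a p / b p" by (rule has_valueE[OF c])
  obtain a' b' where v: "v = F a' b'" "a' \<in> R" "b' \<in> NZ" "b' p \<noteq> 0" "d = a' p / b' p" by (rule has_valueE[OF d])
  show ?thesis
    by (rule has_valueI[OF _ _ NZ_mult[OF u(3) v(3)], of _ "\<lambda>p. a p * b' p + a' p * b p"])
      (use u v in \<open>auto simp: add_fraction field_simps NZ_R intro!: closed\<close>)
qed

lemma has_value_mult:
  assumes c: "has_value u p c" and d: "has_value v p d"
  shows "has_value (u \<otimes>\<^bsub>L\<^esub> v) p (c * d)"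
proof -
  obtain a b where u: "u = F a b" "a \<in> R" "b \<in> NZ" "b p \<noteq> 0" "c = a p / b p" by (rule has_valueE[OF c])
  obtain a' b' where v: "v = F a' b'" "a' \<in> R" "b' \<in> NZ" "b' p \<noteq> 0" "d = a' p / b' p" by (rule has_valueE[OF d])
  show ?thesis
    by (rule has_valueI[OF _ _ NZ_mult[OF u(3) v(3)], of _ "\<lambda>p. a p * a' p"])
      (use u v in \<open>auto simp: mult_fraction intro!: closed\<close>)
qed

lemma has_value_embed: "a \<in> R \<Longrightarrow> has_value (embed a) p (a p)"
  by (rule has_valueI[of _ a "\<lambda>_. 1"]) (auto simp: embed_def intro!: closed)

lemma has_value_zero: "has_value \<zero>\<^bsub>L\<^esub> p 0" and has_value_one: "has_value \<one>\<^bsub>L\<^esub> p 1"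
  using has_value_embed[OF regular_const[OF X, of 0]] has_value_embed[OF regular_const[OF X, of 1]]
  by (simp_all add: zero_L one_L embed_def)

end

locale dominant_endo = integral_variety +
  fixes f :: "'a \<Rightarrow> 'a"
  assumes f: "morphism X X f" and pull_nonzero: "\<And>b. b \<in> NZ \<Longrightarrow> (\<lambda>p. b (f p)) \<in> NZ"
begin

lemma pull_R: "a \<in> R \<Longrightarrow> (\<lambda>p. a (f p)) \<in> R" by (rule morphism_regular[OF f])

lemma pullback_fraction:
  assumes "a \<in> R" "b \<in> NZ" shows "pullback X f (F a b) = F (\<lambda>p. a (f p)) (\<lambda>p. b (f p))"
proof -
  have "F (a' \<circ> f) (b' \<circ> f) = F (\<lambda>p. a (f p)) (\<lambda>p. b (f p))" if "(a', b') \<in> F a b" for a' b'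
    unfolding comp_def
    by (rule fraction_eq) (use that assms pull_R pull_nonzero morphism_point[OF f] in \<open>auto simp: fraction_mem_iff\<close>)
  then have "pullback X f (F a b) = (\<Union>(a', b')\<in>F a b. F (\<lambda>p. a (f p)) (\<lambda>p. b (f p)))"
    unfolding pullback_def by (intro SUP_cong) auto
  then show ?thesis using fraction_self[OF assms] by auto
qed

lemma pullback_hom: "pullback X f \<in> ring_hom L L"
proof (rule ring_hom_memI)
  fix u v assume "u \<in> carrier L" "v \<in> carrier L"
  then obtain a b c d where u: "u = F a b" "a \<in> R" "b \<in> NZ" and v: "v = F c d" "c \<in> R" "d \<in> NZ"
    by (elim L_cases)
  show "pullback X f u \<in> carrier L" using u by (simp add: pullback_fraction pull_R pull_nonzero fraction_in)
  show "pullback X f (u \<otimes>\<^bsub>L\<^esub> v) = pullback X f u \<otimes>\<^bsub>L\<^esub> pullback X f v"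
    using u v by (simp add: pullback_fraction mult_fraction pull_R pull_nonzero closed NZ_R)
  show "pullback X f (u \<oplus>\<^bsub>L\<^esub> v) = pullback X f u \<oplus>\<^bsub>L\<^esub> pullback X f v"
    using u v by (simp add: pullback_fraction add_fraction pull_R pull_nonzero closed NZ_R)
next
  show "pullback X f \<one>\<^bsub>L\<^esub> = \<one>\<^bsub>L\<^esub>" by (simp add: one_L pullback_fraction closed)
qed

definition K where "K = pullback X f ` carrier L"

lemma K_subfield: "subfield K L"
proof -
  interpret L: field L by (rule L_field)
  interpret ring_hom_ring L L "pullback X f"
    by unfold_locales (rule pullback_hom)
  show ?thesis unfolding K_def
    by (rule img_is_subfield(2)[OF L.carrier_is_subfield]) simp
qed

lemma embed_pull_in_K: "a \<in> R \<Longrightarrow> embed (\<lambda>p. a (f p)) \<in> K"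
  unfolding K_def embed_def
  by (rule image_eqI[of _ _ "F a (\<lambda>_. 1)"]) (simp_all add: pullback_fraction closed fraction_in)

lemma embed_const_in_K: "embed (\<lambda>_. c) \<in> K"
  using embed_pull_in_K[OF regular_const[OF X, of c]] .

text \<open>
  An element of the pulled back field takes, at general points, values that depend only on the
  image point.
\<close>

lemma K_has_value:
  assumes "u \<in> K"
  shows "\<exists>b c. b \<in> NZ \<and> (\<forall>p\<in>points X. b (f p) \<noteq> 0 \<longrightarrow> has_value u p (c (f p)))"
proof -
  obtain a b where u: "u = pullback X f (F a b)" "a \<in> R" "b \<in> NZ"
    using assms unfolding K_def by (auto elim!: L_cases)
  have "has_value u p (a (f p) / b (f p))" if "b (f p) \<noteq> 0" for p
    by (rule has_valueI[OF _ pull_R[OF u(2)] pull_nonzero[OF u(3)]])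
      (use that in \<open>simp_all add: u(1) pullback_fraction[OF u(2,3)]\<close>)
  then show ?thesis using u(3) by (intro exI[of _ b] exI[of _ "\<lambda>q. a q / b q"]) simp
qed

end

section \<open>Rotation symmetry and ramification of polynomials\<close>

lemma unity_group_dvd:
  assumes k: "0 < k" and all: "\<And>w::complex. w ^ k = 1 \<Longrightarrow> w ^ n = 1"
  shows "k dvd n"
proof -
  define g where "g = gcd k n"
  have g: "0 < g" using k by (simp add: g_def)
  have "w ^ g = 1" if w: "w ^ k = 1" for w :: complex
  proof -
    obtain x y where "k * x = n * y + gcd k n" using bezout_nat[of k n] k by auto
    then have "(w ^ k) ^ x = (w ^ n) ^ y * w ^ g" by (simp add: g_def power_add flip: power_mult)
    then show ?thesis using w all[OF w] by simp
  qed
  then have "{w::complex. w ^ k = 1} \<subseteq> {w. w ^ g = 1}" by auto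
  moreover have "finite {w::complex. w ^ g = 1}"
    using card_unity_roots[OF g] g by (metis card.infinite less_irrefl)
  ultimately have "k \<le> g" using card_mono card_unity_roots[OF k] card_unity_roots[OF g] by metis
  moreover have "g dvd k" by (simp add: g_def)
  ultimately have "g = k" using k dvd_imp_le[of g k] by simp
  then show ?thesis by (metis g_def gcd_dvd2)
qed

lemma coeff_pcompose_scale: "coeff (pcompose p [:0, w:]) i = w ^ i * coeff p i" for p :: "complex poly"
proof (induction p arbitrary: i)
  case (pCons a p)
  then show ?case by (cases i) (simp_all add: pcompose_pCons mult.assoc)
qed simp

text \<open>
  Comparing coefficients, only exponents congruent to \<open>j\<close> modulo \<open>k\<close>
  occur.
\<close>

lemma rotation_eigenpoly:
  fixes q :: "complex poly"
  assumes k: "0 < k" and j: "j < k" and rot: "\<And>w z. w ^ k = 1 \<Longrightarrow> poly q (w * z) = w ^ j * poly q z"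
  shows "\<exists>S. \<forall>z. poly q z = z ^ j * poly S (z ^ k)"
proof -
  have supp: "\<exists>m. i = j + k * m" if c: "coeff q i \<noteq> 0" for i
  proof -
    have eq: "w ^ i = w ^ j" if w: "w ^ k = 1" for w :: complex
    proof -
      have "pcompose q [:0, w:] = smult (w ^ j) q"
        by (rule poly_eqI_eval) (simp add: poly_pcompose rot[OF w] mult.commute[of _ w])
      then have "w ^ i * coeff q i = w ^ j * coeff q i" by (metis coeff_pcompose_scale coeff_smult)
      then show ?thesis using c by simp
    qed
    have nz: "w \<noteq> 0" if "w ^ k = 1" for w :: complex using that k by (auto simp: power_0_left)
    show ?thesis
    proof (cases "j \<le> i")
      case True
      have "w ^ (i - j) = 1" if w: "w ^ k = 1" for w :: complex
      proof -
        have "w ^ (i - j) * w ^ j = w ^ j" using eq[OF w] True by (simp flip: power_add)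
        then show ?thesis using nz[OF w] by simp
      qed
      then have "k dvd i - j" by (rule unity_group_dvd[OF k])
      then show ?thesis using True by (metis dvd_def le_add_diff_inverse)
    next
      case False
      have "w ^ (j - i) = 1" if w: "w ^ k = 1" for w :: complex
      proof -
        have "w ^ (j - i) * w ^ i = w ^ j" using False by (simp flip: power_add)
        then have "w ^ (j - i) * w ^ i = w ^ i" using eq[OF w] by simp
        then show ?thesis using nz[OF w] by simp
      qed
      then have "k dvd j - i" by (rule unity_group_dvd[OF k])
      then show ?thesis using False j by (auto dest: dvd_imp_le)
    qed
  qed
  define S where "S = (\<Sum>m\<le>degree q. monom (coeff q (j + k * m)) m)"
  have "poly q z = z ^ j * poly S (z ^ k)" for z
  proof -
    have "z ^ j * poly S (z ^ k) = (\<Sum>m\<le>degree q. coeff q (j + k * m) * z ^ (j + k * m))"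
      by (simp add: S_def poly_sum poly_monom sum_distrib_left power_add mult_ac flip: power_mult)
    also have "\<dots> = (\<Sum>i\<in>(\<lambda>m. j + k * m) ` {..degree q}. coeff q i * z ^ i)"
      using k by (subst sum.reindex) (auto simp: inj_on_def)
    also have "\<dots> = (\<Sum>i\<le>degree q. coeff q i * z ^ i)"
    proof (rule sum.mono_neutral_cong)
      fix i assume i: "i \<in> {..degree q} - (\<lambda>m. j + k * m) ` {..degree q}"
      show "coeff q i * z ^ i = 0"
      proof (rule ccontr)
        assume "coeff q i * z ^ i \<noteq> 0"
        then obtain m where m: "i = j + k * m" using supp by auto
        have "m \<le> k * m" using k by simp
        moreover have "i \<le> degree q" using i by blast
        ultimately have "m \<le> degree q" using m by linarith
        then show False using i m by blast
      qed
    qed (auto simp: coeff_eq_0)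
    finally show ?thesis by (simp add: poly_altdef)
  qed
  then show ?thesis by blast
qed

lemma degree_eq_sum_order:
  fixes p :: "complex poly"
  assumes "p \<noteq> 0" shows "degree p = (\<Sum>x | poly p x = 0. Polynomial.order x p)"
proof -
  have "degree p = size (proots p)" by (simp add: size_proots_complex)
  also have "\<dots> = (\<Sum>x\<in>set_mset (proots p). Polynomial.order x p)"
    using assms by (simp add: size_multiset_overloaded_eq)
  finally show ?thesis using assms by simp
qed

lemma order_of_pderiv:
  fixes p :: "complex poly"
  assumes "pderiv p \<noteq> 0" "poly p c = 0"
  shows "Polynomial.order c (pderiv p) = Polynomial.order c p - 1"
proof -
  have "p \<noteq> 0" using assms by auto
  then show ?thesis using order_pderiv[of p c] assms by (simp add: order_root)
qed

lemma order_one: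
  fixes p :: "complex poly"
  assumes "poly p c = 0" "poly (pderiv p) c \<noteq> 0"
  shows "Polynomial.order c p = 1"
proof -
  have p: "p \<noteq> 0" "pderiv p \<noteq> 0" using assms by auto
  have "Polynomial.order c (pderiv p) = 0" using assms p by (simp add: order_root)
  then show ?thesis using order_pderiv[of p c] assms p by (simp add: order_root)
qed

lemma order_power: "p \<noteq> 0 \<Longrightarrow> Polynomial.order c (p ^ n) = n * Polynomial.order c p" for p :: "complex poly"
  by (induction n) (simp_all add: order_mult)

text \<open>
  Riemann-Hurwitz on the line, counting the zeros of \<open>p'\<close> in two ways: its degree
  is \<open>degree p - 1\<close>, each of the \<open>degree p / k\<close> zeros of
  \<open>p\<close> contributes \<open>k - 1\<close>, and each zero of \<open>u\<close>
  contributes \<open>r - 1\<close>.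
\<close>

lemma degree_from_ramification:
  fixes p u :: "complex poly"
  assumes k: "2 \<le> k" and r: "2 \<le> r" and p: "pderiv p \<noteq> 0" and u: "u \<noteq> 0"
    and zeros: "\<And>z. poly p z = 0 \<Longrightarrow> Polynomial.order z p = k"
    and hubs: "\<And>z. poly u z = 0 \<Longrightarrow> poly p z = 1 \<and> Polynomial.order z (p - 1) = r"
    and others: "\<And>z. poly p z \<noteq> 0 \<Longrightarrow> poly u z \<noteq> 0 \<Longrightarrow> poly (pderiv p) z \<noteq> 0"
  shows "\<exists>m. degree p = k * m \<and> m = 1 + (r - 1) * card {z. poly u z = 0}"
proof -
  define Z where "Z = {z. poly p z = 0}"
  define U where "U = {z. poly u z = 0}"
  have p0: "p \<noteq> 0" using p by auto
  have fin: "finite Z" "finite U" using poly_roots_finite p0 u by (auto simp: Z_def U_def)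
  have disj: "Z \<inter> U = {}" using hubs by (force simp: Z_def U_def)
  have "degree p = (\<Sum>x\<in>Z. k)" unfolding degree_eq_sum_order[OF p0] Z_def by (intro sum.cong) (auto simp: zeros)
  then have deg: "degree p = k * card Z" by (simp add: mult.commute)
  have "degree p \<noteq> 0" using p by (auto simp: pderiv_eq_0_iff)
  have pd: "pderiv (p - 1) = pderiv p" by (simp add: pderiv_diff)
  have roots: "{z. poly (pderiv p) z = 0} = Z \<union> U"
  proof
    show "{z. poly (pderiv p) z = 0} \<subseteq> Z \<union> U" using others by (auto simp: Z_def U_def)
    show "Z \<union> U \<subseteq> {z. poly (pderiv p) z = 0}"
    proof
      fix z assume z: "z \<in> Z \<union> U"
      show "z \<in> {z. poly (pderiv p) z = 0}"
      proof (rule ccontr)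
        assume "z \<notin> {z. poly (pderiv p) z = 0}"
        then have nz: "poly (pderiv p) z \<noteq> 0" by simp
        show False
        proof (cases "z \<in> Z")
          case True
          then have "Polynomial.order z p = 1" using order_one[of p z] nz by (simp add: Z_def)
          then show False using zeros[of z] True k by (simp add: Z_def)
        next
          case False
          then have h: "poly p z = 1" "Polynomial.order z (p - 1) = r" using hubs z by (auto simp: U_def)
          then have "Polynomial.order z (p - 1) = 1" using order_one[of "p - 1" z] nz pd by simp
          then show False using h r by simp
        qed
      qed
    qed
  qed
  have "degree p - 1 = degree (pderiv p)" by (simp add: degree_pderiv)
  also have "\<dots> = (\<Sum>z\<in>Z \<union> U. Polynomial.order z (pderiv p))" unfolding degree_eq_sum_order[OF p] roots ..
  also have "\<dots> = (\<Sum>z\<in>Z. Polynomial.order z (pderiv p)) + (\<Sum>z\<in>U. Polynomial.order z (pderiv p))"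
    by (rule sum.union_disjoint[OF fin disj])
  also have "(\<Sum>z\<in>Z. Polynomial.order z (pderiv p)) = (\<Sum>z\<in>Z. k - 1)"
    by (intro sum.cong) (auto simp: Z_def order_of_pderiv[OF p] zeros)
  also have "(\<Sum>z\<in>U. Polynomial.order z (pderiv p)) = (\<Sum>z\<in>U. r - 1)"
  proof (intro sum.cong refl)
    fix z assume "z \<in> U"
    then have h: "poly (p - 1) z = 0" "Polynomial.order z (p - 1) = r" using hubs by (auto simp: U_def)
    then show "Polynomial.order z (pderiv p) = r - 1" using order_of_pderiv[of "p - 1" z] p pd by simp
  qed
  finally have "degree p - 1 = card Z * (k - 1) + card U * (r - 1)" by simp
  moreover have "card Z * (k - 1) + card Z = k * card Z" using k by (cases k) simp_all
  ultimately have "card Z = 1 + (r - 1) * card U"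
    unfolding mult.commute[of "r - 1"] using deg \<open>degree p \<noteq> 0\<close> by linarith
  then show ?thesis using deg by (auto simp: U_def)
qed

text \<open>
  The rotations act freely away from the origin.
\<close>

lemma card_rotation_invariant:
  fixes U :: "complex set"
  assumes k: "0 < k" and fin: "finite U" and rot: "\<And>w z. w ^ k = 1 \<Longrightarrow> z \<in> U \<Longrightarrow> w * z \<in> U"
  shows "\<exists>m. card U = k * m + (if 0 \<in> U then 1 else 0)"
proof -
  define V where "V = U - {0}"
  define T where "T = (\<lambda>z. z ^ k) ` V"
  have finV: "finite V" "finite T" using fin by (auto simp: V_def T_def)
  have "V = (\<Union>t\<in>T. {z. z ^ k = t})"
  proof
    show "V \<subseteq> (\<Union>t\<in>T. {z. z ^ k = t})" by (auto simp: T_def)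
    show "(\<Union>t\<in>T. {z. z ^ k = t}) \<subseteq> V"
    proof
      fix z assume "z \<in> (\<Union>t\<in>T. {z. z ^ k = t})"
      then obtain z' where z': "z' \<in> V" "z ^ k = z' ^ k" by (auto simp: T_def)
      then have nz: "z' \<noteq> 0" by (simp add: V_def)
      then have "(z / z') ^ k = 1" using z'(2) by (simp add: power_divide)
      then have "z / z' * z' \<in> U" using rot z' unfolding V_def by blast
      moreover have "z \<noteq> 0" using z' nz k by (auto simp: power_0_left)
      ultimately show "z \<in> V" using nz by (simp add: V_def)
    qed
  qed
  moreover have "card (\<Union>t\<in>T. {z. z ^ k = t}) = (\<Sum>t\<in>T. card {z. z ^ k = t})"
  proof (rule card_UN_disjoint[OF finV(2)])
    show "\<forall>t\<in>T. finite {z. z ^ k = t}"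
    proof
      fix t assume "t \<in> T"
      then have "t \<noteq> 0" by (auto simp: T_def V_def)
      then have "card {z. z ^ k = t} = k" using card_nth_roots k by blast
      then show "finite {z. z ^ k = t}" using k by (metis card.infinite less_irrefl)
    qed
  qed auto
  moreover have "(\<Sum>t\<in>T. card {z. z ^ k = t}) = (\<Sum>t\<in>T. k)"
    by (intro sum.cong refl card_nth_roots) (use k in \<open>auto simp: T_def V_def\<close>)
  ultimately have "card V = k * card T" by (simp add: mult.commute)
  moreover have "card U = card V + (if 0 \<in> U then 1 else 0)"
    using card.remove[OF fin, of 0] by (cases "0 \<in> U") (simp_all add: V_def)
  ultimately show ?thesis by auto
qed

section \<open>Equivariant endomorphisms in the \<open>z\<close>-line\<close>

context surface_quotient
begin

definition invariant :: "(point3 \<Rightarrow> complex) \<Rightarrow> bool" where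
  "invariant b \<longleftrightarrow> b \<in> regular S \<and> (\<forall>e\<in>H. \<forall>p\<in>points S. b (act e p) = b p)"

text \<open>
  A function on the quotient is obtained by evaluation at any representative of the orbit.
\<close>

definition on_orbits :: "(point3 \<Rightarrow> complex) \<Rightarrow> point3 set \<Rightarrow> complex" where
  "on_orbits b = (\<lambda>P. b (SOME q. q \<in> P))"

lemma invariantI: "b \<in> regular S \<Longrightarrow> (\<And>e p. e \<in> H \<Longrightarrow> p \<in> points S \<Longrightarrow> b (act e p) = b p) \<Longrightarrow> invariant b"
  by (simp add: invariant_def)

lemma on_orbits_orbit:
  assumes "invariant b" "p \<in> points S" shows "on_orbits b (\<pi> p) = b p"
proof -
  have "(SOME q. q \<in> \<pi> p) \<in> \<pi> p" using in_orbit by (rule someI)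
  then show ?thesis using assms by (auto simp: on_orbits_def orbit_def invariant_def)
qed

lemma on_orbits_regular: "invariant b \<Longrightarrow> on_orbits b \<in> regular Sq"
  unfolding regular_Sq
  by (rule regular_cong[OF S_tilde, of b]) (auto simp: invariant_def on_orbits_orbit)

end

locale plane_endo = surface_quotient k r a k for k r a :: nat +
  fixes f :: "point3 set \<Rightarrow> point3 set"
  assumes f: "morphism Sq Sq f"
    and f_equivariant: "equivariant Sq (induced_torus_action r) (induced_torus_action r) f"
begin

text \<open>
  A set-theoretic lift of the endomorphism to the covering surface. It need not be regular, but
  its composition with an invariant regular function is, and only these compositions are used.
\<close>

definition \<phi> :: "point3 \<Rightarrow> point3" where
  "\<phi> p = (SOME q. q \<in> points S \<and> f (\<pi> p) = \<pi> q)"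

lemma phi: assumes "p \<in> points S" shows "\<phi> p \<in> points S" "f (\<pi> p) = \<pi> (\<phi> p)"
proof -
  have "f (\<pi> p) \<in> \<pi> ` points S" using morphism_point[OF f, of "\<pi> p"] assms by (auto simp: points_Sq)
  then have "\<exists>q. q \<in> points S \<and> f (\<pi> p) = \<pi> q" by blast
  from someI_ex[OF this] show "\<phi> p \<in> points S" "f (\<pi> p) = \<pi> (\<phi> p)" by (simp_all add: \<phi>_def)
qed

lemma pull_eq: "invariant b \<Longrightarrow> p \<in> points S \<Longrightarrow> on_orbits b (f (\<pi> p)) = b (\<phi> p)"
  by (simp add: phi on_orbits_orbit)

lemma pull_regular: assumes b: "invariant b" shows "(\<lambda>p. b (\<phi> p)) \<in> regular S"
proof (rule regular_cong[OF S_tilde])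
  show "(\<lambda>p. on_orbits b (f (\<pi> p))) \<in> regular S"
    using morphism_regular[OF f on_orbits_regular[OF b]] by (simp add: regular_Sq)
qed (rule pull_eq[OF b])

lemma pull_act: assumes "invariant b" "e \<in> H" "p \<in> points S" shows "b (\<phi> (act e p)) = b (\<phi> p)"
  using pull_eq[OF assms(1) act_point[OF assms(2,3)]] pull_eq[OF assms(1,3)] orbit_act[OF assms(2)] by simp

lemma f_torus: "l \<noteq> 0 \<Longrightarrow> p \<in> points S \<Longrightarrow> f (\<pi> (torus_action r l p)) = \<pi> (torus_action r l (\<phi> p))"
  using f_equivariant phi[of p]
  by (auto simp: equivariant_def points_Sq induced_torus_orbit[symmetric])

lemma pull_torus:
  assumes b: "invariant b" and l: "l \<noteq> 0" and p: "p \<in> points S"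
    and w: "\<And>q. q \<in> points S \<Longrightarrow> b (torus_action r l q) = c * b q"
  shows "b (\<phi> (torus_action r l p)) = c * b (\<phi> p)"
proof -
  have "b (\<phi> (torus_action r l p)) = on_orbits b (f (\<pi> (torus_action r l p)))"
    using pull_eq[OF b torus_point[OF l p]] by simp
  also have "\<dots> = b (torus_action r l (\<phi> p))"
    unfolding f_torus[OF l p] by (rule on_orbits_orbit[OF b torus_point[OF l phi(1)[OF p]]])
  finally show ?thesis using w[OF phi(1)[OF p]] by simp
qed

text \<open>
  The polynomial in \<open>z\<close> that represents the pullback of an invariant function of
  weight \<open>n\<close>.
\<close>

definition transform :: "nat \<Rightarrow> (point3 \<Rightarrow> complex) \<Rightarrow> complex poly" where
  "transform n b = (SOME q. \<forall>p\<in>points S. b (\<phi> p) = coord_x p ^ n * poly q (coord_z p))"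

lemma transform:
  assumes b: "invariant b" and w: "\<And>l q. l \<noteq> 0 \<Longrightarrow> q \<in> points S \<Longrightarrow> b (torus_action r l q) = l ^ n * b q"
    and p: "p \<in> points S"
  shows "b (\<phi> p) = coord_x p ^ n * poly (transform n b) (coord_z p)"
proof -
  have "\<exists>q. \<forall>p\<in>points S. b (\<phi> p) = coord_x p ^ n * poly q (coord_z p)"
    by (rule weight_function[OF k0 r2 pull_regular[OF b]]) (rule pull_torus[OF b], auto simp: w)
  from someI_ex[OF this] show ?thesis using p by (simp add: transform_def)
qed

lemma transform_rotate:
  assumes b: "invariant b" and w: "\<And>l q. l \<noteq> 0 \<Longrightarrow> q \<in> points S \<Longrightarrow> b (torus_action r l q) = l ^ n * b q"
    and e: "e ^ k = 1"
  shows "e ^ n * poly (transform n b) (inverse (e ^ a) * z) = poly (transform n b) z"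
proof -
  have eH: "e \<in> H" using e by (simp add: H_def)
  have p: "(1, z ^ k - 1, z) \<in> points S" by simp
  show ?thesis
    using transform[OF b w p] transform[OF b w act_point[OF eH p]] pull_act[OF b eH p] by simp
qed

text \<open>
  An inverse of \<open>a\<close> modulo \<open>k\<close>.
\<close>

definition inv_a :: nat where "inv_a = (SOME i. i < k \<and> [a * i = 1] (mod k))"

lemma inv_a: "inv_a < k" "[a * inv_a = 1] (mod k)"
proof -
  obtain i where "[a * i = 1] (mod k)" using cong_solve_coprime_nat[OF coprime_ak] by auto
  then have "[a * (i mod k) = 1] (mod k)" by (simp add: cong_def mod_mult_right_eq)
  then have "\<exists>i. i < k \<and> [a * i = 1] (mod k)" using k0 by (intro exI[of _ "i mod k"]) simp
  from someI_ex[OF this] show "inv_a < k" "[a * inv_a = 1] (mod k)" by (simp_all add: inv_a_def)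
qed

lemma unity_power_cong:
  fixes e :: complex assumes "e ^ k = 1" "[i = j] (mod k)" shows "e ^ i = e ^ j"
proof -
  have "e ^ i = e ^ (i mod k)" for i
    using assms(1) mult_div_mod_eq[of k i, symmetric] by (metis mult_1 power_add power_mult power_one)
  then show ?thesis using assms(2) by (metis cong_def)
qed

lemma unity_inv_a: assumes "e ^ k = (1::complex)" shows "(e ^ a) ^ inv_a = e"
  using unity_power_cong[OF assms inv_a(2)] by (simp add: power_mult)

text \<open>
  The invariant monomials that determine the endomorphism. Near a point of the surface, suitable
  ones among them serve as coordinates of the quotient: \<open>inv_s\<close> is a coordinate
  along \<open>z = 0\<close>, and \<open>inv_w\<close> is one along \<open>x = 0\<close>.
\<close>

definition "inv_t p = coord_z p ^ k" for p :: point3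
definition "inv_u p = coord_x p ^ k" for p :: point3
definition "inv_w p = coord_x p * coord_z p ^ inv_a" for p :: point3
definition "inv_s p = coord_x p ^ a * coord_z p" for p :: point3
definition "inv_v p = coord_y p ^ k" for p :: point3

lemma unity_pow_a: "e \<in> H \<Longrightarrow> (e ^ n) ^ k = 1"
  using H_pow_k[of e] by (simp flip: power_mult add: mult.commute[of n]) (simp add: power_mult)

lemma invariants: "invariant inv_t" "invariant inv_u" "invariant inv_w" "invariant inv_s" "invariant inv_v"
proof -
  note ri = regular_intros[OF S_tilde] coord_regular
  show "invariant inv_t"
  proof (rule invariantI)
    show "inv_t \<in> regular S" unfolding inv_t_def[abs_def] by (intro ri)
  qed (simp add: inv_t_def power_mult_distrib power_inverse unity_pow_a)
  show "invariant inv_u"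
  proof (rule invariantI)
    show "inv_u \<in> regular S" unfolding inv_u_def[abs_def] by (intro ri)
  qed (simp add: inv_u_def power_mult_distrib H_pow_k)
  show "invariant inv_w"
  proof (rule invariantI)
    show "inv_w \<in> regular S" unfolding inv_w_def[abs_def] by (intro ri)
  qed (simp add: inv_w_def power_mult_distrib power_inverse unity_inv_a H_pow_k H_nonzero)
  show "invariant inv_s"
  proof (rule invariantI)
    show "inv_s \<in> regular S" unfolding inv_s_def[abs_def] by (intro ri)
  qed (simp add: inv_s_def power_mult_distrib H_nonzero)
  show "invariant inv_v"
  proof (rule invariantI)
    show "inv_v \<in> regular S" unfolding inv_v_def[abs_def] by (intro ri)
  qed (simp add: inv_v_def power_mult_distrib power_inverse unity_pow_a)
qed

lemma torus_weights:
  "inv_t (torus_action r l q) = l ^ 0 * inv_t q" "inv_u (torus_action r l q) = l ^ k * inv_u q"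
  "inv_w (torus_action r l q) = l ^ 1 * inv_w q" "inv_s (torus_action r l q) = l ^ a * inv_s q"
  by (simp_all add: inv_t_def inv_u_def inv_w_def inv_s_def power_mult_distrib)

definition "t_poly = transform 0 inv_t"
definition "u_poly = transform k inv_u"
definition "w_poly = transform 1 inv_w"
definition "s_poly = transform a inv_s"

lemma basic_transforms:
  assumes p: "p \<in> points S"
  shows "coord_z (\<phi> p) ^ k = poly t_poly (coord_z p)" "coord_x (\<phi> p) ^ k = coord_x p ^ k * poly u_poly (coord_z p)"
    "coord_x (\<phi> p) * coord_z (\<phi> p) ^ inv_a = coord_x p * poly w_poly (coord_z p)"
    "coord_x (\<phi> p) ^ a * coord_z (\<phi> p) = coord_x p ^ a * poly s_poly (coord_z p)"
proof -
  have "inv_t (\<phi> p) = coord_x p ^ 0 * poly t_poly (coord_z p)"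
    unfolding t_poly_def by (rule transform[OF invariants(1) torus_weights(1) p])
  then show "coord_z (\<phi> p) ^ k = poly t_poly (coord_z p)" by (simp add: inv_t_def)
  have "inv_u (\<phi> p) = coord_x p ^ k * poly u_poly (coord_z p)"
    unfolding u_poly_def by (rule transform[OF invariants(2) torus_weights(2) p])
  then show "coord_x (\<phi> p) ^ k = coord_x p ^ k * poly u_poly (coord_z p)" by (simp add: inv_u_def)
  have "inv_w (\<phi> p) = coord_x p ^ 1 * poly w_poly (coord_z p)"
    unfolding w_poly_def by (rule transform[OF invariants(3) torus_weights(3) p])
  then show "coord_x (\<phi> p) * coord_z (\<phi> p) ^ inv_a = coord_x p * poly w_poly (coord_z p)"
    by (simp add: inv_w_def)
  have "inv_s (\<phi> p) = coord_x p ^ a * poly s_poly (coord_z p)"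
    unfolding s_poly_def by (rule transform[OF invariants(4) torus_weights(4) p])
  then show "coord_x (\<phi> p) ^ a * coord_z (\<phi> p) = coord_x p ^ a * poly s_poly (coord_z p)"
    by (simp add: inv_s_def)
qed

lemma rotate_transforms:
  assumes w: "w ^ k = 1"
  shows "poly t_poly (w * z) = poly t_poly z" "poly u_poly (w * z) = poly u_poly z" "poly w_poly (w * z) = w ^ inv_a * poly w_poly z"
proof -
  define e where "e = inverse (w ^ inv_a)"
  have wH: "w \<in> H" using w by (simp add: H_def)
  have ek: "e ^ k = 1" using unity_pow_a[OF wH, of inv_a] by (simp add: e_def power_inverse)
  have "(w ^ inv_a) ^ a = w" using unity_inv_a[OF w] by (simp flip: power_mult add: mult.commute)
  then have ea: "inverse (e ^ a) = w" by (simp add: e_def power_inverse)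
  note tr = transform_rotate[OF _ _ ek, of _ _ z, unfolded ea]
  show "poly t_poly (w * z) = poly t_poly z" using tr[OF invariants(1) torus_weights(1)] by (simp add: t_poly_def)
  show "poly u_poly (w * z) = poly u_poly z" using tr[OF invariants(2) torus_weights(2)] ek by (simp add: u_poly_def)
  have "e * poly w_poly (w * z) = poly w_poly z" using tr[OF invariants(3) torus_weights(3)] by (simp add: w_poly_def)
  moreover have "w ^ inv_a \<noteq> 0" using H_nonzero[OF wH] by simp
  ultimately show "poly w_poly (w * z) = w ^ inv_a * poly w_poly z" by (simp add: e_def field_simps)
qed

text \<open>
  The slice of the torus action over the \<open>z\<close>-line.
\<close>

abbreviation base :: "complex \<Rightarrow> point3" where "base z \<equiv> (1, z ^ k - 1, z)"

lemma polynomial_relations: "w_poly ^ k = u_poly * t_poly ^ inv_a" "s_poly ^ k = u_poly ^ a * t_poly"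
proof -
  show "w_poly ^ k = u_poly * t_poly ^ inv_a"
  proof (rule poly_eqI_eval)
    fix z
    have "(coord_x (\<phi> (base z)) * coord_z (\<phi> (base z)) ^ inv_a) ^ k =
      coord_x (\<phi> (base z)) ^ k * (coord_z (\<phi> (base z)) ^ k) ^ inv_a"
      by (simp add: power_mult_distrib) (simp add: mult.commute flip: power_mult)
    then show "poly (w_poly ^ k) z = poly (u_poly * t_poly ^ inv_a) z" using basic_transforms[of "base z"] by simp
  qed
  show "s_poly ^ k = u_poly ^ a * t_poly"
  proof (rule poly_eqI_eval)
    fix z
    have "(coord_x (\<phi> (base z)) ^ a * coord_z (\<phi> (base z))) ^ k =
      (coord_x (\<phi> (base z)) ^ k) ^ a * coord_z (\<phi> (base z)) ^ k"
      by (simp add: power_mult_distrib) (simp add: mult.commute flip: power_mult)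
    then show "poly (s_poly ^ k) z = poly (u_poly ^ a * t_poly) z" using basic_transforms[of "base z"] by simp
  qed
qed

text \<open>
  The same as \<open>weight_function\<close> for negative weights, after multiplication by a
  power of \<open>x\<close>.
\<close>

lemma clear_weight:
  assumes b: "invariant b" and w: "\<And>l q. l \<noteq> 0 \<Longrightarrow> q \<in> points S \<Longrightarrow> b (torus_action r l q) = inverse (l ^ n) * b q"
  shows "\<exists>m. \<forall>p\<in>points S. coord_x p ^ n * b (\<phi> p) = poly m (coord_z p)"
proof -
  have reg: "(\<lambda>p. coord_x p ^ n * b (\<phi> p)) \<in> regular S"
    by (intro regular_intros[OF S_tilde] coord_regular pull_regular b)
  have wt: "coord_x (torus_action r l p) ^ n * b (\<phi> (torus_action r l p)) = l ^ 0 * (coord_x p ^ n * b (\<phi> p))"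
    if l: "l \<noteq> 0" and p: "p \<in> points S" for l p
    using pull_torus[OF b l p w[OF l]] l by (simp add: power_mult_distrib field_simps)
  from weight_function[OF k0 r2 reg wt] show ?thesis by simp
qed

lemma orbit_fixed_point:
  assumes q: "q \<in> points S" and fixed: "\<pi> (torus_action r 2 q) = \<pi> q"
  shows "coord_x q = 0 \<and> coord_y q = 0"
proof -
  obtain e where e: "e \<in> H" "torus_action r 2 q = act e q" using fixed[symmetric] unfolding orbit_eq_iff by blast
  have ne: "(2::complex) ^ n \<noteq> 1" if "0 < n" for n
  proof
    assume "(2::complex) ^ n = 1"
    then have "norm ((2::complex) ^ n) = 1" by simp
    then have "(2::real) ^ n = 1" by (simp add: norm_power)
    then show False using that one_less_power[of "2::real" n] by simp
  qed
  have "coord_x q = 0"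
  proof (rule ccontr)
    assume x: "coord_x q \<noteq> 0"
    have "2 * coord_x q = e * coord_x q" using arg_cong[OF e(2), of coord_x] by simp
    then have "e = 2" using x by simp
    then show False using H_pow_k[OF e(1)] ne[OF k0] by simp
  qed
  moreover have "coord_y q = 0"
  proof (rule ccontr)
    assume y: "coord_y q \<noteq> 0"
    have "inverse (2 ^ r) * coord_y q = inverse (e ^ r) * coord_y q" using arg_cong[OF e(2), of coord_y] by simp
    then have "2 ^ r = e ^ r" using y by simp
    then have "(2 ^ r) ^ k = (1::complex)" using unity_pow_a[OF e(1), of r] by simp
    then show False using ne[of "r * k"] r2 k0 by (simp add: power_mult)
  qed
  ultimately show ?thesis by blast
qed

text \<open>
  Fixed points of the torus go to fixed points.
\<close>

lemma phi_fixed: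
  assumes z: "z ^ k = 1"
  shows "coord_x (\<phi> (0, 0, z)) = 0" "coord_y (\<phi> (0, 0, z)) = 0"
proof -
  have p: "(0, 0, z) \<in> points S" using z r2 by (simp add: power_0_left)
  have "torus_action r 2 (0, 0, z) = (0, 0, z)" by (simp add: torus_action_eq)
  then have "\<pi> (torus_action r 2 (\<phi> (0, 0, z))) = \<pi> (\<phi> (0, 0, z))"
    using f_torus[of 2, OF _ p] phi(2)[OF p] by simp
  then show "coord_x (\<phi> (0, 0, z)) = 0" "coord_y (\<phi> (0, 0, z)) = 0"
    using orbit_fixed_point[OF phi(1)[OF p]] by auto
qed

end

locale plane_etale_endo = plane_endo +
  assumes f_etale: "etale Sq Sq f" and a_range: "a \<in> {1..k - 1}"
begin

text \<open>
  Tangent vectors can be lifted along \<open>f\<close> and along the etale covering. So every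
  tangent vector at \<open>\<phi> p\<close> comes, as far as invariant functions can tell, from
  one at \<open>p\<close>.
\<close>

lemma lift_tangent:
  assumes p: "p \<in> points S" and E: "E \<in> tangent_space S (\<phi> p)"
  shows "\<exists>D\<in>tangent_space S p. \<forall>b. invariant b \<longrightarrow> D (\<lambda>p. b (\<phi> p)) = E b"
proof -
  have mp: "morphism S Sq \<pi>" using cover_etale by (simp add: etale_def)
  have E': "tangent_map Sq \<pi> E \<in> tangent_space Sq (f (\<pi> p))"
    using tangent_map_in[OF Sq mp phi(1)[OF p] E] phi(2)[OF p] by simp
  have \<pi>p: "\<pi> p \<in> points Sq" using p by (simp add: points_Sq)
  have "bij_betw (tangent_map Sq f) (tangent_space Sq (\<pi> p)) (tangent_space Sq (f (\<pi> p)))"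
    using f_etale \<pi>p unfolding etale_def by (elim conjE bspec)
  then have "tangent_map Sq \<pi> E \<in> tangent_map Sq f ` tangent_space Sq (\<pi> p)"
    using E' by (simp only: bij_betw_imp_surj_on)
  then obtain D' where D': "tangent_map Sq \<pi> E = tangent_map Sq f D'" "D' \<in> tangent_space Sq (\<pi> p)"
    by (rule imageE)
  have "bij_betw (tangent_map Sq \<pi>) (tangent_space S p) (tangent_space Sq (\<pi> p))"
    using cover_etale p unfolding etale_def by (elim conjE bspec)
  then have "D' \<in> tangent_map Sq \<pi> ` tangent_space S p"
    using D'(2) by (simp only: bij_betw_imp_surj_on)
  then obtain D where D: "D' = tangent_map Sq \<pi> D" "D \<in> tangent_space S p"
    by (rule imageE)
  have "D (\<lambda>p. b (\<phi> p)) = E b" if b: "invariant b" for b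
  proof -
    have breg: "b \<in> regular S" using b by (simp add: invariant_def)
    have r0: "(\<lambda>P. on_orbits b (f P)) \<in> regular Sq" by (rule morphism_regular[OF f on_orbits_regular[OF b]])
    then have r1: "(\<lambda>p. on_orbits b (f (\<pi> p))) \<in> regular S" by (simp add: regular_Sq)
    have r2: "(\<lambda>p. on_orbits b (\<pi> p)) \<in> regular S" using on_orbits_regular[OF b] by (simp add: regular_Sq)
    have "D (\<lambda>p. b (\<phi> p)) = D (\<lambda>p. on_orbits b (f (\<pi> p)))"
      by (rule tangent_cong[OF D(2) pull_regular[OF b] r1]) (simp add: pull_eq[OF b])
    also have "\<dots> = tangent_map Sq f D' (on_orbits b)"
      using r0 by (simp add: tangent_map_eq on_orbits_regular[OF b] D(1))
    also have "\<dots> = E (\<lambda>p. on_orbits b (\<pi> p))"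
      by (simp add: D'(1)[symmetric] tangent_map_eq on_orbits_regular[OF b])
    also have "\<dots> = E b"
      by (rule tangent_cong[OF E r2 breg]) (simp add: on_orbits_orbit[OF b])
    finally show ?thesis .
  qed
  then show ?thesis using D(2) by blast
qed

lemma D_weighted:
  assumes D: "D \<in> tangent_space S (x, y, z)" and b: "invariant b"
    and w: "\<And>l q. l \<noteq> 0 \<Longrightarrow> q \<in> points S \<Longrightarrow> b (torus_action r l q) = l ^ n * b q"
  shows "D (\<lambda>p. b (\<phi> p)) = x ^ n * poly (pderiv (transform n b)) z * D coord_z +
    poly (transform n b) z * (of_nat n * x ^ (n - 1) * D coord_x)"
proof -
  have reg: "(\<lambda>p. coord_x p ^ n) \<in> regular S" "(\<lambda>p. poly (transform n b) (coord_z p)) \<in> regular S"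
    by (intro regular_intros[OF S_tilde] coord_regular)+
  have "D (\<lambda>p. b (\<phi> p)) = D (\<lambda>p. coord_x p ^ n * poly (transform n b) (coord_z p))"
    by (rule tangent_cong[OF D pull_regular[OF b] regular_mult[OF S_tilde reg]]) (rule transform[OF b w])
  then show ?thesis
    using tangent_mult[OF D reg] tangent_power[OF S_tilde D coord_regular(1), of n]
      tangent_poly[OF S_tilde D coord_regular(3)] by simp
qed

lemma E_basic:
  assumes E: "E \<in> tangent_space S (x, y, z)"
  shows "E inv_t = of_nat k * z ^ (k - 1) * E coord_z"
    "E inv_w = x * (of_nat inv_a * z ^ (inv_a - 1) * E coord_z) + z ^ inv_a * E coord_x"
    "E inv_s = x ^ a * E coord_z + z * (of_nat a * x ^ (a - 1) * E coord_x)"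
proof -
  note rp = regular_power[OF S_tilde coord_regular(1)] regular_power[OF S_tilde coord_regular(3)]
  show "E inv_t = of_nat k * z ^ (k - 1) * E coord_z"
    using tangent_power[OF S_tilde E coord_regular(3), of k] by (simp add: inv_t_def[abs_def])
  show "E inv_w = x * (of_nat inv_a * z ^ (inv_a - 1) * E coord_z) + z ^ inv_a * E coord_x"
    using tangent_mult[OF E coord_regular(1) rp(2), of inv_a] tangent_power[OF S_tilde E coord_regular(3), of inv_a]
    by (simp add: inv_w_def[abs_def])
  show "E inv_s = x ^ a * E coord_z + z * (of_nat a * x ^ (a - 1) * E coord_x)"
    using tangent_mult[OF E rp(1) coord_regular(3), of a] tangent_power[OF S_tilde E coord_regular(1), of a]
    by (simp add: inv_s_def[abs_def])
qed

lemma base_point: "base z \<in> points S" by simp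

text \<open>
  The conclusion expresses the derivatives of the three invariants in a prescribed direction at
  \<open>\<phi> (base z0)\<close> through their polynomials at \<open>z0\<close>. Each choice of
  direction gives a nonvanishing statement about these polynomials.
\<close>

lemma tangent_at_base:
  assumes q: "\<phi> (base z0) = (x, y, z)"
    and rel: "of_nat r * x ^ (r - 1) * y * \<alpha> + x ^ r * \<beta> = of_nat k * z ^ (k - 1) * \<gamma>"
  shows "\<exists>\<alpha>' \<gamma>'. of_nat k * z ^ (k - 1) * \<gamma> = poly (pderiv t_poly) z0 * \<gamma>' \<and>
    x * (of_nat inv_a * z ^ (inv_a - 1) * \<gamma>) + z ^ inv_a * \<alpha> = poly (pderiv w_poly) z0 * \<gamma>' + poly w_poly z0 * \<alpha>' \<and>
    x ^ a * \<gamma> + z * (of_nat a * x ^ (a - 1) * \<alpha>) = poly (pderiv s_poly) z0 * \<gamma>' + of_nat a * poly s_poly z0 * \<alpha>'"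
proof -
  have "(x, y, z) \<in> points S" using phi(1)[OF base_point[of z0]] q by simp
  then have "x ^ r * y = z ^ k - 1" by simp
  from tangent_S_tilde_exists[OF k0 r2 this rel] obtain E where
    E: "E \<in> tangent_space S (x, y, z)" "E coord_x = \<alpha>" "E coord_y = \<beta>" "E coord_z = \<gamma>" by blast
  obtain D where D: "D \<in> tangent_space S (base z0)" "\<And>b. invariant b \<Longrightarrow> D (\<lambda>p. b (\<phi> p)) = E b"
    using lift_tangent[OF base_point[of z0]] E(1) q by metis
  have "E inv_t = poly (pderiv t_poly) z0 * D coord_z"
    using D_weighted[OF D(1) invariants(1) torus_weights(1)] D(2)[OF invariants(1)] by (simp add: t_poly_def)
  moreover have "E inv_w = poly (pderiv w_poly) z0 * D coord_z + poly w_poly z0 * D coord_x"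
    using D_weighted[OF D(1) invariants(3) torus_weights(3)] D(2)[OF invariants(3)] by (simp add: w_poly_def)
  moreover have "E inv_s = poly (pderiv s_poly) z0 * D coord_z + of_nat a * poly s_poly z0 * D coord_x"
    using D_weighted[OF D(1) invariants(4) torus_weights(4)] D(2)[OF invariants(4)] by (simp add: s_poly_def mult_ac)
  ultimately show ?thesis using E_basic[OF E(1)] E(2-4) by metis
qed

text \<open>
  A direction that moves \<open>z\<close> also moves \<open>inv_t\<close>, as long as
  \<open>z\<close> is not zero there.
\<close>

lemma generic_unramified:
  assumes "poly t_poly z0 \<noteq> 0" "poly u_poly z0 \<noteq> 0" shows "poly (pderiv t_poly) z0 \<noteq> 0"
proof -
  obtain x y z where q: "\<phi> (base z0) = (x, y, z)" by (cases "\<phi> (base z0)")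
  have "z ^ k \<noteq> 0" "x ^ k \<noteq> 0" using basic_transforms[OF base_point[of z0]] q assms by simp_all
  then have xz: "x \<noteq> 0" "z \<noteq> 0" using k0 by (auto simp: power_0_left)
  have "of_nat r * x ^ (r - 1) * y * 0 + x ^ r * (of_nat k * z ^ (k - 1) / x ^ r) = of_nat k * z ^ (k - 1) * 1"
    using xz by simp
  from tangent_at_base[OF q this] show ?thesis using xz k0 by auto
qed

text \<open>
  Along \<open>z = 0\<close> the function \<open>inv_s\<close> is a local coordinate, so
  \<open>s_poly\<close> has a simple zero, and \<open>t_poly\<close> is its \<open>k\<close>-th
  power up to a unit.
\<close>

lemma zero_order:
  assumes t: "poly t_poly z0 = 0" and up0: "u_poly \<noteq> 0" and tp0: "t_poly \<noteq> 0" shows "Polynomial.order z0 t_poly = k"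
proof -
  obtain x y z where q: "\<phi> (base z0) = (x, y, z)" by (cases "\<phi> (base z0)")
  have b: "z ^ k = 0" "x ^ k = poly u_poly z0" "x ^ a * z = poly s_poly z0"
    using basic_transforms[OF base_point[of z0]] q t by simp_all
  then have z: "z = 0" by simp
  have "x ^ r * y = z ^ k - 1" using phi(1)[OF base_point[of z0]] q by simp
  then have x: "x \<noteq> 0" using z k0 r2 by (auto simp: power_0_left)
  have u: "poly u_poly z0 \<noteq> 0" using b x by (metis power_not_zero)
  have s: "poly s_poly z0 = 0" using b z by simp
  have "of_nat r * x ^ (r - 1) * y * 0 + x ^ r * 0 = of_nat k * z ^ (k - 1) * 1" using z k2 by (simp add: power_0_left)
  from tangent_at_base[OF q this] have "poly (pderiv s_poly) z0 \<noteq> 0" using x z s by auto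
  then have o: "Polynomial.order z0 s_poly = 1" using s by (intro order_one)
  have "s_poly \<noteq> 0" using \<open>poly (pderiv s_poly) z0 \<noteq> 0\<close> by auto
  then have "k = Polynomial.order z0 (s_poly ^ k)" using o by (simp add: order_power)
  also have "\<dots> = Polynomial.order z0 (u_poly ^ a) + Polynomial.order z0 t_poly"
    unfolding polynomial_relations using up0 tp0 by (simp add: order_mult)
  also have "Polynomial.order z0 (u_poly ^ a) = 0" using u up0 by (simp add: order_power order_root)
  finally show ?thesis by simp
qed

lemma inv_a_order: "[a * (inv_a * ((k - 1) * r)) + r = 0] (mod k)"
proof -
  have "[(a * inv_a) * ((k - 1) * r) + r = 1 * ((k - 1) * r) + r] (mod k)"
    by (intro cong_add cong_mult inv_a cong_refl)
  moreover have "1 * ((k - 1) * r) + r = k * r" using k2 by (cases k) simp_all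
  ultimately show ?thesis by (simp add: cong_def mult.assoc)
qed

text \<open>
  A free torus orbit cannot be collapsed to a fixed point by an etale map: near the fixed point
  the invariants \<open>inv_w\<close> and \<open>y z\<^sup>c\<close> are independent
  coordinates, but on the orbit of the base point both have vanishing value there, so their
  derivatives along the orbit vanish and the tangent map has rank at most one.
\<close>

lemma phi_base_not_fixed: "\<not> (coord_x (\<phi> (base z0)) = 0 \<and> coord_y (\<phi> (base z0)) = 0)"
proof
  assume fix_: "coord_x (\<phi> (base z0)) = 0 \<and> coord_y (\<phi> (base z0)) = 0"
  then obtain z where q: "\<phi> (base z0) = (0, 0, z)" by (cases "\<phi> (base z0)") auto
  have zk: "z ^ k = 1" using phi(1)[OF base_point[of z0]] q r2 by (simp add: power_0_left)
  then have z: "z \<noteq> 0" using k0 by (auto simp: power_0_left)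
  (* then a c + r is congruent to (k - 1) r + r = k r, so that y z^c is invariant *)
  define c where "c = inv_a * ((k - 1) * r)"
  define b where "b p = coord_y p * coord_z p ^ c" for p
  have b: "invariant b"
  proof (rule invariantI)
    show "b \<in> regular S" unfolding b_def[abs_def] by (intro regular_intros[OF S_tilde] coord_regular)
    fix e p assume e: "e \<in> H"
    have "(e ^ a) ^ c * e ^ r = e ^ (a * c + r)" by (simp add: power_add power_mult)
    also have "\<dots> = 1" using unity_power_cong[OF H_pow_k[OF e] inv_a_order] by (simp add: c_def)
    finally have "inverse (e ^ r) * inverse (e ^ a) ^ c = 1"
      by (simp add: power_inverse mult.commute flip: inverse_mult_distrib)
    then show "b (act e p) = b p"
      by (simp add: b_def power_mult_distrib)
  qed
  have "b (torus_action r l q) = inverse (l ^ r) * b q" for l q by (simp add: b_def)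
  then obtain m where m: "\<And>p. p \<in> points S \<Longrightarrow> coord_x p ^ r * b (\<phi> p) = poly m (coord_z p)"
    using clear_weight[OF b] by metis
  have wp0: "poly w_poly z0 = 0" using basic_transforms(3)[OF base_point[of z0]] q by simp
  have Db: "D (\<lambda>p. b (\<phi> p)) = poly (pderiv m) z0 * D coord_z" if D: "D \<in> tangent_space S (base z0)" for D
  proof -
    have xr: "(\<lambda>p. coord_x p ^ r) \<in> regular S" by (intro regular_intros[OF S_tilde] coord_regular)
    have mz: "(\<lambda>p. poly m (coord_z p)) \<in> regular S" by (intro regular_intros[OF S_tilde] coord_regular)
    have "D (\<lambda>p. coord_x p ^ r * b (\<phi> p)) = D (\<lambda>p. poly m (coord_z p))"
      by (rule tangent_cong[OF D regular_mult[OF S_tilde xr pull_regular[OF b]] mz]) (rule m)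
    moreover have "b (\<phi> (base z0)) = 0" by (simp add: q b_def)
    ultimately show ?thesis
      using tangent_mult[OF D xr pull_regular[OF b]] tangent_poly[OF S_tilde D coord_regular(3), of m] by simp
  qed
  have Dw: "D (\<lambda>p. inv_w (\<phi> p)) = poly (pderiv w_poly) z0 * D coord_z" if D: "D \<in> tangent_space S (base z0)" for D
    using D_weighted[OF D invariants(3) torus_weights(3)] wp0 by (simp add: w_poly_def)
  have ex: "\<exists>D\<in>tangent_space S (base z0). poly (pderiv w_poly) z0 * D coord_z = z ^ inv_a * \<alpha> \<and>
      poly (pderiv m) z0 * D coord_z = z ^ c * \<beta>" for \<alpha> \<beta>
  proof -
    have p: "0 ^ r * 0 = z ^ k - 1" using zk by simp
    have "of_nat r * 0 ^ (r - 1) * 0 * \<alpha> + 0 ^ r * \<beta> = of_nat k * z ^ (k - 1) * 0" using r2 by (simp add: power_0_left)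
    from tangent_S_tilde_exists[OF k0 r2 p this] obtain E where
      E: "E \<in> tangent_space S (0, 0, z)" "E coord_x = \<alpha>" "E coord_y = \<beta>" "E coord_z = 0" by blast
    obtain D where D: "D \<in> tangent_space S (base z0)" "\<And>b. invariant b \<Longrightarrow> D (\<lambda>p. b (\<phi> p)) = E b"
      using lift_tangent[OF base_point[of z0]] E(1) q by metis
    have "E b = z ^ c * \<beta>"
      using tangent_mult[OF E(1) coord_regular(2) regular_power[OF S_tilde coord_regular(3), of c]] E(3)
      by (simp add: b_def[abs_def])
    then have "poly (pderiv m) z0 * D coord_z = z ^ c * \<beta>" using Db[OF D(1)] D(2)[OF b] by simp
    moreover have "poly (pderiv w_poly) z0 * D coord_z = z ^ inv_a * \<alpha>"
      using Dw[OF D(1)] D(2)[OF invariants(3)] E_basic(2)[OF E(1)] E by simp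
    ultimately show ?thesis using D(1) by blast
  qed
  obtain D1 where D1: "poly (pderiv w_poly) z0 * D1 coord_z = z ^ inv_a * 1" "poly (pderiv m) z0 * D1 coord_z = z ^ c * 0"
    using ex[of 1 0] by blast
  obtain D2 where D2: "poly (pderiv m) z0 * D2 coord_z = z ^ c * 1" using ex[of 0 1] by blast
  have "D1 coord_z \<noteq> 0" using D1(1) z by auto
  then have "poly (pderiv m) z0 = 0" using D1(2) by simp
  then show False using D2 z by simp
qed

text \<open>
  Over a zero of \<open>u_poly\<close> the image lies on the line \<open>x = 0\<close>, where
  \<open>inv_w\<close> is a local coordinate; so \<open>w_poly\<close> has a simple zero and
  \<open>u_poly\<close> one of order \<open>k\<close>. As \<open>y\<close> does not vanish at
  the image, the equation of the surface gives the order of \<open>t_poly - 1\<close>. If the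
  zero is the origin, the simple zero of \<open>w_poly\<close> there has to be compatible with
  the rotation symmetry, which forces \<open>a = 1\<close>, and the zero of order
  \<open>r\<close> of \<open>t_poly - 1\<close> forces \<open>k dvd r\<close>.
\<close>

lemma hub_order:
  assumes u: "poly u_poly z0 = 0" and up0: "u_poly \<noteq> 0" and tp1: "t_poly \<noteq> 1"
  shows "poly t_poly z0 = 1" "Polynomial.order z0 (t_poly - 1) = r" "z0 = 0 \<Longrightarrow> a = 1 \<and> k dvd r"
proof -
  obtain x y z where q: "\<phi> (base z0) = (x, y, z)" by (cases "\<phi> (base z0)")
  have b: "z ^ k = poly t_poly z0" "x ^ k = poly u_poly z0" "x * z ^ inv_a = poly w_poly z0"
    using basic_transforms[OF base_point[of z0]] q by simp_all
  then have x: "x = 0" using u by simp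
  have "x ^ r * y = z ^ k - 1" using phi(1)[OF base_point[of z0]] q by simp
  then have zk: "z ^ k = 1" using x r2 by (simp add: power_0_left)
  then show t: "poly t_poly z0 = 1" using b by simp
  have z: "z \<noteq> 0" using zk k0 by (auto simp: power_0_left)
  have w: "poly w_poly z0 = 0" using b x by simp
  have "of_nat r * x ^ (r - 1) * y * 1 + x ^ r * 0 = of_nat k * z ^ (k - 1) * 0" using x r2 by (simp add: power_0_left)
  from tangent_at_base[OF q this] have w': "poly (pderiv w_poly) z0 \<noteq> 0" using x z w by auto
  then have o: "Polynomial.order z0 w_poly = 1" using w by (intro order_one)
  have "w_poly \<noteq> 0" using w' by auto
  have tp0: "t_poly \<noteq> 0" using t by auto
  have "k = Polynomial.order z0 (w_poly ^ k)" using o \<open>w_poly \<noteq> 0\<close> by (simp add: order_power)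
  also have "\<dots> = Polynomial.order z0 u_poly + Polynomial.order z0 (t_poly ^ inv_a)"
    unfolding polynomial_relations using up0 tp0 by (simp add: order_mult)
  also have "Polynomial.order z0 (t_poly ^ inv_a) = 0" using t tp0 order_root[of t_poly z0] by (simp add: order_power)
  finally have ou: "Polynomial.order z0 u_poly = k" by simp
  have y: "y \<noteq> 0" using phi_base_not_fixed[of z0] q x by simp
  have "inv_v (torus_action r l q) = inverse (l ^ (r * k)) * inv_v q" for l q
    by (simp add: inv_v_def power_mult_distrib power_inverse power_mult)
  then obtain m where m: "\<And>p. p \<in> points S \<Longrightarrow> coord_x p ^ (r * k) * inv_v (\<phi> p) = poly m (coord_z p)"
    using clear_weight[OF invariants(5)] by metis
  have mz: "poly m z' = coord_y (\<phi> (base z')) ^ k" for z' using m[OF base_point[of z']] by (simp add: inv_v_def)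
  (* the k-th power of the equation of the surface at the image point *)
  have "u_poly ^ r * m = (t_poly - 1) ^ k"
  proof (rule poly_eqI_eval)
    fix z'
    have "(coord_x (\<phi> (base z')) ^ k) ^ r * coord_y (\<phi> (base z')) ^ k = (coord_x (\<phi> (base z')) ^ r * coord_y (\<phi> (base z'))) ^ k"
      by (simp add: power_mult_distrib) (simp add: mult.commute flip: power_mult)
    also have "\<dots> = (coord_z (\<phi> (base z')) ^ k - 1) ^ k"
      using phi(1)[OF base_point[of z']] by (simp add: in_S_tilde_coord)
    finally show "poly (u_poly ^ r * m) z' = poly ((t_poly - 1) ^ k) z'"
      using basic_transforms[OF base_point[of z']] by (simp add: mz)
  qed
  moreover have m0: "poly m z0 \<noteq> 0" using mz[of z0] q y by simp
  then have "m \<noteq> 0" by auto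
  ultimately have "r * Polynomial.order z0 u_poly + Polynomial.order z0 m = k * Polynomial.order z0 (t_poly - 1)"
    using up0 tp1 by (metis order_mult order_power mult_eq_0_iff power_eq_0_iff right_minus_eq)
  then have "r * k = k * Polynomial.order z0 (t_poly - 1)" using ou m0 by (simp add: order_root)
  then show ord: "Polynomial.order z0 (t_poly - 1) = r" using k0 by (simp add: mult.commute)
  assume z00: "z0 = 0"
  have "w ^ inv_a = w" if w: "w ^ k = 1" for w :: complex
  proof -
    have "pcompose w_poly [:0, w:] = smult (w ^ inv_a) w_poly"
      by (rule poly_eqI_eval) (simp add: poly_pcompose rotate_transforms(3)[OF w] mult.commute[of _ w])
    then have "w ^ 1 * coeff w_poly 1 = w ^ inv_a * coeff w_poly 1" by (metis coeff_pcompose_scale coeff_smult)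
    moreover have "coeff w_poly 1 \<noteq> 0" using w' z00 by (simp add: poly_0_coeff_0 coeff_pderiv)
    ultimately show ?thesis by simp
  qed
  then have wa: "w ^ a = w" if "w ^ k = 1" for w :: complex using unity_inv_a[OF that] that
    by (metis power_commuting_commutes power_mult mult.commute)
  have "w ^ (a - 1) = 1" if w: "w ^ k = 1" for w :: complex
  proof -
    have "w ^ (a - 1) * w = w" using wa[OF w] a_range by (simp flip: power_Suc2)
    moreover have "w \<noteq> 0" using w k0 by (auto simp: power_0_left)
    ultimately show ?thesis by simp
  qed
  then have "k dvd a - 1" by (rule unity_group_dvd[OF k0])
  then have "a = 1" using a_range by (auto dest: dvd_imp_le)
  moreover have "w ^ r = 1" if w: "w ^ k = 1" for w :: complex
  proof -
    have "[:- 0, 1:] ^ r dvd t_poly - 1" using order_1[of 0 "t_poly - 1"] ord z00 by simp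
    then obtain g where g: "t_poly - 1 = [:- 0, 1:] ^ r * g" by blast
    have g0: "poly g 0 \<noteq> 0"
    proof
      assume "poly g 0 = 0"
      then have "[:- 0, 1:] dvd g" by (simp add: poly_eq_0_iff_dvd)
      then have "[:- 0, 1:] ^ Suc r dvd t_poly - 1" unfolding g power_Suc2 by (rule mult_dvd_mono[OF dvd_refl])
      then show False using order_2[of "t_poly - 1" 0] ord z00 tp1 by simp
    qed
    have "pcompose (t_poly - 1) [:0, w:] = t_poly - 1"
      by (rule poly_eqI_eval) (simp add: poly_pcompose rotate_transforms(1)[OF w] mult.commute[of _ w])
    then have "w ^ r * coeff (t_poly - 1) r = coeff (t_poly - 1) r" by (metis coeff_pcompose_scale)
    moreover have "coeff (t_poly - 1) r = coeff g 0"
      unfolding g by (simp add: coeff_monom_mult flip: monom_altdef[of 1, simplified])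
    ultimately show ?thesis using g0 by (metis mult_cancel_right1 poly_0_coeff_0)
  qed
  then have "k dvd r" by (rule unity_group_dvd[OF k0])
  ultimately show "a = 1 \<and> k dvd r" by blast
qed

text \<open>
  At a fixed point of the torus the map is locally equivariant and etale, so it does not
  contract the direction of \<open>x\<close>.
\<close>

lemma at_fixed_point:
  assumes z1: "z1 ^ k = 1" shows "poly t_poly z1 = 1" "poly u_poly z1 \<noteq> 0"
proof -
  have p: "(0, 0, z1) \<in> points S" using z1 r2 by (simp add: power_0_left)
  obtain z where q: "\<phi> (0, 0, z1) = (0, 0, z)" using phi_fixed[OF z1] by (cases "\<phi> (0, 0, z1)") auto
  have zk: "z ^ k = 1" using phi(1)[OF p] q r2 by (simp add: power_0_left)
  then show t: "poly t_poly z1 = 1" using basic_transforms(1)[OF p] q by simp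
  have z: "z \<noteq> 0" using zk k0 by (auto simp: power_0_left)
  have p': "0 ^ r * 0 = z ^ k - 1" using zk by simp
  have "of_nat r * 0 ^ (r - 1) * 0 * 1 + 0 ^ r * 0 = of_nat k * z ^ (k - 1) * 0" using r2 by (simp add: power_0_left)
  from tangent_S_tilde_exists[OF k0 r2 p' this] obtain E where
    E: "E \<in> tangent_space S (0, 0, z)" "E coord_x = 1" "E coord_z = 0" by blast
  obtain D where D: "D \<in> tangent_space S (0, 0, z1)" "\<And>b. invariant b \<Longrightarrow> D (\<lambda>p. b (\<phi> p)) = E b"
    using lift_tangent[OF p] E(1) q by metis
  have "z ^ inv_a = poly w_poly z1 * D coord_x"
    using D_weighted[OF D(1) invariants(3) torus_weights(3)] D(2)[OF invariants(3)] E_basic(2)[OF E(1)] E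
    by (simp add: w_poly_def)
  then have "poly w_poly z1 \<noteq> 0" using z by auto
  then have "poly w_poly z1 ^ k \<noteq> 0" by simp
  moreover have "poly w_poly z1 ^ k = poly u_poly z1 * poly t_poly z1 ^ inv_a"
    using arg_cong[OF polynomial_relations(1), of "\<lambda>p. poly p z1"] by simp
  ultimately show "poly u_poly z1 \<noteq> 0" by auto
qed

lemma u_poly_nonzero: "u_poly \<noteq> 0" and t_poly_nonzero: "t_poly \<noteq> 0" and w_poly_nonzero: "w_poly \<noteq> 0"
proof -
  show u_poly: "u_poly \<noteq> 0" and t_poly: "t_poly \<noteq> 0" using at_fixed_point[of 1] by auto
  show "w_poly \<noteq> 0" using polynomial_relations(1) u_poly t_poly k0 by (auto simp: power_0_left)
qed

lemma pderiv_t_poly_nonzero: "pderiv t_poly \<noteq> 0"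
proof
  assume 0: "pderiv t_poly = 0"
  have "u_poly * t_poly \<noteq> 0" using u_poly_nonzero t_poly_nonzero by simp
  then have "finite {z. poly (u_poly * t_poly) z = 0}" by (rule poly_roots_finite)
  then obtain z where "poly (u_poly * t_poly) z \<noteq> 0" using infinite_UNIV_char_0 by (metis (mono_tags, lifting) ex_new_if_finite mem_Collect_eq)
  then show False using generic_unramified[of z] 0 by simp
qed

lemma t_poly_not_one: "t_poly \<noteq> 1" using pderiv_t_poly_nonzero by auto

text \<open>
  The ramification count, with the rotation symmetry of the set of zeros of
  \<open>u_poly\<close>.
\<close>

theorem degree_t_poly:
  "\<exists>m N. degree t_poly = k * m \<and> m = 1 + (r - 1) * N \<and> (k dvd N \<or> (k dvd r \<and> a = 1 \<and> N mod k = 1))"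
proof -
  define U where "U = {z. poly u_poly z = 0}"
  obtain m where m: "degree t_poly = k * m" "m = 1 + (r - 1) * card U"
    using degree_from_ramification[OF k2 r2 pderiv_t_poly_nonzero u_poly_nonzero zero_order[OF _ u_poly_nonzero t_poly_nonzero]
        _ generic_unramified] hub_order(1,2)[OF _ u_poly_nonzero t_poly_not_one] by (auto simp: U_def)
  have "finite U" unfolding U_def by (rule poly_roots_finite[OF u_poly_nonzero])
  then obtain c where c: "card U = k * c + (if 0 \<in> U then 1 else 0)"
    using card_rotation_invariant[OF k0, of U] rotate_transforms(2) by (auto simp: U_def)
  have "k dvd card U \<or> (k dvd r \<and> a = 1 \<and> card U mod k = 1)"
  proof (cases "0 \<in> U")
    case True
    then have "a = 1 \<and> k dvd r" using hub_order(3)[OF _ u_poly_nonzero t_poly_not_one, of 0] by (simp add: U_def)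
    then show ?thesis using c True k2 mod_mult_self2[of 1 k c] by simp
  qed (use c in simp)
  then show ?thesis using m by blast
qed

text \<open>
  Otherwise all solutions of \<open>t_poly = 1\<close> would be \<open>k\<close>-th roots of
  unity, at which \<open>t_poly\<close> is unramified, so that its degree would be at most
  \<open>k\<close>.
\<close>

theorem collapsed_orbit:
  assumes "k < degree t_poly"
  shows "\<exists>z0. z0 ^ k \<noteq> 1 \<and> poly t_poly z0 = 1"
proof (rule ccontr)
  assume "\<not> ?thesis"
  then have sub: "{z. poly (t_poly - 1) z = 0} \<subseteq> {z. z ^ k = 1}" by auto
  have t1: "t_poly - 1 \<noteq> 0" using t_poly_not_one by simp
  have ord: "Polynomial.order z (t_poly - 1) = 1" if "poly (t_poly - 1) z = 0" for z
  proof (rule order_one[OF that])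
    have "z ^ k = 1" using sub that by auto
    then show "poly (pderiv (t_poly - 1)) z \<noteq> 0"
      using generic_unramified[of z] at_fixed_point[of z] by (simp add: pderiv_diff)
  qed
  have "degree t_poly = degree (t_poly - 1)"
    using assms degree_add_eq_left[of "-1" t_poly] by (simp add: diff_conv_add_uminus del: add_uminus_conv_diff)
  also have "\<dots> = card {z. poly (t_poly - 1) z = 0}"
    unfolding degree_eq_sum_order[OF t1] using ord by simp
  also have "\<dots> \<le> card {z::complex. z ^ k = 1}"
    using sub card_unity_roots[OF k0] k0 by (intro card_mono) (metis card.infinite less_irrefl)
  finally show False using assms card_unity_roots[OF k0] by simp
qed

end

section \<open>The degree of an extension generated by one element\<close>

context integral_variety
begin

lemma has_value_power:
  assumes "u \<in> carrier L" "has_value u p c" shows "has_value (u [^]\<^bsub>L\<^esub> (n::nat)) p (c ^ n)"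
proof -
  interpret L: field L by (rule L_field)
  show ?thesis
    by (induction n) (simp_all add: has_value_one has_value_mult[OF _ assms(2)] mult.commute[of c])
qed

end

context dominant_endo
begin

lemma dominant: "dominant X X f"
  unfolding dominant_def
proof (intro conjI allI impI)
  fix C assume C: "zariski_closed X C \<and> f ` points X \<subseteq> C"
  then obtain G where G: "G \<subseteq> R" "C = {p \<in> points X. \<forall>g\<in>G. g p = 0}" unfolding zariski_closed_def by blast
  have "g p = 0" if "g \<in> G" "p \<in> points X" for g p
  proof (rule ccontr)
    assume "g p \<noteq> 0"
    then have "g \<in> NZ" using that G(1) by (auto simp: nonzero_regular_def)
    then obtain q where "q \<in> points X" "g (f q) \<noteq> 0" using pull_nonzero unfolding nonzero_regular_def by blast
    then show False using C G(2) that by blast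
  qed
  then show "C = points X" using G(2) by blast
qed (rule f)

definition lift_poly :: "complex poly \<Rightarrow> (('a \<Rightarrow> complex) \<times> ('a \<Rightarrow> complex)) set list" where
  "lift_poly P = map (\<lambda>c. embed (\<lambda>_. c)) (rev (coeffs P))"

lemma lift_poly_pCons: "P \<noteq> 0 \<Longrightarrow> lift_poly (pCons c P) = lift_poly P @ [embed (\<lambda>_. c)]"
  by (simp add: lift_poly_def)

lemma set_lift_poly: "set (lift_poly P) \<subseteq> K"
  by (auto simp: lift_poly_def embed_const_in_K)

lemma K_carrier: "K \<subseteq> carrier L"
  using K_subfield subfieldE(3) by metis

lemma eval_lift_poly:
  assumes T: "T \<in> R" shows "ring.eval L (lift_poly P) (embed T) = embed (\<lambda>p. poly P (T p))"
proof (induction P)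
  case 0
  show ?case
  proof -
    interpret L: field L by (rule L_field)
    show ?thesis by (simp add: lift_poly_def embed_def zero_L)
  qed
next
  case (pCons c P)
  interpret L: field L by (rule L_field)
  have c: "embed (\<lambda>_. c) \<in> carrier L" by (intro embed_in closed)
  have P: "(\<lambda>p. poly P (T p)) \<in> R" by (rule regular_poly[OF X T])
  show ?case
  proof (cases "P = 0")
    case True
    then have "lift_poly (pCons c P) = [embed (\<lambda>_. c)]" using pCons.hyps by (simp add: lift_poly_def)
    then show ?thesis using True c by simp
  next
    case False
    have "L.eval (lift_poly (pCons c P)) (embed T) = L.eval (lift_poly P) (embed T) \<otimes>\<^bsub>L\<^esub> embed T \<oplus>\<^bsub>L\<^esub> embed (\<lambda>_. c)"
      unfolding lift_poly_pCons[OF False]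
      by (rule L.eval_append_aux[OF subset_trans[OF set_lift_poly K_carrier] c embed_in[OF T]])
    also have "\<dots> = embed (\<lambda>p. poly P (T p) * T p + c)"
      unfolding pCons.IH by (simp only: embed_add embed_mult regular_mult[OF X] P T closed)
    also have "\<dots> = embed (\<lambda>p. poly (pCons c P) (T p))" by (simp add: mult.commute add.commute)
    finally show ?thesis .
  qed
qed

text \<open>
  For general points \<open>p\<close> over a fixed image point, the value of a polynomial
  expression in \<open>T\<close> over the pulled back field is a polynomial in \<open>T
  p\<close> whose coefficients depend on the image point only.
\<close>

lemma value_of_eval:
  assumes T: "T \<in> R" and us: "set us \<subseteq> K"
  shows "\<exists>b Q. b \<in> NZ \<and> (\<forall>q. \<forall>n\<ge>length us. poly.coeff (Q q) n = 0) \<and>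
    (\<forall>p\<in>points X. b (f p) \<noteq> 0 \<longrightarrow> has_value (ring.eval L us (embed T)) p (poly (Q (f p)) (T p)))"
  using us
proof (induction us)
  case Nil
  interpret L: field L by (rule L_field)
  show ?case
    by (rule exI[of _ "\<lambda>_. 1"], rule exI[of _ "\<lambda>_. 0"]) (simp add: NZ_const has_value_zero)
next
  case (Cons u us)
  interpret L: field L by (rule L_field)
  obtain b Q where b: "b \<in> NZ" "\<And>q n. length us \<le> n \<Longrightarrow> poly.coeff (Q q) n = 0"
    "\<And>p. p \<in> points X \<Longrightarrow> b (f p) \<noteq> 0 \<Longrightarrow> has_value (ring.eval L us (embed T)) p (poly (Q (f p)) (T p))"
  proof -
    have "set us \<subseteq> K" using Cons.prems by simp
    from Cons.IH[OF this] obtain b Q where "b \<in> NZ" "\<forall>q. \<forall>n\<ge>length us. poly.coeff (Q q) n = 0"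
      "\<forall>p\<in>points X. b (f p) \<noteq> 0 \<longrightarrow> has_value (ring.eval L us (embed T)) p (poly (Q (f p)) (T p))"
      by (elim exE conjE)
    then show ?thesis by (intro that[of b Q]) simp_all
  qed
  obtain b' c where b': "b' \<in> NZ" "\<And>p. p \<in> points X \<Longrightarrow> b' (f p) \<noteq> 0 \<Longrightarrow> has_value u p (c (f p))"
    using K_has_value[of u] Cons.prems by (metis list.set_intros(1) subsetD)
  define Q' where "Q' q = Polynomial.monom (c q) (length us) + Q q" for q
  have "has_value (L.eval (u # us) (embed T)) p (poly (Q' (f p)) (T p))"
    if p: "p \<in> points X" and nz: "b (f p) * b' (f p) \<noteq> 0" for p
  proof -
    have "has_value (u \<otimes>\<^bsub>L\<^esub> (embed T [^]\<^bsub>L\<^esub> length us) \<oplus>\<^bsub>L\<^esub> L.eval us (embed T)) p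
        (c (f p) * T p ^ length us + poly (Q (f p)) (T p))"
      by (rule has_value_add[OF has_value_mult[OF b'(2)[OF p] has_value_power[OF embed_in[OF T] has_value_embed[OF T]]] b(3)[OF p]])
        (use nz in auto)
    then show ?thesis by (simp add: Q'_def poly_monom)
  qed
  moreover have "poly.coeff (Q' q) n = 0" if "length (u # us) \<le> n" for q n
    using that b(2) by (simp add: Q'_def)
  moreover have "(\<lambda>q. b q * b' q) \<in> NZ" by (rule NZ_mult[OF b(1) b'(1)])
  ultimately show ?case
    by (intro exI[of _ "\<lambda>q. b q * b' q"] exI[of _ Q']) simp
qed

text \<open>
  The minimal polynomial of \<open>T\<close> over the pulled back field has degree at most
  \<open>degree P\<close> because \<open>T\<close> is a root of \<open>P - f\<^sup>*T\<close>.
  It has at least this degree, because over a general point it specializes to a polynomial that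
  vanishes at the values of \<open>T\<close> on the fibre.
\<close>

theorem dimension_generated_by_one:
  fixes P :: "complex poly"
  assumes T: "T \<in> R" and pull: "\<And>p. p \<in> points X \<Longrightarrow> T (f p) = poly P (T p)" and P: "0 < Polynomial.degree P"
    and fibres: "\<And>b. b \<in> NZ \<Longrightarrow> \<exists>q A. b q \<noteq> 0 \<and> A \<subseteq> points X \<and> (\<forall>p\<in>A. f p = q) \<and> finite (T ` A) \<and> card (T ` A) = Polynomial.degree P"
    and gen: "\<And>E b. subfield E L \<Longrightarrow> K \<subseteq> E \<Longrightarrow> embed T \<in> E \<Longrightarrow> b \<in> R \<Longrightarrow> embed b \<in> E"
  shows "has_degree X X f d \<longleftrightarrow> d = Polynomial.degree P"
proof -
  interpret L: field L by (rule L_field)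
  define t where "t = embed T"
  have t: "t \<in> carrier L" unfolding t_def by (rule embed_in[OF T])
  obtain c P' where P': "P = pCons c P'" by (cases P) auto
  have P'0: "P' \<noteq> 0" using P P' by auto
  have c': "(\<lambda>p. c - T p) \<in> R" by (intro regular_diff[OF X] closed T)
  (* the polynomial P minus the pullback of T, which only changes the constant coefficient *)
  define q where "q = lift_poly P' @ [embed (\<lambda>p. c - T (f p))]"
  have last: "embed (\<lambda>p. c - T (f p)) \<in> K" by (rule embed_pull_in_K[OF c'])
  have "hd (lift_poly P') = embed (\<lambda>_. Polynomial.lead_coeff P')" "lift_poly P' \<noteq> []"
    using P'0 by (simp_all add: lift_poly_def hd_rev hd_map last_coeffs_eq_coeff_degree)
  moreover have "embed (\<lambda>_. Polynomial.lead_coeff P') \<noteq> \<zero>\<^bsub>L\<^esub>"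
    by (rule embed_nonzero[OF NZ_const]) (use P'0 in simp)
  ultimately have q: "q \<in> carrier (K [X]\<^bsub>L\<^esub>)"
    unfolding univ_poly_carrier[symmetric] polynomial_def q_def using set_lift_poly last by auto
  have "L.eval q t = L.eval (lift_poly P') t \<otimes>\<^bsub>L\<^esub> t \<oplus>\<^bsub>L\<^esub> embed (\<lambda>p. c - T (f p))"
    unfolding q_def
    by (rule L.eval_append_aux[OF subset_trans[OF set_lift_poly K_carrier] _ t]) (use last K_carrier in blast)
  also have "\<dots> = embed (\<lambda>p. poly P' (T p) * T p + (c - T (f p)))"
    unfolding t_def eval_lift_poly[OF T]
    by (simp only: embed_add embed_mult regular_mult[OF X] regular_poly[OF X T] T pull_R[OF c'])
  also have "\<dots> = embed (\<lambda>_. 0)"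
  proof (rule embed_cong)
    show "(\<lambda>p. poly P' (T p) * T p + (c - T (f p))) \<in> R"
      by (intro closed regular_poly[OF X T] T pull_R[OF c'])
    show "(\<lambda>_. 0) \<in> R" by (rule closed)
    fix p assume "p \<in> points X"
    then show "poly P' (T p) * T p + (c - T (f p)) = 0" by (simp add: pull P' mult.commute)
  qed
  finally have q0: "L.eval q t = \<zero>\<^bsub>L\<^esub>" by (simp add: embed_def zero_L)
  have qne: "q \<noteq> []" by (simp add: q_def)
  have alg: "(L.algebraic over K) t" by (rule L.algebraicI[OF q qne q0])
  have sub: "subfield (L.simple_extension K t) L"
    using L.simple_extension_is_subfield[OF K_subfield t] alg by blast
  have sub_K: "K \<subseteq> L.simple_extension K t" and t_in: "t \<in> L.simple_extension K t"
    using L.simple_extension_incl[OF K_carrier t] L.simple_extension_mem[OF subfieldE(1)[OF K_subfield] t]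
    by auto
  have all: "carrier L \<subseteq> L.simple_extension K t"
  proof
    fix u assume "u \<in> carrier L"
    then obtain a b where u: "u = F a b" "a \<in> R" "b \<in> NZ" by (rule L_cases)
    have "embed a \<in> L.simple_extension K t" "embed b \<in> L.simple_extension K t"
      using gen[OF sub sub_K] t_in u NZ_R unfolding t_def by auto
    then show "u \<in> L.simple_extension K t"
      using L.subfield_m_inv(1)[OF sub, of "embed b"] embed_nonzero[OF u(3)] subringE(6)[OF subfieldE(1)[OF sub]]
      unfolding u(1) fraction_eq_quotient[OF u(2,3)] by blast
  qed
  have eq: "L.simple_extension K t = carrier L"
    using all subfieldE(3)[OF sub] by blast
  define p where "p = L.Irr K t"
  have Irr: "p \<in> carrier (K [X]\<^bsub>L\<^esub>)" "pirreducible\<^bsub>L\<^esub> K p" "hd p = \<one>\<^bsub>L\<^esub>" "L.eval p t = \<zero>\<^bsub>L\<^esub>"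
    using L.IrrE[OF K_subfield t alg] unfolding p_def by auto
  have le: "length p - 1 \<le> Polynomial.degree P"
  proof -
    have "p pdivides\<^bsub>L\<^esub> q" unfolding p_def by (rule L.Irr_minimal[OF K_subfield t alg q q0])
    then have "length p - 1 \<le> length q - 1"
      using L.pdivides_imp_degree_le[OF subfieldE(1)[OF K_subfield] Irr(1) q qne] by blast
    also have "\<dots> = Polynomial.degree P" using P'0 by (simp add: q_def lift_poly_def P' length_coeffs)
    finally show ?thesis .
  qed
  have pne: "p \<noteq> []" using L.pirreducibleE(1)[OF subfieldE(1)[OF K_subfield] Irr(1,2)] by simp
  then obtain us where us: "p = \<one>\<^bsub>L\<^esub> # us" using Irr(3) by (cases p) auto
  have usK: "set us \<subseteq> K" using Irr(1) us unfolding univ_poly_carrier[symmetric] polynomial_def by auto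
  obtain b Q where b: "b \<in> NZ" "\<And>q n. length us \<le> n \<Longrightarrow> poly.coeff (Q q) n = 0"
    "\<And>p. p \<in> points X \<Longrightarrow> b (f p) \<noteq> 0 \<Longrightarrow> has_value (L.eval us t) p (poly (Q (f p)) (T p))"
  proof -
    from value_of_eval[OF T usK] obtain b Q where "b \<in> NZ" "\<forall>q. \<forall>n\<ge>length us. poly.coeff (Q q) n = 0"
      "\<forall>p\<in>points X. b (f p) \<noteq> 0 \<longrightarrow> has_value (ring.eval L us (embed T)) p (poly (Q (f p)) (T p))"
      by (elim exE conjE)
    then show ?thesis by (intro that[of b Q]) (simp_all add: t_def)
  qed
  obtain x A where A: "b x \<noteq> 0" "A \<subseteq> points X" "\<And>p. p \<in> A \<Longrightarrow> f p = x" "finite (T ` A)" "card (T ` A) = Polynomial.degree P"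
    using fibres[OF b(1)] by blast
  (* the minimal polynomial specialized to the image point x *)
  define W where "W = Polynomial.monom 1 (length us) + Q x"
  have W1: "poly.coeff W (length us) = 1" using b(2)[of "length us" x] by (simp add: W_def)
  have W: "W \<noteq> 0" using W1 by auto
  have Wdeg: "Polynomial.degree W \<le> length us"
    by (rule degree_le) (use b(2) in \<open>simp add: W_def\<close>)
  have "T ` A \<subseteq> {z. poly W z = 0}"
  proof
    fix z assume "z \<in> T ` A"
    then obtain y where y: "y \<in> A" "z = T y" by blast
    have yX: "y \<in> points X" using y A(2) by blast
    have "has_value (\<one>\<^bsub>L\<^esub> \<otimes>\<^bsub>L\<^esub> (t [^]\<^bsub>L\<^esub> length us) \<oplus>\<^bsub>L\<^esub> L.eval us t) y (1 * T y ^ length us + poly (Q (f y)) (T y))"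
      unfolding t_def
      by (rule has_value_add[OF has_value_mult[OF has_value_one has_value_power[OF embed_in[OF T] has_value_embed[OF T]]] b(3)[OF yX, unfolded t_def]])
        (use A y in simp)
    then have "has_value \<zero>\<^bsub>L\<^esub> y (poly W z)" using Irr(4) A(3)[OF y(1)] y(2) by (simp add: us W_def poly_monom)
    then show "z \<in> {z. poly W z = 0}" using has_value_unique[OF yX _ has_value_zero] by blast
  qed
  then have "card (T ` A) \<le> card {z. poly W z = 0}" by (rule card_mono[OF poly_roots_finite[OF W]])
  also have "\<dots> \<le> length us" using card_poly_roots_bound[OF W] Wdeg by simp
  finally have "length p - 1 = Polynomial.degree P" using le A(5) us by simp
  then have "L.dimension (Polynomial.degree P) K (carrier L)"
    using L.dimension_simple_extension[OF K_subfield t alg] unfolding eq p_def by simp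
  then show ?thesis
    unfolding has_degree_def K_def[symmetric] using dominant L.dimension_is_inj[OF K_subfield] by blast
qed

end

section \<open>The degree of an equivariant etale endomorphism\<close>

lemma nth_root_exists:
  assumes "0 < k" shows "\<exists>w::complex. w ^ k = c"
proof (cases "c = 0")
  case True
  then show ?thesis using assms by (intro exI[of _ 0]) simp
next
  case False
  then have "card {w. w ^ k = c} = k" using card_nth_roots assms by blast
  then show ?thesis using assms by (metis (mono_tags, lifting) card.empty empty_Collect_eq less_irrefl)
qed

context surface_quotient
begin

lemma Sq_cases: assumes "P \<in> points Sq" obtains p where "p \<in> points S" "P = \<pi> p"
  using assms by (auto simp: points_Sq)

lemma Sq_point: "p \<in> points S \<Longrightarrow> \<pi> p \<in> points Sq" by (simp add: points_Sq)

lemma nonvanishing: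
  assumes b: "b \<in> nonzero_regular Sq" and g: "g \<noteq> 0"
  shows "\<exists>p\<in>points S. coord_x p \<noteq> 0 \<and> b (\<pi> p) \<noteq> 0 \<and> poly g (coord_z p) \<noteq> 0"
proof -
  obtain p where p: "p \<in> points S" "b (\<pi> p) \<noteq> 0" using b by (auto simp: nonzero_regular_def points_Sq)
  have "finite {z. poly g z = 0}" by (rule poly_roots_finite[OF g])
  then obtain z where "z \<notin> {z. poly g z = 0}" using ex_new_if_finite[OF infinite_UNIV_char_0] by blast
  then have z: "poly g (coord_z (1, z ^ k - 1, z)) \<noteq> 0" by simp
  have br: "(\<lambda>p. b (\<pi> p)) \<in> regular S" using b by (simp add: nonzero_regular_def regular_Sq)
  have gr: "(\<lambda>p. poly g (coord_z p)) \<in> regular S" by (intro regular_intros[OF S_tilde] coord_regular)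
  show ?thesis by (rule S_tilde_domain[OF k0 r2 br gr p _ z]) simp
qed

lemma Sq_integral: "integral_variety Sq"
proof
  show "function_variety Sq" by (rule Sq)
  have "(1, 0, 1) \<in> points S" by simp
  then show "points Sq \<noteq> {}" unfolding points_Sq by blast
  fix b c assume b: "b \<in> nonzero_regular Sq" and c: "c \<in> nonzero_regular Sq"
  obtain p where p: "p \<in> points S" "b (\<pi> p) \<noteq> 0" using b by (auto simp: nonzero_regular_def points_Sq)
  obtain q where q: "q \<in> points S" "c (\<pi> q) \<noteq> 0" using c by (auto simp: nonzero_regular_def points_Sq)
  have "(\<lambda>p. b (\<pi> p)) \<in> regular S" "(\<lambda>p. c (\<pi> p)) \<in> regular S"
    using b c by (simp_all add: nonzero_regular_def regular_Sq)
  from S_tilde_domain[OF k0 r2 this p q] obtain x where "x \<in> points S" "b (\<pi> x) \<noteq> 0" "c (\<pi> x) \<noteq> 0" by blast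
  then show "\<exists>p\<in>points Sq. b p \<noteq> 0 \<and> c p \<noteq> 0" using Sq_point[of x] by blast
qed

end

context plane_etale_endo
begin

text \<open>
  Points off the line \<open>x = 0\<close> with the same value of \<open>z\<^sup>k\<close>
  differ by the torus and the roots of unity. It is therefore enough to hit the right value of
  \<open>z\<^sup>k\<close>, and to move the preimage by the torus.
\<close>

lemma preimage:
  assumes p: "p \<in> points S" "coord_x p \<noteq> 0" "coord_z p \<noteq> 0" "coord_z p ^ k \<noteq> 1"
    and z': "poly t_poly z' = coord_z p ^ k"
  shows "\<exists>p'\<in>points S. coord_z p' = z' \<and> f (\<pi> p') = \<pi> p"
proof -
  define q where "q = \<phi> (base z')"
  have q: "q \<in> points S" "coord_z q ^ k = coord_z p ^ k"
    using phi(1)[OF base_point] basic_transforms(1)[OF base_point[of z']] z' by (simp_all add: q_def)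
  have xq: "coord_x q \<noteq> 0"
  proof
    assume "coord_x q = 0"
    then have "coord_z q ^ k = 1" using q(1) r2 by (simp add: in_S_tilde_coord power_0_left)
    then show False using q(2) p by simp
  qed
  define \<zeta> where "\<zeta> = coord_z q / coord_z p"
  have \<zeta>k: "\<zeta> ^ k = 1" using q(2) p(3) by (simp add: \<zeta>_def power_divide)
  then have \<zeta>: "\<zeta> \<noteq> 0" using k0 by (auto simp: power_0_left)
  define e where "e = \<zeta> ^ inv_a"
  have ea: "e ^ a = \<zeta>" using unity_inv_a[OF \<zeta>k] by (simp add: e_def mult.commute flip: power_mult)
  have e0: "e \<noteq> 0" using \<zeta> by (simp add: e_def)
  have eH: "e \<in> H" using \<zeta>k by (simp add: e_def H_def mult.commute flip: power_mult) (simp add: power_mult)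
  define l where "l = coord_x p / (e * coord_x q)"
  have l: "l \<noteq> 0" using p(2) e0 xq by (simp add: l_def)
  define p' where "p' = act e (torus_action r l q)"
  have xz: "coord_x p' = coord_x p" "coord_z p' = coord_z p"
    using e0 xq \<zeta> p(3) by (simp_all add: p'_def l_def ea) (simp add: \<zeta>_def)
  have "p' \<in> points S" unfolding p'_def by (rule act_point[OF eH torus_point[OF l q(1)]])
  then have "coord_x p ^ r * coord_y p' = coord_x p ^ r * coord_y p" using p(1) xz by (simp add: in_S_tilde_coord)
  then have "p' = p" using p(2) xz by (intro point3_eqI) simp_all
  then have "\<pi> (torus_action r l q) = \<pi> p" using orbit_act[OF eH] unfolding p'_def by metis
  then have "f (\<pi> (torus_action r l (base z'))) = \<pi> p" using f_torus[OF l base_point] by (simp add: q_def)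
  moreover have "torus_action r l (base z') \<in> points S" by (rule torus_point[OF l base_point])
  ultimately show ?thesis by (intro bexI[of _ "torus_action r l (base z')"]) simp_all
qed

text \<open>
  Nonzero exactly where \<open>z\<close> is neither zero nor a \<open>k\<close>-th root of
  unity.
\<close>

definition "generic = [:0, 1:] * (Polynomial.monom 1 k - 1 :: complex poly)"

lemma generic: "generic \<noteq> 0" "poly generic z \<noteq> 0 \<Longrightarrow> z \<noteq> 0 \<and> z ^ k \<noteq> 1"
proof -
  have "poly (Polynomial.monom 1 k - 1) (0::complex) \<noteq> 0" using k0 by (simp add: poly_monom power_0_left)
  then have "Polynomial.monom 1 k - 1 \<noteq> (0::complex poly)" by auto
  then show "generic \<noteq> 0" by (simp add: generic_def)
  show "poly generic z \<noteq> 0 \<Longrightarrow> z \<noteq> 0 \<and> z ^ k \<noteq> 1" by (auto simp: generic_def poly_monom)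
qed

lemma dominant_endo: "dominant_endo Sq f"
proof (intro dominant_endo.intro Sq_integral dominant_endo_axioms.intro f)
  fix b assume b: "b \<in> nonzero_regular Sq"
  obtain p where p: "p \<in> points S" "coord_x p \<noteq> 0" "b (\<pi> p) \<noteq> 0" "poly generic (coord_z p) \<noteq> 0"
    using nonvanishing[OF b generic(1)] by blast
  have "Polynomial.degree t_poly \<noteq> 0" using pderiv_t_poly_nonzero by (auto simp: pderiv_eq_0_iff)
  then have "Polynomial.degree (t_poly - [:coord_z p ^ k:]) \<noteq> 0"
    by (metis degree_pCons_0 degree_diff_less diff_add_cancel gr0I degree_add_le le_zero_eq)
  then have "\<not> constant (poly (t_poly - [:coord_z p ^ k:]))" by (simp add: constant_degree)
  then obtain z' where "poly t_poly z' = coord_z p ^ k"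
    using fundamental_theorem_of_algebra by fastforce
  then obtain p' where "p' \<in> points S" "f (\<pi> p') = \<pi> p"
    using preimage[OF p(1,2)] generic(2)[OF p(4)] by blast
  then have "\<exists>q\<in>points Sq. b (f q) \<noteq> 0" using p(3) Sq_point[of p'] by (intro bexI[of _ "\<pi> p'"]) simp_all
  moreover have "(\<lambda>q. b (f q)) \<in> regular Sq"
    by (rule morphism_regular[OF f]) (use b in \<open>simp add: nonzero_regular_def\<close>)
  ultimately show "(\<lambda>q. b (f q)) \<in> nonzero_regular Sq" by (simp add: nonzero_regular_def)
qed

lemma quotient_polynomial: "\<exists>P. (\<forall>z. poly t_poly z = poly P (z ^ k)) \<and> Polynomial.degree t_poly = k * Polynomial.degree P"
proof -
  obtain P where P: "\<And>z. poly t_poly z = z ^ 0 * poly P (z ^ k)"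
    using rotation_eigenpoly[OF k0 k0, of t_poly] rotate_transforms(1) by auto
  have "t_poly = pcompose P (Polynomial.monom 1 k)"
    by (rule poly_eqI_eval) (simp add: P poly_pcompose poly_monom)
  then have "Polynomial.degree t_poly = k * Polynomial.degree P" by (simp add: degree_pcompose degree_monom_eq)
  then show ?thesis using P by auto
qed

text \<open>
  A general point has a regular value of \<open>P\<close> as its value of
  \<open>z\<^sup>k\<close>, and each of the preimages of this value under \<open>P\<close> is
  realized by a point of the fibre.
\<close>

lemma fibres:
  assumes P: "\<And>z. poly t_poly z = poly P (z ^ k)" and deg: "0 < Polynomial.degree P" and b: "b \<in> nonzero_regular Sq"
  shows "\<exists>q A. b q \<noteq> 0 \<and> A \<subseteq> points Sq \<and> (\<forall>p\<in>A. f p = q) \<and> finite (on_orbits inv_t ` A) \<and>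
    card (on_orbits inv_t ` A) = Polynomial.degree P"
proof -
  define C where "C = {c. poly (pderiv P) c = 0}"
  have "pderiv P \<noteq> 0" using deg by (simp add: pderiv_eq_0_iff)
  then have finC: "finite C" unfolding C_def by (rule poly_roots_finite)
  (* avoids the zeros of x and z, the roots of unity, and the critical values of P *)
  define g where "g = generic * (\<Prod>c\<in>C. Polynomial.monom 1 k - [:poly P c:])"
  have "Polynomial.monom 1 k - [:c:] \<noteq> 0" for c :: complex
  proof
    assume "Polynomial.monom 1 k - [:c:] = 0"
    then have "poly.coeff (Polynomial.monom 1 k - [:c:]) k = 0" by simp
    then show False using k0 by (simp add: coeff_pCons split: nat.splits)
  qed
  then have "g \<noteq> 0" using generic(1) finC by (simp add: g_def)
  from nonvanishing[OF b this] obtain p where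
    p: "p \<in> points S" "coord_x p \<noteq> 0" "b (\<pi> p) \<noteq> 0" "poly g (coord_z p) \<noteq> 0" by blast
  define \<tau> where "\<tau> = coord_z p ^ k"
  have gen: "coord_z p \<noteq> 0" "coord_z p ^ k \<noteq> 1" using generic(2)[of "coord_z p"] p(4) by (auto simp: g_def)
  have reg_val: "poly (pderiv P) c \<noteq> 0" if "poly P c = \<tau>" for c
    using p(4) finC that by (auto simp: g_def C_def poly_prod poly_monom \<tau>_def)
  define D where "D = P - [:\<tau>:]"
  have D: "poly D c = poly P c - \<tau>" "pderiv D = pderiv P" for c
    by (simp_all add: D_def pderiv_diff)
  have D0: "D \<noteq> 0" using \<open>pderiv P \<noteq> 0\<close> D(2) by auto
  have "Polynomial.degree D = Polynomial.degree P"
  proof -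
    have "D = P + [:- \<tau>:]" by (simp add: D_def)
    then show ?thesis using deg degree_add_eq_left[of "[:- \<tau>:]" P] by simp
  qed
  moreover have "Polynomial.degree D = (\<Sum>c | poly D c = 0. 1)"
    unfolding degree_eq_sum_order[OF D0] by (intro sum.cong refl order_one) (use reg_val D in auto)
  ultimately have card: "card {c. poly D c = 0} = Polynomial.degree P" by simp
  define A where "A = {Q \<in> points Sq. f Q = \<pi> p}"
  have "on_orbits inv_t ` A = {c. poly D c = 0}"
  proof
    show "on_orbits inv_t ` A \<subseteq> {c. poly D c = 0}"
    proof
      fix c assume "c \<in> on_orbits inv_t ` A"
      then obtain q where q: "q \<in> points S" "f (\<pi> q) = \<pi> p" "c = on_orbits inv_t (\<pi> q)"
        by (auto simp: A_def points_Sq)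
      have c: "c = coord_z q ^ k" using q(3) on_orbits_orbit[OF invariants(1) q(1)] by (simp add: inv_t_def)
      have "\<tau> = on_orbits inv_t (f (\<pi> q))"
        using on_orbits_orbit[OF invariants(1) p(1)] q(2) by (simp add: inv_t_def \<tau>_def)
      also have "\<dots> = poly P c"
        using pull_eq[OF invariants(1) q(1)] basic_transforms(1)[OF q(1)] P c by (simp add: inv_t_def)
      finally show "c \<in> {c. poly D c = 0}" by (simp add: D)
    qed
    show "{c. poly D c = 0} \<subseteq> on_orbits inv_t ` A"
    proof
      fix c assume "c \<in> {c. poly D c = 0}"
      then have c: "poly P c = \<tau>" by (simp add: D)
      obtain z' where z': "z' ^ k = c" using nth_root_exists[OF k0] by blast
      have "poly t_poly z' = coord_z p ^ k" using c z' P by (simp add: \<tau>_def)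
      from preimage[OF p(1,2) gen this] obtain q where q: "q \<in> points S" "coord_z q = z'" "f (\<pi> q) = \<pi> p" by blast
      have "c = on_orbits inv_t (\<pi> q)" using on_orbits_orbit[OF invariants(1) q(1)] q(2) z' by (simp add: inv_t_def)
      moreover have "\<pi> q \<in> A" using q Sq_point[OF q(1)] by (simp add: A_def)
      ultimately show "c \<in> on_orbits inv_t ` A" by (rule image_eqI)
    qed
  qed
  then have "finite (on_orbits inv_t ` A) \<and> card (on_orbits inv_t ` A) = Polynomial.degree P"
    using poly_roots_finite[OF D0] card by simp
  then show ?thesis using p(3) by (intro exI[of _ "\<pi> p"] exI[of _ A]) (auto simp: A_def)
qed

text \<open>
  The invariant functions that lie in a given intermediate field.
\<close>

definition good :: "_ set \<Rightarrow> (point3 \<Rightarrow> complex) \<Rightarrow> bool" where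
  "good E c \<longleftrightarrow> invariant c \<and> integral_variety.embed Sq (on_orbits c) \<in> E"

text \<open>
  The quotient has dimension two, and its functions are rational in \<open>inv_t\<close> and
  \<open>inv_w\<close>. The pullback of \<open>inv_w\<close> has the same weight as
  \<open>inv_w\<close>, so it is \<open>inv_w\<close> times a polynomial in
  \<open>inv_t\<close>; hence an intermediate field that contains \<open>inv_t\<close> also
  contains \<open>inv_w\<close>. Other invariant functions are, up to a power of
  \<open>x\<^sup>k\<close>, combinations of invariant monomials in \<open>x\<close> and
  \<open>z\<close>.
\<close>

lemma function_field_generated:
  assumes E: "subfield E (function_field Sq)"
    and KE: "pullback Sq f ` carrier (function_field Sq) \<subseteq> E"
    and tE: "integral_variety.embed Sq (on_orbits inv_t) \<in> E" and b: "b \<in> regular Sq"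
  shows "integral_variety.embed Sq b \<in> E"
proof -
  interpret dominant_endo Sq f by (rule dominant_endo)
  interpret L: field L by (rule L_field)
  note sub = subringE[OF subfieldE(1)[OF E]]
  note oo = on_orbits_regular
  have good_regular: "on_orbits c \<in> R" if "good E c" for c using that oo by (simp add: good_def)
  have good_cong: "good E c" if c: "invariant c" and d: "good E d" and eq: "\<And>p. p \<in> points S \<Longrightarrow> c p = d p" for c d
  proof -
    have d': "invariant d" using d by (simp add: good_def)
    have "embed (on_orbits c) = embed (on_orbits d)"
      by (rule embed_cong[OF oo[OF c] oo[OF d']]) (auto simp: points_Sq on_orbits_orbit c d' eq)
    then show ?thesis using c d by (simp add: good_def)
  qed
  have good_const: "good E (\<lambda>_. c)" for c
    using embed_const_in_K[of c] KE unfolding K_def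
    by (auto simp: good_def invariant_def on_orbits_def regular_const[OF S_tilde])
  have good_add: "good E (\<lambda>p. c p + d p)" if c: "good E c" and d: "good E d" for c d
  proof -
    have "embed (on_orbits (\<lambda>p. c p + d p)) = embed (on_orbits c) \<oplus>\<^bsub>L\<^esub> embed (on_orbits d)"
      using embed_add[OF good_regular[OF c] good_regular[OF d]] by (simp add: on_orbits_def)
    then show ?thesis using c d sub(7) by (simp add: good_def invariant_def regular_add[OF S_tilde])
  qed
  have good_mult: "good E (\<lambda>p. c p * d p)" if c: "good E c" and d: "good E d" for c d
  proof -
    have "embed (on_orbits (\<lambda>p. c p * d p)) = embed (on_orbits c) \<otimes>\<^bsub>L\<^esub> embed (on_orbits d)"
      using embed_mult[OF good_regular[OF c] good_regular[OF d]] by (simp add: on_orbits_def)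
    then show ?thesis using c d sub(6) by (simp add: good_def invariant_def regular_mult[OF S_tilde])
  qed
  have good_power: "good E (\<lambda>p. c p ^ n)" if "good E c" for c n
    by (induction n) (simp_all add: good_const good_mult that)
  have good_sum: "good E (\<lambda>p. \<Sum>i\<in>I. c i p)" if "finite I" "\<And>i. i \<in> I \<Longrightarrow> good E (c i)" for c and I :: "nat set"
    using that by (induction I rule: finite_induct) (simp_all add: good_const good_add)
  have good_poly: "good E (\<lambda>p. poly Q (c p))" if "good E c" for c Q
    by (induction Q) (simp_all add: good_const good_add good_mult that)
  have good_divide: "good E c"
    if c: "invariant c" and d: "good E d" and cd: "good E (\<lambda>p. d p * c p)" and nz: "q \<in> points S" "d q \<noteq> 0" for c d q
  proof -
    have d': "invariant d" using d by (simp add: good_def)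
    have "on_orbits d (\<pi> q) \<noteq> 0" using nz on_orbits_orbit[OF d'] by simp
    then have "on_orbits d \<in> NZ" using oo[OF d'] Sq_point[OF nz(1)] unfolding nonzero_regular_def by blast
    then have dn: "embed (on_orbits d) \<noteq> \<zero>\<^bsub>L\<^esub>" by (rule embed_nonzero)
    have in_L: "embed (on_orbits d) \<in> carrier L" "embed (on_orbits c) \<in> carrier L"
      by (rule embed_in[OF oo[OF d']], rule embed_in[OF oo[OF c]])
    have "embed (on_orbits (\<lambda>p. d p * c p)) = embed (on_orbits d) \<otimes>\<^bsub>L\<^esub> embed (on_orbits c)"
      using embed_mult[OF oo[OF d'] oo[OF c]] by (simp add: on_orbits_def)
    then have eq: "inv\<^bsub>L\<^esub> embed (on_orbits d) \<otimes>\<^bsub>L\<^esub> embed (on_orbits (\<lambda>p. d p * c p)) = embed (on_orbits c)"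
      using in_L dn by (simp add: L.field_Units flip: L.m_assoc)
    have dE: "embed (on_orbits d) \<in> E" using d unfolding good_def by (rule conjunct2)
    have cdE: "embed (on_orbits (\<lambda>p. d p * c p)) \<in> E" using cd unfolding good_def by (rule conjunct2)
    have "embed (on_orbits d) \<in> E - {\<zero>\<^bsub>L\<^esub>}" using dE dn by blast
    then have "inv\<^bsub>L\<^esub> embed (on_orbits d) \<in> E" using L.subfield_m_inv(1)[OF E] by blast
    from sub(6)[OF this cdE] have "embed (on_orbits c) \<in> E" unfolding eq .
    then show ?thesis using c by (simp add: good_def)
  qed
  have good_t: "good E inv_t" using tE invariants(1) by (simp add: good_def)
  have good_w: "good E inv_w"
  proof -
    obtain Wp where Wp: "\<And>z. poly w_poly z = z ^ inv_a * poly Wp (z ^ k)"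
      using rotation_eigenpoly[OF k0 inv_a(1), of w_poly] rotate_transforms(3) by blast
    have pull: "inv_w (\<phi> p) = poly Wp (inv_t p) * inv_w p" if "p \<in> points S" for p
      using basic_transforms(3)[OF that] by (simp add: inv_w_def inv_t_def Wp mult_ac)
    have inv_pull: "invariant (\<lambda>p. inv_w (\<phi> p))"
      by (rule invariantI[OF pull_regular[OF invariants(3)]]) (rule pull_act[OF invariants(3)])
    have "embed (on_orbits (\<lambda>p. inv_w (\<phi> p))) = embed (\<lambda>P. on_orbits inv_w (f P))"
      by (rule embed_cong[OF oo[OF inv_pull] pull_R[OF oo[OF invariants(3)]]])
        (auto simp: points_Sq on_orbits_orbit[OF inv_pull] pull_eq[OF invariants(3)])
    then have "good E (\<lambda>p. inv_w (\<phi> p))"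
      using embed_pull_in_K[OF oo[OF invariants(3)]] KE inv_pull unfolding K_def by (auto simp: good_def)
    then have prod: "good E (\<lambda>p. poly Wp (inv_t p) * inv_w p)"
      by (rule good_cong[rotated]) (use pull inv_pull good_poly[OF good_t] invariants(3) in
        \<open>auto simp: good_def invariant_def regular_mult[OF S_tilde]\<close>)
    obtain z where "poly w_poly z \<noteq> 0" using w_poly_nonzero poly_all_0_iff_0 by blast
    then have "poly Wp (inv_t (base z)) \<noteq> 0" by (auto simp: Wp inv_t_def)
    from good_divide[OF invariants(3) good_poly[OF good_t] prod base_point this] show ?thesis .
  qed
  have good_monomial: "good E (\<lambda>p. coord_x p ^ i * coord_z p ^ j)"
    if inv: "invariant (\<lambda>p. coord_x p ^ i * coord_z p ^ j)"
      and char: "\<And>e. e \<in> H \<Longrightarrow> e ^ i * inverse (e ^ a) ^ j = 1" for i j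
  proof -
    have "w ^ (j + k * (inv_a * i) - inv_a * i) = 1" if w: "w ^ k = 1" for w :: complex
    proof -
      have wH: "w \<in> H" using w by (simp add: H_def)
      have w0: "w \<noteq> 0" by (rule H_nonzero[OF wH])
      define e where "e = w ^ inv_a"
      have eH: "e \<in> H" using unity_pow_a[OF wH] by (simp add: e_def H_def)
      have "e ^ a = w" using unity_inv_a[OF w] by (simp add: e_def mult.commute flip: power_mult)
      then have "e ^ i * inverse (w ^ j) = 1" using char[OF eH] by (simp add: power_inverse)
      then have "w ^ (inv_a * i) = w ^ j" using w0 by (simp add: e_def field_simps flip: power_mult)
      moreover have "w ^ (j + k * (inv_a * i)) = w ^ j" using w by (simp add: power_add power_mult)
      moreover have "inv_a * i \<le> j + k * (inv_a * i)" using k0 by (simp add: trans_le_add2)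
      then have "w ^ (j + k * (inv_a * i) - inv_a * i) * w ^ (inv_a * i) = w ^ (j + k * (inv_a * i))"
        by (simp flip: power_add)
      ultimately show ?thesis using w0 by simp
    qed
    then have "k dvd j + k * (inv_a * i) - inv_a * i" by (rule unity_group_dvd[OF k0])
    then obtain n where n: "j + k * (inv_a * i) - inv_a * i = k * n" by blast
    moreover have "inv_a * i \<le> j + k * (inv_a * i)" using k0 by (simp add: trans_le_add2)
    ultimately have eq: "j + k * (inv_a * i) = inv_a * i + k * n" by linarith
    have "inv_t p ^ (inv_a * i) * (coord_x p ^ i * coord_z p ^ j) = inv_w p ^ i * inv_t p ^ n" for p
    proof -
      have "inv_t p ^ (inv_a * i) * (coord_x p ^ i * coord_z p ^ j) = coord_x p ^ i * coord_z p ^ (j + k * (inv_a * i))"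
        by (simp add: inv_t_def power_add mult_ac flip: power_mult)
      also have "\<dots> = inv_w p ^ i * inv_t p ^ n"
        unfolding eq by (simp add: inv_w_def inv_t_def power_add power_mult_distrib mult_ac flip: power_mult)
      finally show ?thesis .
    qed
    then have "good E (\<lambda>p. inv_t p ^ (inv_a * i) * (coord_x p ^ i * coord_z p ^ j))"
      using good_mult[OF good_power[OF good_w] good_power[OF good_t]] by simp
    moreover have "inv_t (base 2) ^ (inv_a * i) \<noteq> 0" by (simp add: inv_t_def)
    ultimately show ?thesis by (rule good_divide[OF inv good_power[OF good_t] _ base_point])
  qed
  have good_average: "good E (\<lambda>p. \<Sum>e\<in>H. coord_x (act e p) ^ i * coord_z (act e p) ^ j)" for i j
  proof -
    define ch where "ch e = e ^ i * inverse (e ^ a) ^ j" for e :: complex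
    have ch_mult: "ch (e * e') = ch e * ch e'" for e e' by (simp add: ch_def power_mult_distrib)
    have avg: "(\<Sum>e\<in>H. coord_x (act e p) ^ i * coord_z (act e p) ^ j) = (\<Sum>e\<in>H. ch e) * (coord_x p ^ i * coord_z p ^ j)" for p
      unfolding sum_distrib_right by (intro sum.cong refl) (simp add: ch_def power_mult_distrib)
    show ?thesis
    proof (cases "\<forall>e\<in>H. ch e = 1")
      case True
      have "invariant (\<lambda>p. coord_x p ^ i * coord_z p ^ j)"
      proof (rule invariantI)
        show "(\<lambda>p. coord_x p ^ i * coord_z p ^ j) \<in> regular S" by (intro regular_intros[OF S_tilde] coord_regular)
        fix e p assume "e \<in> H"
        then have "ch e = 1" using True by blast
        moreover have "coord_x (act e p) ^ i * coord_z (act e p) ^ j = ch e * (coord_x p ^ i * coord_z p ^ j)"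
          by (simp add: ch_def power_mult_distrib mult_ac)
        ultimately show "coord_x (act e p) ^ i * coord_z (act e p) ^ j = coord_x p ^ i * coord_z p ^ j" by simp
      qed
      from good_monomial[OF this] have "good E (\<lambda>p. coord_x p ^ i * coord_z p ^ j)" using True by (simp add: ch_def)
      from good_mult[OF good_const this] show ?thesis unfolding avg .
    next
      case False
      then obtain e0 where e0: "e0 \<in> H" "ch e0 \<noteq> 1" by blast
      have "(\<Sum>e\<in>H. ch e) = (\<Sum>e\<in>H. ch (e * e0))"
        by (rule sum.reindex_bij_betw[OF H_translate[OF e0(1)], symmetric])
      also have "\<dots> = (\<Sum>e\<in>H. ch e) * ch e0" by (simp add: ch_mult sum_distrib_right)
      finally have "(\<Sum>e\<in>H. ch e) = 0" using e0(2) by simp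
      then show ?thesis unfolding avg by (simp add: good_const)
    qed
  qed
  define \<beta> where "\<beta> p = b (\<pi> p)" for p
  have \<beta>: "invariant \<beta>"
    by (rule invariantI) (use b in \<open>simp_all add: \<beta>_def[abs_def] regular_Sq orbit_act\<close>)
  have \<beta>reg: "\<beta> \<in> regular S" using \<beta> by (simp add: invariant_def)
  obtain N B where NB: "\<And>x z. x \<noteq> 0 \<Longrightarrow> x ^ N * \<beta> (x, (z ^ k - 1) / x ^ r, z) = poly (poly B [:x:]) z"
    using regular_on_chart[OF \<beta>reg] by blast
  have N_le: "N \<le> k * N" using k0 by simp
  (* multiplying by x^m turns the exponent N into a multiple of k, and so makes the power of x
     invariant *)
  define m where "m = k * N - N"
  have monomials: "coord_x p ^ (k * N) * \<beta> p = (\<Sum>i\<le>Polynomial.degree B. \<Sum>j\<le>Polynomial.degree (poly.coeff B i).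
      poly.coeff (poly.coeff B i) j * (coord_x p ^ (m + i) * coord_z p ^ j))"
    if p: "p \<in> points S" "coord_x p \<noteq> 0" for p
  proof -
    obtain x y z where xyz: "p = (x, y, z)" by (cases p)
    have x: "x \<noteq> 0" using p(2) xyz by simp
    have "y = (z ^ k - 1) / x ^ r" using p(1) x by (simp add: xyz field_simps)
    then have "x ^ N * \<beta> p = poly (poly B [:x:]) z" using NB[OF x, of z] by (simp add: xyz)
    also have "\<dots> = (\<Sum>i\<le>Polynomial.degree B. poly (poly.coeff B i) z * x ^ i)"
      by (subst poly_altdef) (simp add: poly_sum)
    also have "\<dots> = (\<Sum>i\<le>Polynomial.degree B. \<Sum>j\<le>Polynomial.degree (poly.coeff B i).
        poly.coeff (poly.coeff B i) j * z ^ j * x ^ i)"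
      by (simp add: poly_altdef sum_distrib_right)
    finally have "x ^ m * (x ^ N * \<beta> p) = (\<Sum>i\<le>Polynomial.degree B. \<Sum>j\<le>Polynomial.degree (poly.coeff B i).
        poly.coeff (poly.coeff B i) j * (x ^ (m + i) * z ^ j))"
      by (simp add: sum_distrib_left power_add mult_ac)
    moreover have "x ^ m * (x ^ N * \<beta> p) = x ^ (k * N) * \<beta> p"
      using N_le by (simp add: m_def mult.assoc[symmetric] flip: power_add)
    ultimately show ?thesis by (simp add: xyz)
  qed
  (* averaging over the group replaces each monomial by an invariant one or by zero *)
  define avg where "avg p = (\<Sum>i\<le>Polynomial.degree B. \<Sum>j\<le>Polynomial.degree (poly.coeff B i).
      poly.coeff (poly.coeff B i) j * (\<Sum>e\<in>H. coord_x (act e p) ^ (m + i) * coord_z (act e p) ^ j))" for p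
  have avg: "good E avg" unfolding avg_def[abs_def]
    by (intro good_sum good_mult good_const good_average finite_atMost)
  have avg_reg: "avg \<in> regular S" using avg by (simp add: good_def invariant_def)
  have xN: "invariant (\<lambda>p. coord_x p ^ (k * N))"
    by (rule invariantI) (auto intro!: regular_intros[OF S_tilde] coord_regular simp: power_mult_distrib power_mult H_pow_k)
  have chart: "of_nat (card H) * (coord_x p ^ (k * N) * \<beta> p) = avg p" if p: "p \<in> points S" "coord_x p \<noteq> 0" for p
  proof -
    have "of_nat (card H) * (coord_x p ^ (k * N) * \<beta> p) = (\<Sum>e\<in>H. coord_x (act e p) ^ (k * N) * \<beta> (act e p))"
    proof -
      have "coord_x (act e p) ^ (k * N) * \<beta> (act e p) = coord_x p ^ (k * N) * \<beta> p" if "e \<in> H" for e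
        using xN \<beta> that p(1) unfolding invariant_def by metis
      then show ?thesis by simp
    qed
    also have "\<dots> = (\<Sum>e\<in>H. \<Sum>i\<le>Polynomial.degree B. \<Sum>j\<le>Polynomial.degree (poly.coeff B i).
      poly.coeff (poly.coeff B i) j * (coord_x (act e p) ^ (m + i) * coord_z (act e p) ^ j))"
      by (intro sum.cong refl monomials act_point) (use p H_nonzero in auto)
    also have "\<dots> = avg p"
      unfolding avg_def sum_distrib_left
      by (subst sum.swap, intro sum.cong refl, subst sum.swap, rule refl)
    finally show ?thesis .
  qed
  have "of_nat (card H) * (coord_x p ^ (k * N) * \<beta> p) - avg p = 0" if p: "p \<in> points S" for p
  proof (rule regular_zero_by_density[OF k0 r2 _ _ p])
    show "(\<lambda>p. of_nat (card H) * (coord_x p ^ (k * N) * \<beta> p) - avg p) \<in> regular S"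
      by (intro regular_intros[OF S_tilde] coord_regular \<beta>reg avg_reg)
  qed (use chart in force)
  then have full: "of_nat (card H) * (coord_x p ^ (k * N) * \<beta> p) = avg p" if "p \<in> points S" for p using that by simp
  have cardH: "of_nat (card H) \<noteq> (0::complex)" using finite_H H_one by auto
  have "good E (\<lambda>p. inverse (of_nat (card H)) * avg p)" by (rule good_mult[OF good_const avg])
  then have xb: "good E (\<lambda>p. coord_x p ^ (k * N) * \<beta> p)"
  proof (rule good_cong[rotated])
    show "invariant (\<lambda>p. coord_x p ^ (k * N) * \<beta> p)"
      using xN \<beta> by (simp add: invariant_def regular_mult[OF S_tilde])
    fix p assume "p \<in> points S"
    from full[OF this, symmetric] show "coord_x p ^ (k * N) * \<beta> p = inverse (of_nat (card H)) * avg p"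
      using cardH by simp
  qed
  have "good E (\<lambda>p. coord_x p ^ (k * N) * coord_z p ^ 0)"
    by (rule good_monomial) (use xN in \<open>simp_all add: power_mult H_pow_k\<close>)
  then have "good E (\<lambda>p. coord_x p ^ (k * N))" by simp
  from good_divide[OF \<beta> this xb base_point] have "good E \<beta>" by simp
  then have "embed (on_orbits \<beta>) \<in> E" by (simp add: good_def)
  moreover have "embed (on_orbits \<beta>) = embed b"
    by (rule embed_cong[OF oo[OF \<beta>] b]) (auto simp: points_Sq on_orbits_orbit[OF \<beta>] \<beta>_def)
  ultimately show ?thesis by simp
qed

text \<open>
  The function field is generated over its pullback by \<open>inv_t\<close>, on which the
  endomorphism acts as a polynomial.
\<close>

theorem degree_theorem: "\<exists>m. (\<forall>d. has_degree Sq Sq f d \<longleftrightarrow> d = m) \<and> Polynomial.degree t_poly = k * m"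
proof -
  obtain P where P: "\<And>z. poly t_poly z = poly P (z ^ k)" "Polynomial.degree t_poly = k * Polynomial.degree P"
    using quotient_polynomial by blast
  have "Polynomial.degree t_poly \<noteq> 0" using pderiv_t_poly_nonzero by (auto simp: pderiv_eq_0_iff)
  then have deg: "0 < Polynomial.degree P" using P(2) by auto
  interpret dominant_endo Sq f by (rule dominant_endo)
  have "has_degree Sq Sq f d \<longleftrightarrow> d = Polynomial.degree P" for d
  proof (rule dimension_generated_by_one[OF on_orbits_regular[OF invariants(1)] _ deg fibres[OF P(1) deg]])
    fix p assume "p \<in> points Sq"
    then obtain q where q: "q \<in> points S" "p = \<pi> q" by (rule Sq_cases)
    show "on_orbits inv_t (f p) = poly P (on_orbits inv_t p)"
      using pull_eq[OF invariants(1) q(1)] on_orbits_orbit[OF invariants(1) q(1)] basic_transforms(1)[OF q(1)] P(1)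
      by (simp add: q(2) inv_t_def)
  next
    fix E b assume "subfield E L" "K \<subseteq> E" "embed (on_orbits inv_t) \<in> E" "b \<in> R"
    then show "embed b \<in> E" unfolding K_def by (rule function_field_generated)
  qed
  then show ?thesis using P(2) by blast
qed

end

section \<open>Failure of properness and the degrees that occur\<close>

lemma isomorphism_closed:
  assumes f: "morphism X Y f" and g: "morphism Y X g"
    and gf: "\<And>p. p \<in> points X \<Longrightarrow> g (f p) = p" and fg: "\<And>q. q \<in> points Y \<Longrightarrow> f (g q) = q"
    and C: "zariski_closed X C"
  shows "zariski_closed Y (f ` C)"
proof -
  obtain F where F: "F \<subseteq> regular X" "C = {p \<in> points X. \<forall>h\<in>F. h p = 0}" using C unfolding zariski_closed_def by blast
  have "f ` C = {q \<in> points Y. \<forall>h\<in>(\<lambda>h q. h (g q)) ` F. h q = 0}"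
  proof
    show "f ` C \<subseteq> {q \<in> points Y. \<forall>h\<in>(\<lambda>h q. h (g q)) ` F. h q = 0}"
      using F(2) morphism_point[OF f] gf by auto
    show "{q \<in> points Y. \<forall>h\<in>(\<lambda>h q. h (g q)) ` F. h q = 0} \<subseteq> f ` C"
    proof
      fix q assume q: "q \<in> {q \<in> points Y. \<forall>h\<in>(\<lambda>h q. h (g q)) ` F. h q = 0}"
      then have "g q \<in> C" using F(2) morphism_point[OF g] by auto
      then show "q \<in> f ` C" using fg q by (intro image_eqI[of _ _ "g q"]) auto
    qed
  qed
  moreover have "(\<lambda>h q. h (g q)) ` F \<subseteq> regular Y" using F(1) morphism_regular[OF g] by auto
  ultimately show ?thesis unfolding zariski_closed_def by blast
qed

text \<open>
  By the product trick every element of \<open>G\<close> satisfies \<open>e ^ card G =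
  1\<close>, and there are only \<open>card G\<close> such numbers.
\<close>

lemma subgroup_of_unity:
  assumes k: "0 < k" and G: "subgroup G (roots_of_unity_group k)"
  shows "\<exists>h. 0 < h \<and> G = {e. e ^ h = 1} \<and> (\<forall>e::complex. e ^ h = 1 \<longrightarrow> e ^ k = 1)"
proof -
  have sub: "G \<subseteq> {e. e ^ k = 1}" using subgroup.subset[OF G] by (simp add: roots_of_unity_group_def)
  have finU: "finite {e::complex. e ^ n = 1}" if "0 < n" for n
    using card_unity_roots[OF that] that by (metis card.infinite less_irrefl)
  have fin: "finite G" by (rule finite_subset[OF sub finU[OF k]])
  have one: "1 \<in> G" using subgroup.one_closed[OF G] by (simp add: roots_of_unity_group_def)
  have mult: "e * e' \<in> G" if "e \<in> G" "e' \<in> G" for e e'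
    using subgroup.m_closed[OF G that] by (simp add: roots_of_unity_group_def)
  have nz: "e \<noteq> 0" if "e \<in> G" for e using that sub k by (auto simp: power_0_left)
  define h where "h = card G"
  have h: "0 < h" using fin one by (auto simp: h_def card_gt_0_iff)
  have "e ^ h = 1" if e: "e \<in> G" for e
  proof -
    have inj: "inj_on (\<lambda>x. e * x) G" using nz[OF e] by (simp add: inj_on_def)
    have "(\<lambda>x. e * x) ` G = G" by (rule endo_inj_surj[OF fin _ inj]) (use mult[OF e] in auto)
    then have "(\<Prod>x\<in>G. x) = (\<Prod>x\<in>G. e * x)" using prod.reindex[OF inj, of "\<lambda>x. x"] by simp
    also have "\<dots> = e ^ h * (\<Prod>x\<in>G. x)" by (simp add: prod.distrib h_def)
    finally show ?thesis using fin nz by simp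
  qed
  then have "G \<subseteq> {e. e ^ h = 1}" by blast
  then have "G = {e. e ^ h = 1}" by (rule card_subset_eq[OF finU[OF h]]) (metis card_unity_roots[OF h] h_def)
  then show ?thesis using h sub by blast
qed

context surface_quotient
begin

lemma H_power_surjective: assumes "\<zeta> \<in> H" shows "\<exists>e\<in>H. e ^ a = \<zeta>"
proof -
  have into: "(\<lambda>e. e ^ a) ` H \<subseteq> H"
  proof (rule image_subsetI)
    fix e assume "e \<in> H"
    then have "(e ^ a) ^ h = 1" by (metis H_pow_h mult.commute power_mult power_one)
    then show "e ^ a \<in> H" by (simp add: H_def)
  qed
  have "inj_on (\<lambda>e. e ^ a) H"
  proof (rule inj_onI)
    fix e e' assume e: "e \<in> H" "e' \<in> H" "e ^ a = e' ^ a"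
    have "e * inverse e' = 1"
    proof (rule unity_coprime[OF _ _ coprime_ak])
      show "(e * inverse e') ^ a = 1" using e H_nonzero[OF e(2)] by (simp add: power_mult_distrib power_inverse)
      show "(e * inverse e') ^ k = 1" using e H_pow_k by (simp add: power_mult_distrib power_inverse)
    qed
    then show "e = e'" using H_nonzero[OF e(2)] by (simp add: field_simps)
  qed
  then have "\<zeta> \<in> (\<lambda>e. e ^ a) ` H" using endo_inj_surj[OF finite_H into] assms by simp
  then obtain e where "\<zeta> = e ^ a" "e \<in> H" by (rule imageE)
  then show ?thesis by blast
qed

text \<open>
  The fibre of \<open>z\<close> over a \<open>k\<close>-th root of unity consists of two axes
  that meet in a fixed point of the torus; every orbit in the fibre has this point in its
  closure.
\<close>

lemma orbit_limit:
  assumes q: "q \<in> points S" "coord_z q ^ k = 1" and g: "g \<in> regular Sq"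
    and zero: "\<And>l. l \<noteq> 0 \<Longrightarrow> g (\<pi> (torus_action r l q)) = 0"
  shows "g (\<pi> (0, 0, coord_z q)) = 0"
proof -
  obtain x y z where xyz: "q = (x, y, z)" by (cases q)
  have xy: "x = 0 \<or> y = 0" "z ^ k = 1" using q r2 by (auto simp: xyz)
  have "(s * x, s * y, z) \<in> points S" for s using xy r2 by (auto simp: power_0_left)
  then have ev: "\<forall>\<^sub>F s in nhds 0. (s * x, s * y, z) \<in> points S" by simp
  have gr: "(\<lambda>p. g (\<pi> p)) \<in> regular S" using g by (simp add: regular_Sq)
  have d: "((\<lambda>s. s * x) has_field_derivative x) (at 0)" "((\<lambda>s. s * y) has_field_derivative y) (at 0)"
    "((\<lambda>s. z) has_field_derivative 0) (at 0)"
    by (auto intro!: derivative_eq_intros)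
  obtain D where "((\<lambda>s. g (\<pi> (s * x, s * y, z))) has_field_derivative D) (at 0)"
    using regular_along_curve[OF gr ev d] by blast
  then have "isCont (\<lambda>s. g (\<pi> (s * x, s * y, z))) 0" by (rule DERIV_isCont)
  then have lim: "((\<lambda>s. g (\<pi> (s * x, s * y, z))) \<longlongrightarrow> g (\<pi> (0, 0, z))) (at 0)" by (simp add: isCont_def)
  have "g (\<pi> (s * x, s * y, z)) = 0" if s: "s \<noteq> 0" for s
  proof (cases "x = 0")
    case True
    have r0: "0 < r" using r2 by simp
    obtain l where l: "l ^ r = inverse s" using nth_root_exists[OF r0] by blast
    have l0: "l \<noteq> 0" using l s r0 by (auto simp: power_0_left)
    have "torus_action r l q = (s * x, s * y, z)" using l by (simp add: xyz torus_action_eq True)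
    then show ?thesis using zero[OF l0] by simp
  next
    case False
    then have "torus_action r s q = (s * x, s * y, z)" using xy by (simp add: xyz torus_action_eq)
    then show ?thesis using zero[OF s] by simp
  qed
  then have "\<forall>\<^sub>F s in at 0. g (\<pi> (s * x, s * y, z)) = 0" by (simp add: eventually_at_filter)
  then have "((\<lambda>s. g (\<pi> (s * x, s * y, z))) \<longlongrightarrow> 0) (at 0)" by (rule tendsto_eventually)
  from tendsto_unique[OF _ lim this] show ?thesis by (simp add: xyz)
qed

text \<open>
  The torus orbit over \<open>z0\<close> is closed, being given by the value of
  \<open>z\<^sup>h\<close>. Its image is a single orbit over a root of unity, which is not
  closed.
\<close>

theorem collapse_not_closed:
  assumes f_equivariant: "equivariant Sq (induced_torus_action r) (induced_torus_action r) f"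
    and z0: "z0 ^ k \<noteq> 1" and q: "q \<in> points S" "f (\<pi> (1, z0 ^ k - 1, z0)) = \<pi> q" "coord_z q ^ k = 1"
    and not_fixed: "\<not> (coord_x q = 0 \<and> coord_y q = 0)"
  shows "\<not> Defs.closed_map Sq Sq f"
proof
  assume closed: "Defs.closed_map Sq Sq f"
  (* the equation of the orbit of base z0 under the torus and the group *)
  define b where "b p = coord_z p ^ h - z0 ^ h" for p
  have b: "invariant b"
  proof (rule invariantI)
    show "b \<in> regular S" unfolding b_def[abs_def] by (intro regular_intros[OF S_tilde] coord_regular)
    fix e p assume "e \<in> H"
    then have "(e ^ a) ^ h = 1" by (metis H_pow_h mult.commute power_mult power_one)
    then show "b (act e p) = b p" by (simp add: b_def power_mult_distrib power_inverse)
  qed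
  (* all points of C lie on the image of a single torus orbit *)
  define C where "C = {P \<in> points Sq. \<forall>g\<in>{on_orbits b}. g P = 0}"
  have "zariski_closed Sq C"
    unfolding zariski_closed_def C_def using on_orbits_regular[OF b] by blast
  then have "zariski_closed Sq (f ` C)" using closed unfolding Defs.closed_map_def by blast
  then obtain G where G: "G \<subseteq> regular Sq" "f ` C = {P \<in> points Sq. \<forall>g\<in>G. g P = 0}"
    unfolding zariski_closed_def by blast
  have base: "(1, z0 ^ k - 1, z0) \<in> points S" by simp
  have ft: "f (\<pi> (torus_action r l (1, z0 ^ k - 1, z0))) = \<pi> (torus_action r l q)" if "l \<noteq> 0" for l
    using f_equivariant that Sq_point[OF base] q(2)
    by (simp add: equivariant_def flip: induced_torus_orbit)
  have orbit_in: "\<pi> (torus_action r l q) \<in> f ` C" if l: "l \<noteq> 0" for l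
  proof (rule image_eqI)
    show "\<pi> (torus_action r l q) = f (\<pi> (torus_action r l (1, z0 ^ k - 1, z0)))" using ft[OF l] by simp
    have tp: "torus_action r l (1, z0 ^ k - 1, z0) \<in> points S" by (rule torus_point[OF l base])
    have "on_orbits b (\<pi> (torus_action r l (1, z0 ^ k - 1, z0))) = 0"
      unfolding on_orbits_orbit[OF b tp] by (simp add: b_def)
    then show "\<pi> (torus_action r l (1, z0 ^ k - 1, z0)) \<in> C" using Sq_point[OF tp] by (simp add: C_def)
  qed
  have "g (\<pi> (0, 0, coord_z q)) = 0" if "g \<in> G" for g
    by (rule orbit_limit[OF q(1,3)]) (use that G orbit_in in blast)+
  moreover have "(0, 0, coord_z q) \<in> points S" using q(3) r2 by simp
  ultimately have "\<pi> (0, 0, coord_z q) \<in> f ` C" using G(2) Sq_point by blast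
  then obtain P where P': "\<pi> (0, 0, coord_z q) = f P" "P \<in> C" by (rule imageE)
  note P = P'(2,1)
  obtain p where p: "p \<in> points S" "P = \<pi> p" using P(1) unfolding C_def by (blast elim: Sq_cases)
  have "coord_z p ^ h = z0 ^ h" using P(1) p on_orbits_orbit[OF b p(1)] by (simp add: C_def b_def)
  then have "\<exists>\<zeta>\<in>H. coord_z p = \<zeta> * z0"
  proof (cases "z0 = 0")
    case True
    then show ?thesis using \<open>coord_z p ^ h = z0 ^ h\<close> h0 H_one by (intro bexI[of _ 1]) (simp_all add: power_0_left)
  next
    case False
    then show ?thesis using \<open>coord_z p ^ h = z0 ^ h\<close> by (intro bexI[of _ "coord_z p / z0"]) (simp_all add: H_def power_divide)
  qed
  then obtain \<zeta> where \<zeta>: "\<zeta> \<in> H" "coord_z p = \<zeta> * z0" by blast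
  obtain e where e: "e \<in> H" "e ^ a = \<zeta>" using H_power_surjective[OF \<zeta>(1)] by blast
  define p' where "p' = act e p"
  have p': "p' \<in> points S" "\<pi> p' = P" unfolding p'_def using act_point[OF e(1) p(1)] orbit_act[OF e(1)] p(2) by auto
  have zp': "coord_z p' = z0" using \<zeta>(2) e(2) H_nonzero[OF \<zeta>(1)] by (simp add: p'_def)
  have rel: "coord_x p' ^ r * coord_y p' = z0 ^ k - 1" using p'(1) zp' by (simp add: in_S_tilde_coord)
  then have x: "coord_x p' \<noteq> 0" using z0 r2 by (auto simp: power_0_left)
  have "p' = torus_action r (coord_x p') (1, z0 ^ k - 1, z0)"
    by (rule point3_eqI) (use rel x zp' in \<open>simp_all add: field_simps\<close>)
  then have "f P = \<pi> (torus_action r (coord_x p') q)" using ft[OF x] p'(2) by simp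
  then have "\<pi> (0, 0, coord_z q) = \<pi> (torus_action r (coord_x p') q)" using P(2) by simp
  then obtain e' where "torus_action r (coord_x p') q = act e' (0, 0, coord_z q)" unfolding orbit_eq_iff by blast
  then have "coord_x (torus_action r (coord_x p') q) = 0" "coord_y (torus_action r (coord_x p') q) = 0" by simp_all
  then show False using not_fixed x by simp
qed

text \<open>
  For \<open>\<delta> = 0\<close> the lifted map commutes with the roots of unity; for
  \<open>\<delta> = 1\<close> it is invariant under them.
\<close>

lemma lift_map_descends:
  assumes d: "lift_data k r A B Q" and Q: "0 < Polynomial.degree Q"
    and rot: "\<And>w z. w ^ k = 1 \<Longrightarrow> poly A (w * z) = w ^ \<delta> * poly A z \<and> poly B (w * z) = poly B z \<and>
        poly Q (w * z) = w ^ (1 - \<delta>) * poly Q z"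
    and \<delta>: "\<delta> = 0 \<or> \<delta> = 1 \<and> a = 1 \<and> k dvd r"
  shows "equivariant_etale_endo Sq (induced_torus_action r) (descend_map (lift_map A B Q))"
    and "p \<in> points S \<Longrightarrow> descend_map (lift_map A B Q) (\<pi> p) = \<pi> (lift_map A B Q p)"
proof -
  have inv: "\<pi> (lift_map A B Q (act e p)) = \<pi> (lift_map A B Q p)" if e: "e \<in> H" for e p
  proof -
    have "(e ^ a) ^ k = 1" using H_pow_k[OF e] by (metis mult.commute power_mult power_one)
    then have w: "inverse (e ^ a) ^ k = 1" by (simp add: power_inverse)
    show ?thesis using \<delta>
    proof
      assume "\<delta> = 0"
      then have "lift_map A B Q (act e p) = act e (lift_map A B Q p)"
        using rot[OF w, of "coord_z p"] by (intro point3_eqI) simp_all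
      then show ?thesis using orbit_act[OF e] by simp
    next
      assume \<delta>: "\<delta> = 1 \<and> a = 1 \<and> k dvd r"
      then obtain n where "r = k * n" by blast
      then have "e ^ r = 1" using H_pow_k[OF e] by (simp add: power_mult)
      then have "lift_map A B Q (act e p) = lift_map A B Q p"
        using rot[OF w, of "coord_z p"] \<delta> H_nonzero[OF e] by (intro point3_eqI) simp_all
      then show ?thesis by simp
    qed
  qed
  show "equivariant_etale_endo Sq (induced_torus_action r) (descend_map (lift_map A B Q))"
    by (rule descend_map_equivariant_etale[OF lift_map_etale[OF k0 r2 d Q]]) (simp_all add: inv lift_map_torus)
  show "descend_map (lift_map A B Q) (\<pi> p) = \<pi> (lift_map A B Q p)" if "p \<in> points S"
    by (rule descend_map_orbit[OF that]) (rule inv)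
qed

text \<open>
  With \<open>\<delta> = 0\<close> the construction is compatible with every group of roots of
  unity. A zero of \<open>A\<close> is the base point of an orbit that is collapsed.
\<close>

theorem exists_nonclosed_endo:
  "\<exists>f. equivariant_etale_endo Sq (induced_torus_action r) f \<and> \<not> Defs.closed_map Sq Sq f"
proof -
  obtain A B Q where d: "lift_data k r A B Q" and deg: "Polynomial.degree A = k" "Polynomial.degree Q = 1 + (r - 1) * k"
    and rot: "\<And>w z. w ^ k = 1 \<Longrightarrow> poly A (w * z) = w ^ 0 * poly A z \<and> poly B (w * z) = poly B z \<and>
        poly Q (w * z) = w ^ (1 - 0) * poly Q z"
    using exists_lift_data[OF k2 r2, of k 0] by auto
  define f where "f = descend_map (lift_map A B Q)"
  have Q: "0 < Polynomial.degree Q" using deg by simp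
  have f: "equivariant_etale_endo Sq (induced_torus_action r) f"
    "\<And>p. p \<in> points S \<Longrightarrow> f (\<pi> p) = \<pi> (lift_map A B Q p)"
    unfolding f_def using lift_map_descends[OF d Q rot] by auto
  have "\<not> constant (poly A)" using deg k0 by (simp add: constant_degree)
  then obtain z0 where z0: "poly A z0 = 0" using fundamental_theorem_of_algebra by blast
  have Qz: "poly Q z0 ^ k = 1" using lift_data_eval[OF d, of z0] z0 r2 by (simp add: power_0_left)
  then have Q0: "poly Q z0 \<noteq> 0" using k0 by (auto simp: power_0_left)
  obtain c where c: "c \<noteq> 0" and "\<And>z. poly (pderiv Q) z = c * poly A z ^ (r - 1)"
    and eq: "\<And>z. of_nat r * poly (pderiv A) z * (poly B z * (z ^ k - 1)) +
       poly A z * (poly (pderiv B) z * (z ^ k - 1) + poly B z * (of_nat k * z ^ (k - 1))) =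
       of_nat k * c * poly Q z ^ (k - 1)"
    using lift_data_derivative[OF k0 r2 d Q] by blast
  have "of_nat k * c * poly Q z0 ^ (k - 1) \<noteq> 0" using k0 c Q0 by simp
  then have nz: "poly B z0 \<noteq> 0" "z0 ^ k \<noteq> 1" using eq[of z0] z0 by auto
  define q where "q = lift_map A B Q (1, z0 ^ k - 1, z0)"
  have base: "(1, z0 ^ k - 1, z0) \<in> points S" by simp
  have "morphism S S (lift_map A B Q)" using lift_map_etale[OF k0 r2 d Q] by (simp add: etale_def)
  then have "q \<in> points S" unfolding q_def by (rule morphism_point[OF _ base])
  moreover have "f (\<pi> (1, z0 ^ k - 1, z0)) = \<pi> q" unfolding q_def by (rule f(2)[OF base])
  moreover have "coord_z q ^ k = 1" "\<not> (coord_x q = 0 \<and> coord_y q = 0)"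
    using Qz nz by (simp_all add: q_def)
  ultimately have "\<not> Defs.closed_map Sq Sq f"
    using f(1) nz(2) by (intro collapse_not_closed) (auto simp: equivariant_etale_endo_def)
  then show ?thesis using f(1) by blast
qed

theorem not_GJC: "\<not> equivariant_GJC Sq (induced_torus_action r)"
  using exists_nonclosed_endo closed_map_of_proper[OF Sq Sq] unfolding equivariant_GJC_def by blast

text \<open>
  The endomorphism and the failure of closedness are transported along the isomorphism.
\<close>

theorem isomorphic_not_GJC:
  assumes X: "affine_variety X" and act: "algebraic_torus_action X t"
    and iso: "equivariant_iso X t Sq (induced_torus_action r) g"
  shows "\<not> equivariant_GJC X t"
proof -
  obtain n x where "X = generated_variety (points X) (x ` {..<n::nat})" using X unfolding affine_variety_def by blast
  then have fX: "function_variety X" by (metis function_variety_generated)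
  obtain f where f: "equivariant_etale_endo Sq (induced_torus_action r) f" "\<not> Defs.closed_map Sq Sq f"
    using exists_nonclosed_endo by blast
  have g: "morphism X Sq g" "equivariant X t (induced_torus_action r) g" using iso by (simp_all add: equivariant_iso_def)
  obtain g' where g': "morphism Sq X g'" "\<And>p. p \<in> points X \<Longrightarrow> g' (g p) = p" "\<And>q. q \<in> points Sq \<Longrightarrow> g (g' q) = q"
    using iso unfolding equivariant_iso_def by blast
  have ef: "etale Sq Sq f" and eq: "equivariant Sq (induced_torus_action r) (induced_torus_action r) f"
    using f(1) by (simp_all add: equivariant_etale_endo_def)
  have mf: "morphism Sq Sq f" using ef by (simp add: etale_def)
  define F where "F = g' \<circ> (f \<circ> g)"
  have eg: "etale X Sq g" and eg': "etale Sq X g'"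
    using etale_isomorphism[OF fX Sq g(1) g'(1)] etale_isomorphism[OF Sq fX g'(1) g(1)] g'(2,3) by blast+
  have "etale X X F" unfolding F_def by (intro etale_compose[OF etale_compose[OF eg ef] eg'])
  moreover have "equivariant X t t F"
    unfolding equivariant_def
  proof (intro allI impI ballI)
    fix l :: complex and p assume l: "l \<noteq> 0" and p: "p \<in> points X"
    have act_point: "t l p \<in> points X" if "p \<in> points X" for p
    proof -
      have "(l, p) \<in> points (product_variety multiplicative_group X)"
        using l that by (simp add: product_variety_def multiplicative_group_def)
      then have "(\<lambda>(l, p). t l p) (l, p) \<in> points X"
        using act unfolding algebraic_torus_action_def by (blast intro: morphism_point)
      then show ?thesis by simp
    qed
    have commutes: "g' (induced_torus_action r l q) = t l (g' q)" if q: "q \<in> points Sq" for q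
    proof -
      have q': "g' q \<in> points X" by (rule morphism_point[OF g'(1) q])
      have "g (t l (g' q)) = induced_torus_action r l q" using g(2) l q' g'(3)[OF q] by (simp add: equivariant_def)
      then show ?thesis using g'(2)[OF act_point[OF q']] by simp
    qed
    have gp: "g p \<in> points Sq" "f (g p) \<in> points Sq"
      using morphism_point[OF g(1) p] morphism_point[OF mf] by auto
    have "g (t l p) = induced_torus_action r l (g p)" using g(2) l p by (simp add: equivariant_def)
    moreover have "f (induced_torus_action r l (g p)) = induced_torus_action r l (f (g p))"
      using eq l gp by (simp add: equivariant_def)
    ultimately show "F (t l p) = t l (F p)" using commutes[OF gp(2)] by (simp add: F_def)
  qed
  ultimately have endo: "equivariant_etale_endo X t F" by (simp add: equivariant_etale_endo_def)
  have "\<not> proper X X F"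
  proof
    assume "proper X X F"
    then have closed: "Defs.closed_map X X F" by (rule closed_map_of_proper[OF fX fX])
    have "Defs.closed_map Sq Sq f"
      unfolding Defs.closed_map_def
    proof (intro allI impI)
      fix C assume C: "zariski_closed Sq C"
      then have Csub: "C \<subseteq> points Sq" unfolding zariski_closed_def by blast
      have "zariski_closed X (g' ` C)" by (rule isomorphism_closed[OF g'(1) g(1) g'(3,2) C])
      then have FC: "zariski_closed X (F ` g' ` C)" using closed by (simp add: Defs.closed_map_def)
      have "zariski_closed Sq (g ` F ` g' ` C)" by (rule isomorphism_closed[OF g(1) g'(1) g'(2,3) FC])
      moreover have "g (F (g' q)) = f q" if "q \<in> C" for q
      proof -
        have q: "q \<in> points Sq" using Csub that by blast
        show ?thesis using g'(3)[OF q] g'(3)[OF morphism_point[OF mf q]] by (simp add: F_def)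
      qed
      then have "g ` F ` g' ` C = f ` C" unfolding image_image by (intro image_cong refl)
      ultimately show "zariski_closed Sq (f ` C)" by simp
    qed
    then show False using f(2) by blast
  qed
  then show ?thesis using endo unfolding equivariant_GJC_def by blast
qed

end

context plane_etale_endo
begin

lemma degree_form:
  assumes "has_degree Sq Sq f d"
  shows "\<exists>N. d = 1 + (r - 1) * N \<and> (k dvd N \<or> k dvd r \<and> a = 1 \<and> N mod k = 1)"
  using degree_theorem degree_t_poly assms k0 by (metis mult_left_cancel not_less_zero)

lemma not_closed:
  assumes d: "has_degree Sq Sq f d" "1 < d" shows "\<not> Defs.closed_map Sq Sq f"
proof -
  obtain m where m: "\<And>d. has_degree Sq Sq f d \<longleftrightarrow> d = m" "Polynomial.degree t_poly = k * m"
    using degree_theorem by blast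
  then have "Polynomial.degree t_poly = k * d" using m(1)[of d] d(1) by simp
  then have "k < Polynomial.degree t_poly" using d(2) k0 by simp
  then obtain z0 where z0: "z0 ^ k \<noteq> 1" "poly t_poly z0 = 1" using collapsed_orbit by blast
  show ?thesis
    by (rule collapse_not_closed[OF f_equivariant z0(1) phi[OF base_point] _ phi_base_not_fixed])
      (use basic_transforms(1)[OF base_point[of z0]] z0(2) in simp)
qed

end

context
  fixes k r a :: nat
  assumes k2: "2 \<le> k" and r2: "2 \<le> r" and a_range: "a \<in> {1..k - 1}" and coprime_ak: "coprime a k"
begin

interpretation surface_quotient k r a k
  using k2 r2 coprime_ak by unfold_locales auto

lemma plane_etale_endoI:
  "equivariant_etale_endo Sq (induced_torus_action r) f \<Longrightarrow> plane_etale_endo k r a f"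
  using a_range by unfold_locales (auto simp: equivariant_etale_endo_def etale_def)

text \<open>
  For the endomorphism from \<open>lift_data\<close> the polynomial \<open>t_poly\<close> is
  \<open>Q\<^sup>k\<close>, so its degree is that of \<open>Q\<close>.
\<close>

lemma exists_endo_of_degree:
  assumes N: "N mod k = \<delta>" "\<delta> = 0 \<or> \<delta> = 1 \<and> a = 1 \<and> k dvd r"
  shows "\<exists>f. equivariant_etale_endo Sq (induced_torus_action r) f \<and> has_degree Sq Sq f (1 + (r - 1) * N)"
proof -
  obtain A B Q where d: "lift_data k r A B Q" and deg: "Polynomial.degree Q = 1 + (r - 1) * N"
    and rot: "\<And>w z. w ^ k = 1 \<Longrightarrow> poly A (w * z) = w ^ \<delta> * poly A z \<and> poly B (w * z) = poly B z \<and>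
        poly Q (w * z) = w ^ (1 - \<delta>) * poly Q z"
    using exists_lift_data[OF k2 r2 N(1)] N(2) by auto
  define f where "f = descend_map (lift_map A B Q)"
  have Q: "0 < Polynomial.degree Q" using deg by simp
  have f: "equivariant_etale_endo Sq (induced_torus_action r) f"
    "\<And>p. p \<in> points S \<Longrightarrow> f (\<pi> p) = \<pi> (lift_map A B Q p)"
    unfolding f_def using lift_map_descends[OF d Q rot N(2)] by auto
  interpret f: plane_etale_endo k r a f by (rule plane_etale_endoI[OF f(1)])
  have "f.t_poly = Q ^ k"
  proof (rule poly_eqI_eval)
    fix z
    have base: "(1, z ^ k - 1, z) \<in> points S" by simp
    have "morphism S S (lift_map A B Q)" using lift_map_etale[OF k0 r2 d Q] by (simp add: etale_def)
    then have "lift_map A B Q (1, z ^ k - 1, z) \<in> points S" by (rule morphism_point[OF _ base])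
    then have "on_orbits f.inv_t (f (\<pi> (1, z ^ k - 1, z))) = poly Q z ^ k"
      unfolding f(2)[OF base] by (simp add: on_orbits_orbit[OF f.invariants(1)] f.inv_t_def)
    moreover have "on_orbits f.inv_t (f (\<pi> (1, z ^ k - 1, z))) = poly f.t_poly z"
      using f.pull_eq[OF f.invariants(1) base] f.basic_transforms(1)[OF base] by (simp add: f.inv_t_def)
    ultimately show "poly f.t_poly z = poly (Q ^ k) z" by simp
  qed
  moreover have "Q \<noteq> 0" using Q by auto
  ultimately have "Polynomial.degree f.t_poly = k * Polynomial.degree Q" by (simp add: degree_power_eq)
  then have "has_degree Sq Sq f (Polynomial.degree Q)" using f.degree_theorem k0 by (metis mult_left_cancel not_less_zero)
  then show ?thesis using f(1) deg by auto
qed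

lemma degree_form_iff_cong:
  fixes d :: nat
  assumes d: "0 < d"
  shows "(\<exists>N. d = 1 + (r - 1) * N \<and> (k dvd N \<or> k dvd r \<and> a = 1 \<and> N mod k = 1)) \<longleftrightarrow>
    [d = 1] (mod k * (r - 1)) \<or> k dvd r \<and> a = 1 \<and> [d = r] (mod k * (r - 1))"
proof
  have hub: "1 + (r - 1) * (k * e + 1) = e * (k * (r - 1)) + r" for e
    using r2 by (cases r) (simp_all add: algebra_simps)
  assume "\<exists>N. d = 1 + (r - 1) * N \<and> (k dvd N \<or> k dvd r \<and> a = 1 \<and> N mod k = 1)"
  then obtain N where N: "d = 1 + (r - 1) * N" "k dvd N \<or> k dvd r \<and> a = 1 \<and> N mod k = 1" by blast
  show "[d = 1] (mod k * (r - 1)) \<or> k dvd r \<and> a = 1 \<and> [d = r] (mod k * (r - 1))"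
    using N(2)
  proof
    assume "k dvd N"
    then obtain e where "N = k * e" by blast
    then have "d = e * (k * (r - 1)) + 1" using N(1) by simp
    then show ?thesis using cong_le_nat[of 1 d "k * (r - 1)"] by auto
  next
    assume *: "k dvd r \<and> a = 1 \<and> N mod k = 1"
    then have "N = k * (N div k) + 1" by (metis mult_div_mod_eq)
    then have "d = 1 + (r - 1) * (k * (N div k) + 1)" using N(1) by simp
    then have "d = (N div k) * (k * (r - 1)) + r" by (simp only: hub)
    then show ?thesis using * cong_le_nat[of r d "k * (r - 1)"] by auto
  qed
next
  assume "[d = 1] (mod k * (r - 1)) \<or> k dvd r \<and> a = 1 \<and> [d = r] (mod k * (r - 1))"
  then show "\<exists>N. d = 1 + (r - 1) * N \<and> (k dvd N \<or> k dvd r \<and> a = 1 \<and> N mod k = 1)"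
  proof
    assume "[d = 1] (mod k * (r - 1))"
    then obtain e where "d = e * (k * (r - 1)) + 1" using cong_le_nat[of 1 d "k * (r - 1)"] d by auto
    then show ?thesis by (intro exI[of _ "k * e"]) simp
  next
    assume *: "k dvd r \<and> a = 1 \<and> [d = r] (mod k * (r - 1))"
    (* the smallest positive number congruent to r is r itself, as r - k (r - 1) is at most 0 *)
    have "r \<le> d"
    proof (rule ccontr)
      assume "\<not> r \<le> d"
      then obtain e where e: "r = e * (k * (r - 1)) + d"
        using * cong_le_nat[of d r "k * (r - 1)"] by (auto simp: cong_sym_eq)
      have "e \<noteq> 0"
      proof
        assume "e = 0"
        then show False using e \<open>\<not> r \<le> d\<close> by simp
      qed
      then have "1 * (2 * (r - 1)) \<le> e * (k * (r - 1))" using k2 by (intro mult_le_mono) auto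
      then show False using e d r2 by linarith
    qed
    then obtain e where "d = e * (k * (r - 1)) + r" using * cong_le_nat[of r d "k * (r - 1)"] by auto
    moreover have "(k * e + 1) mod k = 1" using k2 mod_mult_self2[of 1 k e] by simp
    moreover have "1 + (r - 1) * (k * e + 1) = e * (k * (r - 1)) + r" using r2 by (cases r) (simp_all add: algebra_simps)
    ultimately show ?thesis using * by (intro exI[of _ "k * e + 1"]) simp
  qed
qed

lemma degrees_of_pseudo_plane:
  assumes d: "0 < d"
  shows "(\<exists>f. equivariant_etale_endo Sq (induced_torus_action r) f \<and> has_degree Sq Sq f d) \<longleftrightarrow>
    [d = 1] (mod k * (r - 1)) \<or> k dvd r \<and> a = 1 \<and> [d = r] (mod k * (r - 1))"
  unfolding degree_form_iff_cong[OF d, symmetric]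
proof
  assume "\<exists>f. equivariant_etale_endo Sq (induced_torus_action r) f \<and> has_degree Sq Sq f d"
  then obtain f where f: "equivariant_etale_endo Sq (induced_torus_action r) f" "has_degree Sq Sq f d" by blast
  show "\<exists>N. d = 1 + (r - 1) * N \<and> (k dvd N \<or> k dvd r \<and> a = 1 \<and> N mod k = 1)"
    by (rule plane_etale_endo.degree_form[OF plane_etale_endoI[OF f(1)] f(2)])
next
  assume "\<exists>N. d = 1 + (r - 1) * N \<and> (k dvd N \<or> k dvd r \<and> a = 1 \<and> N mod k = 1)"
  then obtain N where N: "d = 1 + (r - 1) * N" "k dvd N \<or> k dvd r \<and> a = 1 \<and> N mod k = 1" by blast
  show "\<exists>f. equivariant_etale_endo Sq (induced_torus_action r) f \<and> has_degree Sq Sq f d"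
    unfolding N(1) by (rule exists_endo_of_degree[OF refl]) (use N(2) in auto)
qed

lemma nonproper_of_degree:
  assumes "1 < d" "equivariant_etale_endo Sq (induced_torus_action r) f" "has_degree Sq Sq f d"
  shows "\<not> proper Sq Sq f"
  using plane_etale_endo.not_closed[OF plane_etale_endoI[OF assms(2)] assms(3,1)] closed_map_of_proper[OF Sq Sq] by blast

lemma cover_not_GJC:
  assumes "finite_cover_of_pseudo_plane k r a X t" shows "\<not> equivariant_GJC X t"
proof -
  obtain G g where X: "affine_variety X" "algebraic_torus_action X t" "subgroup G (roots_of_unity_group k)"
    "equivariant_iso X t (S_tilde_quotient k r a G) (induced_torus_action r) g"
    using assms unfolding finite_cover_of_pseudo_plane_def by blast
  obtain h where h: "0 < h" "G = {e. e ^ h = 1}" "\<And>e::complex. e ^ h = 1 \<Longrightarrow> e ^ k = 1"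
    using subgroup_of_unity[OF k0 X(3)] by blast
  interpret cover: surface_quotient k r a h using k2 r2 coprime_ak h by unfold_locales
  have "G = cover.H" using h(2) by (simp add: cover.H_def)
  then show ?thesis using cover.isomorphic_not_GJC X by simp
qed

lemma pseudo_plane_eq: "pseudo_plane k r a = Sq"
  by (simp add: pseudo_plane_def roots_of_unity_group_def H_def)

lemmas main_parts = degrees_of_pseudo_plane[folded pseudo_plane_eq] nonproper_of_degree[folded pseudo_plane_eq]
  not_GJC[folded pseudo_plane_eq] cover_not_GJC

end

theorem theorem2:
  fixes k r a d :: nat
  assumes "2 \<le> k" and "2 \<le> r"
    and "a \<in> {1..k - 1}" and "coprime a k"
    and "0 < d"
  shows "((\<exists>f. equivariant_etale_endo (pseudo_plane k r a) (induced_torus_action r) f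
               \<and> has_degree (pseudo_plane k r a) (pseudo_plane k r a) f d)
            \<longleftrightarrow> [d = 1] (mod k * (r - 1)) \<or>
                (k dvd r \<and> a = 1 \<and> [d = r] (mod k * (r - 1))))
         \<and> (1 < d \<longrightarrow>
              (\<forall>f. equivariant_etale_endo (pseudo_plane k r a) (induced_torus_action r) f
                   \<and> has_degree (pseudo_plane k r a) (pseudo_plane k r a) f d
                 \<longrightarrow> \<not> proper (pseudo_plane k r a) (pseudo_plane k r a) f))
         \<and> \<not> equivariant_GJC (pseudo_plane k r a) (induced_torus_action r)
         \<and> (\<forall>(X :: 'a variety) act. finite_cover_of_pseudo_plane k r a X act \<longrightarrow> \<not> equivariant_GJC X act)"
  using main_parts[OF assms(1-4)] assms(5) by blast

end
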